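(* Let $F$ be a non-archimedean local field, let $n_1$ and $n_2$ be two positive even integers, and let $\pi_1$ and $\pi_2$ be smooth complex representations of $GL(n_1,F)$ and $GL(n_2,F)$ respectively. If $\pi_1$ and $\pi_2$ both admit a Shalika functional, then the normalised parabolically induced representation $\pi_1\times\pi_2$ of $GL(n_1+n_2,F)$ also admits a Shalika functional.
   Context: Fix once and for all a nontrivial (smooth) character $\theta$ of $(F,+)$. For a positive even integer $n=2m$, the Shalika subgroup of $GL(n,F)$ is $$S=\left\{\begin{pmatrix} I_m & x\\ 0& I_m\end{pmatrix}\begin{pmatrix} g & 0\\ 0& g\end{pmatrix} : x\in \mathcal{M}(m,m,F),\ g\in GL(m,F)\right\},$$ and $\Theta$ is the character of $S$ given by $\Theta\left(\begin{pmatrix} I_m & x\\ 0& I_m\end{pmatrix}\begin{pmatrix} g & 0\\ 0& g\end{pmatrix}\right)=\theta(\mathrm{Tr}(x))$. A smooth representation $\pi$ of $GL(n,F)$ is said to admit (or have) a Shalika functional if $\mathrm{Hom}_S(\pi,\Theta)\neq 0$; a Shalika functional on $\pi$ is a nonzero element of $\mathrm{Hom}_S(\pi,\Theta)$. The representation $\pi_1\times\pi_2$ is $\mathrm{Ind}_P^{G}(\pi_1\otimes\pi_2)$, where $G=GL(n_1+n_2,F)$, $P$ is the block upper triangular parabolic subgroup of type $(n_1,n_2)$, $\pi_1\otimes\pi_2$ is inflated to $P$ (trivially on the unipotent radical), and $\mathrm{Ind}$ denotes normalised smooth parabolic induction: the space of smooth functions $f$ on $G$ with $f(pg)=\delta_P(p)^{1/2}(\pi_1\otimes\pi_2)(p)f(g)$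 for $p\in P$, $g\in G$, with $G$ acting by right translation, where $\delta_P$ is the modulus character, $\delta_P(p)=|\det a|^{n_2}|\det d|^{-n_1}$ for $p=\begin{pmatrix} a& b\\ 0 & d\end{pmatrix}$, with $a\in GL(n_1,F)$, $d\in GL(n_2,F)$. *)

theory Defs
  imports
    "HOL-Analysis.Abstract_Metric_Spaces"
    "HOL-Analysis.Function_Topology"
    "HOL-Library.Function_Algebras"
    "HOL-Library.Poly_Mapping"
    "Jordan_Normal_Form.Determinant"
begin

section \<open>Complex vector spaces\<close>

class complex_vector = ab_group_add +
  fixes scaleC :: "complex \<Rightarrow> 'a \<Rightarrow> 'a" (infixr \<open>*\<^sub>C\<close> 75)
  assumes scaleC_add_right: "c *\<^sub>C (x + y) = c *\<^sub>C x + c *\<^sub>C y"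
    and scaleC_add_left: "(c + d) *\<^sub>C x = c *\<^sub>C x + d *\<^sub>C x"
    and scaleC_scaleC: "c *\<^sub>C d *\<^sub>C x = (c * d) *\<^sub>C x"
    and scaleC_one: "1 *\<^sub>C x = x"

global_interpretation complex_vector:
    vector_space "scaleC :: complex \<Rightarrow> 'a \<Rightarrow> 'a :: complex_vector"
  by unfold_locales (simp_all add: scaleC_add_right scaleC_add_left scaleC_scaleC scaleC_one)

abbreviation clinear :: "('a::complex_vector \<Rightarrow> 'b::complex_vector) \<Rightarrow> bool" where
  "clinear \<equiv> Vector_Spaces.linear scaleC scaleC"

lemma clinear_iff:
  "clinear f \<longleftrightarrow> (\<forall>x y. f (x + y) = f x + f y) \<and> (\<forall>c x. f (c *\<^sub>C x) = c *\<^sub>C f x)"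
  by (auto simp: Vector_Spaces.linear_iff complex_vector.vector_space_axioms)

instantiation complex :: complex_vector
begin
definition scaleC_complex :: "complex \<Rightarrow> complex \<Rightarrow> complex" where
  "scaleC_complex = (*)"
instance by standard (simp_all add: scaleC_complex_def algebra_simps)
end

instantiation "fun" :: (type, complex_vector) complex_vector
begin
definition scaleC_fun :: "complex \<Rightarrow> ('a \<Rightarrow> 'b) \<Rightarrow> 'a \<Rightarrow> 'b" where
  "scaleC_fun c f = (\<lambda>x. c *\<^sub>C f x)"
instance
  by standard (simp_all add: scaleC_fun_def fun_eq_iff scaleC_add_right scaleC_add_left
      scaleC_scaleC scaleC_one)
end

instantiation poly_mapping :: (type, complex_vector) complex_vector
begin
lift_definition scaleC_poly_mapping ::
    "complex \<Rightarrow> ('a \<Rightarrow>\<^sub>0 'b) \<Rightarrow> ('a \<Rightarrow>\<^sub>0 'b)" is "\<lambda>c f x. c *\<^sub>C f x"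
  by (erule finite_subset[rotated]) auto
instance
  by standard (transfer, simp add: fun_eq_iff scaleC_add_right scaleC_add_left
      scaleC_scaleC scaleC_one)+
end


section \<open>Tensor products\<close>

text \<open>The tensor product over the complex numbers is the free vector space on pairs modulo the
  span of the bilinearity relations.\<close>

abbreviation free_pair :: "'v \<Rightarrow> 'w \<Rightarrow> ('v \<times> 'w \<Rightarrow>\<^sub>0 complex)" where
  "free_pair v w \<equiv> Poly_Mapping.single (v, w) 1"

definition tensor_relators :: "('v::complex_vector \<times> 'w::complex_vector \<Rightarrow>\<^sub>0 complex) set" where
  "tensor_relators =
     {free_pair (v + v') w - free_pair v w - free_pair v' w | v v' w. True} \<union>
     {free_pair v (w + w') - free_pair v w - free_pair v w' | v w w'. True} \<union>
     {free_pair (c *\<^sub>C v) w - c *\<^sub>C free_pair v w | c v w. True} \<union>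
     {free_pair v (c *\<^sub>C w) - c *\<^sub>C free_pair v w | c v w. True}"

definition tensor_rel ::
    "('v::complex_vector \<times> 'w::complex_vector \<Rightarrow>\<^sub>0 complex) \<Rightarrow> ('v \<times> 'w \<Rightarrow>\<^sub>0 complex) \<Rightarrow> bool" where
  "tensor_rel r s \<longleftrightarrow> r - s \<in> complex_vector.span tensor_relators"

lemma equivp_tensor_rel: "equivp tensor_rel"
proof (rule equivpI)
  show "reflp tensor_rel"
    by (simp add: reflp_def tensor_rel_def complex_vector.span_zero)
  show "symp tensor_rel"
    unfolding symp_def tensor_rel_def by (metis complex_vector.span_neg minus_diff_eq)
  show "transp tensor_rel"
    unfolding transp_def tensor_rel_def by (auto dest: complex_vector.span_add)
qed

quotient_type (overloaded) ('v, 'w) tensor =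
  "'v::complex_vector \<times> 'w::complex_vector \<Rightarrow>\<^sub>0 complex" / tensor_rel
  by (rule equivp_tensor_rel)

instantiation tensor :: (complex_vector, complex_vector) complex_vector
begin

lift_definition zero_tensor :: "('a, 'b) tensor" is 0 .

lift_definition plus_tensor :: "('a, 'b) tensor \<Rightarrow> ('a, 'b) tensor \<Rightarrow> ('a, 'b) tensor" is "(+)"
  unfolding tensor_rel_def by (drule (1) complex_vector.span_add) (simp add: algebra_simps)

lift_definition uminus_tensor :: "('a, 'b) tensor \<Rightarrow> ('a, 'b) tensor" is uminus
  unfolding tensor_rel_def by (drule complex_vector.span_neg) (simp add: algebra_simps)

lift_definition minus_tensor :: "('a, 'b) tensor \<Rightarrow> ('a, 'b) tensor \<Rightarrow> ('a, 'b) tensor" is "(-)"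
  unfolding tensor_rel_def by (drule (1) complex_vector.span_diff) (simp add: algebra_simps)

lift_definition scaleC_tensor :: "complex \<Rightarrow> ('a, 'b) tensor \<Rightarrow> ('a, 'b) tensor" is scaleC
  unfolding tensor_rel_def
  by (drule complex_vector.span_scale) (simp add: complex_vector.scale_right_diff_distrib)

instance
  by standard (transfer, simp add: tensor_rel_def complex_vector.span_zero algebra_simps
      scaleC_add_right scaleC_add_left scaleC_scaleC scaleC_one)+

end

lift_definition tens :: "'v::complex_vector \<Rightarrow> 'w::complex_vector \<Rightarrow> ('v, 'w) tensor"
  is free_pair .

text \<open>The description below determines a unique map whenever \<open>A\<close> and \<open>B\<close> are linear; this is
  \<open>tensor_map_props\<close>.\<close>

definition tensor_map ::
    "('v::complex_vector \<Rightarrow> 'v2::complex_vector) \<Rightarrow> ('w::complex_vector \<Rightarrow> 'w2::complex_vector)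
      \<Rightarrow> ('v, 'w) tensor \<Rightarrow> ('v2, 'w2) tensor" where
  "tensor_map A B = (THE T. clinear T \<and> (\<forall>v w. T (tens v w) = tens (A v) (B w)))"

lemma tens_add_left: "tens (v + v') w = tens v w + tens v' w"
  unfolding tens.abs_eq plus_tensor.abs_eq tensor.abs_eq_iff tensor_rel_def diff_diff_eq[symmetric]
  by (rule complex_vector.span_base) (unfold tensor_relators_def, blast)

lemma tens_add_right: "tens v (w + w') = tens v w + tens v w'"
  unfolding tens.abs_eq plus_tensor.abs_eq tensor.abs_eq_iff tensor_rel_def diff_diff_eq[symmetric]
  by (rule complex_vector.span_base) (unfold tensor_relators_def, blast)

lemma tens_scale_left: "tens (c *\<^sub>C v) w = c *\<^sub>C tens v w"
  unfolding tens.abs_eq scaleC_tensor.abs_eq tensor.abs_eq_iff tensor_rel_def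
  by (rule complex_vector.span_base) (unfold tensor_relators_def, blast)

lemma tens_scale_right: "tens v (c *\<^sub>C w) = c *\<^sub>C tens v w"
  unfolding tens.abs_eq scaleC_tensor.abs_eq tensor.abs_eq_iff tensor_rel_def
  by (rule complex_vector.span_base) (unfold tensor_relators_def, blast)

lemma poly_mapping_in_span_single:
  fixes p :: "'a \<Rightarrow>\<^sub>0 complex"
  shows "p \<in> complex_vector.span (range (\<lambda>k. Poly_Mapping.single k 1))"
proof (induction p rule: update_induct)
  case const
  then show ?case by (simp add: complex_vector.span_zero)
next
  case (update f a b)
  have "Poly_Mapping.update a b f = f + b *\<^sub>C Poly_Mapping.single a 1"
    using update(1)
    by (intro poly_mapping_eqI)
      (auto simp: lookup_update lookup_add lookup_single scaleC_poly_mapping.rep_eq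
        scaleC_complex_def when_def in_keys_iff)
  then show ?case
    using update by (simp add: complex_vector.span_add complex_vector.span_scale complex_vector.span_base)
qed

lemma abs_tensor_simps:
  "abs_tensor (p + q) = abs_tensor p + abs_tensor q"
  "abs_tensor (c *\<^sub>C p) = c *\<^sub>C abs_tensor p"
  "abs_tensor 0 = 0"
  by (simp_all add: plus_tensor.abs_eq scaleC_tensor.abs_eq zero_tensor_def)

lemma tensor_map_unique:
  fixes S T :: "('v::complex_vector, 'w::complex_vector) tensor \<Rightarrow> 'u::complex_vector"
  assumes "clinear S" "clinear T" "\<And>v w. S (tens v w) = T (tens v w)"
  shows "S = T"
proof
  fix t
  obtain p :: "'v \<times> 'w \<Rightarrow>\<^sub>0 complex" where t: "t = abs_tensor p"
    by (metis Quotient3_abs_rep Quotient3_tensor)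
  have "p \<in> complex_vector.span (range (\<lambda>k. Poly_Mapping.single k 1))"
    by (rule poly_mapping_in_span_single)
  then have "S (abs_tensor p) = T (abs_tensor p)"
  proof (induction rule: complex_vector.span_induct_alt)
    case base
    then show ?case
      using assms(1,2) by (metis abs_tensor_simps(3) clinear_iff complex_vector.scale_zero_left)
  next
    case (step c x y)
    then obtain v w where "x = free_pair v w" by auto
    then have "abs_tensor x = tens v w" by (simp add: tens.abs_eq)
    then show ?case
      using assms step by (simp add: abs_tensor_simps clinear_iff)
  qed
  then show "S t = T t" by (simp add: t)
qed

lemma tensor_lift:
  fixes b :: "'v::complex_vector \<Rightarrow> 'w::complex_vector \<Rightarrow> 'u::complex_vector"
  assumes b: "\<And>w. clinear (\<lambda>v. b v w)" "\<And>v. clinear (b v)"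
  obtains T where "clinear T" "\<And>v w. T (tens v w) = b v w"
proof -
  define L where "L p = (\<Sum>k\<in>Poly_Mapping.keys p. Poly_Mapping.lookup p k *\<^sub>C b (fst k) (snd k))"
    for p :: "'v \<times> 'w \<Rightarrow>\<^sub>0 complex"
  have L_eq: "L p = (\<Sum>k\<in>K. Poly_Mapping.lookup p k *\<^sub>C b (fst k) (snd k))"
    if "finite K" "Poly_Mapping.keys p \<subseteq> K" for p K
    unfolding L_def using that
    by (intro sum.mono_neutral_left) (auto simp: in_keys_iff)
  have L_add: "L (p + q) = L p + L q" for p q
  proof -
    let ?K = "Poly_Mapping.keys p \<union> Poly_Mapping.keys q"
    have "L (p + q) = (\<Sum>k\<in>?K. Poly_Mapping.lookup (p + q) k *\<^sub>C b (fst k) (snd k))"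
      using keys_add[of p q] by (intro L_eq) auto
    moreover have "L p = (\<Sum>k\<in>?K. Poly_Mapping.lookup p k *\<^sub>C b (fst k) (snd k))" by (intro L_eq) auto
    moreover have "L q = (\<Sum>k\<in>?K. Poly_Mapping.lookup q k *\<^sub>C b (fst k) (snd k))" by (intro L_eq) auto
    ultimately show ?thesis by (simp add: lookup_add scaleC_add_left sum.distrib)
  qed
  have L_scale: "L (c *\<^sub>C p) = c *\<^sub>C L p" for c p
  proof -
    have "L (c *\<^sub>C p) = (\<Sum>k\<in>Poly_Mapping.keys p. Poly_Mapping.lookup (c *\<^sub>C p) k *\<^sub>C b (fst k) (snd k))"
      by (intro L_eq) (auto simp: in_keys_iff scaleC_poly_mapping.rep_eq scaleC_complex_def)
    also have "\<dots> = c *\<^sub>C L p"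
      by (simp add: L_def scaleC_poly_mapping.rep_eq scaleC_complex_def
          complex_vector.scale_sum_right scaleC_scaleC)
    finally show ?thesis .
  qed
  have L_lin: "clinear L" by (simp add: clinear_iff L_add L_scale)
  have L_diff: "L (p - q) = L p - L q" for p q
    by (metis L_add diff_add_cancel eq_diff_eq)
  have L_single: "L (free_pair v w) = b v w" for v w
    by (simp add: L_def scaleC_one)
  have "L r = 0" if "r \<in> complex_vector.span tensor_relators" for r
    using that
  proof (induction rule: complex_vector.span_induct_alt)
    case base
    then show ?case by (simp add: L_def)
  next
    case (step c x y)
    have "L x = 0"
      using step(1) b unfolding tensor_relators_def clinear_iff
      by (auto simp: L_diff L_scale L_single)
    then show ?case using step by (simp add: L_add L_scale)
  qed
  then have resp: "L p = L q" if "tensor_rel p q" for p q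
    using that L_diff[of p q] by (simp add: tensor_rel_def)
  define T where "T t = L (rep_tensor t)" for t
  have T_abs: "T (abs_tensor p) = L p" for p
    unfolding T_def by (intro resp) (metis Quotient3_abs_rep Quotient3_tensor tensor.abs_eq_iff)
  have "clinear T"
    unfolding clinear_iff
  proof (intro conjI allI)
    fix x y :: "('v, 'w) tensor" and c
    obtain p q where xy: "x = abs_tensor p" "y = abs_tensor q"
      by (metis Quotient3_abs_rep Quotient3_tensor)
    show "T (x + y) = T x + T y"
      unfolding xy abs_tensor_simps(1)[symmetric] T_abs by (rule L_add)
    show "T (c *\<^sub>C x) = c *\<^sub>C T x"
      unfolding xy abs_tensor_simps(2)[symmetric] T_abs by (rule L_scale)
  qed
  moreover have "T (tens v w) = b v w" for v w
    by (simp add: tens.abs_eq T_abs L_single)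
  ultimately show ?thesis using that by blast
qed

lemma tensor_map_props:
  assumes "clinear A" "clinear B"
  shows "clinear (tensor_map A B)" and "tensor_map A B (tens v w) = tens (A v) (B w)"
proof -
  obtain T where T: "clinear T" "\<And>v w. T (tens v w) = tens (A v) (B w)"
    by (rule tensor_lift[of "\<lambda>v w. tens (A v) (B w)"])
      (use assms in \<open>auto simp: clinear_iff tens_add_left tens_add_right
          tens_scale_left tens_scale_right\<close>)
  have "clinear (tensor_map A B) \<and> (\<forall>v w. tensor_map A B (tens v w) = tens (A v) (B w))"
    unfolding tensor_map_def by (rule theI[of _ T]) (auto intro: tensor_map_unique simp: T)
  then show "clinear (tensor_map A B)" "tensor_map A B (tens v w) = tens (A v) (B w)"
    by auto
qed


section \<open>Non-archimedean local fields\<close>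

text \<open>The value of a valuation at \<open>0\<close> (mathematically infinite) is never used.\<close>

definition valuation_ring :: "('f::field \<Rightarrow> int) \<Rightarrow> 'f set" where
  "valuation_ring val = {x. x = 0 \<or> val x \<ge> 0}"

definition valuation_ideal :: "('f::field \<Rightarrow> int) \<Rightarrow> 'f set" where
  "valuation_ideal val = {x. x = 0 \<or> val x \<ge> 1}"

definition residue_field :: "('f::field \<Rightarrow> int) \<Rightarrow> 'f set set" where
  "residue_field val = valuation_ring val //
     {(x, y). x \<in> valuation_ring val \<and> y \<in> valuation_ring val \<and> x - y \<in> valuation_ideal val}"

definition normalised_abs :: "('f::field \<Rightarrow> int) \<Rightarrow> 'f \<Rightarrow> real" where
  "normalised_abs val x = (if x = 0 then 0 else real (card (residue_field val)) powi (- val x))"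

abbreviation field_dist :: "('f::field \<Rightarrow> int) \<Rightarrow> 'f \<Rightarrow> 'f \<Rightarrow> real" where
  "field_dist val x y \<equiv> normalised_abs val (x - y)"

definition field_topology :: "('f::field \<Rightarrow> int) \<Rightarrow> 'f topology" where
  "field_topology val = Metric_space.mtopology UNIV (field_dist val)"

text \<open>A field complete with respect to a normalised discrete valuation with finite residue field.\<close>

locale nonarchimedean_local_field =
  fixes val :: "'f::field \<Rightarrow> int"
  assumes val_mult: "x \<noteq> 0 \<Longrightarrow> y \<noteq> 0 \<Longrightarrow> val (x * y) = val x + val y"
    and val_add: "x \<noteq> 0 \<Longrightarrow> y \<noteq> 0 \<Longrightarrow> x + y \<noteq> 0 \<Longrightarrow> val (x + y) \<ge> min (val x) (val y)"
    and val_uniformizer: "\<exists>x. x \<noteq> 0 \<and> val x = 1"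
    and finite_residue_field: "finite (residue_field val)"
    and complete: "Metric_space.mcomplete UNIV (field_dist val)"
begin

lemma val_one: "val 1 = 0"
  using val_mult[of 1 1] by simp

lemma val_minus: "val (- x) = val x"
proof (cases "x = 0")
  case False
  have "val (- 1) = 0"
    using val_mult[of "- 1" "- 1"] val_one by simp
  then show ?thesis using val_mult[of "- 1" x] False by simp
qed simp

lemma card_residue_field: "card (residue_field val) \<ge> 2"
proof -
  let ?R = "{(x, y). x \<in> valuation_ring val \<and> y \<in> valuation_ring val \<and> x - y \<in> valuation_ideal val}"
  have mem: "?R `` {0} \<in> residue_field val" "?R `` {1} \<in> residue_field val"
    unfolding residue_field_def by (intro quotientI; simp add: valuation_ring_def val_one)+
  have "1 \<in> ?R `` {1}" "1 \<notin> ?R `` {0}"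
    by (auto simp: valuation_ring_def valuation_ideal_def val_minus val_one)
  then have "?R `` {0} \<noteq> ?R `` {1}" by metis
  then have "card {?R `` {0}, ?R `` {1}} = 2" by (simp only: card_2_iff) metis
  moreover have "card {?R `` {0}, ?R `` {1}} \<le> card (residue_field val)"
    by (intro card_mono finite_residue_field) (use mem in blast)
  ultimately show ?thesis by (simp only:)
qed

lemma metric_space_field_dist: "Metric_space UNIV (field_dist val)"
proof
  let ?q = "real (card (residue_field val))"
  have q: "?q \<ge> 2" using card_residue_field by linarith
  show "0 \<le> field_dist val x y" for x y
    by (simp add: normalised_abs_def)
  show "field_dist val x y = field_dist val y x" for x y
    using val_minus[of "x - y"] by (simp add: normalised_abs_def)
  show "field_dist val x y = 0 \<longleftrightarrow> x = y" for x y
    using q by (simp add: normalised_abs_def)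
  show "field_dist val x z \<le> field_dist val x y + field_dist val y z" for x y z
  proof (cases "x = y \<or> y = z \<or> x = z")
    case False
    then have "val (x - z) \<ge> min (val (x - y)) (val (y - z))"
      using val_add[of "x - y" "y - z"] by simp
    then consider "- val (x - z) \<le> - val (x - y)" | "- val (x - z) \<le> - val (y - z)"
      by linarith
    then have "?q powi (- val (x - z)) \<le> ?q powi (- val (x - y)) \<or>
        ?q powi (- val (x - z)) \<le> ?q powi (- val (y - z))"
      by cases (use q in \<open>simp_all add: power_int_increasing\<close>)
    moreover have "0 \<le> ?q powi (- val (x - y))" "0 \<le> ?q powi (- val (y - z))"
      by simp_all
    ultimately have "?q powi (- val (x - z)) \<le> ?q powi (- val (x - y)) + ?q powi (- val (y - z))"
      by linarith
    then show ?thesis using False by (simp add: normalised_abs_def)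
  qed (use q in \<open>auto simp: normalised_abs_def\<close>)
qed

end


section \<open>Smoothness\<close>

definition locally_constant_on :: "'a topology \<Rightarrow> ('a \<Rightarrow> 'b) \<Rightarrow> bool" where
  "locally_constant_on X f \<longleftrightarrow>
     (\<forall>x\<in>topspace X. \<exists>U. openin X U \<and> x \<in> U \<and> (\<forall>y\<in>U. f y = f x))"

definition smooth_additive_character :: "('f::field \<Rightarrow> int) \<Rightarrow> ('f \<Rightarrow> complex) \<Rightarrow> bool" where
  "smooth_additive_character val \<theta> \<longleftrightarrow>
     (\<forall>x y. \<theta> (x + y) = \<theta> x * \<theta> y) \<and> (\<forall>x. \<theta> x \<noteq> 0) \<and>
     locally_constant_on (field_topology val) \<theta>"

definition GL :: "nat \<Rightarrow> 'f::field mat set" where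
  "GL n = {g \<in> carrier_mat n n. invertible_mat g}"

definition GL_topology :: "('f::field \<Rightarrow> int) \<Rightarrow> nat \<Rightarrow> 'f mat topology" where
  "GL_topology val n =
     pullback_topology (GL n) (\<lambda>g. \<lambda>ij\<in>{..<n} \<times> {..<n}. g $$ ij)
       (product_topology (\<lambda>_. field_topology val) ({..<n} \<times> {..<n}))"

text \<open>A representation acts on a subspace \<open>V\<close> of the type \<open>'v\<close>, so that spaces of functions can
  be treated in the same way as full types; the values of \<open>\<pi> g\<close> off \<open>V\<close> and of \<open>\<pi>\<close>
  off \<open>GL n\<close> are irrelevant.\<close>

definition smooth_representation ::
    "('f::field \<Rightarrow> int) \<Rightarrow> nat \<Rightarrow> 'v::complex_vector set \<Rightarrow> ('f mat \<Rightarrow> 'v \<Rightarrow> 'v) \<Rightarrow> bool" where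
  "smooth_representation val n V \<pi> \<longleftrightarrow>
     complex_vector.subspace V \<and>
     (\<forall>g\<in>GL n. \<forall>x\<in>V. \<pi> g x \<in> V) \<and>
     (\<forall>g\<in>GL n. \<forall>x\<in>V. \<forall>y\<in>V. \<pi> g (x + y) = \<pi> g x + \<pi> g y) \<and>
     (\<forall>g\<in>GL n. \<forall>c. \<forall>x\<in>V. \<pi> g (c *\<^sub>C x) = c *\<^sub>C \<pi> g x) \<and>
     (\<forall>x\<in>V. \<pi> (1\<^sub>m n) x = x) \<and>
     (\<forall>g\<in>GL n. \<forall>h\<in>GL n. \<forall>x\<in>V. \<pi> (g * h) x = \<pi> g (\<pi> h x)) \<and>
     (\<forall>x\<in>V. openin (GL_topology val n) {g \<in> GL n. \<pi> g x = x})"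


section \<open>Shalika functionals\<close>

definition mat_trace :: "'f::field mat \<Rightarrow> 'f" where
  "mat_trace A = (\<Sum>i<dim_row A. A $$ (i, i))"

definition shalika_element :: "nat \<Rightarrow> 'f::field mat \<Rightarrow> 'f mat \<Rightarrow> 'f mat" where
  "shalika_element m x g =
     four_block_mat (1\<^sub>m m) x (0\<^sub>m m m) (1\<^sub>m m) * four_block_mat g (0\<^sub>m m m) (0\<^sub>m m m) g"

definition shalika_subgroup :: "nat \<Rightarrow> 'f::field mat set" where
  "shalika_subgroup m = {shalika_element m x g | x g. x \<in> carrier_mat m m \<and> g \<in> GL m}"

text \<open>The decomposition of an element of the Shalika subgroup is unique; see
  \<open>shalika_character_eq\<close>.\<close>

definition shalika_character :: "('f::field \<Rightarrow> complex) \<Rightarrow> nat \<Rightarrow> 'f mat \<Rightarrow> complex" where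
  "shalika_character \<theta> m s =
     \<theta> (mat_trace (THE x. x \<in> carrier_mat m m \<and> (\<exists>g\<in>GL m. s = shalika_element m x g)))"

lemma shalika_element_eq:
  assumes "x \<in> carrier_mat m m" "g \<in> carrier_mat m m"
  shows "shalika_element m x g = four_block_mat g (x * g) (0\<^sub>m m m) g"
  unfolding shalika_element_def using assms
  by (subst mult_four_block_mat[of _ m m _ m _ m _ _ m _ m]) auto

lemma shalika_character_eq:
  assumes x: "x \<in> carrier_mat m m" and g: "g \<in> GL m"
  shows "shalika_character \<theta> m (shalika_element m x g) = \<theta> (mat_trace x)"
proof -
  have "y = x" if y: "y \<in> carrier_mat m m" and h: "h \<in> GL m"
    and eq: "shalika_element m x g = shalika_element m y h" for y h
  proof -
    have c: "g \<in> carrier_mat m m" "h \<in> carrier_mat m m"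
      using g h by (auto simp: GL_def)
    have eq': "four_block_mat g (x * g) (0\<^sub>m m m) g = four_block_mat h (y * h) (0\<^sub>m m m) h"
      using eq x y c by (simp add: shalika_element_eq)
    have gh: "g = h"
    proof (rule eq_matI)
      fix i j assume "i < dim_row h" "j < dim_col h"
      then show "g $$ (i, j) = h $$ (i, j)"
        using c arg_cong[OF eq', of "\<lambda>A. A $$ (i, j)"] by auto
    qed (use c in auto)
    have "x * g = y * g"
    proof (rule eq_matI)
      fix i j assume "i < dim_row (y * g)" "j < dim_col (y * g)"
      then show "(x * g) $$ (i, j) = (y * g) $$ (i, j)"
        using c x y arg_cong[OF eq', of "\<lambda>A. A $$ (i, m + j)"] unfolding gh by simp
    qed (use c x y in auto)
    moreover obtain k where "g * k = 1\<^sub>m m" "k \<in> carrier_mat m m"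
    proof -
      obtain k where k: "inverts_mat g k" "inverts_mat k g"
        using g by (auto simp: GL_def invertible_mat_def)
      from k(2) have "dim_row k = m" "dim_col k = m"
        using k c unfolding inverts_mat_def
        by (metis carrier_matD index_mult_mat(2,3) index_one_mat(2,3))+
      then show ?thesis using that k c by (auto simp: inverts_mat_def)
    qed
    moreover have "x * (g * k) = x * g * k" "y * (g * k) = y * g * k"
      using x y c \<open>k \<in> carrier_mat m m\<close> by simp_all
    ultimately show "y = x"
      using x y by simp
  qed
  then have "(THE y. y \<in> carrier_mat m m \<and> (\<exists>h\<in>GL m. shalika_element m x g = shalika_element m y h)) = x"
    using x g by (intro the_equality) blast+
  then show ?thesis by (simp add: shalika_character_def)
qed

definition linear_functional_on :: "'v::complex_vector set \<Rightarrow> ('v \<Rightarrow> complex) \<Rightarrow> bool" where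
  "linear_functional_on V L \<longleftrightarrow>
     (\<forall>x\<in>V. \<forall>y\<in>V. L (x + y) = L x + L y) \<and> (\<forall>c. \<forall>x\<in>V. L (c *\<^sub>C x) = c * L x)"

text \<open>Homomorphisms from the restriction of a representation \<open>\<pi>\<close> on \<open>V\<close> to a subgroup \<open>H\<close>
  into the character \<open>\<psi>\<close>; only the values on \<open>V\<close> of such a functional matter.\<close>

definition Hom_character ::
    "'g set \<Rightarrow> 'v::complex_vector set \<Rightarrow> ('g \<Rightarrow> 'v \<Rightarrow> 'v) \<Rightarrow> ('g \<Rightarrow> complex) \<Rightarrow> ('v \<Rightarrow> complex) set" where
  "Hom_character H V \<pi> \<psi> =
     {L. linear_functional_on V L \<and> (\<forall>h\<in>H. \<forall>x\<in>V. L (\<pi> h x) = \<psi> h * L x)}"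

definition admits_shalika_functional ::
    "('f::field \<Rightarrow> complex) \<Rightarrow> nat \<Rightarrow> 'v::complex_vector set \<Rightarrow> ('f mat \<Rightarrow> 'v \<Rightarrow> 'v) \<Rightarrow> bool" where
  "admits_shalika_functional \<theta> n V \<pi> \<longleftrightarrow>
     (\<exists>L \<in> Hom_character (shalika_subgroup (n div 2)) V \<pi> (shalika_character \<theta> (n div 2)).
        \<exists>x\<in>V. L x \<noteq> 0)"


section \<open>Normalised parabolic induction\<close>

text \<open>The modulus character at an element of the parabolic with diagonal blocks \<open>a\<close>, \<open>d\<close>.\<close>

definition parabolic_modulus ::
    "('f::field \<Rightarrow> int) \<Rightarrow> nat \<Rightarrow> nat \<Rightarrow> 'f mat \<Rightarrow> 'f mat \<Rightarrow> real" where
  "parabolic_modulus val n1 n2 a d =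
     normalised_abs val (det a) ^ n2 * normalised_abs val (det d) powi (- int n1)"

text \<open>Functions on the group are represented by functions on all matrices vanishing off it.\<close>

definition induced_space ::
    "('f::field \<Rightarrow> int) \<Rightarrow> nat \<Rightarrow> nat \<Rightarrow>
     ('f mat \<Rightarrow> 'v::complex_vector \<Rightarrow> 'v) \<Rightarrow> ('f mat \<Rightarrow> 'w::complex_vector \<Rightarrow> 'w) \<Rightarrow>
     ('f mat \<Rightarrow> ('v, 'w) tensor) set" where
  "induced_space val n1 n2 \<pi>1 \<pi>2 =
     {f. (\<forall>g. g \<notin> GL (n1 + n2) \<longrightarrow> f g = 0) \<and>
         locally_constant_on (GL_topology val (n1 + n2)) f \<and>
         (\<forall>a\<in>GL n1. \<forall>d\<in>GL n2. \<forall>b\<in>carrier_mat n1 n2. \<forall>g\<in>GL (n1 + n2).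
            f (four_block_mat a b (0\<^sub>m n2 n1) d * g) =
              complex_of_real (sqrt (parabolic_modulus val n1 n2 a d)) *\<^sub>C
                tensor_map (\<pi>1 a) (\<pi>2 d) (f g))}"

definition right_translation ::
    "nat \<Rightarrow> 'f::field mat \<Rightarrow> ('f mat \<Rightarrow> 'u::complex_vector) \<Rightarrow> 'f mat \<Rightarrow> 'u" where
  "right_translation n h f = (\<lambda>g. if g \<in> GL n then f (g * h) else 0)"

end

(*
The Shalika subgroup S is GL_m over the dual numbers F[e] (e^2 = 0): g + e z stands for the matrix
with diagonal blocks g and upper right block z, and its character reads the trace of z g^-1.
Conjugating by a permutation w of the coordinates moves S so that it meets the parabolic P in the
block upper triangular subgroup Q of GL_m(F[e]), whose Levi factor is S1 x S2. For f in the induced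
space, the function s |-> (l1 (x) l2)(f(w s)) / Theta(s) on S is Q-equivariant under the restriction
of the square root of delta_P, which is precisely the modulus character of Q. Integrating such
functions over Q \ S gives an S-invariant functional because S is unimodular. Although Q \ S is not
compact, smoothness of f together with nontriviality of theta forces the support to be compact
modulo Q. The functional is nonzero on a section supported in a single small translate P K w.
All integrals are finite sums over double cosets weighted by generalised indices of compact open
subgroups, so no measure theory is involved.
*)
theory Submission
  imports Defs "HOL-Algebra.Coset"
begin

section \<open>Commensurable families of subgroups\<close>

text \<open>Why the square root of delta_P restricts to the modulus of Q: g + e z, seen as a matrix
  of size 2m, has determinant (det g)^2, which cancels the square root, while the unipotent radical
  of Q consists of matrices over F[e] and so has twice as many coordinates over F. The obstacle is
  convergence. Modulo Q on the left and integral matrices on the right only a lower left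
  infinitesimal block y remains, and y is unbounded. A small upper unipotent with parameter v, under
  which f is right invariant, can be moved past y to the left, where it acts by theta(trace(y v));
  hence f vanishes unless y is bounded. Both modulus characters are found without integration.
  Infinitesimal unipotents lie in compact subgroups, so only the GL_m factors matter; there a
  positive character trivial on integral matrices is a power of |det|, and the exponent is read off
  from central elements and one explicit index. Nonvanishing needs no evaluation: the test integrand
  takes values in the nonnegative multiples of the single number l1(v) l2(u), so nothing
  cancels.\<close>

lemma card_image_eq_of_same_fibres:
  assumes "\<And>a a'. a \<in> A \<Longrightarrow> a' \<in> A \<Longrightarrow> f a = f a' \<longleftrightarrow> g a = g a'"
  shows "card (f ` A) = card (g ` A)" and "finite (f ` A) \<longleftrightarrow> finite (g ` A)"
proof -
  define h where "h y = g (SOME a. a \<in> A \<and> f a = y)" for y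
  have h: "h (f a) = g a" if "a \<in> A" for a
  proof -
    have "\<exists>b. b \<in> A \<and> f b = f a" using that by blast
    then have "(SOME b. b \<in> A \<and> f b = f a) \<in> A \<and> f (SOME b. b \<in> A \<and> f b = f a) = f a"
      by (rule someI_ex)
    then show ?thesis unfolding h_def using assms that by blast
  qed
  have "inj_on h (f ` A)" by (auto simp: inj_on_def h assms)
  moreover have "h ` f ` A = g ` A" by (auto simp: h image_iff)
  ultimately have "bij_betw h (f ` A) (g ` A)" by (simp add: bij_betw_def)
  then show "card (f ` A) = card (g ` A)" "finite (f ` A) \<longleftrightarrow> finite (g ` A)"
    by (auto simp: bij_betw_same_card bij_betw_finite)
qed

section \<open>Coset counts and conjugates in an abstract group\<close>

context group
begin

lemma inv_cancel_left [simp]: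
  assumes "a \<in> carrier G" "b \<in> carrier G"
  shows "inv a \<otimes> (a \<otimes> b) = b" "a \<otimes> (inv a \<otimes> b) = b"
  using assms by (simp_all add: m_assoc[symmetric])

lemma mem_l_coset: "x \<in> a <# B \<longleftrightarrow> (\<exists>b\<in>B. x = a \<otimes> b)"
  by (auto simp: l_coset_def)

lemma l_coset_eq_iff:
  assumes B: "subgroup B G" and a: "a \<in> carrier G" "a' \<in> carrier G"
  shows "a <# B = a' <# B \<longleftrightarrow> inv a \<otimes> a' \<in> B"
proof
  assume "a <# B = a' <# B"
  moreover have "a' \<in> a' <# B"
    using subgroup.one_closed[OF B] a by (auto simp: mem_l_coset intro!: bexI[of _ \<one>])
  ultimately have "a' \<in> a <# B" by simp
  then obtain b where "b \<in> B" "a' = a \<otimes> b" by (auto simp: mem_l_coset)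
  then show "inv a \<otimes> a' \<in> B" using a subgroup.mem_carrier[OF B] by simp
next
  assume h: "inv a \<otimes> a' \<in> B"
  then have h2: "inv a' \<otimes> a \<in> B"
    using subgroup.m_inv_closed[OF B h] a by (simp add: inv_mult_group)
  have "u <# B \<subseteq> v <# B" if "u \<in> carrier G" "v \<in> carrier G" "inv v \<otimes> u \<in> B" for u v
  proof
    fix x assume "x \<in> u <# B"
    then obtain b where b: "b \<in> B" "x = u \<otimes> b" by (auto simp: mem_l_coset)
    then have "(inv v \<otimes> u) \<otimes> b \<in> B" using that subgroup.m_closed[OF B] by blast
    moreover have "x = v \<otimes> ((inv v \<otimes> u) \<otimes> b)"
      using b that subgroup.mem_carrier[OF B] by (simp add: m_assoc)
    ultimately show "x \<in> v <# B" by (auto simp: mem_l_coset)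
  qed
  then show "a <# B = a' <# B" using a h h2 by blast
qed

definition cosets_on :: "'a set \<Rightarrow> 'a set \<Rightarrow> 'a set set" where
  "cosets_on A B = (\<lambda>a. a <# B) ` A"

definition index :: "'a set \<Rightarrow> 'a set \<Rightarrow> nat" where
  "index A B = card (cosets_on A B)"

text \<open>The conjugate s A s^-1, encoded as a preimage so that intersections and iterated
  conjugations are immediate; \<open>conj_set_image\<close> recovers the image form.\<close>

definition conj_set :: "'a \<Rightarrow> 'a set \<Rightarrow> 'a set" where
  "conj_set s A = {x \<in> carrier G. inv s \<otimes> x \<otimes> s \<in> A}"

text \<open>An index may be counted with any map whose fibres on A are the left cosets of B; this is
  how orbit counts and residue counts become indices below.\<close>

lemma card_image_eq_index:
  assumes "subgroup B G" "A \<subseteq> carrier G"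
    and "\<And>a a'. a \<in> A \<Longrightarrow> a' \<in> A \<Longrightarrow> f a = f a' \<longleftrightarrow> inv a \<otimes> a' \<in> B"
  shows "card (f ` A) = index A B" and "finite (f ` A) \<longleftrightarrow> finite (cosets_on A B)"
  unfolding index_def cosets_on_def
  by (rule card_image_eq_of_same_fibres; use assms in \<open>simp add: subset_iff l_coset_eq_iff\<close>)+

lemma index_pos:
  assumes "finite (cosets_on A B)" "subgroup A G"
  shows "index A B > 0"
  using assms subgroup.one_closed[OF assms(2)]
  unfolding index_def cosets_on_def by (subst card_gt_0_iff) auto

lemma index_self:
  assumes "subgroup A G"
  shows "index A A = 1"
proof -
  have "card ((\<lambda>a. ()) ` A) = index A A"
    using assms by (intro card_image_eq_index)
      (auto intro: subgroup.m_closed subgroup.m_inv_closed subgroup.mem_carrier)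
  moreover have "(\<lambda>a. ()) ` A = {()}" using subgroup.one_closed[OF assms] by auto
  ultimately show ?thesis by (metis card_1_singleton_iff One_nat_def)
qed

text \<open>The map a C -> a B is onto, and its fibre over a B consists of the cosets a b C with b
  in B, so every fibre has \<open>index B C\<close> elements.\<close>

lemma index_tower:
  assumes A: "subgroup A G" and B: "subgroup B G" and C: "subgroup C G"
    and sub: "C \<subseteq> B" "B \<subseteq> A" and fin: "finite (cosets_on A C)"
  shows "index A C = index A B * index B C" and "finite (cosets_on A B)" and "finite (cosets_on B C)"
proof -
  note car = subgroup.mem_carrier[OF A] subgroup.mem_carrier[OF B] subgroup.mem_carrier[OF C]
  \<comment> \<open>\<open>f X\<close> is the product set X B, so it sends the coset a C to a
    B.\<close>
  define f where "f X = (\<Union>x\<in>X. x <# B)" for X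
  have f: "f (a <# C) = a <# B" if "a \<in> A" for a
  proof -
    have "x <# B = a <# B" if x: "x \<in> a <# C" for x
    proof -
      obtain c where c: "c \<in> C" "x = a \<otimes> c" using x by (auto simp: mem_l_coset)
      then have "inv x \<otimes> a = inv c" using \<open>a \<in> A\<close> car by (simp add: inv_mult_group m_assoc)
      then have "inv x \<otimes> a \<in> B" using c sub subgroup.m_inv_closed[OF C] by auto
      then show ?thesis using l_coset_eq_iff[OF B, of x a] c \<open>a \<in> A\<close> car by auto
    qed
    moreover have "a \<in> a <# C"
      using subgroup.one_closed[OF C] car \<open>a \<in> A\<close> by (auto simp: mem_l_coset intro!: bexI[of _ \<one>])
    ultimately show ?thesis unfolding f_def by blast
  qed
  show finB: "finite (cosets_on A B)"
  proof -
    have "cosets_on A B = f ` cosets_on A C" using f by (force simp: cosets_on_def)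
    then show ?thesis using fin by simp
  qed
  show "finite (cosets_on B C)"
    using fin by (rule rev_finite_subset) (use sub in \<open>auto simp: cosets_on_def\<close>)
  have fib: "card {X \<in> cosets_on A C. f X = Y} = index B C" if Y: "Y \<in> cosets_on A B" for Y
  proof -
    obtain a where a: "a \<in> A" "Y = a <# B" using Y by (auto simp: cosets_on_def)
    have "{X \<in> cosets_on A C. f X = Y} = (\<lambda>b. (a \<otimes> b) <# C) ` B"
    proof (intro equalityI subsetI)
      fix X assume "X \<in> {X \<in> cosets_on A C. f X = Y}"
      then obtain a' where a': "a' \<in> A" "X = a' <# C" "a' <# B = a <# B"
        using f a by (auto simp: cosets_on_def)
      then have "inv a \<otimes> a' \<in> B" using l_coset_eq_iff[OF B, of a a'] a car by auto
      moreover have "X = (a \<otimes> (inv a \<otimes> a')) <# C" using a a' car by simp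
      ultimately show "X \<in> (\<lambda>b. (a \<otimes> b) <# C) ` B" by blast
    next
      fix X assume "X \<in> (\<lambda>b. (a \<otimes> b) <# C) ` B"
      then obtain b where b: "b \<in> B" "X = (a \<otimes> b) <# C" by blast
      then have ab: "a \<otimes> b \<in> A" using a sub subgroup.m_closed[OF A] by blast
      moreover have "(a \<otimes> b) <# B = a <# B"
        using l_coset_eq_iff[OF B, of a "a \<otimes> b"] a b car by auto
      ultimately show "X \<in> {X \<in> cosets_on A C. f X = Y}"
        using f a b by (auto simp: cosets_on_def)
    qed
    moreover have "card ((\<lambda>b. (a \<otimes> b) <# C) ` B) = index B C"
    proof (rule card_image_eq_index(1)[OF C])
      fix b b' assume "b \<in> B" "b' \<in> B"
      then show "((a \<otimes> b) <# C = (a \<otimes> b') <# C) = (inv b \<otimes> b' \<in> C)"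
        using l_coset_eq_iff[OF C, of "a \<otimes> b" "a \<otimes> b'"] a car
        by (simp add: inv_mult_group m_assoc)
    qed (use car in auto)
    ultimately show ?thesis by simp
  qed
  have "index A C = (\<Sum>Y\<in>cosets_on A B. card {X \<in> cosets_on A C. f X = Y})"
    unfolding index_def card_eq_sum
    by (rule sum.group[symmetric]) (use fin finB f in \<open>auto simp: cosets_on_def\<close>)
  also have "\<dots> = index A B * index B C" using fib by (simp add: index_def)
  finally show "index A C = index A B * index B C" .
qed

lemma conj_set_subgroup:
  assumes A: "subgroup A G" and s: "s \<in> carrier G"
  shows "subgroup (conj_set s A) G"
proof (rule subgroupI)
  show "conj_set s A \<noteq> {}"
    using s subgroup.one_closed[OF A] by (auto simp: conj_set_def intro!: exI[of _ \<one>])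
next
  fix a assume "a \<in> conj_set s A"
  then have a: "a \<in> carrier G" "inv s \<otimes> a \<otimes> s \<in> A" by (auto simp: conj_set_def)
  then have "inv (inv s \<otimes> a \<otimes> s) \<in> A" using subgroup.m_inv_closed[OF A] by blast
  then show "inv a \<in> conj_set s A" using a s by (simp add: conj_set_def inv_mult_group m_assoc)
next
  fix a b assume "a \<in> conj_set s A" "b \<in> conj_set s A"
  then have a: "a \<in> carrier G" "inv s \<otimes> a \<otimes> s \<in> A" and b: "b \<in> carrier G" "inv s \<otimes> b \<otimes> s \<in> A"
    by (auto simp: conj_set_def)
  then have "(inv s \<otimes> a \<otimes> s) \<otimes> (inv s \<otimes> b \<otimes> s) \<in> A" using subgroup.m_closed[OF A] by blast
  then show "a \<otimes> b \<in> conj_set s A" using a b s by (simp add: conj_set_def m_assoc)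
qed (auto simp: conj_set_def)

lemma conj_set_conj_set:
  "s \<in> carrier G \<Longrightarrow> t \<in> carrier G \<Longrightarrow> conj_set s (conj_set t A) = conj_set (s \<otimes> t) A"
  by (auto simp: conj_set_def inv_mult_group m_assoc)

lemma conj_set_self:
  assumes A: "subgroup A G" and s: "s \<in> A"
  shows "conj_set s A = A"
proof -
  have c: "s \<in> carrier G" using subgroup.mem_carrier[OF A s] .
  have "x \<in> A" if "x \<in> carrier G" "inv s \<otimes> x \<otimes> s \<in> A" for x
  proof -
    have "s \<otimes> (inv s \<otimes> x \<otimes> s) \<otimes> inv s \<in> A"
      using that s A by (meson subgroup.m_closed subgroup.m_inv_closed)
    then show ?thesis using that c by (simp add: m_assoc)
  qed
  then show ?thesis
    using A s c unfolding conj_set_def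
    by (auto intro: subgroup.m_closed subgroup.m_inv_closed subgroup.mem_carrier)
qed

lemma conj_set_Int: "conj_set s (A \<inter> B) = conj_set s A \<inter> conj_set s B"
  by (auto simp: conj_set_def)

lemma conj_set_image:
  assumes "A \<subseteq> carrier G" "s \<in> carrier G"
  shows "conj_set s A = (\<lambda>a. s \<otimes> a \<otimes> inv s) ` A"
proof -
  have "x = s \<otimes> (inv s \<otimes> x \<otimes> s) \<otimes> inv s" if "x \<in> carrier G" for x
    using that assms by (simp add: m_assoc)
  then show ?thesis
    using assms by (force simp: conj_set_def m_assoc)
qed

lemma index_conj_set:
  assumes A: "subgroup A G" and B: "subgroup B G" and s: "s \<in> carrier G"
  shows "index (conj_set s A) (conj_set s B) = index A B"
    and "finite (cosets_on (conj_set s A) (conj_set s B)) \<longleftrightarrow> finite (cosets_on A B)"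
proof -
  have c: "A \<subseteq> carrier G" using A subgroup.subset by blast
  let ?f = "\<lambda>a. (s \<otimes> a \<otimes> inv s) <# conj_set s B"
  have eq: "?f ` A = cosets_on (conj_set s A) (conj_set s B)"
    unfolding cosets_on_def conj_set_image[OF c s] by (simp add: image_image)
  have "?f a = ?f a' \<longleftrightarrow> inv a \<otimes> a' \<in> B" if "a \<in> A" "a' \<in> A" for a a'
  proof -
    have ca: "a \<in> carrier G" "a' \<in> carrier G" using that c by auto
    have "?f a = ?f a' \<longleftrightarrow> inv (s \<otimes> a \<otimes> inv s) \<otimes> (s \<otimes> a' \<otimes> inv s) \<in> conj_set s B"
      using ca s by (intro l_coset_eq_iff conj_set_subgroup B) auto
    also have "\<dots> \<longleftrightarrow> inv a \<otimes> a' \<in> B"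
      using ca s by (simp add: conj_set_def inv_mult_group m_assoc)
    finally show ?thesis .
  qed
  from card_image_eq_index[OF B c this]
  show "index (conj_set s A) (conj_set s B) = index A B"
    "finite (cosets_on (conj_set s A) (conj_set s B)) \<longleftrightarrow> finite (cosets_on A B)"
    by (simp_all add: eq index_def)
qed

text \<open>The Haar volume of \<open>A\<close>, normalised by \<open>K0\<close>, as a generalised index.\<close>

definition vol :: "'a set \<Rightarrow> 'a set \<Rightarrow> real" where
  "vol K0 A = real (index A (A \<inter> K0)) / real (index K0 (A \<inter> K0))"

text \<open>As K0 has volume one, this is the factor by which conjugation by s scales volumes;
  \<open>vol_conj_set\<close> shows that every member of the family is scaled alike.\<close>

definition modulus :: "'a set \<Rightarrow> 'a \<Rightarrow> real" where
  "modulus K0 s = vol K0 (conj_set s K0)"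

end

text \<open>The members of \<K> stand for the compact open subgroups of Q. Stability under
  intersection and conjugation, together with finite mutual indices, is the substitute for topology
  on which the volume rests.\<close>

locale commensurable_family = group G for G (structure) +
  fixes Q :: "'a set" and \<K> :: "'a set set" and K0 :: "'a set"
  assumes Q: "subgroup Q G"
    and family_subgroup: "A \<in> \<K> \<Longrightarrow> subgroup A G"
    and family_subset: "A \<in> \<K> \<Longrightarrow> A \<subseteq> Q"
    and family_Int: "A \<in> \<K> \<Longrightarrow> B \<in> \<K> \<Longrightarrow> A \<inter> B \<in> \<K>"
    and family_conj: "A \<in> \<K> \<Longrightarrow> q \<in> Q \<Longrightarrow> conj_set q A \<in> \<K>"
    and family_finite: "A \<in> \<K> \<Longrightarrow> B \<in> \<K> \<Longrightarrow> finite (cosets_on A (A \<inter> B))"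
    and base: "K0 \<in> \<K>"
begin

lemma finite_cosets: "A \<in> \<K> \<Longrightarrow> B \<in> \<K> \<Longrightarrow> B \<subseteq> A \<Longrightarrow> finite (cosets_on A B)"
  using family_finite[of A B] by (simp add: inf_absorb2)

lemma family_index_pos: "A \<in> \<K> \<Longrightarrow> B \<in> \<K> \<Longrightarrow> B \<subseteq> A \<Longrightarrow> index A B > 0"
  by (intro index_pos finite_cosets family_subgroup)

lemma vol_pos:
  assumes "A \<in> \<K>"
  shows "vol K0 A > 0"
  unfolding vol_def using assms base by (simp add: family_index_pos family_Int)

lemma vol_base: "vol K0 K0 = 1"
  by (simp add: vol_def index_self family_subgroup base)

text \<open>The index of B meet K0 in A is computed along two towers, through A meet K0 and through
  B; comparing the results eliminates the reference subgroup K0.\<close>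

lemma vol_index:
  assumes "A \<in> \<K>" "B \<in> \<K>" "B \<subseteq> A"
  shows "vol K0 A = index A B * vol K0 B"
proof -
  let ?a = "A \<inter> K0" and ?b = "B \<inter> K0"
  note mem = assms(1,2) base family_Int[OF assms(1) base] family_Int[OF assms(2) base]
  note sg = mem[THEN family_subgroup]
  have "index A ?a * index ?a ?b = index A B * index B ?b"
  proof -
    have "?b \<subseteq> A" "?b \<subseteq> ?a" using assms(3) by auto
    then show ?thesis
      using index_tower(1)[OF sg(1) sg(4) sg(5)] index_tower(1)[OF sg(1) sg(2) sg(5)]
        finite_cosets[OF mem(1) mem(5)] assms(3) by auto
  qed
  moreover have "index K0 ?b = index K0 ?a * index ?a ?b"
    using index_tower(1)[OF sg(3) sg(4) sg(5)] finite_cosets[OF mem(3) mem(5)] assms(3) by auto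
  moreover have "index K0 ?a > 0" "index ?a ?b > 0" "index K0 ?b > 0"
    using family_index_pos mem assms(3) by auto
  moreover have "real (index A ?a) * real (index ?a ?b) = real (index A B) * real (index B ?b)"
    using calculation(1) by (metis of_nat_mult)
  ultimately show ?thesis
    unfolding vol_def by (simp add: field_simps)
qed

text \<open>Conjugation preserves indices, so A and K0 can both be compared with A meet K0; this
  transfers the scaling factor of K0 to A.\<close>

lemma vol_conj_set:
  assumes A: "A \<in> \<K>" and q: "q \<in> Q"
  shows "vol K0 (conj_set q A) = modulus K0 q * vol K0 A"
proof -
  have qc: "q \<in> carrier G" using subgroup.mem_carrier[OF Q q] .
  have *: "vol K0 (conj_set q C) = index C B * vol K0 (conj_set q B)"
    if "C \<in> \<K>" "B \<in> \<K>" "B \<subseteq> C" for B C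
  proof -
    have "conj_set q B \<subseteq> conj_set q C" using that(3) by (auto simp: conj_set_def)
    then have "vol K0 (conj_set q C) = index (conj_set q C) (conj_set q B) * vol K0 (conj_set q B)"
      using that q by (intro vol_index family_conj)
    then show ?thesis using that qc by (simp add: index_conj_set family_subgroup)
  qed
  let ?B = "A \<inter> K0"
  have B: "?B \<in> \<K>" using A base by (rule family_Int)
  have 1: "vol K0 (conj_set q A) = index A ?B * vol K0 (conj_set q ?B)"
    and 2: "vol K0 (conj_set q K0) = index K0 ?B * vol K0 (conj_set q ?B)"
    using *[OF A B] *[OF base B] by simp_all
  have 3: "vol K0 A = index A ?B * vol K0 ?B" by (intro vol_index A B) simp
  have "vol K0 K0 = index K0 ?B * vol K0 ?B" by (intro vol_index base B) simp
  then have 4: "real (index K0 ?B) * vol K0 ?B = 1" by (simp add: vol_base)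
  have "modulus K0 q * vol K0 A
      = vol K0 (conj_set q A) * (real (index K0 ?B) * vol K0 ?B)"
    unfolding modulus_def 1 2 3 by (simp only: ac_simps)
  then show ?thesis unfolding 4 by simp
qed

lemma modulus_pos: "q \<in> Q \<Longrightarrow> modulus K0 q > 0"
  by (simp add: modulus_def vol_pos family_conj base)

lemma modulus_mult:
  assumes "q \<in> Q" "r \<in> Q"
  shows "modulus K0 (q \<otimes> r) = modulus K0 q * modulus K0 r"
proof -
  have "q \<in> carrier G" "r \<in> carrier G" using assms subgroup.mem_carrier[OF Q] by auto
  then have "modulus K0 (q \<otimes> r) = vol K0 (conj_set q (conj_set r K0))"
    by (simp add: modulus_def conj_set_conj_set)
  also have "\<dots> = modulus K0 q * modulus K0 r"
    unfolding vol_conj_set[OF family_conj[OF base assms(2)] assms(1)] by (simp add: modulus_def)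
  finally show ?thesis .
qed

text \<open>A subgroup is normalised by its own elements, so its positive volume is scaled by
  one.\<close>

lemma modulus_compact:
  assumes "A \<in> \<K>" "q \<in> A"
  shows "modulus K0 q = 1"
proof -
  have "q \<in> Q" using assms family_subset by blast
  have "conj_set q A = A" using assms by (simp add: conj_set_self family_subgroup)
  then show ?thesis
    using vol_conj_set[OF assms(1) \<open>q \<in> Q\<close>] vol_pos[OF assms(1)] by simp
qed

lemma modulus_central:
  assumes "q \<in> Q" "\<And>x. x \<in> carrier G \<Longrightarrow> q \<otimes> x = x \<otimes> q"
  shows "modulus K0 q = 1"
proof -
  have q: "q \<in> carrier G" using assms(1) subgroup.mem_carrier[OF Q] by auto
  have "inv q \<otimes> x \<otimes> q = x" if "x \<in> carrier G" for x
    using that q assms(2)[OF that] by (simp add: m_assoc) (metis assms(2) inv_cancel_left(1))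
  then have "conj_set q K0 = K0"
    using subgroup.subset[OF family_subgroup[OF base]] by (auto simp: conj_set_def)
  then show ?thesis by (simp add: modulus_def vol_base)
qed

end

section \<open>The invariant functional on equivariant functions\<close>

text \<open>The setting for integrals over Q-orbits: the compact open subgroups of G, their traces
  on Q, and unimodularity of G, which \<open>haar_translate\<close> turns into invariance.\<close>

locale relative_haar = group G for G (structure) +
  fixes Q :: "'a set" and \<K> :: "'a set set" and K0 :: "'a set"
  assumes total_family: "commensurable_family G (carrier G) \<K> K0"
    and rel_family: "commensurable_family G Q ((\<inter>) Q ` \<K>) (Q \<inter> K0)"
    and unimodular: "s \<in> carrier G \<Longrightarrow> modulus K0 s = 1"
begin

sublocale total: commensurable_family G "carrier G" \<K> K0 by (rule total_family)
sublocale rel: commensurable_family G Q "(\<inter>) Q ` \<K>" "Q \<inter> K0" by (rule rel_family)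

abbreviation "\<delta> \<equiv> modulus (Q \<inter> K0)"

definition double_coset :: "'a set \<Rightarrow> 'a \<Rightarrow> 'a set" where
  "double_coset K s = {q \<otimes> s \<otimes> k | q k. q \<in> Q \<and> k \<in> K}"

definition right_invariant :: "('a \<Rightarrow> complex) \<Rightarrow> 'a set \<Rightarrow> bool" where
  "right_invariant \<phi> K \<longleftrightarrow> (\<forall>s\<in>carrier G. \<forall>k\<in>K. \<phi> (s \<otimes> k) = \<phi> s)"

text \<open>Such functions, rather than functions on the quotient, are what integrates over the left
  Q-orbits: the factor matches the change of the volume of Q meet s K s^-1 when s is replaced by q
  s.\<close>

definition equivariant :: "('a \<Rightarrow> complex) \<Rightarrow> bool" where
  "equivariant \<phi> \<longleftrightarrow> (\<forall>q\<in>Q. \<forall>s\<in>carrier G. \<phi> (q \<otimes> s) = of_real (\<delta> q) * \<phi> s)"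

text \<open>Double cosets outside the support are discarded; for a function of level K, finiteness
  of this set expresses compactness of the support modulo Q.\<close>

definition double_cosets :: "('a \<Rightarrow> complex) \<Rightarrow> 'a set \<Rightarrow> 'a set set" where
  "double_cosets \<phi> K = double_coset K ` {s \<in> carrier G. \<phi> s \<noteq> 0}"

definition density :: "('a \<Rightarrow> complex) \<Rightarrow> 'a set \<Rightarrow> 'a \<Rightarrow> complex" where
  "density \<phi> K s = \<phi> s / of_real (vol (Q \<inter> K0) (Q \<inter> conj_set s K))"

definition coset_density :: "('a \<Rightarrow> complex) \<Rightarrow> 'a set \<Rightarrow> 'a set \<Rightarrow> complex" where
  "coset_density \<phi> K D = density \<phi> K (SOME s. s \<in> D)"

text \<open>\<open>vol K0 K\<close> divided by the volume of Q meet s K s^-1 is the mass of the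
  image of Q s K among the left Q-orbits, so the sum is the integral of \<phi> over these orbits
  computed at level K.\<close>

definition level_functional :: "('a \<Rightarrow> complex) \<Rightarrow> 'a set \<Rightarrow> complex" where
  "level_functional \<phi> K = of_real (vol K0 K) * (\<Sum>D\<in>double_cosets \<phi> K. coset_density \<phi> K D)"

definition admissible_level :: "('a \<Rightarrow> complex) \<Rightarrow> 'a set \<Rightarrow> bool" where
  "admissible_level \<phi> K \<longleftrightarrow> K \<in> \<K> \<and> right_invariant \<phi> K \<and> finite (double_cosets \<phi> K)"

text \<open>The level is an arbitrary choice; \<open>refine_level\<close> makes the value
  independent of it.\<close>

definition haar :: "('a \<Rightarrow> complex) \<Rightarrow> complex" where
  "haar \<phi> = level_functional \<phi> (SOME K. admissible_level \<phi> K)"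

lemma Q_carrier: "q \<in> Q \<Longrightarrow> q \<in> carrier G"
  using subgroup.mem_carrier[OF rel.Q] by auto

lemma level_carrier: "K \<in> \<K> \<Longrightarrow> k \<in> K \<Longrightarrow> k \<in> carrier G"
  using total.family_subset by blast

lemma rel_mem: "K \<in> \<K> \<Longrightarrow> s \<in> carrier G \<Longrightarrow> Q \<inter> conj_set s K \<in> (\<inter>) Q ` \<K>"
  using total.family_conj by blast

lemma self_in_double_coset:
  assumes "K \<in> \<K>" "s \<in> carrier G"
  shows "s \<in> double_coset K s"
  using assms subgroup.one_closed[OF rel.Q] subgroup.one_closed[OF total.family_subgroup]
  unfolding double_coset_def by (auto intro!: exI[of _ \<one>])

lemma double_coset_subset:
  assumes K: "K \<in> \<K>" and s: "s \<in> carrier G" and q: "q \<in> Q" and k: "k \<in> K"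
  shows "double_coset K (q \<otimes> s \<otimes> k) \<subseteq> double_coset K s"
proof
  fix x assume "x \<in> double_coset K (q \<otimes> s \<otimes> k)"
  then obtain q' k' where "q' \<in> Q" "k' \<in> K" "x = q' \<otimes> (q \<otimes> s \<otimes> k) \<otimes> k'"
    by (auto simp: double_coset_def)
  then have "x = (q' \<otimes> q) \<otimes> s \<otimes> (k \<otimes> k')" "q' \<otimes> q \<in> Q" "k \<otimes> k' \<in> K"
    using assms Q_carrier level_carrier[OF K] subgroup.m_closed[OF rel.Q]
      subgroup.m_closed[OF total.family_subgroup[OF K]]
    by (simp_all add: m_assoc)
  then show "x \<in> double_coset K s" by (auto simp: double_coset_def)
qed

lemma double_coset_eq:
  assumes K: "K \<in> \<K>" and s: "s \<in> carrier G" and q: "q \<in> Q" and k: "k \<in> K"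
  shows "double_coset K (q \<otimes> s \<otimes> k) = double_coset K s"
proof
  have c: "q \<in> carrier G" "k \<in> carrier G" using Q_carrier level_carrier assms by auto
  have "inv q \<in> Q" "inv k \<in> K"
    using q k K rel.Q total.family_subgroup subgroup.m_inv_closed by metis+
  then have "double_coset K (inv q \<otimes> (q \<otimes> s \<otimes> k) \<otimes> inv k) \<subseteq> double_coset K (q \<otimes> s \<otimes> k)"
    using K s c by (intro double_coset_subset) auto
  moreover have "inv q \<otimes> (q \<otimes> s \<otimes> k) \<otimes> inv k = s" using s c by (simp add: m_assoc)
  ultimately show "double_coset K s \<subseteq> double_coset K (q \<otimes> s \<otimes> k)" by simp
qed (rule double_coset_subset[OF assms])

lemma double_coset_eqD:
  assumes "K \<in> \<K>" "s \<in> carrier G" "t \<in> carrier G" "double_coset K s = double_coset K t"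
  obtains q k where "q \<in> Q" "k \<in> K" "s = q \<otimes> t \<otimes> k"
  using self_in_double_coset[OF assms(1,2)] assms(4) that unfolding double_coset_def by auto

text \<open>Left multiplication by q scales the numerator by equivariance and the denominator by
  conjugation, both by the modulus of q; right multiplication by k changes neither, as k normalises
  K.\<close>

lemma density_double_coset:
  assumes \<phi>: "equivariant \<phi>" "right_invariant \<phi> K" and K: "K \<in> \<K>" and s: "s \<in> carrier G"
    and q: "q \<in> Q" and k: "k \<in> K"
  shows "density \<phi> K (q \<otimes> s \<otimes> k) = density \<phi> K s"
proof -
  have c: "q \<in> carrier G" "k \<in> carrier G" using Q_carrier level_carrier assms by auto
  have "conj_set (q \<otimes> s \<otimes> k) K = conj_set (q \<otimes> s) (conj_set k K)"
    using c s by (simp add: conj_set_conj_set)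
  also have "\<dots> = conj_set q (conj_set s K)"
    using c s k K by (simp add: conj_set_self total.family_subgroup conj_set_conj_set)
  finally have "Q \<inter> conj_set (q \<otimes> s \<otimes> k) K = conj_set q (Q \<inter> conj_set s K)"
    using conj_set_self[OF rel.Q q] by (simp add: conj_set_Int)
  then have "vol (Q \<inter> K0) (Q \<inter> conj_set (q \<otimes> s \<otimes> k) K) = \<delta> q * vol (Q \<inter> K0) (Q \<inter> conj_set s K)"
    using rel.vol_conj_set[OF rel_mem[OF K s] q] by simp
  moreover have "\<phi> (q \<otimes> s \<otimes> k) = of_real (\<delta> q) * \<phi> s"
    using \<phi> c s q k by (simp add: equivariant_def right_invariant_def)
  ultimately show ?thesis
    using rel.modulus_pos[OF q] by (simp add: density_def)
qed

lemma coset_density: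
  assumes \<phi>: "equivariant \<phi>" "right_invariant \<phi> K" and K: "K \<in> \<K>" and s: "s \<in> carrier G"
  shows "coset_density \<phi> K (double_coset K s) = density \<phi> K s"
proof -
  have "(SOME t. t \<in> double_coset K s) \<in> double_coset K s"
    using self_in_double_coset[OF K s] by (rule someI)
  then show ?thesis
    unfolding coset_density_def using density_double_coset[OF assms]
    by (auto simp: double_coset_def)
qed

text \<open>A double coset Q s K1 breaks into pieces Q s k K2. By orbit counting, the piece through
  k arises from as many cosets of K2 in K1 as the index of Q meet (s k) K2 (s k)^-1 in Q meet s K1
  s^-1, and its density exceeds that of Q s K1 by the same factor. The densities of the pieces
  therefore add up to \<open>index K1 K2\<close> times the old density, and this index is the ratio
  of the volumes of K1 and K2.\<close>

lemma refine_level: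
  assumes \<phi>: "equivariant \<phi>" and K1: "admissible_level \<phi> K1" and K2: "K2 \<in> \<K>" and sub: "K2 \<subseteq> K1"
  shows "admissible_level \<phi> K2" and "level_functional \<phi> K2 = level_functional \<phi> K1"
proof -
  have K1': "K1 \<in> \<K>" and r1: "right_invariant \<phi> K1" and fin1: "finite (double_cosets \<phi> K1)"
    using K1 by (auto simp: admissible_level_def)
  have r2: "right_invariant \<phi> K2" using r1 sub by (auto simp: right_invariant_def)
  note sg1 = total.family_subgroup[OF K1'] and sg2 = total.family_subgroup[OF K2]
  note car = Q_carrier level_carrier[OF K1'] level_carrier[OF K2]
  \<comment> \<open>\<open>g D\<close> is D K1, the coarse double coset containing the fine one
    D.\<close>
  define g where "g D = {d \<otimes> k | d k. d \<in> D \<and> k \<in> K1}" for D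
  have g: "g (double_coset K2 s) = double_coset K1 s" if s: "s \<in> carrier G" for s
  proof (intro equalityI subsetI)
    fix x assume "x \<in> g (double_coset K2 s)"
    then obtain q k2 k where "q \<in> Q" "k2 \<in> K2" "k \<in> K1" "x = (q \<otimes> s \<otimes> k2) \<otimes> k"
      by (auto simp: g_def double_coset_def)
    moreover from this have "x = q \<otimes> s \<otimes> (k2 \<otimes> k)" "k2 \<otimes> k \<in> K1"
      using s car sub subgroup.m_closed[OF sg1] by (auto simp: m_assoc)
    ultimately show "x \<in> double_coset K1 s" unfolding double_coset_def by blast
  next
    fix x assume "x \<in> double_coset K1 s"
    then obtain q k where "q \<in> Q" "k \<in> K1" "x = q \<otimes> s \<otimes> k" by (auto simp: double_coset_def)
    moreover from this have "x = (q \<otimes> s \<otimes> \<one>) \<otimes> k" using s car by simp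
    ultimately show "x \<in> g (double_coset K2 s)"
      unfolding g_def double_coset_def using subgroup.one_closed[OF sg2] by blast
  qed
  define fib where "fib s = (\<lambda>k. double_coset K2 (s \<otimes> k)) ` K1" for s
  have fib: "{D \<in> double_cosets \<phi> K2. g D = double_coset K1 s} = fib s"
    if s: "s \<in> carrier G" "\<phi> s \<noteq> 0" for s
  proof (intro equalityI subsetI)
    fix D assume "D \<in> {D \<in> double_cosets \<phi> K2. g D = double_coset K1 s}"
    then obtain t where t: "t \<in> carrier G" "D = double_coset K2 t" "double_coset K1 t = double_coset K1 s"
      using g by (auto simp: double_cosets_def)
    obtain q k where qk: "q \<in> Q" "k \<in> K1" "t = q \<otimes> s \<otimes> k"
      using double_coset_eqD[OF K1' t(1) s(1) t(3)] by blast
    have "double_coset K2 (q \<otimes> (s \<otimes> k) \<otimes> \<one>) = double_coset K2 (s \<otimes> k)"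
      using s qk car subgroup.one_closed[OF sg2] K2 by (intro double_coset_eq) auto
    then have "D = double_coset K2 (s \<otimes> k)" using t qk s car by (simp add: m_assoc)
    then show "D \<in> fib s" using qk by (auto simp: fib_def)
  next
    fix D assume "D \<in> fib s"
    then obtain k where k: "k \<in> K1" "D = double_coset K2 (s \<otimes> k)" by (auto simp: fib_def)
    have sk: "s \<otimes> k \<in> carrier G" "\<phi> (s \<otimes> k) \<noteq> 0"
      using s k r1 car by (auto simp: right_invariant_def)
    have "double_coset K1 (\<one> \<otimes> s \<otimes> k) = double_coset K1 s"
      using s k K1' subgroup.one_closed[OF rel.Q] by (intro double_coset_eq) auto
    then show "D \<in> {D \<in> double_cosets \<phi> K2. g D = double_coset K1 s}"
      using k sk s g by (auto simp: double_cosets_def)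
  qed
  \<comment> \<open>\<open>h s\<close> sends the coset k K2 to Q s k K2, so it maps the cosets of K2
    in K1 onto the pieces of Q s K1.\<close>
  define h where "h s X = {q \<otimes> (s \<otimes> x) | q x. q \<in> Q \<and> x \<in> X}" for s X
  have h: "h s (k <# K2) = double_coset K2 (s \<otimes> k)" if "s \<in> carrier G" "k \<in> K1" for s k
  proof (intro equalityI subsetI)
    fix x assume "x \<in> h s (k <# K2)"
    then obtain q k2 where "q \<in> Q" "k2 \<in> K2" "x = q \<otimes> (s \<otimes> (k \<otimes> k2))"
      by (auto simp: h_def mem_l_coset)
    moreover from this have "x = q \<otimes> (s \<otimes> k) \<otimes> k2" using that car by (simp add: m_assoc)
    ultimately show "x \<in> double_coset K2 (s \<otimes> k)" unfolding double_coset_def by blast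
  next
    fix x assume "x \<in> double_coset K2 (s \<otimes> k)"
    then obtain q k2 where "q \<in> Q" "k2 \<in> K2" "x = q \<otimes> (s \<otimes> k) \<otimes> k2"
      by (auto simp: double_coset_def)
    moreover from this have "x = q \<otimes> (s \<otimes> (k \<otimes> k2))" using that car by (simp add: m_assoc)
    ultimately show "x \<in> h s (k <# K2)" unfolding h_def mem_l_coset by blast
  qed
  have fin12: "finite (cosets_on K1 K2)" by (rule total.finite_cosets[OF K1' K2 sub])
  have fib_h: "fib s = h s ` cosets_on K1 K2" if "s \<in> carrier G" for s
    using h[OF that] by (auto simp: fib_def cosets_on_def image_image)
  have D1: "\<exists>s. s \<in> carrier G \<and> \<phi> s \<noteq> 0 \<and> D = double_coset K1 s" if "D \<in> double_cosets \<phi> K1" for D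
    using that by (auto simp: double_cosets_def)
  have gD: "g ` double_cosets \<phi> K2 \<subseteq> double_cosets \<phi> K1"
    using g by (auto simp: double_cosets_def)
  have fin2: "finite (double_cosets \<phi> K2)"
  proof (rule finite_subset)
    show "double_cosets \<phi> K2 \<subseteq> (\<Union>D\<in>double_cosets \<phi> K1. {E \<in> double_cosets \<phi> K2. g E = D})"
      using gD by auto
    show "finite (\<Union>D\<in>double_cosets \<phi> K1. {E \<in> double_cosets \<phi> K2. g E = D})"
    proof (intro finite_UN_I fin1)
      fix D assume "D \<in> double_cosets \<phi> K1"
      then obtain s where s: "s \<in> carrier G" "\<phi> s \<noteq> 0" "D = double_coset K1 s" using D1 by blast
      show "finite {E \<in> double_cosets \<phi> K2. g E = D}"
        unfolding s(3) fib[OF s(1,2)] fib_h[OF s(1)] using fin12 by simp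
    qed
  qed
  then show "admissible_level \<phi> K2" using K2 r2 by (simp add: admissible_level_def)
  have sum_fib: "(\<Sum>E\<in>fib s. coset_density \<phi> K2 E) = index K1 K2 * coset_density \<phi> K1 (double_coset K1 s)"
    if s: "s \<in> carrier G" for s
  proof -
    let ?v = "vol (Q \<inter> K0)"
    let ?A = "Q \<inter> conj_set s K1"
    have card: "coset_density \<phi> K2 E = card {X \<in> cosets_on K1 K2. h s X = E} * density \<phi> K1 s"
      if E: "E \<in> fib s" for E
    proof -
      obtain k where k: "k \<in> K1" "E = double_coset K2 (s \<otimes> k)" using E by (auto simp: fib_def)
      let ?B = "Q \<inter> conj_set (s \<otimes> k) K2"
      have kc: "k \<in> carrier G" using k car by auto
      have Bsub: "?B \<subseteq> ?A"
      proof -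
        have "conj_set (s \<otimes> k) K2 \<subseteq> conj_set (s \<otimes> k) K1" using sub by (auto simp: conj_set_def)
        also have "\<dots> = conj_set s K1"
          using conj_set_conj_set[OF s kc, of K1] conj_set_self[OF sg1 k(1)] by simp
        finally show ?thesis by auto
      qed
      have BA: "?B \<in> (\<inter>) Q ` \<K>" "?A \<in> (\<inter>) Q ` \<K>"
        using rel_mem K1' K2 s kc by auto
      \<comment> \<open>Conjugated by s, the group \<open>?A\<close> acts on the cosets of K2 in K1.
        The fibre of \<open>h s\<close> over E is the orbit of k K2, and \<open>?B\<close> is the
        stabiliser of k K2.\<close>
      let ?f = "\<lambda>q. (inv s \<otimes> q \<otimes> s \<otimes> k) <# K2"
      have f_in: "inv s \<otimes> q \<otimes> s \<otimes> k \<in> K1" if "q \<in> ?A" for q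
        using that k subgroup.m_closed[OF sg1] by (auto simp: conj_set_def)
      have "{X \<in> cosets_on K1 K2. h s X = E} = ?f ` ?A"
      proof (intro equalityI subsetI)
        fix X assume "X \<in> {X \<in> cosets_on K1 K2. h s X = E}"
        then obtain k' where k': "k' \<in> K1" "X = k' <# K2" "double_coset K2 (s \<otimes> k') = double_coset K2 (s \<otimes> k)"
          using h[OF s] k by (auto simp: cosets_on_def)
        then have k'c: "k' \<in> carrier G" using car by auto
        obtain q k2 where q: "q \<in> Q" "k2 \<in> K2" "s \<otimes> k' = q \<otimes> (s \<otimes> k) \<otimes> k2"
          using double_coset_eqD[OF K2 _ _ k'(3)] s kc k'c by auto
        have qc: "q \<in> carrier G" "k2 \<in> carrier G" using q car by auto
        have e: "k' = inv s \<otimes> (q \<otimes> (s \<otimes> k) \<otimes> k2)"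
          using q(3) inv_cancel_left(1)[OF s k'c] by simp
        have "inv s \<otimes> q \<otimes> s = k' \<otimes> inv (k \<otimes> k2)"
          unfolding e using s kc qc by (simp add: m_assoc inv_mult_group)
        moreover have "k' \<otimes> inv (k \<otimes> k2) \<in> K1"
          using k' k q sub by (meson sg1 subgroup.m_closed subgroup.m_inv_closed subsetD)
        ultimately have "q \<in> ?A" using q qc by (simp add: conj_set_def)
        moreover have "X = ?f q"
        proof -
          have "inv (inv s \<otimes> q \<otimes> s \<otimes> k) \<otimes> k' = k2"
            unfolding e using s kc qc by (simp add: m_assoc inv_mult_group)
          then show ?thesis
            using k'(2) l_coset_eq_iff[OF sg2, of "inv s \<otimes> q \<otimes> s \<otimes> k" k'] s kc qc k'c q(2) by auto
        qed
        ultimately show "X \<in> ?f ` ?A" by blast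
      next
        fix X assume "X \<in> ?f ` ?A"
        then obtain q where q: "q \<in> ?A" "X = ?f q" by blast
        have qc: "q \<in> carrier G" "q \<in> Q" using q car by auto
        have "h s X = double_coset K2 (s \<otimes> (inv s \<otimes> q \<otimes> s \<otimes> k))"
          unfolding q(2) using h[OF s f_in[OF q(1)]] .
        also have "s \<otimes> (inv s \<otimes> q \<otimes> s \<otimes> k) = q \<otimes> (s \<otimes> k) \<otimes> \<one>"
          using s kc qc by (simp add: m_assoc)
        also have "double_coset K2 \<dots> = E"
          unfolding k(2) using s kc qc K2 subgroup.one_closed[OF sg2] by (intro double_coset_eq) auto
        finally have "h s X = E" .
        then show "X \<in> {X \<in> cosets_on K1 K2. h s X = E}"
          using f_in[OF q(1)] q(2) by (auto simp: cosets_on_def)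
      qed
      moreover have "card (?f ` ?A) = index ?A ?B"
      proof (rule card_image_eq_index(1))
        show "subgroup ?B G" using BA(1) by (rule rel.family_subgroup)
        fix q q' assume q: "q \<in> ?A" "q' \<in> ?A"
        then have qc: "q \<in> carrier G" "q' \<in> carrier G" "q \<in> Q" "q' \<in> Q" using car by auto
        have "?f q = ?f q' \<longleftrightarrow> inv (inv s \<otimes> q \<otimes> s \<otimes> k) \<otimes> (inv s \<otimes> q' \<otimes> s \<otimes> k) \<in> K2"
          using s kc qc by (intro l_coset_eq_iff sg2) auto
        also have "inv (inv s \<otimes> q \<otimes> s \<otimes> k) \<otimes> (inv s \<otimes> q' \<otimes> s \<otimes> k)
            = inv (s \<otimes> k) \<otimes> (inv q \<otimes> q') \<otimes> (s \<otimes> k)"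
          using s kc qc by (simp add: m_assoc inv_mult_group)
        also have "\<dots> \<in> K2 \<longleftrightarrow> inv q \<otimes> q' \<in> ?B"
          using qc subgroup.m_closed[OF rel.Q] subgroup.m_inv_closed[OF rel.Q] by (simp add: conj_set_def)
        finally show "?f q = ?f q' \<longleftrightarrow> inv q \<otimes> q' \<in> ?B" .
      qed (use car in auto)
      moreover have vA: "?v ?A = index ?A ?B * ?v ?B"
        using BA Bsub by (intro rel.vol_index)
      moreover have "coset_density \<phi> K2 E = \<phi> s / of_real (?v ?B)"
        using coset_density[OF \<phi> r2 K2, of "s \<otimes> k"] k s kc r1
        by (simp add: density_def right_invariant_def)
      moreover have "\<phi> s / of_real (?v ?B) = of_nat (index ?A ?B) * (\<phi> s / of_real (?v ?A))"
      proof -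
        have "?v ?A > 0" "?v ?B > 0" using rel.vol_pos BA by auto
        then have "index ?A ?B \<noteq> 0" "?v ?B \<noteq> 0" using vA by (auto intro: ccontr)
        then show ?thesis unfolding vA of_real_mult of_real_of_nat_eq by simp
      qed
      ultimately show ?thesis by (simp add: density_def)
    qed
    have "(\<Sum>E\<in>fib s. coset_density \<phi> K2 E)
        = (\<Sum>E\<in>fib s. of_nat (card {X \<in> cosets_on K1 K2. h s X = E})) * density \<phi> K1 s"
      unfolding sum_distrib_right by (rule sum.cong) (use card in auto)
    also have "(\<Sum>E\<in>fib s. of_nat (card {X \<in> cosets_on K1 K2. h s X = E}))
        = (of_nat (\<Sum>E\<in>fib s. card {X \<in> cosets_on K1 K2. h s X = E}) :: complex)" by simp
    also have "(\<Sum>E\<in>fib s. card {X \<in> cosets_on K1 K2. h s X = E}) = index K1 K2"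
      unfolding index_def card_eq_sum
      by (rule sum.group) (use fin12 fib_h[OF s] in auto)
    also have "density \<phi> K1 s = coset_density \<phi> K1 (double_coset K1 s)"
      using coset_density[OF \<phi> r1 K1' s] by simp
    finally show ?thesis by simp
  qed
  \<comment> \<open>The fine double cosets are grouped by the coarse ones containing them; the
    factor \<open>index K1 K2\<close> then passes into the volume of K1.\<close>
  have "(\<Sum>E\<in>double_cosets \<phi> K2. coset_density \<phi> K2 E)
      = (\<Sum>D\<in>double_cosets \<phi> K1. \<Sum>E\<in>{E \<in> double_cosets \<phi> K2. g E = D}. coset_density \<phi> K2 E)"
    by (rule sum.group[symmetric]) (use fin1 fin2 gD in auto)
  also have "\<dots> = (\<Sum>D\<in>double_cosets \<phi> K1. index K1 K2 * coset_density \<phi> K1 D)"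
    by (rule sum.cong[OF refl]) (use D1 fib sum_fib in force)
  finally show "level_functional \<phi> K2 = level_functional \<phi> K1"
    using total.vol_index[OF K1' K2 sub]
    by (simp add: level_functional_def sum_distrib_left[symmetric])
qed

definition admissible :: "('a \<Rightarrow> complex) \<Rightarrow> bool" where
  "admissible \<phi> \<longleftrightarrow> equivariant \<phi> \<and> (\<exists>K. admissible_level \<phi> K)"

lemma haar_eq:
  assumes "equivariant \<phi>" "admissible_level \<phi> K"
  shows "haar \<phi> = level_functional \<phi> K"
proof -
  define J where "J = (SOME K. admissible_level \<phi> K)"
  have J: "admissible_level \<phi> J" unfolding J_def using assms(2) by (rule someI)
  have "J \<inter> K \<in> \<K>" using J assms by (auto simp: admissible_level_def intro: total.family_Int)
  then show ?thesis
    using refine_level(2)[OF assms(1) J, of "J \<inter> K"] refine_level(2)[OF assms, of "J \<inter> K"]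
    by (simp add: haar_def J_def)
qed

lemma haar_scale:
  assumes "admissible \<phi>"
  shows "haar (\<lambda>s. c * \<phi> s) = c * haar \<phi>"
\<comment> \<open>Scaling by zero empties the set of double cosets in the support, whereas any other
  scalar leaves it unchanged.\<close>
proof (cases "c = 0")
  case True
  have "equivariant (\<lambda>s. 0)" "admissible_level (\<lambda>s. 0) K0"
    using total.base by (auto simp: equivariant_def admissible_level_def right_invariant_def double_cosets_def)
  from haar_eq[OF this] show ?thesis using True by (simp add: level_functional_def double_cosets_def)
next
  case False
  obtain K where \<phi>: "equivariant \<phi>" and K: "admissible_level \<phi> K" using assms by (auto simp: admissible_def)
  have 1: "equivariant (\<lambda>s. c * \<phi> s)" using \<phi> by (simp add: equivariant_def)
  have 2: "double_cosets (\<lambda>s. c * \<phi> s) K = double_cosets \<phi> K" using False by (simp add: double_cosets_def)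
  have 3: "admissible_level (\<lambda>s. c * \<phi> s) K"
    using K 2 by (simp add: admissible_level_def right_invariant_def)
  show ?thesis
    unfolding haar_eq[OF 1 3] haar_eq[OF \<phi> K]
    by (simp add: level_functional_def 2 coset_density_def density_def sum_distrib_left mult_ac)
qed

text \<open>Sums for different functions run over different supports. Enlarging the index set by
  double cosets of density zero lets \<open>haar_add\<close> compare them over one common
  set.\<close>

lemma level_functional_superset:
  assumes \<phi>: "equivariant \<phi>" and K: "K \<in> \<K>" "right_invariant \<phi> K" and fin: "finite T"
    and T: "T \<subseteq> double_coset K ` carrier G" "double_cosets \<phi> K \<subseteq> T"
  shows "level_functional \<phi> K = of_real (vol K0 K) * (\<Sum>D\<in>T. coset_density \<phi> K D)"
proof -
  have "coset_density \<phi> K D = 0" if D: "D \<in> T - double_cosets \<phi> K" for D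
  proof -
    obtain s where s: "s \<in> carrier G" "D = double_coset K s" using D T(1) by auto
    then have "\<phi> s = 0" using D by (auto simp: double_cosets_def)
    then show ?thesis using coset_density[OF \<phi> K(2,1) s(1)] s by (simp add: density_def)
  qed
  then have "(\<Sum>D\<in>double_cosets \<phi> K. coset_density \<phi> K D) = (\<Sum>D\<in>T. coset_density \<phi> K D)"
    using fin T by (intro sum.mono_neutral_left) auto
  then show ?thesis by (simp add: level_functional_def)
qed

lemma haar_add:
  assumes "admissible \<phi>" "admissible \<psi>"
  shows "haar (\<lambda>s. \<phi> s + \<psi> s) = haar \<phi> + haar \<psi>"
proof -
  obtain K1 K2 where \<phi>: "equivariant \<phi>" "admissible_level \<phi> K1"
    and \<psi>: "equivariant \<psi>" "admissible_level \<psi> K2" using assms by (auto simp: admissible_def)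
  define K where "K = K1 \<inter> K2"
  have K: "K \<in> \<K>" using \<phi> \<psi> by (auto simp: K_def admissible_level_def intro: total.family_Int)
  have \<phi>K: "admissible_level \<phi> K" using refine_level(1)[OF \<phi> K] by (simp add: K_def)
  have \<psi>K: "admissible_level \<psi> K" using refine_level(1)[OF \<psi> K] by (simp add: K_def)
  let ?c = "\<lambda>s. \<phi> s + \<psi> s"
  let ?T = "double_cosets \<phi> K \<union> double_cosets \<psi> K"
  have sub: "double_cosets ?c K \<subseteq> ?T" "?T \<subseteq> double_coset K ` carrier G" by (auto simp: double_cosets_def)
  have fin: "finite ?T" using \<phi>K \<psi>K by (simp add: admissible_level_def)
  have c: "equivariant ?c" using \<phi> \<psi> by (simp add: equivariant_def algebra_simps)
  have cK: "admissible_level ?c K"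
    using \<phi>K \<psi>K finite_subset[OF sub(1) fin] by (simp add: admissible_level_def right_invariant_def)
  have r: "right_invariant ?c K" "right_invariant \<phi> K" "right_invariant \<psi> K"
    using cK \<phi>K \<psi>K by (auto simp: admissible_level_def)
  show ?thesis
    unfolding haar_eq[OF c cK] haar_eq[OF \<phi>(1) \<phi>K] haar_eq[OF \<psi>(1) \<psi>K]
      level_functional_superset[OF c K r(1) fin sub(2,1)]
      level_functional_superset[OF \<phi>(1) K r(2) fin sub(2) Un_upper1]
      level_functional_superset[OF \<psi>(1) K r(3) fin sub(2) Un_upper2]
    by (simp add: coset_density_def density_def add_divide_distrib sum.distrib distrib_left)
qed

text \<open>Right translation by t^-1 carries Q s K to Q s t^-1 K' with K' = t K t^-1 and preserves
  densities; unimodularity gives K and K' the same volume.\<close>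

lemma haar_translate:
  assumes "admissible \<phi>" and t: "t \<in> carrier G"
  shows "admissible (\<lambda>s. \<phi> (s \<otimes> t))" and "haar (\<lambda>s. \<phi> (s \<otimes> t)) = haar \<phi>"
proof -
  obtain K where \<phi>: "equivariant \<phi>" and aK: "admissible_level \<phi> K" using assms by (auto simp: admissible_def)
  have K: "K \<in> \<K>" and r: "right_invariant \<phi> K" and fin: "finite (double_cosets \<phi> K)"
    using aK by (auto simp: admissible_level_def)
  define K' where "K' = conj_set t K"
  have K': "K' \<in> \<K>" using K t by (auto simp: K'_def total.family_conj)
  let ?p = "\<lambda>s. \<phi> (s \<otimes> t)"
  have p: "equivariant ?p" using \<phi> t Q_carrier by (simp add: equivariant_def m_assoc)
  have r': "right_invariant ?p K'"
    unfolding right_invariant_def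
  proof (intro ballI)
    fix s k assume s: "s \<in> carrier G" and k: "k \<in> K'"
    then have kc: "k \<in> carrier G" and ik: "inv t \<otimes> k \<otimes> t \<in> K" by (auto simp: K'_def conj_set_def)
    have "\<phi> ((s \<otimes> t) \<otimes> (inv t \<otimes> k \<otimes> t)) = \<phi> (s \<otimes> t)"
      using r s t ik unfolding right_invariant_def by blast
    then show "\<phi> (s \<otimes> k \<otimes> t) = \<phi> (s \<otimes> t)" using s t kc by (simp add: m_assoc)
  qed
  define \<rho> where "\<rho> D = (\<lambda>x. x \<otimes> inv t) ` D" for D
  have \<rho>: "\<rho> (double_coset K s) = double_coset K' (s \<otimes> inv t)" if s: "s \<in> carrier G" for s
  proof -
    have "q \<otimes> s \<otimes> k \<otimes> inv t = q \<otimes> (s \<otimes> inv t) \<otimes> (t \<otimes> k \<otimes> inv t)" if "q \<in> Q" "k \<in> K" for q k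
      using that s t Q_carrier level_carrier[OF K] by (simp add: m_assoc)
    then show ?thesis
      unfolding \<rho>_def double_coset_def K'_def
        conj_set_image[OF subgroup.subset[OF total.family_subgroup[OF K]] t] by force
  qed
  have inj_rho: "inj_on \<rho> (double_cosets \<phi> K)"
  proof (rule inj_onI)
    have restore: "(\<lambda>x. x \<otimes> t) ` \<rho> D = D" if "D \<in> double_cosets \<phi> K" for D
    proof -
      have "D \<subseteq> carrier G"
        using that Q_carrier level_carrier[OF K] by (auto simp: double_cosets_def double_coset_def)
      then have "(x \<otimes> inv t) \<otimes> t = x" if "x \<in> D" for x using t that by (auto simp: m_assoc)
      then show ?thesis by (simp add: \<rho>_def image_image)
    qed
    fix D E assume "D \<in> double_cosets \<phi> K" "E \<in> double_cosets \<phi> K" "\<rho> D = \<rho> E"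
    then show "D = E" using restore by metis
  qed
  have im: "\<rho> ` double_cosets \<phi> K = double_cosets ?p K'"
  proof (intro equalityI subsetI)
    fix D assume "D \<in> \<rho> ` double_cosets \<phi> K"
    then obtain s where s: "s \<in> carrier G" "\<phi> s \<noteq> 0" "D = double_coset K' (s \<otimes> inv t)"
      using \<rho> by (auto simp: double_cosets_def)
    moreover have "s \<otimes> inv t \<otimes> t = s" using s t by (simp add: m_assoc)
    ultimately show "D \<in> double_cosets ?p K'" using t
      unfolding double_cosets_def by (intro image_eqI[of _ _ "s \<otimes> inv t"]) auto
  next
    fix D assume "D \<in> double_cosets ?p K'"
    then obtain s where s: "s \<in> carrier G" "\<phi> (s \<otimes> t) \<noteq> 0" "D = double_coset K' s"
      by (auto simp: double_cosets_def)
    moreover have "s \<otimes> t \<otimes> inv t = s" using s t by (simp add: m_assoc)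
    ultimately have "D = \<rho> (double_coset K (s \<otimes> t))" using \<rho>[of "s \<otimes> t"] t by simp
    then show "D \<in> \<rho> ` double_cosets \<phi> K" using s t by (auto simp: double_cosets_def)
  qed
  have aK': "admissible_level ?p K'"
    using K' r' fin im by (metis admissible_level_def finite_imageI)
  have cd: "coset_density ?p K' (\<rho> D) = coset_density \<phi> K D" if D: "D \<in> double_cosets \<phi> K" for D
  proof -
    obtain s where s: "s \<in> carrier G" "D = double_coset K s" using D by (auto simp: double_cosets_def)
    have "coset_density ?p K' (\<rho> D) = density ?p K' (s \<otimes> inv t)"
      unfolding s(2) \<rho>[OF s(1)] using p r' K' s t by (intro coset_density) auto
    also have "\<dots> = density \<phi> K s"
      using s t by (simp add: density_def K'_def conj_set_conj_set m_assoc)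
    also have "\<dots> = coset_density \<phi> K D"
      unfolding s(2) using \<phi> r K s by (intro coset_density[symmetric]) auto
    finally show ?thesis .
  qed
  have "level_functional ?p K' = of_real (vol K0 K) * (\<Sum>D\<in>double_cosets ?p K'. coset_density ?p K' D)"
    using total.vol_conj_set[OF K t] unimodular[OF t] by (simp add: level_functional_def K'_def)
  also have "(\<Sum>D\<in>double_cosets ?p K'. coset_density ?p K' D) = (\<Sum>D\<in>double_cosets \<phi> K. coset_density \<phi> K D)"
    unfolding im[symmetric] using cd by (simp add: sum.reindex[OF inj_rho])
  finally show "haar ?p = haar \<phi>"
    unfolding haar_eq[OF p aK'] haar_eq[OF \<phi> aK] by (simp add: level_functional_def)
  show "admissible ?p" using p aK' by (auto simp: admissible_def)
qed

text \<open>Every summand is a positive multiple of c, so the sum cannot cancel.\<close>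

lemma haar_nonzero:
  assumes "admissible \<phi>" and pos: "\<And>s. s \<in> carrier G \<Longrightarrow> \<exists>r\<ge>0. \<phi> s = of_real r * c"
    and s0: "s0 \<in> carrier G" "\<phi> s0 \<noteq> 0"
  shows "haar \<phi> \<noteq> 0"
proof -
  obtain K where \<phi>: "equivariant \<phi>" and aK: "admissible_level \<phi> K" using assms(1) by (auto simp: admissible_def)
  have K: "K \<in> \<K>" and r: "right_invariant \<phi> K" and fin: "finite (double_cosets \<phi> K)"
    using aK by (auto simp: admissible_level_def)
  have "\<exists>x>0. coset_density \<phi> K D = of_real x * c" if D: "D \<in> double_cosets \<phi> K" for D
  proof -
    obtain s where s: "s \<in> carrier G" "\<phi> s \<noteq> 0" "D = double_coset K s" using D by (auto simp: double_cosets_def)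
    obtain x where x: "x \<ge> 0" "\<phi> s = of_real x * c" using pos s by blast
    then have "x > 0" using s by (cases "x = 0") auto
    then show ?thesis
      using coset_density[OF \<phi> r K s(1)] rel.vol_pos[OF rel_mem[OF K s(1)]] s x
      by (intro exI[of _ "x / vol (Q \<inter> K0) (Q \<inter> conj_set s K)"]) (simp add: density_def)
  qed
  then obtain x where x: "\<And>D. D \<in> double_cosets \<phi> K \<Longrightarrow> x D > 0 \<and> coset_density \<phi> K D = of_real (x D) * c"
    by metis
  have ne: "double_cosets \<phi> K \<noteq> {}" using s0 by (auto simp: double_cosets_def)
  have "level_functional \<phi> K = of_real (vol K0 K * (\<Sum>D\<in>double_cosets \<phi> K. x D)) * c"
    using x by (simp add: level_functional_def sum_distrib_right)
  moreover have "(\<Sum>D\<in>double_cosets \<phi> K. x D) > 0" using x fin ne by (intro sum_pos) auto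
  moreover have "vol K0 K > 0" using K by (rule total.vol_pos)
  moreover have "c \<noteq> 0" using pos[OF s0(1)] s0(2) by auto
  ultimately show ?thesis unfolding haar_eq[OF \<phi> aK] by (simp del: of_real_sum)
qed

text \<open>Equality is only available on the group, while \<open>haar\<close> sees functions on the
  whole type; everything it evaluates, including the chosen representatives, lies in the
  group.\<close>

lemma haar_cong:
  assumes eq: "\<And>s. s \<in> carrier G \<Longrightarrow> \<phi> s = \<psi> s" and adm: "admissible \<psi>"
  shows "haar \<phi> = haar \<psi>"
proof -
  have d: "double_cosets \<phi> K = double_cosets \<psi> K" for K
    using eq by (auto simp: double_cosets_def)
  have r: "right_invariant \<phi> K \<longleftrightarrow> right_invariant \<psi> K" if "K \<in> \<K>" for K
    using eq level_carrier[OF that] by (simp add: right_invariant_def)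
  have l: "admissible_level \<phi> = admissible_level \<psi>"
    using r d by (auto simp: admissible_level_def fun_eq_iff)
  have lf: "level_functional \<phi> K = level_functional \<psi> K" if K: "K \<in> \<K>" for K
  proof -
    have "coset_density \<phi> K D = coset_density \<psi> K D" if D: "D \<in> double_cosets \<psi> K" for D
    proof -
      obtain s where s: "s \<in> carrier G" "D = double_coset K s" using D by (auto simp: double_cosets_def)
      have "(SOME t. t \<in> D) \<in> D"
        using self_in_double_coset[OF K s(1)] unfolding s(2) by (rule someI)
      moreover have "D \<subseteq> carrier G"
        using s Q_carrier level_carrier[OF K] by (auto simp: double_coset_def)
      ultimately show ?thesis using eq by (auto simp: coset_density_def density_def)
    qed
    then show ?thesis by (simp add: level_functional_def d)
  qed
  have "admissible_level \<psi> (SOME K. admissible_level \<psi> K)"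
    using adm by (auto simp: admissible_def intro: someI)
  then show ?thesis using lf by (simp add: haar_def l admissible_level_def)
qed

lemma admissible_scale:
  assumes "admissible \<phi>"
  shows "admissible (\<lambda>s. c * \<phi> s)"
proof -
  obtain K where \<phi>: "equivariant \<phi>" and K: "admissible_level \<phi> K" using assms by (auto simp: admissible_def)
  have "double_cosets (\<lambda>s. c * \<phi> s) K \<subseteq> double_cosets \<phi> K" by (auto simp: double_cosets_def)
  then have "admissible_level (\<lambda>s. c * \<phi> s) K"
    using K finite_subset by (auto simp: admissible_level_def right_invariant_def)
  moreover have "equivariant (\<lambda>s. c * \<phi> s)" using \<phi> by (simp add: equivariant_def)
  ultimately show ?thesis by (auto simp: admissible_def)
qed

end

section \<open>Matrix groups over filtered rings\<close>

text \<open>For finiteness: two elements of R meet A' are congruent modulo A' meet B' exactly when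
  they are congruent modulo its trace on R, so the cosets on R inject into those on the ambient
  group.\<close>

lemma (in commensurable_family) restrict_family:
  assumes R: "subgroup R G" "R \<subseteq> Q"
  shows "commensurable_family G R ((\<inter>) R ` \<K>) (R \<inter> K0)"
proof (rule commensurable_family.intro, rule group_axioms, rule commensurable_family_axioms.intro)
  fix A assume "A \<in> (\<inter>) R ` \<K>"
  then show "subgroup A G" using R family_subgroup by (auto intro: subgroups_Inter_pair)
next
  fix A B assume "A \<in> (\<inter>) R ` \<K>" "B \<in> (\<inter>) R ` \<K>"
  then obtain A' B' where AB: "A' \<in> \<K>" "B' \<in> \<K>" "A = R \<inter> A'" "B = R \<inter> B'" by auto
  have "R \<inter> A' \<inter> (R \<inter> B') = R \<inter> (A' \<inter> B')" by auto
  then show "A \<inter> B \<in> (\<inter>) R ` \<K>" using AB family_Int by auto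
  have sg: "subgroup (A' \<inter> B') G" "subgroup (A \<inter> B) G" "subgroup A' G"
    using AB R family_subgroup by (auto intro!: subgroups_Inter_pair)
  have c: "A' \<subseteq> carrier G" using sg(3) subgroup.subset by blast
  have "finite ((\<lambda>a. a <# (A' \<inter> B')) ` A) \<longleftrightarrow> finite (cosets_on A (A \<inter> B))"
  proof (rule card_image_eq_index(2)[OF sg(2)])
    fix a a' assume a: "a \<in> A" "a' \<in> A"
    then have "inv a \<otimes> a' \<in> R"
      using AB R by (simp add: subgroup.m_closed subgroup.m_inv_closed)
    then show "a <# (A' \<inter> B') = a' <# (A' \<inter> B') \<longleftrightarrow> inv a \<otimes> a' \<in> A \<inter> B"
      using a AB c by (subst l_coset_eq_iff[OF sg(1)]) auto
  qed (use AB c in auto)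
  moreover have "finite ((\<lambda>a. a <# (A' \<inter> B')) ` A)"
    by (rule finite_subset[OF _ family_finite[OF AB(1,2)]]) (use AB in \<open>auto simp: cosets_on_def\<close>)
  ultimately show "finite (cosets_on A (A \<inter> B))" by simp
next
  fix A q assume A: "A \<in> (\<inter>) R ` \<K>" and q: "q \<in> R"
  then obtain A' where A': "A' \<in> \<K>" "A = R \<inter> A'" by auto
  have "conj_set q A = R \<inter> conj_set q A'"
    using conj_set_self[OF R(1) q] A' by (simp add: conj_set_Int)
  then show "conj_set q A \<in> (\<inter>) R ` \<K>" using family_conj[OF A'(1), of q] q R by auto
qed (use R base in auto)

lemma mult_mat_entry:
  assumes "A \<in> carrier_mat nr n" "B \<in> carrier_mat n nc" "i < nr" "j < nc"
  shows "(A * B) $$ (i, j) = (\<Sum>k<n. A $$ (i, k) * B $$ (k, j))"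
  using assms by (simp add: scalar_prod_def atLeast0LessThan)

text \<open>Set up over any commutative ring so that F and the dual numbers share one development;
  over the field it is identified with \<open>GL\<close> by \<open>GL_eq\<close>.\<close>

definition gl_group :: "nat \<Rightarrow> 'a::comm_ring_1 mat monoid" where
  "gl_group n = units_of (ring_mat TYPE('a) n ())"

lemma gl_group_simps [simp]:
  "x \<otimes>\<^bsub>gl_group n\<^esub> y = x * y" "\<one>\<^bsub>gl_group n\<^esub> = 1\<^sub>m n"
  by (simp_all add: gl_group_def units_of_mult units_of_one ring_mat_simps)

lemma gl_group_carrier:
  "A \<in> carrier (gl_group n) \<longleftrightarrow>
     A \<in> carrier_mat n n \<and> (\<exists>B\<in>carrier_mat n n. A * B = 1\<^sub>m n \<and> B * A = 1\<^sub>m n)"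
  unfolding gl_group_def units_of_carrier Units_def ring_mat_simps by auto

lemma group_gl_group: "group (gl_group n :: 'a::comm_ring_1 mat monoid)"
proof -
  interpret ring "ring_mat TYPE('a) n ()" by (rule ring_mat)
  show ?thesis unfolding gl_group_def by (rule units_group)
qed

lemma gl_group_carrierD: "A \<in> carrier (gl_group n) \<Longrightarrow> A \<in> carrier_mat n n"
  by (simp add: gl_group_carrier)

lemma gl_group_inv:
  assumes "A \<in> carrier (gl_group n)"
  shows "inv\<^bsub>gl_group n\<^esub> A \<in> carrier_mat n n"
    and "A * inv\<^bsub>gl_group n\<^esub> A = 1\<^sub>m n" and "inv\<^bsub>gl_group n\<^esub> A * A = 1\<^sub>m n"
  using group.inv_closed[OF group_gl_group assms] group.r_inv[OF group_gl_group assms]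
    group.l_inv[OF group_gl_group assms] by (auto dest: gl_group_carrierD)

lemma gl_groupI:
  assumes "A \<in> carrier_mat n n" "B \<in> carrier_mat n n" "A * B = 1\<^sub>m n" "B * A = 1\<^sub>m n"
  shows "A \<in> carrier (gl_group n)" and "inv\<^bsub>gl_group n\<^esub> A = B"
proof -
  show A: "A \<in> carrier (gl_group n)" using assms by (auto simp: gl_group_carrier)
  have "B \<in> carrier (gl_group n)" using assms by (auto simp: gl_group_carrier)
  then show "inv\<^bsub>gl_group n\<^esub> A = B"
    using A assms by (intro group.inv_equality[OF group_gl_group]) simp_all
qed

text \<open>The features common to the powers of the maximal ideal in F and their analogues in F[e]:
  exhaustion, invertibility of 1 + x for x in \<open>I 1\<close>, and finiteness of the quotients of
  one step by another.\<close>

locale filtered_ring =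
  fixes I :: "int \<Rightarrow> 'a::comm_ring_1 set"
  assumes filt_zero: "0 \<in> I r"
    and filt_add: "x \<in> I r \<Longrightarrow> y \<in> I r \<Longrightarrow> x + y \<in> I r"
    and filt_uminus: "x \<in> I r \<Longrightarrow> - x \<in> I r"
    and filt_mult: "x \<in> I r \<Longrightarrow> y \<in> I s \<Longrightarrow> x * y \<in> I (r + s)"
    and filt_one: "1 \<in> I 0"
    and filt_mono: "x \<in> I s \<Longrightarrow> r \<le> s \<Longrightarrow> x \<in> I r"
    and filt_exhaust: "\<exists>r. x \<in> I r"
    and filt_unit: "x \<in> I 1 \<Longrightarrow> \<exists>y\<in>I 0. (1 + x) * y = 1"
    and filt_finite: "\<exists>T. finite T \<and> (\<forall>x\<in>I r. \<exists>t\<in>T. x - t \<in> I s)"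
begin

lemma filt_diff: "x \<in> I r \<Longrightarrow> y \<in> I r \<Longrightarrow> x - y \<in> I r"
  using filt_add[of x r "- y"] filt_uminus[of y r] by simp

lemma filt_sum: "(\<And>i. i \<in> S \<Longrightarrow> f i \<in> I r) \<Longrightarrow> sum f S \<in> I r"
  by (induction S rule: infinite_finite_induct) (auto simp: filt_zero filt_add)

lemma filt_prod: "(\<And>i. i \<in> S \<Longrightarrow> f i \<in> I 0) \<Longrightarrow> prod f S \<in> I 0"
  by (induction S rule: infinite_finite_induct)
    (use filt_mult[of _ 0 _ 0] in \<open>auto simp: filt_one\<close>)

lemma filt_prod_cong:
  assumes "\<And>i. i \<in> S \<Longrightarrow> f i \<in> I 0" "\<And>i. i \<in> S \<Longrightarrow> g i \<in> I 0" "\<And>i. i \<in> S \<Longrightarrow> f i - g i \<in> I r"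
  shows "prod f S - prod g S \<in> I r"
  using assms
proof (induction S rule: infinite_finite_induct)
  case (insert x S)
  have "f x * (prod f S - prod g S) \<in> I (0 + r)"
    using insert by (intro filt_mult) auto
  moreover have "(f x - g x) * prod g S \<in> I (r + 0)"
    using insert filt_prod[of S g] by (intro filt_mult) auto
  moreover have "prod f (insert x S) - prod g (insert x S)
      = f x * (prod f S - prod g S) + (f x - g x) * prod g S"
    using insert by (simp add: algebra_simps)
  ultimately show ?case using filt_add by simp
qed (auto simp: filt_zero)

definition FM :: "int \<Rightarrow> nat \<Rightarrow> nat \<Rightarrow> 'a mat set" where
  "FM r nr nc = {A \<in> carrier_mat nr nc. \<forall>i<nr. \<forall>j<nc. A $$ (i, j) \<in> I r}"

lemma FM_carrier: "A \<in> FM r nr nc \<Longrightarrow> A \<in> carrier_mat nr nc"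
  by (simp add: FM_def)

lemma FM_zero: "0\<^sub>m nr nc \<in> FM r nr nc"
  by (simp add: FM_def filt_zero)

lemma FM_one: "1\<^sub>m n \<in> FM 0 n n"
  by (simp add: FM_def filt_zero filt_one)

lemma FM_add: "A \<in> FM r nr nc \<Longrightarrow> B \<in> FM r nr nc \<Longrightarrow> A + B \<in> FM r nr nc"
  by (auto simp: FM_def filt_add)

lemma FM_uminus: "A \<in> FM r nr nc \<Longrightarrow> - A \<in> FM r nr nc"
  by (auto simp: FM_def filt_uminus)

lemma FM_mult:
  assumes A: "A \<in> FM r nr n" and B: "B \<in> FM s n nc"
  shows "A * B \<in> FM (r + s) nr nc"
proof -
  have "(A * B) $$ (i, j) \<in> I (r + s)" if "i < nr" "j < nc" for i j
    using that A B mult_mat_entry[OF FM_carrier[OF A] FM_carrier[OF B] that]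
    by (auto simp: FM_def intro!: filt_sum filt_mult)
  then show ?thesis using A B by (auto simp: FM_def)
qed

lemma FM_mult0: "A \<in> FM 0 nr n \<Longrightarrow> B \<in> FM r n nc \<Longrightarrow> A * B \<in> FM r nr nc"
  "A \<in> FM r nr n \<Longrightarrow> B \<in> FM 0 n nc \<Longrightarrow> A * B \<in> FM r nr nc"
  using FM_mult[of A 0 nr n B r nc] FM_mult[of A r nr n B 0 nc] by auto

lemma FM_mono: "A \<in> FM s nr nc \<Longrightarrow> r \<le> s \<Longrightarrow> A \<in> FM r nr nc"
  by (auto simp: FM_def intro: filt_mono)

lemma FM_exhaust:
  assumes A: "A \<in> carrier_mat nr nc"
  shows "\<exists>r. A \<in> FM r nr nc"
proof -
  define f where "f x = (SOME r. x \<in> I r)" for x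
  have f: "x \<in> I (f x)" for x unfolding f_def by (rule someI_ex[OF filt_exhaust])
  let ?S = "(\<lambda>ij. f (A $$ ij)) ` ({..<nr} \<times> {..<nc})"
  have "A $$ (i, j) \<in> I (Min (insert 0 ?S))" if "i < nr" "j < nc" for i j
    by (rule filt_mono[OF f]) (use that in \<open>auto intro!: Min_le\<close>)
  then show ?thesis using A by (auto simp: FM_def)
qed

lemma FM_four_block:
  assumes "A \<in> FM r n1 m1" "B \<in> FM r n1 m2" "C \<in> FM r n2 m1" "D \<in> FM r n2 m2"
  shows "four_block_mat A B C D \<in> FM r (n1 + n2) (m1 + m2)"
  using assms by (auto simp: FM_def)

lemma FM_four_blockD:
  assumes "four_block_mat A B C D \<in> FM r (n1 + n2) (m1 + m2)"
    and "A \<in> carrier_mat n1 m1" "B \<in> carrier_mat n1 m2" "C \<in> carrier_mat n2 m1" "D \<in> carrier_mat n2 m2"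
  shows "A \<in> FM r n1 m1" "B \<in> FM r n1 m2" "C \<in> FM r n2 m1" "D \<in> FM r n2 m2"
proof -
  have e: "four_block_mat A B C D $$ (i, j) \<in> I r" if "i < n1 + n2" "j < m1 + m2" for i j
    using assms(1) that by (auto simp: FM_def)
  show "A \<in> FM r n1 m1"
    unfolding FM_def
  proof (clarsimp, intro conjI assms allI impI)
    fix i j assume "i < n1" "j < m1"
    then show "A $$ (i, j) \<in> I r" using e[of i j] assms(2-) by auto
  qed
  show "B \<in> FM r n1 m2"
    unfolding FM_def
  proof (clarsimp, intro conjI assms allI impI)
    fix i j assume "i < n1" "j < m2"
    then show "B $$ (i, j) \<in> I r" using e[of i "j + m1"] assms(2-) by auto
  qed
  show "C \<in> FM r n2 m1"
    unfolding FM_def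
  proof (clarsimp, intro conjI assms allI impI)
    fix i j assume "i < n2" "j < m1"
    then show "C $$ (i, j) \<in> I r" using e[of "i + n1" j] assms(2-) by auto
  qed
  show "D \<in> FM r n2 m2"
    unfolding FM_def
  proof (clarsimp, intro conjI assms allI impI)
    fix i j assume "i < n2" "j < m2"
    then show "D $$ (i, j) \<in> I r" using e[of "i + n1" "j + m1"] assms(2-) by auto
  qed
qed

lemma filt_signof: "of_int (sign p) * x \<in> I r \<longleftrightarrow> x \<in> I r"
  by (cases p rule: sign_cases) (auto dest: filt_uminus)

lemma det_cong_filt:
  assumes A: "A \<in> FM 0 n n" and B: "B \<in> FM 0 n n" and AB: "A - B \<in> FM r n n"
  shows "det A - det B \<in> I r"
proof -
  let ?P = "{p. p permutes {0..<n}}"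
  have "det A - det B = (\<Sum>p\<in>?P. of_int (sign p) * ((\<Prod>i = 0..<n. A $$ (i, p i)) - (\<Prod>i = 0..<n. B $$ (i, p i))))"
    using det_def'[OF FM_carrier[OF A]] det_def'[OF FM_carrier[OF B]]
    by (simp add: sum_subtractf algebra_simps)
  also have "\<dots> \<in> I r"
  proof (rule filt_sum, subst filt_signof, rule filt_prod_cong)
    fix p i assume "p \<in> ?P" "i \<in> {0..<n}"
    then have i: "i < n" "p i < n" by (auto dest: permutes_in_image)
    show "A $$ (i, p i) \<in> I 0" "B $$ (i, p i) \<in> I 0" using A B i by (auto simp: FM_def)
    have "(A - B) $$ (i, p i) \<in> I r" using AB i by (auto simp: FM_def)
    then show "A $$ (i, p i) - B $$ (i, p i) \<in> I r" using i FM_carrier[OF B] by auto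
  qed
  finally show ?thesis .
qed

lemma det_filt:
  assumes A: "A \<in> FM 0 n n"
  shows "det A \<in> I 0"
  unfolding det_def'[OF FM_carrier[OF A]]
proof (rule filt_sum, subst filt_signof, rule filt_prod)
  fix p i assume "p \<in> {p. p permutes {0..<n}}" "i \<in> {0..<n}"
  then show "A $$ (i, p i) \<in> I 0" using A by (auto simp: FM_def dest: permutes_in_image)
qed

lemma adj_mat_filt:
  assumes A: "A \<in> FM 0 n n"
  shows "adj_mat A \<in> FM 0 n n"
proof -
  have "cofactor A j i \<in> I 0" if ij: "i < n" "j < n" for i j
  proof -
    have "mat_delete A j i \<in> FM 0 (n - 1) (n - 1)"
      using A ij by (auto simp: FM_def mat_delete_def)
    then have "det (mat_delete A j i) \<in> I 0" by (rule det_filt)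
    moreover have "(-1) ^ (j + i) \<in> I 0"
      using filt_prod[of "{..<j + i}" "\<lambda>_. -1"] filt_uminus[OF filt_one] by simp
    ultimately show ?thesis
      using filt_mult[of "(-1) ^ (j + i)" 0 "det (mat_delete A j i)" 0] by (simp add: cofactor_def)
  qed
  then show ?thesis using A by (auto simp: FM_def adj_mat_def)
qed

text \<open>The adjugate of an integral matrix is integral, so dividing it by a unit determinant
  gives an integral inverse.\<close>

lemma gl_of_unit_det:
  assumes A: "A \<in> FM 0 n n" and y: "y \<in> I 0" "det A * y = 1"
  shows "A \<in> carrier (gl_group n)" and "inv\<^bsub>gl_group n\<^esub> A \<in> FM 0 n n"
proof -
  let ?B = "y \<cdot>\<^sub>m adj_mat A"
  note Ac = FM_carrier[OF A] and adj = adj_mat[OF FM_carrier[OF A]]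
  have B: "?B \<in> FM 0 n n"
    using adj_mat_filt[OF A] y filt_mult[of y 0 _ 0] by (auto simp: FM_def)
  have "A * ?B = 1\<^sub>m n" "?B * A = 1\<^sub>m n"
    using adj y Ac by (auto simp: mult_smult_distrib mult_smult_assoc_mat smult_smult_assoc mult.commute)
  then show "A \<in> carrier (gl_group n)" "inv\<^bsub>gl_group n\<^esub> A \<in> FM 0 n n"
    using gl_groupI[OF Ac FM_carrier[OF B]] B by auto
qed

text \<open>The group of integral matrices with integral inverse. For F this is the standard maximal
  compact subgroup; it serves as reference subgroup for volumes.\<close>

definition GL0 :: "nat \<Rightarrow> 'a mat set" where
  "GL0 n = {A \<in> carrier (gl_group n). A \<in> FM 0 n n \<and> inv\<^bsub>gl_group n\<^esub> A \<in> FM 0 n n}"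

definition congruence :: "int \<Rightarrow> nat \<Rightarrow> 'a mat set" where
  "congruence r n = {A \<in> carrier_mat n n. A - 1\<^sub>m n \<in> FM r n n}"

lemma subgroup_GL0: "subgroup (GL0 n) (gl_group n)"
proof -
  interpret group "gl_group n :: 'a mat monoid" by (rule group_gl_group)
  show ?thesis
  proof (rule subgroupI)
    have "inv\<^bsub>gl_group n\<^esub> (1\<^sub>m n :: 'a mat) = 1\<^sub>m n" using inv_one by simp
    moreover have "1\<^sub>m n \<in> carrier (gl_group n :: 'a mat monoid)" using one_closed by simp
    ultimately have "1\<^sub>m n \<in> GL0 n" using FM_one by (simp add: GL0_def)
    then show "GL0 n \<noteq> {}" by blast
  next
    fix a b assume "a \<in> GL0 n" "b \<in> GL0 n"
    then have a: "a \<in> carrier (gl_group n)" "a \<in> FM 0 n n" "inv\<^bsub>gl_group n\<^esub> a \<in> FM 0 n n"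
      and b: "b \<in> carrier (gl_group n)" "b \<in> FM 0 n n" "inv\<^bsub>gl_group n\<^esub> b \<in> FM 0 n n"
      by (auto simp: GL0_def)
    show "a \<otimes>\<^bsub>gl_group n\<^esub> b \<in> GL0 n"
      using m_closed[OF a(1) b(1)] FM_mult0(1)[OF a(2) b(2)] FM_mult0(1)[OF b(3) a(3)]
        inv_mult_group[OF a(1) b(1)] by (simp add: GL0_def)
    show "inv\<^bsub>gl_group n\<^esub> a \<in> GL0 n" using a by (simp add: GL0_def)
  qed (auto simp: GL0_def)
qed

text \<open>Modulo \<open>I 1\<close> the determinant agrees with that of the identity, so it has
  the form 1 + x with x in \<open>I 1\<close> and is a unit.\<close>

lemma congruence_GL0:
  assumes "r \<ge> 1"
  shows "congruence r n \<subseteq> GL0 n"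
proof
  fix A assume "A \<in> congruence r n"
  then have Ac: "A \<in> carrier_mat n n" and X: "A - 1\<^sub>m n \<in> FM r n n" by (auto simp: congruence_def)
  have "A = (A - 1\<^sub>m n) + 1\<^sub>m n" using Ac by auto
  then have A: "A \<in> FM 0 n n" using FM_add[OF FM_mono[OF X, of 0] FM_one] assms by simp
  have "det A - det (1\<^sub>m n :: 'a mat) \<in> I 1"
    using det_cong_filt[OF A FM_one FM_mono[OF X, of 1]] assms by simp
  then obtain y where "y \<in> I 0" "(1 + (det A - 1)) * y = 1" using filt_unit[of "det A - 1"] by auto
  then show "A \<in> GL0 n" using gl_of_unit_det[OF A] A by (auto simp: GL0_def)
qed

lemma congruence_mult_diff:
  assumes A: "A \<in> GL0 n" and B: "B \<in> carrier_mat n n" and AB: "B - A \<in> FM r n n"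
  shows "inv\<^bsub>gl_group n\<^esub> A * B \<in> congruence r n"
proof -
  have A': "A \<in> carrier (gl_group n)" "inv\<^bsub>gl_group n\<^esub> A \<in> FM 0 n n" using A by (auto simp: GL0_def)
  note i = gl_group_inv[OF A'(1)]
  have "inv\<^bsub>gl_group n\<^esub> A * B - 1\<^sub>m n = inv\<^bsub>gl_group n\<^esub> A * (B - A)"
    using i B gl_group_carrierD[OF A'(1)] by (simp add: mult_minus_distrib_mat)
  then show ?thesis using FM_mult0(1)[OF A'(2) AB] i B by (simp add: congruence_def)
qed

lemma subgroup_congruence:
  assumes r: "r \<ge> 1"
  shows "subgroup (congruence r n) (gl_group n)"
proof -
  interpret group "gl_group n :: 'a mat monoid" by (rule group_gl_group)
  note sub = congruence_GL0[OF r, of n]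
  show ?thesis
  proof (rule subgroupI)
    show "congruence r n \<subseteq> carrier (gl_group n)" using sub by (auto simp: GL0_def)
    have "1\<^sub>m n \<in> congruence r n" by (simp add: congruence_def FM_def filt_zero minus_carrier_mat)
    then show "congruence r n \<noteq> {}" by blast
  next
    fix a assume a: "a \<in> congruence r n"
    have "1\<^sub>m n - a = - (a - 1\<^sub>m n)" using a by (intro eq_matI) (auto simp: congruence_def)
    then have "1\<^sub>m n - a \<in> FM r n n" using a FM_uminus by (auto simp: congruence_def)
    then have "inv\<^bsub>gl_group n\<^esub> a * 1\<^sub>m n \<in> congruence r n"
      using a sub by (intro congruence_mult_diff) auto
    moreover have ac: "a \<in> carrier (gl_group n)" using a sub by (auto simp: GL0_def)
    ultimately show "inv\<^bsub>gl_group n\<^esub> a \<in> congruence r n" using gl_group_inv(1)[OF ac] by simp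
  next
    fix a b assume a: "a \<in> congruence r n" and b: "b \<in> congruence r n"
    have c: "a \<in> carrier_mat n n" "b \<in> carrier_mat n n" using a b by (auto simp: congruence_def)
    have "a * b - 1\<^sub>m n = a * (b - 1\<^sub>m n) + (a - 1\<^sub>m n)"
    proof -
      have "a * (b - 1\<^sub>m n) = a * b - a" using c by (simp add: mult_minus_distrib_mat)
      then show ?thesis using c by (intro eq_matI) auto
    qed
    moreover have "a \<in> FM 0 n n" using a sub by (auto simp: GL0_def)
    then have "a * (b - 1\<^sub>m n) \<in> FM r n n" using b by (intro FM_mult0) (auto simp: congruence_def)
    ultimately show "a \<otimes>\<^bsub>gl_group n\<^esub> b \<in> congruence r n"
      using a c FM_add by (simp add: congruence_def)
  qed
qed

lemma congruence_mono: "r \<le> s \<Longrightarrow> congruence s n \<subseteq> congruence r n"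
  by (auto simp: congruence_def intro: FM_mono)

text \<open>Since s A s^-1 - 1 = s (A - 1) s^-1, each outer factor contributes c to the level, and
  starting at r - 2 c leaves r.\<close>

lemma congruence_conj:
  assumes s: "s \<in> carrier (gl_group n)" and c: "s \<in> FM c n n" "inv\<^bsub>gl_group n\<^esub> s \<in> FM c n n"
    and A: "A \<in> congruence (r - 2 * c) n"
  shows "s * A * inv\<^bsub>gl_group n\<^esub> s \<in> congruence r n"
    and "inv\<^bsub>gl_group n\<^esub> s * A * s \<in> congruence r n"
proof -
  note i = gl_group_inv[OF s] gl_group_carrierD[OF s]
  have A': "A \<in> carrier_mat n n" "A - 1\<^sub>m n \<in> FM (r - 2 * c) n n" using A by (auto simp: congruence_def)
  have *: "u * A * v - 1\<^sub>m n \<in> FM r n n" if "u \<in> FM c n n" "v \<in> FM c n n" "u * v = 1\<^sub>m n" for u v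
  proof -
    have uv: "u \<in> carrier_mat n n" "v \<in> carrier_mat n n" using that FM_carrier by auto
    have "u * (A - 1\<^sub>m n) * v = u * A * v - 1\<^sub>m n"
      using uv A' that by (simp add: mult_minus_distrib_mat minus_mult_distrib_mat[of _ n n])
    moreover have "u * (A - 1\<^sub>m n) * v \<in> FM (c + (r - 2 * c) + c) n n"
      by (rule FM_mult[OF FM_mult[OF that(1) A'(2)] that(2)])
    ultimately show ?thesis by simp
  qed
  show "s * A * inv\<^bsub>gl_group n\<^esub> s \<in> congruence r n" "inv\<^bsub>gl_group n\<^esub> s * A * s \<in> congruence r n"
    using *[of s "inv\<^bsub>gl_group n\<^esub> s"] *[of "inv\<^bsub>gl_group n\<^esub> s" s] c i A' by (auto simp: congruence_def)
qed

lemma bounded_element: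
  assumes s: "s \<in> carrier (gl_group n)"
  obtains c where "c \<le> 0" "s \<in> FM c n n" "inv\<^bsub>gl_group n\<^esub> s \<in> FM c n n"
proof -
  obtain a b where a: "s \<in> FM a n n" and b: "inv\<^bsub>gl_group n\<^esub> s \<in> FM b n n"
    using FM_exhaust gl_group_inv(1)[OF s] gl_group_carrierD[OF s] by meson
  show ?thesis
    by (rule that[of "min 0 (min a b)"]) (use a b FM_mono in auto)
qed

text \<open>Two elements of C whose entries agree modulo a deep enough ideal lie in the same coset
  of B, and bounded entries have finitely many residues.\<close>

lemma finite_cosets_bounded:
  assumes C: "\<And>a. a \<in> C \<Longrightarrow> a \<in> carrier (gl_group n) \<and> a \<in> FM c n n \<and> inv\<^bsub>gl_group n\<^esub> a \<in> FM c n n"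
    and B: "subgroup B (gl_group n)" "congruence r n \<subseteq> B"
  shows "finite ((\<lambda>a. a <#\<^bsub>gl_group n\<^esub> B) ` C)"
proof -
  interpret group "gl_group n :: 'a mat monoid" by (rule group_gl_group)
  \<comment> \<open>Agreement modulo \<open>I (r - c)\<close> is the right precision: multiplying
    the difference by the inverse of a, which has level c, brings it to level r.\<close>
  obtain T where T: "finite T" "\<And>x. x \<in> I c \<Longrightarrow> \<exists>t\<in>T. x - t \<in> I (r - c)"
    using filt_finite[of c "r - c"] by blast
  define t where "t x = (SOME t. t \<in> T \<and> x - t \<in> I (r - c))" for x
  have t: "t x \<in> T" "x - t x \<in> I (r - c)" if "x \<in> I c" for x
    using someI_ex[of "\<lambda>t. t \<in> T \<and> x - t \<in> I (r - c)"] T(2)[OF that] unfolding t_def by blast+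
  define f where "f a = (\<lambda>(i, j)\<in>{..<n} \<times> {..<n}. t (a $$ (i, j)))" for a :: "'a mat"
  have fin: "finite (f ` C)"
  proof (rule finite_subset)
    have "t (a $$ (i, j)) \<in> T" if "a \<in> C" "i < n" "j < n" for a i j
      using C[OF that(1)] that by (intro t(1)) (simp add: FM_def)
    then show "f ` C \<subseteq> ({..<n} \<times> {..<n}) \<rightarrow>\<^sub>E T" by (auto simp: f_def split: if_splits)
    show "finite (({..<n} \<times> {..<n}) \<rightarrow>\<^sub>E T)" using T(1) by (intro finite_PiE) auto
  qed
  have eq: "a <#\<^bsub>gl_group n\<^esub> B = b <#\<^bsub>gl_group n\<^esub> B" if ab: "a \<in> C" "b \<in> C" "f a = f b" for a b
  proof -
    note a = C[OF ab(1)] and b = C[OF ab(2)]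
    note ac = a[THEN conjunct1] and bc = b[THEN conjunct1]
    note i = gl_group_inv[OF ac] gl_group_carrierD[OF ac] gl_group_carrierD[OF bc]
    have "b $$ (i, j) - a $$ (i, j) \<in> I (r - c)" if "i < n" "j < n" for i j
    proof -
      have "t (a $$ (i, j)) = t (b $$ (i, j))"
        using fun_cong[OF ab(3), of "(i, j)"] that by (simp add: f_def)
      then show ?thesis
        using filt_diff[OF t(2)[of "b $$ (i, j)"] t(2)[of "a $$ (i, j)"]] a b that by (simp add: FM_def)
    qed
    then have "b - a \<in> FM (r - c) n n" using i by (auto simp: FM_def)
    then have "inv\<^bsub>gl_group n\<^esub> a * (b - a) \<in> FM (c + (r - c)) n n" using a by (intro FM_mult) auto
    moreover have "inv\<^bsub>gl_group n\<^esub> a * (b - a) = inv\<^bsub>gl_group n\<^esub> a * b - 1\<^sub>m n"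
      using i by (simp add: mult_minus_distrib_mat)
    ultimately have "inv\<^bsub>gl_group n\<^esub> a * b \<in> congruence r n" using i by (simp add: congruence_def)
    then show ?thesis using l_coset_eq_iff[OF B(1) ac bc] B(2) by auto
  qed
  define h where "h y = (SOME b. b \<in> C \<and> f b = y)" for y
  have "a <#\<^bsub>gl_group n\<^esub> B = h (f a) <#\<^bsub>gl_group n\<^esub> B" if "a \<in> C" for a
  proof -
    have "h (f a) \<in> C \<and> f (h (f a)) = f a"
      unfolding h_def by (rule someI_ex) (use that in blast)
    then show ?thesis using eq that by metis
  qed
  then have "(\<lambda>a. a <#\<^bsub>gl_group n\<^esub> B) ` C \<subseteq> (\<lambda>y. h y <#\<^bsub>gl_group n\<^esub> B) ` f ` C" by blast
  then show ?thesis using fin finite_surj by blast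
qed

text \<open>Containing a congruence subgroup is openness, bounded entries are compactness; being a
  subgroup, it has bounded inverses as well.\<close>

definition compact_open :: "nat \<Rightarrow> 'a mat set set" where
  "compact_open n = {H. subgroup H (gl_group n) \<and> (\<exists>r\<ge>1. congruence r n \<subseteq> H) \<and> (\<exists>c. H \<subseteq> FM c n n)}"

lemma GL0_compact_open: "GL0 n \<in> compact_open n"
  unfolding compact_open_def using subgroup_GL0 congruence_GL0[of 1 n] by (auto simp: GL0_def)

lemma congruence_compact_open: "r \<ge> 1 \<Longrightarrow> congruence r n \<in> compact_open n"
  unfolding compact_open_def using subgroup_congruence congruence_GL0[of r n] by (auto simp: GL0_def)

lemma compact_open_family:
  "commensurable_family (gl_group n) (carrier (gl_group n)) (compact_open n) (GL0 n)"
proof -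
  interpret group "gl_group n :: 'a mat monoid" by (rule group_gl_group)
  show ?thesis
  proof (rule commensurable_family.intro, rule group_axioms, rule commensurable_family_axioms.intro)
    fix A B assume A: "A \<in> compact_open n" and B: "B \<in> compact_open n"
    obtain r c where r: "r \<ge> 1" "congruence r n \<subseteq> A" "A \<subseteq> FM c n n" and sA: "subgroup A (gl_group n)"
      using A by (auto simp: compact_open_def)
    obtain r' where r': "r' \<ge> 1" "congruence r' n \<subseteq> B" and sB: "subgroup B (gl_group n)"
      using B by (auto simp: compact_open_def)
    have mx: "congruence (max r r') n \<subseteq> A \<inter> B"
      using r r' congruence_mono[of r "max r r'" n] congruence_mono[of r' "max r r'" n] by auto
    have sAB: "subgroup (A \<inter> B) (gl_group n)" using sA sB by (rule subgroups_Inter_pair)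
    have "max r r' \<ge> 1" using r by simp
    then show "A \<inter> B \<in> compact_open n"
      unfolding compact_open_def using sAB mx r(3) by blast
    have "a \<in> carrier (gl_group n) \<and> a \<in> FM c n n \<and> inv\<^bsub>gl_group n\<^esub> a \<in> FM c n n" if "a \<in> A" for a
      using that r sA subgroup.m_inv_closed[OF sA] subgroup.mem_carrier[OF sA] by auto
    then show "finite (cosets_on A (A \<inter> B))"
      unfolding cosets_on_def using sAB mx by (rule finite_cosets_bounded)
  next
    fix A and s :: "'a mat" assume A: "A \<in> compact_open n" and s: "s \<in> carrier (gl_group n)"
    obtain r c where r: "r \<ge> 1" "congruence r n \<subseteq> A" "A \<subseteq> FM c n n" and sA: "subgroup A (gl_group n)"
      using A by (auto simp: compact_open_def)
    obtain d where d: "d \<le> 0" "s \<in> FM d n n" "inv\<^bsub>gl_group n\<^esub> s \<in> FM d n n"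
      using bounded_element[OF s] by blast
    \<comment> \<open>As d \<le> 0, the level r - 2 d stays positive and absorbs the loss caused by
      conjugation.\<close>
    have ge: "r - 2 * d \<ge> 1" using r d by simp
    have "congruence (r - 2 * d) n \<subseteq> conj_set s A"
    proof
      fix x assume x: "x \<in> congruence (r - 2 * d) n"
      then have "inv\<^bsub>gl_group n\<^esub> s * x * s \<in> A" using congruence_conj(2)[OF s d(2,3)] r by blast
      moreover have "x \<in> carrier (gl_group n)" using x congruence_GL0[OF ge] by (auto simp: GL0_def)
      ultimately show "x \<in> conj_set s A" by (simp add: conj_set_def)
    qed
    moreover have "conj_set s A \<subseteq> FM (d + c + d) n n"
      unfolding conj_set_image[OF subgroup.subset[OF sA] s] gl_group_simps
    proof (intro image_subsetI)
      fix x assume "x \<in> A"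
      then have "x \<in> FM c n n" using r(3) by blast
      then show "s * x * inv\<^bsub>gl_group n\<^esub> s \<in> FM (d + c + d) n n"
        using FM_mult[OF FM_mult[OF d(2)] d(3)] by blast
    qed
    ultimately show "conj_set s A \<in> compact_open n"
      unfolding compact_open_def using conj_set_subgroup[OF sA s] ge by blast
  next
    show "GL0 n \<in> compact_open n" by (rule GL0_compact_open)
  qed (auto simp: compact_open_def subgroup_self dest: subgroup.subset)
qed

end

section \<open>The valuation filtration\<close>

context nonarchimedean_local_field
begin

definition pp :: "int \<Rightarrow> 'f set" where
  "pp r = {x. x = 0 \<or> r \<le> val x}"

definition unif :: 'f where
  "unif = (SOME x. x \<noteq> 0 \<and> val x = 1)"

definition resq :: nat where
  "resq = card (residue_field val)"

lemma unif: "unif \<noteq> 0" "val unif = 1"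
  using someI_ex[OF val_uniformizer] unfolding unif_def by auto

lemma resq_ge: "resq \<ge> 2"
  using card_residue_field by (simp add: resq_def)

lemma val_inverse: "x \<noteq> 0 \<Longrightarrow> val (inverse x) = - val x"
  using val_mult[of x "inverse x"] by (simp add: val_one)

lemma val_power: "x \<noteq> 0 \<Longrightarrow> val (x ^ n) = int n * val x"
  by (induction n) (auto simp: val_one val_mult algebra_simps)

lemma val_power_int: "x \<noteq> 0 \<Longrightarrow> val (x powi k) = k * val x"
  by (cases "k \<ge> 0") (auto simp: power_int_def val_power val_inverse power_inverse)

lemma unif_powi: "unif powi k \<noteq> 0" "val (unif powi k) = k"
  using unif by (auto simp: val_power_int)

lemma pp_add:
  assumes "x \<in> pp r" "y \<in> pp r"
  shows "x + y \<in> pp r"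
proof (cases "x = 0 \<or> y = 0 \<or> x + y = 0")
  case False
  then show ?thesis using val_add[of x y] assms by (auto simp: pp_def)
qed (use assms in \<open>auto simp: pp_def\<close>)

lemma pp_uminus: "x \<in> pp r \<Longrightarrow> - x \<in> pp r"
  by (auto simp: pp_def val_minus)

lemma pp_diff: "x \<in> pp r \<Longrightarrow> y \<in> pp r \<Longrightarrow> x - y \<in> pp r"
  using pp_add[of x r "- y"] pp_uminus[of y r] by simp

lemma pp_mult: "x \<in> pp r \<Longrightarrow> y \<in> pp s \<Longrightarrow> x * y \<in> pp (r + s)"
  by (cases "x = 0 \<or> y = 0") (auto simp: pp_def val_mult)

lemma pp_mono: "x \<in> pp s \<Longrightarrow> r \<le> s \<Longrightarrow> x \<in> pp r"
  by (auto simp: pp_def)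

lemma pp_zero: "0 \<in> pp r"
  by (simp add: pp_def)

lemma val_one_plus:
  assumes "x \<in> pp 1"
  shows "1 + x \<noteq> 0" "val (1 + x) = 0"
proof -
  have *: "x \<noteq> - 1" using assms by (auto simp: pp_def val_minus val_one)
  then show nz: "1 + x \<noteq> 0" by (metis add.commute add_eq_0_iff)
  show "val (1 + x) = 0"
  proof (cases "x = 0")
    case False
    then have x: "val x \<ge> 1" using assms by (auto simp: pp_def)
    have "val (1 + x) \<ge> 0" using val_add[of 1 x] False nz x by (simp add: val_one)
    moreover have "\<not> val (1 + x) \<ge> 1"
    proof
      assume "val (1 + x) \<ge> 1"
      then have "(1 + x) - x \<in> pp 1" using assms by (intro pp_diff) (auto simp: pp_def)
      then show False by (simp add: pp_def val_one)
    qed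
    ultimately show ?thesis by simp
  qed (simp add: val_one)
qed

text \<open>The exact number of representatives matters here and not only finiteness: it yields the
  index in \<open>index_torus\<close> and so the base of the modulus character.\<close>

lemma residue_representatives:
  obtains T where "finite T" "card T = resq" "T \<subseteq> pp 0"
    "\<And>x. x \<in> pp 0 \<Longrightarrow> \<exists>t\<in>T. x - t \<in> pp 1"
    "\<And>s t. s \<in> T \<Longrightarrow> t \<in> T \<Longrightarrow> s - t \<in> pp 1 \<Longrightarrow> s = t"
proof -
  let ?R = "{(x, y). x \<in> valuation_ring val \<and> y \<in> valuation_ring val \<and> x - y \<in> valuation_ideal val}"
  have pp01: "valuation_ring val = pp 0" "valuation_ideal val = pp 1"
    by (auto simp: valuation_ring_def valuation_ideal_def pp_def)
  have equiv: "equiv (pp 0) ?R"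
  proof (rule equivI)
    show "sym ?R"
    proof (rule symI)
      fix x y assume "(x, y) \<in> ?R"
      then show "(y, x) \<in> ?R" unfolding pp01 using pp_uminus[of "x - y" 1] by auto
    qed
    show "trans ?R"
    proof (rule transI)
      fix x y z assume "(x, y) \<in> ?R" "(y, z) \<in> ?R"
      then show "(x, z) \<in> ?R" unfolding pp01 using pp_add[of "x - y" 1 "y - z"] by auto
    qed
    show "refl_on (pp 0) ?R" by (auto simp: refl_on_def pp01 pp_zero)
    show "?R \<subseteq> pp 0 \<times> pp 0" by (auto simp: pp01)
  qed
  define f where "f C = (SOME x. x \<in> C)" for C :: "'f set"
  have f: "f C \<in> C" if "C \<in> residue_field val" for C
  proof -
    have "C \<noteq> {}" using that in_quotient_imp_non_empty[OF equiv] unfolding residue_field_def pp01 by blast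
    then show ?thesis unfolding f_def by (simp add: some_in_eq)
  qed
  have cl: "C \<subseteq> pp 0" if "C \<in> residue_field val" for C
    using that in_quotient_imp_subset[OF equiv] unfolding residue_field_def pp01 by blast
  have eq: "C = D" if "C \<in> residue_field val" "D \<in> residue_field val" "x \<in> C" "y \<in> D" "x - y \<in> pp 1" for C D x y
  proof -
    have "(x, y) \<in> ?R" using that cl unfolding pp01 by auto
    then show ?thesis
      using quotient_eq_iff[OF equiv, of C D x y] that unfolding residue_field_def pp01 by blast
  qed
  show ?thesis
  proof (rule that[of "f ` residue_field val"])
    show "finite (f ` residue_field val)" using finite_residue_field by simp
    have "inj_on f (residue_field val)"
    proof (rule inj_onI)
      fix C D assume CD: "C \<in> residue_field val" "D \<in> residue_field val" "f C = f D"
      show "C = D" using eq[OF CD(1,2) f[OF CD(1)] f[OF CD(2)]] CD(3) by (simp add: pp_zero)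
    qed
    then show "card (f ` residue_field val) = resq" by (simp add: card_image resq_def)
    show "f ` residue_field val \<subseteq> pp 0" using f cl by blast
  next
    fix x assume x: "x \<in> pp 0"
    have C: "?R `` {x} \<in> residue_field val"
      unfolding residue_field_def pp01 by (rule quotientI[OF x])
    then have "(x, f (?R `` {x})) \<in> ?R" using f by blast
    then show "\<exists>t\<in>f ` residue_field val. x - t \<in> pp 1" using C unfolding pp01 by blast
  next
    fix s t assume "s \<in> f ` residue_field val" "t \<in> f ` residue_field val" "s - t \<in> pp 1"
    then show "s = t" using eq f by blast
  qed
qed

text \<open>Digit expansion: each further power of the uniformiser adds one digit taken from the
  finite set of residue representatives.\<close>

lemma finite_pp_quotient: "\<exists>T. finite T \<and> (\<forall>x\<in>pp r. \<exists>t\<in>T. x - t \<in> pp s)"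
proof -
  obtain T0 where T0: "finite T0" "\<And>x. x \<in> pp 0 \<Longrightarrow> \<exists>t\<in>T0. x - t \<in> pp 1"
    using residue_representatives by metis
  have "\<exists>T. finite T \<and> (\<forall>x\<in>pp r. \<exists>t\<in>T. x - t \<in> pp (r + int k))" for k
  proof (induction k)
    case 0
    show ?case by (rule exI[of _ "{0}"]) auto
  next
    case (Suc k)
    then obtain T where T: "finite T" "\<And>x. x \<in> pp r \<Longrightarrow> \<exists>t\<in>T. x - t \<in> pp (r + int k)" by auto
    let ?u = "unif powi (r + int k)"
    let ?T = "(\<lambda>(t, a). t + ?u * a) ` (T \<times> T0)"
    have "\<exists>t\<in>?T. x - t \<in> pp (r + int (Suc k))" if x: "x \<in> pp r" for x
    proof -
      obtain t where t: "t \<in> T" "x - t \<in> pp (r + int k)" using T(2)[OF x] by blast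
      have "inverse ?u \<in> pp (- (r + int k))" using unif_powi by (simp add: pp_def val_inverse)
      then have "inverse ?u * (x - t) \<in> pp (- (r + int k) + (r + int k))" using t by (intro pp_mult)
      then obtain a where a: "a \<in> T0" "inverse ?u * (x - t) - a \<in> pp 1" using T0(2) by auto
      have "?u \<in> pp (r + int k)" using unif_powi by (simp add: pp_def)
      then have "?u * (inverse ?u * (x - t) - a) \<in> pp (r + int k + 1)" using a by (intro pp_mult)
      moreover have "?u * (inverse ?u * (x - t) - a) = x - (t + ?u * a)"
        using unif_powi(1)[of "r + int k"] by (simp add: right_diff_distrib mult.assoc[symmetric])
      ultimately have "x - (t + ?u * a) \<in> pp (r + int k + 1)" by simp
      moreover have "r + int k + 1 = r + int (Suc k)" by simp
      ultimately have "x - (t + ?u * a) \<in> pp (r + int (Suc k))" by simp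
      then show ?thesis using t(1) a(1) by (intro bexI[of _ "t + ?u * a"]) auto
    qed
    then show ?case using T(1) T0(1) by (intro exI[of _ ?T]) auto
  qed
  from this[of "nat (s - r)"] obtain T where T: "finite T" "\<forall>x\<in>pp r. \<exists>t\<in>T. x - t \<in> pp (r + int (nat (s - r)))"
    by blast
  have "r + int (nat (s - r)) \<ge> s" by simp
  then show ?thesis using T pp_mono by meson
qed

sublocale F: filtered_ring pp
proof
  fix x assume x: "x \<in> pp 1"
  show "\<exists>y\<in>pp 0. (1 + x) * y = 1"
    using val_one_plus[OF x] by (intro bexI[of _ "inverse (1 + x)"]) (auto simp: pp_def val_inverse)
next
  fix x show "\<exists>r. x \<in> pp r" by (auto simp: pp_def)
qed (auto intro: pp_zero pp_add pp_uminus pp_mult pp_mono finite_pp_quotient simp: val_one pp_def[of 0])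

lemma normalised_abs_simps:
  "normalised_abs val 0 = 0" "x \<noteq> 0 \<Longrightarrow> normalised_abs val x = real resq powi (- val x)"
  "normalised_abs val x \<ge> 0" "x \<noteq> 0 \<Longrightarrow> normalised_abs val x > 0"
  using resq_ge by (auto simp: normalised_abs_def resq_def)

lemma normalised_abs_mult: "normalised_abs val (x * y) = normalised_abs val x * normalised_abs val y"
proof (cases "x = 0 \<or> y = 0")
  case False
  then show ?thesis using resq_ge
    by (simp add: normalised_abs_simps val_mult power_int_add[symmetric])
qed (auto simp: normalised_abs_simps)

text \<open>Metric balls are defined by a strict inequality; since the values are integral powers of
  \<open>resq\<close>, the strict bound must be one power larger, whence 1 - r.\<close>

lemma normalised_abs_less_iff:
  "normalised_abs val x < real resq powi (1 - r) \<longleftrightarrow> x \<in> pp r"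
proof (cases "x = 0")
  case True
  then show ?thesis using resq_ge by (simp add: normalised_abs_simps pp_def)
next
  case False
  have "real resq > 1" using resq_ge by simp
  then have "real resq powi (- val x) < real resq powi (1 - r) \<longleftrightarrow> - val x < 1 - r"
    using power_int_strict_increasing[of "- val x" "1 - r" "real resq"]
      power_int_increasing[of "1 - r" "- val x" "real resq"] by (meson less_imp_le not_le)
  also have "\<dots> \<longleftrightarrow> r \<le> val x" by arith
  finally show ?thesis using False by (simp add: normalised_abs_simps pp_def)
qed

interpretation M: Metric_space UNIV "field_dist val"
  by (rule metric_space_field_dist)

lemma pp_ball: "\<exists>e>0. M.mball x e = {y. y - x \<in> pp r}"
proof (intro exI conjI)
  show "real resq powi (1 - r) > 0" using resq_ge by simp
  have "x - y \<in> pp r \<longleftrightarrow> y - x \<in> pp r" for y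
    using pp_uminus[of "x - y" r] pp_uminus[of "y - x" r] by auto
  then show "M.mball x (real resq powi (1 - r)) = {y. y - x \<in> pp r}"
    by (auto simp: M.mball_def normalised_abs_less_iff)
qed

lemma pp_ball_subset: "e > 0 \<Longrightarrow> \<exists>r. {y. y - x \<in> pp r} \<subseteq> M.mball x e"
proof -
  assume e: "e > 0"
  have "inverse (real resq) < 1" using resq_ge by (simp add: field_simps)
  then obtain k where k: "inverse (real resq) ^ k < e" using e real_arch_pow_inv by blast
  have "real resq powi (1 - int (k + 1)) = inverse (real resq) ^ k"
    by (simp add: power_int_minus power_inverse)
  then have "y \<in> M.mball x e" if "y - x \<in> pp (int (k + 1))" for y
  proof -
    have "x - y \<in> pp (int (k + 1))" using pp_uminus[OF that] by simp
    then have "normalised_abs val (x - y) < inverse (real resq) ^ k"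
      using normalised_abs_less_iff[of "x - y" "int (k + 1)"]
        \<open>real resq powi (1 - int (k + 1)) = inverse (real resq) ^ k\<close> by simp
    then show ?thesis using k by (simp add: M.mball_def)
  qed
  then show ?thesis by blast
qed

lemma openin_field_topology:
  "openin (field_topology val) U \<longleftrightarrow> (\<forall>x\<in>U. \<exists>r. \<forall>y. y - x \<in> pp r \<longrightarrow> y \<in> U)"
proof -
  have "openin (field_topology val) U \<longleftrightarrow> (\<forall>x. x \<in> U \<longrightarrow> (\<exists>e>0. M.mball x e \<subseteq> U))"
    by (simp add: field_topology_def M.openin_mtopology)
  also have "\<dots> \<longleftrightarrow> (\<forall>x\<in>U. \<exists>r. \<forall>y. y - x \<in> pp r \<longrightarrow> y \<in> U)"
  proof (intro iffI ballI allI impI)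
    fix x assume "\<forall>x. x \<in> U \<longrightarrow> (\<exists>e>0. M.mball x e \<subseteq> U)" "x \<in> U"
    then obtain e where "e > 0" "M.mball x e \<subseteq> U" by blast
    then show "\<exists>r. \<forall>y. y - x \<in> pp r \<longrightarrow> y \<in> U" using pp_ball_subset[of e x] by blast
  next
    fix x assume "\<forall>x\<in>U. \<exists>r. \<forall>y. y - x \<in> pp r \<longrightarrow> y \<in> U" "x \<in> U"
    then obtain r where r: "\<forall>y. y - x \<in> pp r \<longrightarrow> y \<in> U" by blast
    obtain e where "e > 0" "M.mball x e = {y. y - x \<in> pp r}" using pp_ball by blast
    then show "\<exists>e>0. M.mball x e \<subseteq> U" using r by blast
  qed
  finally show ?thesis .
qed

lemma openin_pp_ball: "openin (field_topology val) {y. y - x \<in> pp r}"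
  unfolding openin_field_topology
proof (intro ballI exI allI impI)
  fix y z assume "y \<in> {y. y - x \<in> pp r}" "z - y \<in> pp r"
  then show "z \<in> {y. y - x \<in> pp r}" using pp_add[of "z - y" r "y - x"] by simp
qed

lemma topspace_field_topology [simp]: "topspace (field_topology val) = UNIV"
  by (simp add: field_topology_def)

text \<open>Finite quotients give total boundedness, and completeness of the field together with
  closedness of \<open>pp 0\<close> turns it into compactness.\<close>

lemma compact_pp0: "compactin (field_topology val) (pp 0)"
proof -
  have "M.mtotally_bounded (pp 0)"
    unfolding M.mtotally_bounded_def
  proof (intro allI impI)
    fix e :: real assume "e > 0"
    then obtain s0 where s0: "{y. y - 0 \<in> pp s0} \<subseteq> M.mball 0 e" using pp_ball_subset by blast
    \<comment> \<open>The maximum with 0 ensures that a representative t of a point of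
      \<open>pp 0\<close> lies in \<open>pp 0\<close> itself, so that the centres can be chosen
      inside the set.\<close>
    define s where "s = max s0 0"
    have s: "y \<in> M.mball x e" if "y - x \<in> pp s" for x y
    proof -
      have "y - x \<in> M.mball 0 e" using s0 pp_mono[OF that, of s0] by (auto simp: s_def)
      then show ?thesis unfolding M.mball_def by simp
    qed
    obtain T where T: "finite T" "\<forall>x\<in>pp 0. \<exists>t\<in>T. x - t \<in> pp s" using finite_pp_quotient by blast
    have "pp 0 \<subseteq> (\<Union>x\<in>T \<inter> pp 0. M.mball x e)"
    proof
      fix x assume x: "x \<in> pp 0"
      then obtain t where t: "t \<in> T" "x - t \<in> pp s" using T by blast
      have "x - (x - t) \<in> pp 0" using x pp_mono[OF t(2), of 0] by (intro pp_diff[of x 0 "x - t"]) (auto simp: s_def)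
      then show "x \<in> (\<Union>x\<in>T \<inter> pp 0. M.mball x e)" using t s by auto
    qed
    then show "\<exists>K. finite K \<and> K \<subseteq> pp 0 \<and> pp 0 \<subseteq> (\<Union>x\<in>K. M.mball x e)"
      using T(1) by (intro exI[of _ "T \<inter> pp 0"]) auto
  qed
  then have "compactin M.mtopology (M.mtopology closure_of (pp 0))"
    using M.mtotally_bounded_eq_compact_closure_of[OF complete] by blast
  moreover have "closedin (field_topology val) (pp 0)"
    unfolding closedin_def openin_field_topology
  proof (intro conjI ballI exI allI impI)
    fix x y assume "x \<in> topspace (field_topology val) - pp 0" "y - x \<in> pp 0"
    then show "y \<in> topspace (field_topology val) - pp 0" using pp_diff[of y 0 "y - x"] by auto
  qed auto
  ultimately show ?thesis by (simp add: field_topology_def closure_of_closedin)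
qed

section \<open>The topology of the general linear group\<close>

lemma GL_eq: "GL n = carrier (gl_group n :: 'f mat monoid)"
proof -
  have "A \<in> GL n \<longleftrightarrow> A \<in> carrier (gl_group n)" for A :: "'f mat"
  proof
    assume "A \<in> GL n"
    then have A: "A \<in> carrier_mat n n" "invertible_mat A" by (auto simp: GL_def)
    then obtain B where B: "A * B = 1\<^sub>m (dim_row A)" "B * A = 1\<^sub>m (dim_row B)"
      by (auto simp: invertible_mat_def inverts_mat_def)
    have "dim_row B = n" using arg_cong[OF B(2), of dim_col] A by simp
    moreover have "dim_col B = n" using arg_cong[OF B(1), of dim_col] A by simp
    ultimately have "B \<in> carrier_mat n n" by auto
    then show "A \<in> carrier (gl_group n)" using A B by (auto simp: gl_group_carrier)
  next
    assume "A \<in> carrier (gl_group n)"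
    then show "A \<in> GL n"
      by (auto simp: gl_group_carrier GL_def invertible_mat_def inverts_mat_def square_mat.simps)
  qed
  then show ?thesis by blast
qed

text \<open>Topological statements about the group are reduced to congruences of entries; finitely
  many entries allow one common level r for all of them.\<close>

lemma openin_GL_topology:
  "openin (GL_topology val n) S \<longleftrightarrow>
     S \<subseteq> GL n \<and> (\<forall>g\<in>S. \<exists>r. \<forall>h\<in>GL n. h - g \<in> F.FM r n n \<longrightarrow> h \<in> S)"
proof -
  let ?I = "{..<n} \<times> {..<n}"
  let ?T = "product_topology (\<lambda>_. field_topology val) ?I"
  let ?f = "\<lambda>g. \<lambda>ij\<in>?I. (g :: 'f mat) $$ ij"
  let ?box = "\<lambda>g r. PiE ?I (\<lambda>ij. {y. y - (g :: 'f mat) $$ ij \<in> pp r})"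
  have f_box: "?f h \<in> ?box g r \<longleftrightarrow> h - g \<in> F.FM r n n"
    if "g \<in> carrier_mat n n" "h \<in> carrier_mat n n" for g h r
    using that by (auto simp: restrict_PiE_iff F.FM_def)
  have GLc: "g \<in> carrier_mat n n" if "g \<in> GL n" for g :: "'f mat" using that by (simp add: GL_def)
  show ?thesis
    unfolding GL_topology_def openin_pullback_topology
  proof (intro iffI conjI ballI)
    assume "\<exists>U. openin ?T U \<and> S = ?f -` U \<inter> GL n"
    then obtain U where U: "openin ?T U" "S = ?f -` U \<inter> GL n" by blast
    then show "S \<subseteq> GL n" by blast
    fix g assume g: "g \<in> S"
    then have "?f g \<in> U" using U by auto
    with U(1) have "\<exists>X. finite {i \<in> ?I. X i \<noteq> topspace (field_topology val)} \<and>
        (\<forall>i\<in>?I. openin (field_topology val) (X i)) \<and> ?f g \<in> PiE ?I X \<and> PiE ?I X \<subseteq> U"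
      unfolding openin_product_topology_alt by (rule bspec)
    then obtain X where X: "?f g \<in> PiE ?I X" "\<And>i. i \<in> ?I \<Longrightarrow> openin (field_topology val) (X i)"
      "PiE ?I X \<subseteq> U" by blast
    have "\<exists>r. \<forall>y. y - g $$ ij \<in> pp r \<longrightarrow> y \<in> X ij" if "ij \<in> ?I" for ij
    proof -
      have "g $$ ij \<in> X ij" using X(1) that by (auto simp: restrict_PiE_iff)
      then show ?thesis using X(2)[OF that] unfolding openin_field_topology by blast
    qed
    then obtain r where r: "\<And>ij y. ij \<in> ?I \<Longrightarrow> y - g $$ ij \<in> pp (r ij) \<Longrightarrow> y \<in> X ij" by metis
    define R where "R = Max (insert 0 (r ` ?I))"
    have R: "r ij \<le> R" if "ij \<in> ?I" for ij unfolding R_def using that by (intro Max_ge) auto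
    show "\<exists>r. \<forall>h\<in>GL n. h - g \<in> F.FM r n n \<longrightarrow> h \<in> S"
    proof (intro exI ballI impI)
      fix h assume h: "h \<in> GL n" "h - g \<in> F.FM R n n"
      have gc: "g \<in> carrier_mat n n" using g U GLc by auto
      have "h $$ ij \<in> X ij" if ij: "ij \<in> ?I" for ij
      proof (rule r[OF ij], rule pp_mono[OF _ R[OF ij]])
        show "h $$ ij - g $$ ij \<in> pp R"
          using h(2) GLc[OF h(1)] gc ij by (auto simp: F.FM_def)
      qed
      then have "?f h \<in> PiE ?I X" by (simp add: restrict_PiE_iff)
      then have "?f h \<in> U" by (rule subsetD[OF X(3)])
      then show "h \<in> S" using U(2) h(1) by simp
    qed
  next
    assume S: "S \<subseteq> GL n \<and> (\<forall>g\<in>S. \<exists>r. \<forall>h\<in>GL n. h - g \<in> F.FM r n n \<longrightarrow> h \<in> S)"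
    then obtain r where r: "\<And>g h. g \<in> S \<Longrightarrow> h \<in> GL n \<Longrightarrow> h - g \<in> F.FM (r g) n n \<Longrightarrow> h \<in> S" by metis
    let ?U = "\<Union>g\<in>S. ?box g (r g)"
    have "openin ?T (?box g (r g))" for g
      by (subst openin_PiE_gen) (auto intro: openin_pp_ball)
    then have "openin ?T ?U" by blast
    moreover have "S = ?f -` ?U \<inter> GL n"
    proof (intro equalityI subsetI)
      fix g assume g: "g \<in> S"
      then have "g \<in> carrier_mat n n" "g \<in> GL n" using S GLc by auto
      then have "?f g \<in> ?box g (r g)" using f_box[of g g] by (simp add: F.FM_def pp_zero)
      then have "?f g \<in> ?U" using g by (intro UN_I)
      then show "g \<in> ?f -` ?U \<inter> GL n" using \<open>g \<in> GL n\<close> by (intro IntI vimageI2)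
    next
      fix h assume "h \<in> ?f -` ?U \<inter> GL n"
      then obtain g where g: "g \<in> S" "?f h \<in> ?box g (r g)" "h \<in> GL n" by blast
      then show "h \<in> S" using f_box[of g h] r[of g h] S GLc by blast
    qed
    ultimately show "\<exists>U. openin ?T U \<and> S = ?f -` U \<inter> GL n" by blast
  qed
qed

lemma locally_constant_GL:
  "locally_constant_on (GL_topology val n) f \<longleftrightarrow>
     (\<forall>g\<in>GL n. \<exists>r. \<forall>h\<in>GL n. h - g \<in> F.FM r n n \<longrightarrow> f h = f g)"
proof -
  have GLc: "g \<in> carrier_mat n n" if "g \<in> GL n" for g :: "'f mat" using that by (simp add: GL_def)
  have "openin (GL_topology val n) (GL n)" unfolding openin_GL_topology by auto
  then have top: "topspace (GL_topology val n) = GL n"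
    using openin_subset[of "GL_topology val n" "GL n"] openin_topspace[of "GL_topology val n"]
    unfolding openin_GL_topology by blast
  show ?thesis
    unfolding locally_constant_on_def top
  proof (intro ball_cong refl iffI)
    fix g assume g: "g \<in> GL n" and "\<exists>U. openin (GL_topology val n) U \<and> g \<in> U \<and> (\<forall>y\<in>U. f y = f g)"
    then show "\<exists>r. \<forall>h\<in>GL n. h - g \<in> F.FM r n n \<longrightarrow> f h = f g"
      unfolding openin_GL_topology by meson
  next
    fix g assume g: "g \<in> GL n" and "\<exists>r. \<forall>h\<in>GL n. h - g \<in> F.FM r n n \<longrightarrow> f h = f g"
    then obtain r where r: "\<And>h. h \<in> GL n \<Longrightarrow> h - g \<in> F.FM r n n \<Longrightarrow> f h = f g" by blast
    let ?U = "{h \<in> GL n. h - g \<in> F.FM r n n}"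
    have "openin (GL_topology val n) ?U"
      unfolding openin_GL_topology
    proof (intro conjI ballI exI impI)
      fix h k assume h: "h \<in> ?U" and k: "k \<in> GL n" "k - h \<in> F.FM r n n"
      have "(k - h) + (h - g) \<in> F.FM r n n" using h k by (intro F.FM_add) auto
      moreover have "(k - h) + (h - g) = k - g"
        using GLc[OF g] GLc[OF k(1)] GLc[of h] h by (intro eq_matI) auto
      ultimately show "k \<in> ?U" using k by simp
    qed auto
    moreover have "g \<in> ?U" using g GLc[OF g] by (simp add: F.FM_def pp_zero)
    ultimately show "\<exists>U. openin (GL_topology val n) U \<and> g \<in> U \<and> (\<forall>y\<in>U. f y = f g)"
      using r by (intro exI[of _ ?U] conjI ballI) blast+
  qed
qed

text \<open>Compactness of a finite product of copies of \<open>pp 0\<close>, stated for balls whose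
  radius \<rho> depends on the centre. This is the form needed to make local constancy
  uniform.\<close>

lemma compact_integral_matrices:
  fixes \<rho> :: "'f mat \<Rightarrow> int"
  shows "\<exists>T. finite T \<and> T \<subseteq> F.FM 0 n n \<and> (\<forall>A\<in>F.FM 0 n n. \<exists>B\<in>T. A - B \<in> F.FM (\<rho> B) n n)"
proof -
  let ?I = "{..<n} \<times> {..<n}"
  let ?T = "product_topology (\<lambda>_. field_topology val) ?I"
  let ?f = "\<lambda>g. \<lambda>ij\<in>?I. (g :: 'f mat) $$ ij"
  let ?box = "\<lambda>g. PiE ?I (\<lambda>ij. {y. y - (g :: 'f mat) $$ ij \<in> pp (\<rho> g)})"
  have f_box: "?f h \<in> ?box g \<longleftrightarrow> h - g \<in> F.FM (\<rho> g) n n"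
    if "g \<in> carrier_mat n n" "h \<in> carrier_mat n n" for g h
    using that by (auto simp: restrict_PiE_iff F.FM_def)
  have comp: "compactin ?T (PiE ?I (\<lambda>_. pp 0))"
    using compact_pp0 by (simp add: compactin_PiE)
  have op: "openin ?T U" if U: "U \<in> ?box ` F.FM 0 n n" for U
  proof -
    obtain g where g: "U = ?box g" using U by blast
    show ?thesis unfolding g by (subst openin_PiE_gen) (auto intro: openin_pp_ball)
  qed
  have "PiE ?I (\<lambda>_. pp 0) \<subseteq> \<Union>(?box ` F.FM 0 n n)"
  proof
    fix x assume x: "x \<in> PiE ?I (\<lambda>_. pp 0)"
    let ?g = "mat n n x"
    have "?g \<in> F.FM 0 n n" using x by (auto simp: F.FM_def PiE_iff)
    moreover have "x \<in> ?box ?g" using x by (auto simp: PiE_iff pp_zero)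
    ultimately show "x \<in> \<Union>(?box ` F.FM 0 n n)" by blast
  qed
  from compactinD[OF comp op this]
  obtain C where C: "finite C" "C \<subseteq> ?box ` F.FM 0 n n" "PiE ?I (\<lambda>_. pp 0) \<subseteq> \<Union>C"
    by blast
  then obtain T where T: "T \<subseteq> F.FM 0 n n" "finite T" "C = ?box ` T"
    using finite_subset_image[of C ?box "F.FM 0 n n"] by auto
  have "\<exists>B\<in>T. A - B \<in> F.FM (\<rho> B) n n" if A: "A \<in> F.FM 0 n n" for A
  proof -
    have "?f A \<in> PiE ?I (\<lambda>_. pp 0)" using A by (auto simp: restrict_PiE_iff F.FM_def)
    then have "?f A \<in> \<Union>(?box ` T)" using C(3) unfolding T(3) by (rule subsetD[rotated])
    then obtain B where B: "B \<in> T" "?f A \<in> ?box B" by (rule UN_E)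
    then have "A - B \<in> F.FM (\<rho> B) n n"
      using f_box[of B A] F.FM_carrier[OF A] F.FM_carrier[OF subsetD[OF T(1) B(1)]] by simp
    then show ?thesis using B(1) by (rule bexI)
  qed
  then show ?thesis using T by blast
qed

end

section \<open>Integral matrices and the Iwasawa decomposition\<close>

context nonarchimedean_local_field
begin

lemma GL_iff_det: "A \<in> carrier_mat n n \<Longrightarrow> A \<in> GL n \<longleftrightarrow> det (A :: 'f mat) \<noteq> 0"
proof
  assume A: "A \<in> carrier_mat n n" "A \<in> GL n"
  then obtain B where "B \<in> carrier_mat n n" "A * B = 1\<^sub>m n" by (auto simp: GL_eq gl_group_carrier)
  then have "det A * det B = 1" using A det_mult[of A n B] by simp
  then show "det A \<noteq> 0" by auto
next
  assume A: "A \<in> carrier_mat n n" "det A \<noteq> 0"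
  let ?B = "inverse (det A) \<cdot>\<^sub>m adj_mat A"
  have "inverse (det A) \<cdot>\<^sub>m (det A \<cdot>\<^sub>m 1\<^sub>m n) = 1\<^sub>m n" using A by (intro eq_matI) auto
  then have "A * ?B = 1\<^sub>m n" "?B * A = 1\<^sub>m n"
    using adj_mat[OF A(1)] A by (simp_all add: mult_smult_distrib mult_smult_assoc_mat)
  then show "A \<in> GL n"
    unfolding GL_eq using gl_groupI(1)[of A n ?B] A adj_mat(1)[OF A(1)] by simp
qed

lemma GL_carrier: "A \<in> GL n \<Longrightarrow> A \<in> carrier_mat n n"
  by (simp add: GL_def)

lemma GL_mult: "A \<in> GL n \<Longrightarrow> B \<in> GL n \<Longrightarrow> A * B \<in> GL (n :: nat)" for A B :: "'f mat"
  using group.subgroup_self[OF group_gl_group] group.is_monoid[OF group_gl_group[of n]]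
    monoid.m_closed[of "gl_group n" A B] by (simp add: GL_eq)

lemma GL_one: "1\<^sub>m n \<in> (GL n :: 'f mat set)"
  by (simp add: GL_iff_det)

lemma GL_det_mult: "A \<in> GL n \<Longrightarrow> B \<in> GL n \<Longrightarrow> det (A * B) = det A * det (B :: 'f mat)"
  using det_mult[OF GL_carrier GL_carrier] .

text \<open>The determinants of A and of its inverse are integral and their valuations add up to
  zero, so both vanish.\<close>

lemma GL0_iff: "A \<in> F.GL0 n \<longleftrightarrow> A \<in> F.FM 0 n n \<and> det A \<noteq> 0 \<and> val (det A) = 0"
proof
  assume A: "A \<in> F.GL0 n"
  then have A': "A \<in> carrier (gl_group n)" "A \<in> F.FM 0 n n" "inv\<^bsub>gl_group n\<^esub> A \<in> F.FM 0 n n"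
    by (auto simp: F.GL0_def)
  then have "det A * det (inv\<^bsub>gl_group n\<^esub> A) = 1"
    using gl_group_inv[OF A'(1)] det_mult[of A n "inv\<^bsub>gl_group n\<^esub> A"] F.FM_carrier by auto
  moreover from this have nz: "det A \<noteq> 0" "det (inv\<^bsub>gl_group n\<^esub> A) \<noteq> 0" by auto
  ultimately have "val (det A) + val (det (inv\<^bsub>gl_group n\<^esub> A)) = 0"
    using val_mult[OF nz] by (simp add: val_one)
  moreover have "det A \<in> pp 0" "det (inv\<^bsub>gl_group n\<^esub> A) \<in> pp 0" using A' F.det_filt by auto
  ultimately show "A \<in> F.FM 0 n n \<and> det A \<noteq> 0 \<and> val (det A) = 0" using A' nz by (auto simp: pp_def)
next
  assume A: "A \<in> F.FM 0 n n \<and> det A \<noteq> 0 \<and> val (det A) = 0"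
  then show "A \<in> F.GL0 n"
    using F.gl_of_unit_det[of A n "inverse (det A)"] by (simp add: F.GL0_def pp_def val_inverse)
qed

lemma GL0_GL: "A \<in> F.GL0 n \<Longrightarrow> A \<in> GL n"
  by (simp add: F.GL0_def GL_eq)

lemma GL0_mult: "A \<in> F.GL0 n \<Longrightarrow> B \<in> F.GL0 n \<Longrightarrow> A * B \<in> F.GL0 n"
  using subgroup.m_closed[OF F.subgroup_GL0[of n]] by simp

lemma GL0_one: "1\<^sub>m n \<in> F.GL0 n"
  using subgroup.one_closed[OF F.subgroup_GL0[of n]] by simp

lemma GL0_inverse:
  assumes "A \<in> F.GL0 n"
  obtains B where "B \<in> F.GL0 n" "A * B = 1\<^sub>m n" "B * A = 1\<^sub>m n"
  using assms subgroup.m_inv_closed[OF F.subgroup_GL0 assms] gl_group_inv[of A n]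
  by (auto simp: F.GL0_def)

lemma GL_inverse:
  assumes "(A :: 'f mat) \<in> GL n"
  obtains B where "B \<in> GL n" "A * B = 1\<^sub>m n" "B * A = 1\<^sub>m n"
proof -
  have "A \<in> carrier (gl_group n)" using assms by (simp add: GL_eq)
  then show ?thesis
    using gl_group_inv[of A n] group.inv_closed[OF group_gl_group] by (intro that) (auto simp: GL_eq)
qed

lemma four_block_GL0:
  assumes A: "A \<in> F.GL0 n1" and B: "B \<in> F.FM 0 n1 n2" and D: "D \<in> F.GL0 n2"
  shows "four_block_mat A B (0\<^sub>m n2 n1) D \<in> F.GL0 (n1 + n2)"
proof -
  have A': "A \<in> F.FM 0 n1 n1" and D': "D \<in> F.FM 0 n2 n2" using A D by (auto simp: GL0_iff)
  have "det (four_block_mat A B (0\<^sub>m n2 n1) D) = det A * det D"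
    using F.FM_carrier A' B D' by (intro det_four_block_mat_lower_left_zero) auto
  then show ?thesis
    using F.FM_four_block[OF A' B F.FM_zero D'] A D by (simp add: GL0_iff val_mult)
qed

lemma four_block_GL:
  assumes A: "A \<in> GL n1" and B: "(B :: 'f mat) \<in> carrier_mat n1 n2" and D: "D \<in> GL n2"
  shows "four_block_mat A B (0\<^sub>m n2 n1) D \<in> GL (n1 + n2)"
    and "det (four_block_mat A B (0\<^sub>m n2 n1) D) = det A * det D"
proof -
  note c = GL_carrier[OF A] GL_carrier[OF D]
  show d: "det (four_block_mat A B (0\<^sub>m n2 n1) D) = det A * det D"
    using c B by (intro det_four_block_mat_lower_left_zero) auto
  show "four_block_mat A B (0\<^sub>m n2 n1) D \<in> GL (n1 + n2)"
    using A D c d by (subst GL_iff_det) (auto simp: GL_iff_det)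
qed

lemma swaprows_GL0:
  assumes "k < n" "l < n"
  shows "swaprows_mat n k l \<in> F.GL0 n"
proof -
  let ?P = "swaprows_mat n k l :: 'f mat"
  have P: "?P \<in> F.FM 0 n n"
    by (auto simp: F.FM_def pp_def val_one)
  have i: "?P * ?P = 1\<^sub>m n" using assms by (rule swaprows_mat_inv)
  show ?thesis
    using gl_groupI[OF F.FM_carrier[OF P] F.FM_carrier[OF P] i i] P by (simp add: F.GL0_def)
qed

text \<open>The pivot is an entry of least valuation in the last row. Dividing by it keeps the
  multipliers integral, so the column operations stay inside \<open>F.GL0\<close>.\<close>

lemma clear_last_row:
  assumes g: "g \<in> GL (n + 1)"
  shows "\<exists>k\<in>F.GL0 (n + 1). \<exists>g' c d. g' \<in> GL n \<and> c \<in> carrier_mat n 1 \<and> d \<noteq> 0 \<and>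
      g * k = four_block_mat g' c (0\<^sub>m 1 n) (mat 1 1 (\<lambda>_. d))"
proof -
  have gc: "g \<in> carrier_mat (n + 1) (n + 1)" using g by (rule GL_carrier)
  obtain h where h: "h \<in> GL (n + 1)" "g * h = 1\<^sub>m (n + 1)" using GL_inverse[OF g] by blast
  define J where "J = {j. j < n + 1 \<and> g $$ (n, j) \<noteq> 0}"
  have "J \<noteq> {}"
  proof
    assume "J = {}"
    then have "(g * h) $$ (n, n) = 0"
      using mult_mat_entry[OF gc GL_carrier[OF h(1)], of n n] by (simp add: J_def)
    then show False using h(2) by simp
  qed
  moreover have fin: "finite J" by (simp add: J_def)
  ultimately obtain j0 where j0: "j0 \<in> J" "\<And>j. j \<in> J \<Longrightarrow> val (g $$ (n, j0)) \<le> val (g $$ (n, j))"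
    using arg_min_if_finite[of J "\<lambda>j. val (g $$ (n, j))"] by (metis not_le)
  have j0': "j0 < n + 1" "g $$ (n, j0) \<noteq> 0" using j0(1) by (auto simp: J_def)
  define P where "P = (swaprows_mat (n + 1) j0 n :: 'f mat)"
  have P: "P \<in> F.GL0 (n + 1)" unfolding P_def using j0' by (intro swaprows_GL0) auto
  define v where "v = g * P"
  have v: "v = swapcols j0 n g" unfolding v_def P_def using gc j0' by (subst swapcols_mat[OF gc]) auto
  have vc: "v \<in> carrier_mat (n + 1) (n + 1)" using gc by (simp add: v)
  define d where "d = v $$ (n, n)"
  have d: "d = g $$ (n, j0)" using gc j0' by (simp add: d_def v)
  have vn: "v $$ (n, j) = 0 \<or> val d \<le> val (v $$ (n, j))" if "j < n + 1" for j
    using j0 gc that unfolding d by (auto simp: v J_def)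
  \<comment> \<open>The multipliers of the elimination; minimality of the valuation of d puts them
    in \<open>pp 0\<close>.\<close>
  define u where "u = mat 1 n (\<lambda>(_, j). - (v $$ (n, j) / d))"
  have u: "u \<in> F.FM 0 1 n"
  proof -
    have dz: "d \<noteq> 0" using d j0' by simp
    have "v $$ (n, j) / d \<in> pp 0" if "j < n" for j
      using vn[of j] that dz
      by (cases "v $$ (n, j) = 0") (simp_all add: pp_def divide_inverse val_mult val_inverse)
    then show ?thesis by (auto simp: F.FM_def u_def intro: pp_uminus)
  qed
  define k2 where "k2 = four_block_mat (1\<^sub>m n) (0\<^sub>m n 1) u (1\<^sub>m 1)"
  have k2: "k2 \<in> F.GL0 (n + 1)"
  proof -
    have uc: "u \<in> carrier_mat 1 n" using u by (rule F.FM_carrier)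
    have "det k2 = det (1\<^sub>m n :: 'f mat) * det (1\<^sub>m 1 :: 'f mat)"
      unfolding k2_def by (intro det_four_block_mat_upper_right_zero) (use uc in auto)
    moreover have "k2 \<in> F.FM 0 (n + 1) (n + 1)"
      unfolding k2_def by (intro F.FM_four_block F.FM_one F.FM_zero u)
    ultimately show ?thesis by (simp add: GL0_iff val_one)
  qed
  obtain A B C D where sp: "split_block v n n = (A, B, C, D)" by (metis prod_cases4)
  note spl = split_block[OF sp, of 1 1]
  have dims: "A \<in> carrier_mat n n" "B \<in> carrier_mat n 1" "C \<in> carrier_mat 1 n" "D \<in> carrier_mat 1 1"
    and veq: "v = four_block_mat A B C D" using spl vc by auto
  have C: "C $$ (0, j) = v $$ (n, j)" if "j < n" for j using that dims unfolding veq by simp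
  have D: "D $$ (0, 0) = d" using dims unfolding d_def veq by simp
  have uc: "u \<in> carrier_mat 1 n" using u by (rule F.FM_carrier)
  have "v * k2 = four_block_mat (A * 1\<^sub>m n + B * u) (A * 0\<^sub>m n 1 + B * 1\<^sub>m 1) (C * 1\<^sub>m n + D * u) (C * 0\<^sub>m n 1 + D * 1\<^sub>m 1)"
    unfolding veq k2_def using dims uc by (intro mult_four_block_mat) auto
  moreover have "C * 1\<^sub>m n + D * u = 0\<^sub>m 1 n"
  proof (rule eq_matI)
    fix i j assume "i < dim_row (0\<^sub>m 1 n)" "j < dim_col (0\<^sub>m 1 n)"
    then have ij: "i = 0" "j < n" by auto
    have "(D * u) $$ (0, j) = D $$ (0, 0) * u $$ (0, j)"
      using mult_mat_entry[OF dims(4) uc, of 0 j] ij by simp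
    also have "\<dots> = - v $$ (n, j)" using ij j0' d by (simp add: D u_def)
    finally show "(C * 1\<^sub>m n + D * u) $$ (i, j) = 0\<^sub>m 1 n $$ (i, j)"
      using ij dims uc C by simp
  qed (use dims uc in auto)
  moreover have "C * 0\<^sub>m n 1 + D * 1\<^sub>m 1 = mat 1 1 (\<lambda>_. d)"
    using dims D by (intro eq_matI) auto
  moreover have "A * 0\<^sub>m n 1 + B * 1\<^sub>m 1 = B" using dims by simp
  ultimately have eq: "v * k2 = four_block_mat (A * 1\<^sub>m n + B * u) B (0\<^sub>m 1 n) (mat 1 1 (\<lambda>_. d))" by simp
  have g': "A * 1\<^sub>m n + B * u \<in> carrier_mat n n" using dims uc by simp
  have k: "P * k2 \<in> F.GL0 (n + 1)" using P k2 by (rule GL0_mult)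
  have vk: "v * k2 = g * (P * k2)"
    unfolding v_def using gc GL_carrier[OF GL0_GL[OF P]] GL_carrier[OF GL0_GL[OF k2]] by simp
  have "v * k2 \<in> GL (n + 1)" unfolding vk using g GL0_GL[OF k] by (rule GL_mult)
  then have "det (v * k2) \<noteq> 0" using GL_carrier GL_iff_det by blast
  moreover have "det (v * k2) = det (A * 1\<^sub>m n + B * u) * det (mat 1 1 (\<lambda>_. d))"
    unfolding eq using g' dims by (intro det_four_block_mat_lower_left_zero) auto
  ultimately have "A * 1\<^sub>m n + B * u \<in> GL n" using GL_iff_det[OF g'] by auto
  then show ?thesis
    using k eq vk dims j0' d by (intro bexI[of _ "P * k2"] exI conjI) auto
qed

text \<open>Induction on the size: once the last row is cleared, the upper left block is factored,
  and its integral factor is extended by a 1 in the last place.\<close>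

lemma iwasawa:
  "g \<in> GL n \<Longrightarrow> \<exists>b k. b \<in> GL n \<and> upper_triangular b \<and> k \<in> F.GL0 n \<and> g = b * k"
proof (induction n arbitrary: g)
  case 0
  then show ?case
    using GL0_one[of 0] GL_carrier[OF 0] by (intro exI[of _ g] exI[of _ "1\<^sub>m 0"]) auto
next
  case (Suc n)
  then have g: "g \<in> GL (n + 1)" by simp
  obtain k g' c d where k: "k \<in> F.GL0 (n + 1)" and g': "g' \<in> GL n" and c: "c \<in> carrier_mat n 1"
    and d: "d \<noteq> 0" and gk: "g * k = four_block_mat g' c (0\<^sub>m 1 n) (mat 1 1 (\<lambda>_. d))"
    using clear_last_row[OF g] by blast
  obtain b' k' where b': "b' \<in> GL n" "upper_triangular b'" and k': "k' \<in> F.GL0 n" "g' = b' * k'"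
    using Suc.IH[OF g'] by blast
  obtain ki where ki: "ki \<in> F.GL0 (n + 1)" "k * ki = 1\<^sub>m (n + 1)" using GL0_inverse[OF k] by blast
  let ?D = "mat 1 1 (\<lambda>_. d)"
  let ?b = "four_block_mat b' c (0\<^sub>m 1 n) ?D"
  let ?k = "four_block_mat k' (0\<^sub>m n 1) (0\<^sub>m 1 n) (1\<^sub>m 1)"
  have D: "?D \<in> GL 1" using d by (subst GL_iff_det) (auto simp: det_single)
  have cc: "b' \<in> carrier_mat n n" "k' \<in> carrier_mat n n" using b' k' GL_carrier GL0_GL by auto
  have bk: "?b * ?k = g * k"
    unfolding gk k'(2) using cc c by (subst mult_four_block_mat[OF cc(1) c _ _ cc(2)]) auto
  have b: "?b \<in> GL (n + 1)" using b' c D by (intro four_block_GL)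
  have kk: "?k \<in> F.GL0 (n + 1)" using k' by (intro four_block_GL0 GL0_one F.FM_zero)
  have "upper_triangular ?b"
    using b' cc by (intro upper_triangular_four_block[of _ n _ 1]) (auto simp: upper_triangular_def)
  moreover have "g = ?b * (?k * ki)"
  proof -
    note m = GL_carrier[OF g] GL_carrier[OF b] GL_carrier[OF GL0_GL[OF kk]] GL_carrier[OF GL0_GL[OF ki(1)]]
      GL_carrier[OF GL0_GL[OF k]]
    have "?b * (?k * ki) = ?b * ?k * ki" by (rule assoc_mult_mat[symmetric, OF m(2-4)])
    also have "\<dots> = g * (k * ki)" unfolding bk by (rule assoc_mult_mat[OF m(1,5,4)])
    also have "\<dots> = g" unfolding ki(2) using m(1) by simp
    finally show ?thesis by simp
  qed
  moreover have "?k * ki \<in> F.GL0 (n + 1)" using kk ki by (intro GL0_mult)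
  ultimately show ?case using b by (intro exI[of _ ?b] exI[of _ "?k * ki"]) simp
qed

lemma iwasawa_block:
  assumes g: "g \<in> GL (n1 + n2)"
  obtains a b d k where "a \<in> GL n1" "b \<in> carrier_mat n1 n2" "d \<in> GL n2" "k \<in> F.GL0 (n1 + n2)"
    "g = four_block_mat a b (0\<^sub>m n2 n1) d * k"
proof -
  obtain u k where u: "u \<in> GL (n1 + n2)" "upper_triangular u" and k: "k \<in> F.GL0 (n1 + n2)" "g = u * k"
    using iwasawa[OF g] by blast
  obtain a b c d where sp: "split_block u n1 n1 = (a, b, c, d)" by (metis prod_cases4)
  note uc = GL_carrier[OF u(1)]
  have dims: "a \<in> carrier_mat n1 n1" "b \<in> carrier_mat n1 n2" "c \<in> carrier_mat n2 n1" "d \<in> carrier_mat n2 n2"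
    and ueq: "u = four_block_mat a b c d" using split_block[OF sp, of n2 n2] uc by auto
  have "c $$ (i, j) = 0" if "i < n2" "j < n1" for i j
  proof -
    have "u $$ (i + n1, j) = 0" using u(2) uc that by (intro upper_triangularD) auto
    then show ?thesis using that dims unfolding ueq by simp
  qed
  then have c: "c = 0\<^sub>m n2 n1" using dims by (intro eq_matI) auto
  have "det u = det a * det d" unfolding ueq c using dims by (intro det_four_block_mat_lower_left_zero) auto
  moreover have "det u \<noteq> 0" using u(1) uc GL_iff_det by blast
  ultimately have "a \<in> GL n1" "d \<in> GL n2" using dims by (auto simp: GL_iff_det)
  then show ?thesis using that k dims unfolding ueq c by blast
qed

section \<open>Characters of the general linear group trivial on integral matrices\<close>

lemma unramified_power:
  assumes mult: "\<And>x y. x \<noteq> 0 \<Longrightarrow> y \<noteq> 0 \<Longrightarrow> \<psi> (x * y) = \<psi> x * (\<psi> y :: real)"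
    and unit: "\<And>x. x \<noteq> 0 \<Longrightarrow> val x = 0 \<Longrightarrow> \<psi> x = 1" and x: "x \<noteq> 0"
  shows "\<psi> x = \<psi> unif powi (val x)"
proof -
  have pow: "\<psi> (unif ^ k) = \<psi> unif ^ k" for k
    by (induction k) (use unit[of 1] mult unif in \<open>auto simp: val_one\<close>)
  have inv: "\<psi> (inverse y) = inverse (\<psi> y)" if "y \<noteq> 0" for y
    using mult[of y "inverse y"] unit[of 1] that by (simp add: val_one inverse_unique)
  have powi: "\<psi> (unif powi k) = \<psi> unif powi k" for k
    using pow inv[of "unif ^ nat (- k)"] unif by (auto simp: power_int_def power_inverse)
  have "x = (x * inverse (unif powi val x)) * unif powi val x" using unif_powi(1)[of "val x"] by simp
  then have "\<psi> x = \<psi> (x * inverse (unif powi val x) * unif powi val x)" by (rule arg_cong)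
  also have "\<dots> = \<psi> (x * inverse (unif powi val x)) * \<psi> (unif powi val x)"
    by (rule mult) (use x unif_powi in auto)
  also have "\<psi> (x * inverse (unif powi val x)) = 1"
    using x unif_powi by (intro unit) (auto simp: val_mult val_inverse)
  finally show ?thesis using powi by simp
qed

text \<open>By \<open>clear_last_row\<close> every g is, up to an integral factor, a unipotent times
  a block diagonal matrix. Unipotents contribute nothing, the large block is handled by induction
  and the last entry by \<open>unramified_power\<close>; a permutation matrix shows that the two
  constants agree.\<close>

lemma unramified_character:
  fixes \<omega> :: "'f mat \<Rightarrow> real"
  assumes "\<And>g h. g \<in> GL n \<Longrightarrow> h \<in> GL n \<Longrightarrow> \<omega> (g * h) = \<omega> g * \<omega> h"
    and "\<And>g. g \<in> GL n \<Longrightarrow> \<omega> g > 0" and "\<And>k. k \<in> F.GL0 n \<Longrightarrow> \<omega> k = 1"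
  shows "\<exists>a>0. \<forall>g\<in>GL n. \<omega> g = a powi val (det g)"
  using assms
proof (induction n arbitrary: \<omega>)
  case 0
  have "g \<in> F.GL0 0" if "g \<in> GL 0" for g
    using GL_carrier[OF that] by (simp add: GL0_iff F.FM_def val_one)
  then show ?case using 0(3) GL_carrier by (intro exI[of _ 1]) auto
next
  case (Suc n)
  have mult: "\<omega> (g * h) = \<omega> g * \<omega> h" if "g \<in> GL (n + 1)" "h \<in> GL (n + 1)" for g h using Suc.prems(1) that by simp
  have pos: "\<omega> g > 0" if "g \<in> GL (n + 1)" for g using Suc.prems(2) that by simp
  have triv: "\<omega> k = 1" if "k \<in> F.GL0 (n + 1)" for k using Suc.prems(3) that by simp
  let ?S = "\<lambda>x::'f. mat 1 1 (\<lambda>_. x)"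
  have S: "?S x \<in> GL 1" if "x \<noteq> 0" for x using that by (subst GL_iff_det) (auto simp: det_single)
  have Smult: "?S x * ?S y = ?S (x * y)" for x y by (intro eq_matI) (auto simp: scalar_prod_def)
  have Sdet: "det (?S x) = x" for x by (simp add: det_single)
  define blk where "blk g x = four_block_mat g (0\<^sub>m n 1) (0\<^sub>m 1 n) (?S x)" for g x
  have blk: "blk g x \<in> GL (n + 1)" if "g \<in> GL n" "x \<noteq> 0" for g x
    unfolding blk_def using that S by (intro four_block_GL) auto
  have blk_mult: "blk g x * blk h y = blk (g * h) (x * y)" if "g \<in> GL n" "h \<in> GL n" for g h x y
    unfolding blk_def using GL_carrier[OF that(1)] GL_carrier[OF that(2)] Smult
    by (subst mult_four_block_mat[of _ n n _ 1 _ 1 _ _ n _ 1]) auto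
  have S0: "?S x \<in> F.GL0 1" if "x \<noteq> 0" "val x = 0" for x
    using that unfolding GL0_iff Sdet by (auto simp: F.FM_def pp_def)
  have blk0: "blk g x \<in> F.GL0 (n + 1)" if "g \<in> F.GL0 n" "x \<noteq> 0" "val x = 0" for g x
    unfolding blk_def using that S0 by (intro four_block_GL0 F.FM_zero) auto
  obtain a where a: "a > 0" "\<And>g. g \<in> GL n \<Longrightarrow> \<omega> (blk g 1) = a powi val (det g)"
  proof -
    have "\<exists>a>0. \<forall>g\<in>GL n. \<omega> (blk g 1) = a powi val (det g)"
    proof (rule Suc.IH)
      fix g h :: "'f mat" assume "g \<in> GL n" "h \<in> GL n"
      then show "\<omega> (blk (g * h) 1) = \<omega> (blk g 1) * \<omega> (blk h 1)"
        using blk_mult[of g h 1 1] mult blk by (metis mult_1 zero_neq_one)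
    next
      fix g :: "'f mat" assume "g \<in> GL n" then show "\<omega> (blk g 1) > 0" using pos blk by simp
    next
      fix g assume "g \<in> F.GL0 n" then show "\<omega> (blk g 1) = 1" using triv blk0 by (simp add: val_one)
    qed
    then show ?thesis using that by blast
  qed
  define b where "b = \<omega> (blk (1\<^sub>m n) unif)"
  have b0: "b > 0" unfolding b_def using pos blk GL_one unif by blast
  have b: "\<omega> (blk (1\<^sub>m n) x) = b powi val x" if "x \<noteq> 0" for x
    unfolding b_def
  proof (rule unramified_power)
    fix x y :: 'f assume "x \<noteq> 0" "y \<noteq> 0"
    then show "\<omega> (blk (1\<^sub>m n) (x * y)) = \<omega> (blk (1\<^sub>m n) x) * \<omega> (blk (1\<^sub>m n) y)"
      using blk_mult[OF GL_one GL_one, of x y] mult[OF blk[OF GL_one] blk[OF GL_one], of x y] by simp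
  qed (use that triv blk0 GL0_one in auto)
  \<comment> \<open>Conjugation by a diagonal matrix with a large power of the uniformiser makes y
    integral, and a character with nonzero real values does not notice conjugation.\<close>
  have unip: "\<omega> (four_block_mat (1\<^sub>m n) y (0\<^sub>m 1 n) (1\<^sub>m 1)) = 1" if y: "y \<in> carrier_mat n 1" for y
  proof -
    obtain r where r: "y \<in> F.FM r n 1" using F.FM_exhaust[OF y] by blast
    define t where "t = unif powi (- r)"
    have t: "t \<noteq> 0" "val t = - r" unfolding t_def using unif_powi by auto
    let ?u = "\<lambda>y. four_block_mat (1\<^sub>m n) y (0\<^sub>m 1 n) (1\<^sub>m 1)"
    let ?t = "four_block_mat (t \<cdot>\<^sub>m 1\<^sub>m n) (0\<^sub>m n 1) (0\<^sub>m 1 n) (1\<^sub>m 1)"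
    have tG: "?t \<in> GL (n + 1)"
      using t by (intro four_block_GL GL_one) (auto simp: GL_iff_det)
    have ty: "t \<cdot>\<^sub>m y \<in> F.FM 0 n 1"
      using r pp_mult[of t "- r" _ r] t by (auto simp: F.FM_def pp_def[of "- r"])
    have "t \<cdot>\<^sub>m 1\<^sub>m n * y = t \<cdot>\<^sub>m y" using mult_smult_assoc_mat[of "1\<^sub>m n" n n y 1 t] y by simp
    then have "?t * ?u y = four_block_mat (t \<cdot>\<^sub>m 1\<^sub>m n) (t \<cdot>\<^sub>m y) (0\<^sub>m 1 n) (1\<^sub>m 1)"
      using y by (subst mult_four_block_mat[of _ n n _ 1 _ 1 _ _ n _ 1]) auto
    also have "\<dots> = ?u (t \<cdot>\<^sub>m y) * ?t"
      using y by (subst mult_four_block_mat[of _ n n _ 1 _ 1 _ _ n _ 1]) auto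
    finally have eq: "?t * ?u y = ?u (t \<cdot>\<^sub>m y) * ?t" .
    have uG: "?u y \<in> GL (n + 1)" "?u (t \<cdot>\<^sub>m y) \<in> GL (n + 1)" using y by (intro four_block_GL GL_one; simp)+
    have "\<omega> (?u (t \<cdot>\<^sub>m y)) = 1" using ty by (intro triv four_block_GL0 GL0_one)
    then have "\<omega> ?t * \<omega> (?u y) = \<omega> ?t"
      using mult[OF tG uG(1)] mult[OF uG(2) tG] eq by simp
    then show ?thesis using pos[OF tG] by simp
  qed
  have step: "\<omega> g = a powi val (det h) * b powi val d \<and> val (det g) = val (det h) + val d"
    if "g \<in> GL (n + 1)" "k \<in> F.GL0 (n + 1)" "h \<in> GL n" "c \<in> carrier_mat n 1" "d \<noteq> 0"
      "g * k = four_block_mat h c (0\<^sub>m 1 n) (?S d)" for g k h c d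
  proof -
    note kG = GL0_GL[OF that(2)] and hc = GL_carrier[OF that(3)]
    let ?y = "inverse d \<cdot>\<^sub>m c"
    let ?U = "four_block_mat (1\<^sub>m n) ?y (0\<^sub>m 1 n) (1\<^sub>m 1)"
    have UG: "?U \<in> GL (n + 1)" using that by (intro four_block_GL GL_one) auto
    have "?y * ?S d = c" using that(4,5) by (intro eq_matI) (auto simp: scalar_prod_def)
    then have "?U * blk h d = g * k"
      unfolding that(6) blk_def using hc that(4) by (subst mult_four_block_mat[of _ n n _ 1 _ 1 _ _ n _ 1]) auto
    then have "\<omega> (g * k) = \<omega> (blk h d)"
      using mult[OF UG blk[OF that(3,5)]] unip[of ?y] that(4) by simp
    also have "blk h d = blk h 1 * blk (1\<^sub>m n) d"
      using blk_mult[OF that(3) GL_one, of 1 d] hc by simp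
    also have "\<omega> \<dots> = a powi val (det h) * b powi val d"
      using mult[OF blk[OF that(3)] blk[OF GL_one that(5)], of 1] a(2)[OF that(3)] b[OF that(5)] by simp
    finally have 1: "\<omega> g = a powi val (det h) * b powi val d"
      using mult[OF that(1) kG] triv[OF that(2)] by simp
    have "det (g * k) = det h * d"
      unfolding that(6) using hc that(4) Sdet by (subst det_four_block_mat_lower_left_zero) auto
    moreover have "det (g * k) = det g * det k" using GL_det_mult that(1) kG by blast
    moreover have "det g \<noteq> 0" "det h \<noteq> 0" "det k \<noteq> 0"
      using that(1,3) kG GL_carrier GL_iff_det by blast+
    ultimately have "val (det g) + val (det k) = val (det h) + val d"
      using val_mult that(5) by metis
    then show ?thesis using 1 that(2) by (simp add: GL0_iff)
  qed
  \<comment> \<open>For n = 0 the constant a is unrelated to \<omega>, so the exponent of a must be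
    recorded as zero in that case.\<close>
  have step': "\<exists>i j. \<omega> g = a powi i * b powi j \<and> val (det g) = i + j \<and> (n = 0 \<longrightarrow> i = 0)" if g: "g \<in> GL (n + 1)" for g
  proof -
    obtain k h c d where k: "k \<in> F.GL0 (n + 1)" and h: "h \<in> GL n" and "c \<in> carrier_mat n 1"
      "d \<noteq> 0" "g * k = four_block_mat h c (0\<^sub>m 1 n) (?S d)"
      using clear_last_row[OF g] by blast
    from step[OF g this] have "\<omega> g = a powi val (det h) * b powi val d" "val (det g) = val (det h) + val d"
      by auto
    moreover have "n = 0 \<longrightarrow> val (det h) = 0" using GL_carrier[OF h] by (auto simp: val_one)
    ultimately show ?thesis by blast
  qed
  show ?case
  proof (cases "n = 0")
    case True
    have "\<omega> g = b powi val (det g)" if g: "g \<in> GL (Suc n)" for g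
    proof -
      obtain i j where "\<omega> g = a powi i * b powi j" "val (det g) = i + j" "n = 0 \<longrightarrow> i = 0"
        using step'[of g] g by auto
      then show ?thesis using True by simp
    qed
    then show ?thesis using b0 by blast
  next
    case False
    \<comment> \<open>The uniformiser in the first and in the last diagonal place are exchanged by
      an integral permutation, on which \<omega> is one.\<close>
    have "a = b"
    proof -
      let ?E = "\<lambda>m i. multrow_mat m i unif"
      let ?W = "swaprows_mat (n + 1) 0 n :: 'f mat"
      have E: "?E m i \<in> GL m" "det (?E m i) = unif" if "i < m" for i m
        using that unif det_multrow_mat[of i m unif] by (auto simp: GL_iff_det)
      have e1: "blk (?E n 0) 1 = ?E (n + 1) 0"
        unfolding blk_def using False by (intro eq_matI) (auto simp: multrow_mat_def)
      have e2: "blk (1\<^sub>m n) unif = ?E (n + 1) n"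
        unfolding blk_def by (intro eq_matI) (auto simp: multrow_mat_def)
      have W: "?W \<in> F.GL0 (n + 1)" by (rule swaprows_GL0) auto
      have "?W * ?E (n + 1) 0 = ?E (n + 1) n * ?W"
      proof (rule eq_matI)
        fix i j assume ij: "i < dim_row (?E (n + 1) n * ?W)" "j < dim_col (?E (n + 1) n * ?W)"
        then have ij': "i < n + 1" "j < n + 1" by auto
        have "(?W * ?E (n + 1) 0) $$ (i, j) = mat_swaprows 0 n (?E (n + 1) 0) $$ (i, j)"
          by (subst swaprows_mat[of _ "n + 1" "n + 1"]) auto
        moreover have "(?E (n + 1) n * ?W) $$ (i, j) = swapcols 0 n (?E (n + 1) n) $$ (i, j)"
          by (subst swapcols_mat[of _ "n + 1" "n + 1"]) auto
        ultimately show "(?W * ?E (n + 1) 0) $$ (i, j) = (?E (n + 1) n * ?W) $$ (i, j)"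
          using ij' False by (auto simp: multrow_mat_def)
      qed auto
      then have "\<omega> (?E (n + 1) 0) = \<omega> (?E (n + 1) n)"
        using mult[OF GL0_GL[OF W] E(1)[of 0 "n + 1"]] mult[OF E(1)[of n "n + 1"] GL0_GL[OF W]] triv[OF W] by simp
      then have "\<omega> (blk (?E n 0) 1) = b" unfolding e1[symmetric] b_def e2 .
      moreover have "\<omega> (blk (?E n 0) 1) = a"
        using a(2)[OF E(1)[of 0 n]] E(2)[of 0 n] False unif by simp
      ultimately show ?thesis by simp
    qed
    then have "\<omega> g = a powi val (det g)" if g: "g \<in> GL (Suc n)" for g
    proof -
      obtain i j where "\<omega> g = a powi i * b powi j" "val (det g) = i + j"
        using step'[of g] g by auto
      then show ?thesis using \<open>a = b\<close> a(1) by (simp add: power_int_add)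
    qed
    then show ?thesis using a(1) by blast
  qed
qed

section \<open>Uniform local constancy\<close>

text \<open>A finite subcover by balls of local constancy yields a common level R: k and k h with h
  of level R fall into the same ball.\<close>

lemma uniform_on_GL0:
  assumes f: "locally_constant_on (GL_topology val n) f"
  shows "\<exists>r\<ge>1. \<forall>k\<in>F.GL0 n. \<forall>h\<in>F.congruence r n. f (k * h) = f k"
proof -
  have "\<exists>r\<ge>1. \<forall>h\<in>GL n. h - g \<in> F.FM r n n \<longrightarrow> f h = f g" if g: "g \<in> GL n" for g
  proof -
    obtain r where "\<forall>h\<in>GL n. h - g \<in> F.FM r n n \<longrightarrow> f h = f g"
      using f g unfolding locally_constant_GL by blast
    moreover have "h - g \<in> F.FM r n n" if "h - g \<in> F.FM (max 1 r) n n" for h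
      using that by (rule F.FM_mono) simp
    ultimately show ?thesis by (intro exI[of _ "max 1 r"]) auto
  qed
  then obtain \<rho> where \<rho>: "\<And>g. g \<in> GL n \<Longrightarrow> \<rho> g \<ge> 1"
    "\<And>g h. g \<in> GL n \<Longrightarrow> h \<in> GL n \<Longrightarrow> h - g \<in> F.FM (\<rho> g) n n \<Longrightarrow> f h = f g" by metis
  \<comment> \<open>Compactness is available for all integral matrices, not for \<open>F.GL0\<close>
    alone. Other centres get radius 1; their balls miss \<open>F.GL0\<close>, since a determinant
    congruent to a nonunit is a nonunit.\<close>
  define \<rho>' where "\<rho>' A = (if A \<in> F.GL0 n then \<rho> A else 1)" for A
  obtain T where T: "finite T" "T \<subseteq> F.FM 0 n n" "\<And>A. A \<in> F.FM 0 n n \<Longrightarrow> \<exists>B\<in>T. A - B \<in> F.FM (\<rho>' B) n n"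
    using compact_integral_matrices[of n \<rho>'] by blast
  define R where "R = Max (insert 1 (\<rho>' ` T))"
  have R: "\<rho>' B \<le> R" if "B \<in> T" for B unfolding R_def using T(1) that by (intro Max_ge) auto
  have R1: "1 \<le> R" unfolding R_def using T(1) by (intro Max_ge) auto
  have "f (k * h) = f k" if k: "k \<in> F.GL0 n" and h: "h \<in> F.congruence R n" for k h
  proof -
    have k0: "k \<in> F.FM 0 n n" using k by (simp add: GL0_iff)
    obtain B where B: "B \<in> T" "k - B \<in> F.FM (\<rho>' B) n n" using T(3)[OF k0] by blast
    have B0: "B \<in> F.FM 0 n n" using B T by blast
    have BG: "B \<in> F.GL0 n"
    proof (rule ccontr)
      assume nB: "B \<notin> F.GL0 n"
      then have "det k - det B \<in> pp 1"
        using F.det_cong_filt[OF k0 B0, of 1] B by (simp add: \<rho>'_def)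
      moreover have "det B \<in> pp 1"
        using nB B0 F.det_filt[OF B0] by (auto simp: GL0_iff pp_def)
      ultimately have "det k \<in> pp 1" using pp_add[of "det k - det B" 1 "det B"] by simp
      then show False using k by (simp add: GL0_iff pp_def)
    qed
    have hG: "h \<in> F.GL0 n" using h F.congruence_GL0[OF R1] by blast
    have khG: "k * h \<in> GL n" using GL0_mult[OF k hG] by (rule GL0_GL)
    note c = F.FM_carrier[OF k0] F.FM_carrier[OF B0] GL_carrier[OF GL0_GL[OF hG]]
    have "k * (h - 1\<^sub>m n) \<in> F.FM R n n"
      using h by (intro F.FM_mult0[OF k0]) (simp add: F.congruence_def)
    then have "k * (h - 1\<^sub>m n) + (k - B) \<in> F.FM (\<rho>' B) n n"
      using B R[OF B(1)] F.FM_mono F.FM_add by meson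
    moreover have "k * (h - 1\<^sub>m n) + (k - B) = k * h - B"
    proof -
      have "k * (h - 1\<^sub>m n) = k * h - k" using c by (simp add: mult_minus_distrib_mat)
      then show ?thesis using c by (intro eq_matI) auto
    qed
    ultimately have "f (k * h) = f B"
      using \<rho>(2)[OF GL0_GL[OF BG] khG] BG by (simp add: \<rho>'_def)
    moreover have "f k = f B"
      using \<rho>(2)[OF GL0_GL[OF BG] GL0_GL[OF k]] BG B by (simp add: \<rho>'_def)
    ultimately show ?thesis by simp
  qed
  then show ?thesis using R1 by blast
qed

end

section \<open>Matrices over the dual numbers\<close>

text \<open>The Shalika subgroup is the general linear group over the dual numbers: \<open>g + \<epsilon> z\<close>
  corresponds to the block matrix with diagonal blocks \<open>g\<close> and upper right block \<open>z\<close>.\<close>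

datatype 'a dual = Dual (std: 'a) (eps: 'a)

instantiation dual :: (comm_ring_1) comm_ring_1
begin
definition zero_dual :: "'a dual" where "0 = Dual 0 0"
definition one_dual :: "'a dual" where "1 = Dual 1 0"
definition plus_dual :: "'a dual \<Rightarrow> 'a dual \<Rightarrow> 'a dual" where
  "x + y = Dual (std x + std y) (eps x + eps y)"
definition minus_dual :: "'a dual \<Rightarrow> 'a dual \<Rightarrow> 'a dual" where
  "x - y = Dual (std x - std y) (eps x - eps y)"
definition uminus_dual :: "'a dual \<Rightarrow> 'a dual" where
  "- x = Dual (- std x) (- eps x)"
definition times_dual :: "'a dual \<Rightarrow> 'a dual \<Rightarrow> 'a dual" where
  "x * y = Dual (std x * std y) (std x * eps y + eps x * std y)"
instance
  by standard (auto simp: zero_dual_def one_dual_def plus_dual_def minus_dual_def uminus_dual_def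
      times_dual_def algebra_simps intro: dual.expand)
end

lemma dual_simps [simp]:
  "std 0 = 0" "eps 0 = 0" "std 1 = 1" "eps 1 = 0"
  "std (x + y) = std x + std y" "eps (x + y) = eps x + eps y"
  "std (x - y) = std x - std y" "eps (x - y) = eps x - eps y"
  "std (- x) = - std x" "eps (- x) = - eps x"
  "std (x * y) = std x * std y" "eps (x * y) = std x * eps y + eps x * std y"
  by (simp_all add: zero_dual_def one_dual_def plus_dual_def minus_dual_def uminus_dual_def times_dual_def)

lemma dual_sum: "std (sum f A) = (\<Sum>x\<in>A. std (f x))" "eps (sum f A) = (\<Sum>x\<in>A. eps (f x))"
  for f :: "'b \<Rightarrow> 'a::comm_ring_1 dual"
  by (induction A rule: infinite_finite_induct; simp)+

abbreviation std_mat :: "'a dual mat \<Rightarrow> 'a mat" where "std_mat \<equiv> map_mat std"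
abbreviation eps_mat :: "'a dual mat \<Rightarrow> 'a mat" where "eps_mat \<equiv> map_mat eps"

definition dual_mat :: "'a mat \<Rightarrow> 'a mat \<Rightarrow> 'a dual mat" where
  "dual_mat g z = mat (dim_row g) (dim_col g) (\<lambda>ij. Dual (g $$ ij) (z $$ ij))"

lemma dual_mat_carrier [simp]: "g \<in> carrier_mat nr nc \<Longrightarrow> dual_mat g z \<in> carrier_mat nr nc"
  by (auto simp: dual_mat_def)

lemma dual_mat_parts [simp]:
  assumes "g \<in> carrier_mat nr nc" "z \<in> carrier_mat nr nc"
  shows "std_mat (dual_mat g z) = g" "eps_mat (dual_mat g z) = z"
  using assms by (auto simp: dual_mat_def intro!: eq_matI)

lemma dual_mat_eta: "dual_mat (std_mat A) (eps_mat A) = A"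
  by (auto simp: dual_mat_def intro!: eq_matI)

lemma dual_mat_eqI:
  assumes "std_mat A = std_mat B" "eps_mat A = eps_mat B"
  shows "A = B"
  using assms by (metis dual_mat_eta)

lemma std_mat_mult:
  assumes "A \<in> carrier_mat nr n" "B \<in> carrier_mat n nc"
  shows "std_mat (A * B) = std_mat A * std_mat (B :: 'a::comm_ring_1 dual mat)"
  using assms by (intro eq_matI) (auto simp: scalar_prod_def dual_sum)

lemma eps_mat_mult:
  assumes "A \<in> carrier_mat nr n" "B \<in> carrier_mat n nc"
  shows "eps_mat (A * B) = std_mat A * eps_mat B + eps_mat A * std_mat (B :: 'a::comm_ring_1 dual mat)"
  using assms by (intro eq_matI) (auto simp: scalar_prod_def dual_sum sum.distrib)

lemma dual_mat_mult:
  fixes g h z w :: "'a::comm_ring_1 mat"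
  assumes "g \<in> carrier_mat nr n" "z \<in> carrier_mat nr n" "h \<in> carrier_mat n nc" "w \<in> carrier_mat n nc"
  shows "dual_mat g z * dual_mat h w = dual_mat (g * h) (g * w + z * h)"
proof -
  have c: "g * h \<in> carrier_mat nr nc" "g * w + z * h \<in> carrier_mat nr nc" using assms by auto
  show ?thesis
    using std_mat_mult[of "dual_mat g z" nr n "dual_mat h w" nc]
      eps_mat_mult[of "dual_mat g z" nr n "dual_mat h w" nc] assms
    by (intro dual_mat_eqI) (simp_all only: dual_mat_parts[OF c] dual_mat_parts[OF assms(1,2)]
        dual_mat_parts[OF assms(3,4)] dual_mat_carrier)
qed

lemma std_mat_simps:
  "std_mat (1\<^sub>m n) = 1\<^sub>m n" "std_mat (0\<^sub>m nr nc) = 0\<^sub>m nr nc"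
  "eps_mat (1\<^sub>m n) = 0\<^sub>m n n" "eps_mat (0\<^sub>m nr nc) = 0\<^sub>m nr nc"
  by (auto intro!: eq_matI)

lemma std_mat_four_block:
  assumes "A \<in> carrier_mat n1 m1" "B \<in> carrier_mat n1 m2" "C \<in> carrier_mat n2 m1" "D \<in> carrier_mat n2 m2"
  shows "std_mat (four_block_mat A B C D) = four_block_mat (std_mat A) (std_mat B) (std_mat C) (std_mat D)"
    and "eps_mat (four_block_mat A B C D) = four_block_mat (eps_mat A) (eps_mat B) (eps_mat C) (eps_mat D)"
  using assms by (auto intro!: eq_matI)

definition const_mat :: "'a::zero mat \<Rightarrow> 'a dual mat" where
  "const_mat g = map_mat (\<lambda>a. Dual a 0) g"

lemma const_mat_carrier [simp]: "g \<in> carrier_mat nr nc \<Longrightarrow> const_mat g \<in> carrier_mat nr nc"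
  by (simp add: const_mat_def)

lemma const_mat_parts [simp]:
  "g \<in> carrier_mat nr nc \<Longrightarrow> std_mat (const_mat g) = g"
  "g \<in> carrier_mat nr nc \<Longrightarrow> eps_mat (const_mat g) = 0\<^sub>m nr nc"
  by (auto simp: const_mat_def intro!: eq_matI)

lemma const_mat_mult:
  assumes "g \<in> carrier_mat nr n" "h \<in> carrier_mat n nc"
  shows "const_mat g * const_mat h = const_mat (g * h :: 'a::comm_ring_1 mat)"
proof -
  have c: "g * h \<in> carrier_mat nr nc" using assms by simp
  show ?thesis
    using std_mat_mult[of "const_mat g" nr n "const_mat h" nc]
      eps_mat_mult[of "const_mat g" nr n "const_mat h" nc] assms
    by (intro dual_mat_eqI) (simp_all add: const_mat_parts[OF c] const_mat_parts[OF assms(1)] const_mat_parts[OF assms(2)])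
qed

section \<open>Invertible matrices over the dual numbers\<close>

context nonarchimedean_local_field
begin

abbreviation dual_group :: "nat \<Rightarrow> 'f dual mat monoid" where
  "dual_group m \<equiv> gl_group m"

lemma dual_groupD:
  assumes s: "s \<in> carrier (dual_group m)"
  shows "s \<in> carrier_mat m m \<and> std_mat s \<in> GL m"
proof (intro conjI)
  show sc: "s \<in> carrier_mat m m" using s by (rule gl_group_carrierD)
  obtain t where t: "t \<in> carrier_mat m m" "s * t = 1\<^sub>m m" "t * s = 1\<^sub>m m"
    using s by (auto simp: gl_group_carrier)
  have "std_mat s * std_mat t = 1\<^sub>m m" "std_mat t * std_mat s = 1\<^sub>m m"
    using std_mat_mult[OF sc t(1)] std_mat_mult[OF t(1) sc] t by (simp_all add: std_mat_simps)
  then show "std_mat s \<in> GL m"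
    unfolding GL_eq using sc t by (intro gl_groupI(1)[of _ _ "std_mat t"]) auto
qed

text \<open>With h = g^-1 the inverse of g + e z is h - e h z h; the quadratic term disappears
  because e^2 = 0.\<close>

lemma dual_inverse:
  assumes s: "s \<in> carrier_mat m m" and h: "h \<in> carrier_mat m m" "std_mat s * h = 1\<^sub>m m" "h * std_mat s = 1\<^sub>m m"
  shows "s \<in> carrier (dual_group m)"
    and "inv\<^bsub>dual_group m\<^esub> s = dual_mat h (- (h * eps_mat s * h))"
proof -
  let ?g = "std_mat s" and ?z = "eps_mat s"
  have gz: "?g \<in> carrier_mat m m" "?z \<in> carrier_mat m m" using s by auto
  let ?w = "- (h * ?z * h)"
  have wc: "?w \<in> carrier_mat m m" "h * ?z \<in> carrier_mat m m" "h * ?z * h \<in> carrier_mat m m" using gz h by auto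
  have "?g * ?w + ?z * h = 0\<^sub>m m m"
  proof -
    have zh: "?z * h \<in> carrier_mat m m" using gz h by auto
    have "?g * (h * ?z * h) = ?g * (h * (?z * h))" using assoc_mult_mat[OF h(1) gz(2) h(1)] by simp
    also have "\<dots> = (?g * h) * (?z * h)" by (rule assoc_mult_mat[OF gz(1) h(1) zh, symmetric])
    also have "\<dots> = ?z * h" using left_mult_one_mat[OF zh] by (simp add: h)
    finally have "?g * ?w = - (?z * h)"
      using carrier_matD[OF gz(1)] carrier_matD[OF wc(3)] by (subst uminus_mult_right_mat) auto
    then show ?thesis using gz h by (simp add: uminus_l_inv_mat[of _ m m])
  qed
  moreover have "h * ?z + ?w * ?g = 0\<^sub>m m m"
  proof -
    have "(h * ?z * h) * ?g = h * ?z * (h * ?g)" using gz h wc by (intro assoc_mult_mat) auto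
    also have "\<dots> = h * ?z" using right_mult_one_mat[OF wc(2)] by (simp add: h)
    finally have "?w * ?g = - (h * ?z)"
      using carrier_matD[OF gz(1)] carrier_matD[OF wc(3)] by (subst uminus_mult_left_mat) auto
    then show ?thesis using wc by (simp add: add_uminus_minus_mat[of _ m m])
  qed
  moreover have s_eq: "dual_mat ?g ?z = s" by (simp add: dual_mat_eta)
  moreover have "dual_mat (1\<^sub>m m) (0\<^sub>m m m :: 'f mat) = 1\<^sub>m m"
    by (auto simp: dual_mat_def intro!: eq_matI dual.expand)
  ultimately have "s * dual_mat h ?w = 1\<^sub>m m" "dual_mat h ?w * s = 1\<^sub>m m"
    using dual_mat_mult[OF gz h(1) wc(1)] dual_mat_mult[OF h(1) wc(1) gz] h by auto
  then show "s \<in> carrier (dual_group m)" "inv\<^bsub>dual_group m\<^esub> s = dual_mat h ?w"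
    using s h gl_groupI[of s m "dual_mat h ?w"] by auto
qed

lemma dual_groupI: "s \<in> carrier_mat m m \<Longrightarrow> std_mat s \<in> GL m \<Longrightarrow> s \<in> carrier (dual_group m)"
  using dual_inverse(1) GL_inverse[of "std_mat s" m] GL_carrier by metis

lemma dual_group_iff: "s \<in> carrier (dual_group m) \<longleftrightarrow> s \<in> carrier_mat m m \<and> std_mat s \<in> GL m"
  using dual_groupI dual_groupD by blast

lemma GL0_carrier: "g \<in> F.GL0 m \<Longrightarrow> g \<in> carrier_mat m m"
  by (simp add: GL_carrier GL0_GL)

lemma std_mat_carrierD: "std_mat s \<in> carrier_mat nr nc \<Longrightarrow> s \<in> carrier_mat nr nc"
  by simp

lemma dual_inverse_bounded:
  assumes "std_mat s \<in> F.GL0 m" "eps_mat s \<in> F.FM c m m"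
  shows "std_mat (inv\<^bsub>dual_group m\<^esub> s) \<in> F.GL0 m" "eps_mat (inv\<^bsub>dual_group m\<^esub> s) \<in> F.FM c m m"
proof -
  have sc: "s \<in> carrier_mat m m" using GL0_carrier[OF assms(1)] by simp
  obtain h where h: "h \<in> F.GL0 m" "std_mat s * h = 1\<^sub>m m" "h * std_mat s = 1\<^sub>m m"
    using GL0_inverse[OF assms(1)] by blast
  note hc = GL0_carrier[OF h(1)]
  have w: "- (h * eps_mat s * h) \<in> F.FM c m m"
    using h assms(2) by (intro F.FM_uminus F.FM_mult0(2)[OF F.FM_mult0(1)]) (auto simp: GL0_iff)
  show "std_mat (inv\<^bsub>dual_group m\<^esub> s) \<in> F.GL0 m" "eps_mat (inv\<^bsub>dual_group m\<^esub> s) \<in> F.FM c m m"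
    unfolding dual_inverse(2)[OF sc hc h(2,3)]
    using w h dual_mat_parts[OF hc F.FM_carrier[OF w]] by auto
qed

definition dpp :: "int \<Rightarrow> 'f dual set" where
  "dpp r = {x. std x \<in> pp r \<and> eps x \<in> pp r}"

sublocale D: filtered_ring dpp
proof
  fix x :: "'f dual" obtain a b where ab: "std x \<in> pp a" "eps x \<in> pp b" using F.filt_exhaust by meson
  then have "x \<in> dpp (min a b)" unfolding dpp_def by (auto intro: pp_mono)
  then show "\<exists>r. x \<in> dpp r" by blast
next
  fix x assume x: "x \<in> dpp 1"
  then obtain y where y: "y \<in> pp 0" "(1 + std x) * y = 1" using F.filt_unit[of "std x"] by (auto simp: dpp_def)
  \<comment> \<open>The scalar case of the inverse formula, with y the inverse of the standard part
    1 + std x.\<close>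
  have "(1 + x) * Dual y (- (y * eps x * y)) = 1"
  proof (rule dual.expand, intro conjI)
    have "(1 + std x) * (y * eps x * y) = ((1 + std x) * y) * (eps x * y)" by (simp only: mult.assoc)
    then have e: "(1 + std x) * (y * eps x * y) = eps x * y" by (simp only: y(2) mult_1)
    have "eps ((1 + x) * Dual y (- (y * eps x * y))) = eps x * y - (1 + std x) * (y * eps x * y)"
      by (simp add: algebra_simps)
    then show "eps ((1 + x) * Dual y (- (y * eps x * y))) = eps 1" unfolding e by simp
  qed (use y in simp)
  moreover have "y * eps x * y \<in> pp (0 + 1 + 0)" using x y by (intro pp_mult) (auto simp: dpp_def)
  then have "Dual y (- (y * eps x * y)) \<in> dpp 0"
    using y pp_uminus[OF pp_mono[of "y * eps x * y" 1 0]] by (simp add: dpp_def)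
  ultimately show "\<exists>y\<in>dpp 0. (1 + x) * y = 1" by blast
next
  fix r s
  obtain T where T: "finite T" "\<forall>x\<in>pp r. \<exists>t\<in>T. x - t \<in> pp s" using finite_pp_quotient by blast
  let ?T = "(\<lambda>(a, b). Dual a b) ` (T \<times> T)"
  have "\<exists>t\<in>?T. x - t \<in> dpp s" if x: "x \<in> dpp r" for x
  proof -
    have "std x \<in> pp r" "eps x \<in> pp r" using x by (auto simp: dpp_def)
    then obtain a b where "a \<in> T" "b \<in> T" "std x - a \<in> pp s" "eps x - b \<in> pp s" using T(2) by meson
    then show ?thesis by (intro bexI[of _ "Dual a b"]) (auto simp: dpp_def)
  qed
  then show "\<exists>T. finite T \<and> (\<forall>x\<in>dpp r. \<exists>t\<in>T. x - t \<in> dpp s)"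
    using T(1) by (intro exI[of _ ?T]) auto
next
  fix x y r s assume "x \<in> dpp r" "y \<in> dpp s"
  then show "x * y \<in> dpp (r + s)"
    using pp_mult[of "std x" r "std y" s] pp_mult[of "std x" r "eps y" s] pp_mult[of "eps x" r "std y" s] pp_add
    by (simp add: dpp_def)
qed (auto simp: dpp_def pp_zero F.filt_one intro: pp_add pp_uminus pp_mono)

lemma dual_FM_iff: "A \<in> D.FM r nr nc \<longleftrightarrow> std_mat A \<in> F.FM r nr nc \<and> eps_mat A \<in> F.FM r nr nc"
  by (auto simp: D.FM_def F.FM_def dpp_def)

lemma dual_GL0_iff: "s \<in> D.GL0 m \<longleftrightarrow> std_mat s \<in> F.GL0 m \<and> eps_mat s \<in> F.FM 0 m m"
proof
  assume s: "s \<in> D.GL0 m"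
  then have s': "s \<in> carrier (dual_group m)" "s \<in> D.FM 0 m m" "inv\<^bsub>dual_group m\<^esub> s \<in> D.FM 0 m m"
    by (auto simp: D.GL0_def)
  let ?t = "inv\<^bsub>dual_group m\<^esub> s"
  note i = gl_group_inv[OF s'(1)] and sc = gl_group_carrierD[OF s'(1)]
  have e: "std_mat s * std_mat ?t = 1\<^sub>m m" "std_mat ?t * std_mat s = 1\<^sub>m m"
    using std_mat_mult[OF sc i(1)] std_mat_mult[OF i(1) sc] i by (simp_all add: std_mat_simps)
  have "std_mat s \<in> carrier_mat m m" "std_mat ?t \<in> carrier_mat m m" using i sc by auto
  from gl_groupI[OF this e] have "std_mat s \<in> F.GL0 m"
    using s' by (simp add: F.GL0_def dual_FM_iff)
  then show "std_mat s \<in> F.GL0 m \<and> eps_mat s \<in> F.FM 0 m m" using s' by (simp add: dual_FM_iff)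
next
  assume s: "std_mat s \<in> F.GL0 m \<and> eps_mat s \<in> F.FM 0 m m"
  then have "s \<in> carrier (dual_group m)" by (metis dual_groupI GL0_carrier GL0_GL std_mat_carrierD)
  then show "s \<in> D.GL0 m"
    using s dual_inverse_bounded[of s m 0] by (simp add: D.GL0_def dual_FM_iff GL0_iff)
qed

lemma const_mat_group: "g \<in> GL m \<Longrightarrow> const_mat g \<in> carrier (dual_group m)"
  using GL_carrier[of g m] by (simp add: dual_group_iff const_mat_parts[of g m m])

lemma const_mat_GL0: "g \<in> F.GL0 m \<Longrightarrow> const_mat g \<in> D.GL0 m"
  using F.FM_carrier[of g 0 m m] by (simp add: dual_GL0_iff const_mat_parts[of g m m] F.FM_zero GL0_iff)

lemma unipotent_decomposition:
  assumes s: "s \<in> carrier (dual_group m)"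
  obtains x where "x \<in> carrier_mat m m" "s = dual_mat (1\<^sub>m m) x * const_mat (std_mat s)"
proof -
  have sc: "s \<in> carrier_mat m m" "std_mat s \<in> GL m" using s by (auto simp: dual_group_iff)
  obtain h where h: "h \<in> GL m" "h * std_mat s = 1\<^sub>m m" using GL_inverse[OF sc(2)] by blast
  let ?x = "eps_mat s * h"
  have c: "std_mat s \<in> carrier_mat m m" "eps_mat s \<in> carrier_mat m m" "h \<in> carrier_mat m m" "?x \<in> carrier_mat m m"
    using sc GL_carrier[OF h(1)] by auto
  have "const_mat (std_mat s) = dual_mat (std_mat s) (0\<^sub>m m m)"
    using c by (intro dual_mat_eqI) (simp_all add: const_mat_parts[of _ m m] dual_mat_parts[of _ m m])
  then have "dual_mat (1\<^sub>m m) ?x * const_mat (std_mat s)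
      = dual_mat (1\<^sub>m m * std_mat s) (1\<^sub>m m * 0\<^sub>m m m + ?x * std_mat s)"
    using c by (simp only:) (rule dual_mat_mult, auto)
  also have "?x * std_mat s = eps_mat s * (h * std_mat s)"
    using c by (intro assoc_mult_mat) auto
  finally have "dual_mat (1\<^sub>m m) ?x * const_mat (std_mat s) = dual_mat (std_mat s) (eps_mat s)"
    using c h(2) by simp
  then have "s = dual_mat (1\<^sub>m m) ?x * const_mat (std_mat s)" by (simp only: dual_mat_eta)
  then show ?thesis by (rule that[OF c(4)])
qed

text \<open>A compact open subgroup absorbing a prescribed infinitesimal part.\<close>

definition fat_compact :: "int \<Rightarrow> nat \<Rightarrow> 'f dual mat set" where
  "fat_compact c m = {s. std_mat s \<in> F.GL0 m \<and> eps_mat s \<in> F.FM c m m}"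

text \<open>As e^2 = 0, the infinitesimal part of a product is std s eps t + eps s std t, linear in
  the infinitesimal parts. Multiplication by integral matrices therefore preserves any bound c, even
  a very negative one.\<close>

lemma fat_compact_open: "fat_compact c m \<in> D.compact_open m"
proof -
  interpret group "dual_group m" by (rule group_gl_group)
  have sub: "fat_compact c m \<subseteq> carrier (dual_group m)"
    unfolding fat_compact_def using dual_groupI GL0_carrier GL0_GL std_mat_carrierD by blast
  have sg: "subgroup (fat_compact c m) (dual_group m)"
  proof (rule subgroupI[OF sub])
    have "1\<^sub>m m \<in> fat_compact c m"
      by (simp add: fat_compact_def std_mat_simps GL0_one F.FM_zero)
    then show "fat_compact c m \<noteq> {}" by blast
  next
    fix s t assume s: "s \<in> fat_compact c m" and t: "t \<in> fat_compact c m"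
    have c: "s \<in> carrier_mat m m" "t \<in> carrier_mat m m" using s t sub gl_group_carrierD by auto
    have "std_mat s * eps_mat t \<in> F.FM c m m" "eps_mat s * std_mat t \<in> F.FM c m m"
      using s t F.FM_mult0(1)[of "std_mat s" m m "eps_mat t" c m] F.FM_mult0(2)[of "eps_mat s" c m m "std_mat t" m]
      by (auto simp: fat_compact_def GL0_iff)
    then show "s \<otimes>\<^bsub>dual_group m\<^esub> t \<in> fat_compact c m"
      using s t by (simp add: fat_compact_def std_mat_mult[OF c] eps_mat_mult[OF c] GL0_mult F.FM_add)
  next
    fix s assume "s \<in> fat_compact c m"
    then show "inv\<^bsub>dual_group m\<^esub> s \<in> fat_compact c m"
      using dual_inverse_bounded[of s m c] by (simp add: fat_compact_def)
  qed
  have "D.congruence (max 1 c) m \<subseteq> fat_compact c m"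
  proof
    fix s assume s: "s \<in> D.congruence (max 1 c) m"
    have "std_mat s \<in> F.GL0 m"
      using s D.congruence_GL0[of "max 1 c" m] by (auto simp: dual_GL0_iff)
    moreover have "eps_mat s = eps_mat (s - 1\<^sub>m m)" using s by (auto simp: D.congruence_def intro!: eq_matI)
    then have "eps_mat s \<in> F.FM c m m"
      using s by (auto simp: D.congruence_def dual_FM_iff intro: F.FM_mono)
    ultimately show "s \<in> fat_compact c m" by (simp add: fat_compact_def)
  qed
  moreover have "fat_compact c m \<subseteq> D.FM (min 0 c) m m"
    by (auto simp: fat_compact_def dual_FM_iff GL0_iff
        elim!: F.FM_mono[OF _ min.cobounded1] F.FM_mono[OF _ min.cobounded2])
  ultimately show ?thesis
    unfolding D.compact_open_def using sg by (intro CollectI conjI exI[of _ "max 1 c"] exI[of _ "min 0 c"]) auto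
qed

text \<open>Each single element 1 + e x is compact, so every modulus character is trivial on it
  although these elements form a noncompact group.\<close>

lemma unipotent_fat_compact:
  assumes "x \<in> carrier_mat m m"
  shows "\<exists>A\<in>D.compact_open m. dual_mat (1\<^sub>m m) x \<in> A"
proof -
  obtain c where "x \<in> F.FM c m m" using F.FM_exhaust[OF assms] by blast
  then have "dual_mat (1\<^sub>m m) x \<in> fat_compact c m"
    using assms by (simp add: fat_compact_def dual_mat_parts[of _ m m] GL0_one)
  then show ?thesis using fat_compact_open by blast
qed

end

section \<open>Modulus characters\<close>

context nonarchimedean_local_field
begin

lemma const_scalar: "const_mat (c \<cdot>\<^sub>m 1\<^sub>m m) = Dual c 0 \<cdot>\<^sub>m (1\<^sub>m m :: 'f dual mat)"
  by (auto simp: const_mat_def zero_dual_def one_dual_def times_dual_def intro!: eq_matI)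

lemma scalar_mult_mat:
  "A \<in> carrier_mat m n \<Longrightarrow> (k \<cdot>\<^sub>m 1\<^sub>m m) * A = k \<cdot>\<^sub>m (A :: 'a::comm_ring_1 mat)"
  "A \<in> carrier_mat n m \<Longrightarrow> A * (k \<cdot>\<^sub>m 1\<^sub>m m) = k \<cdot>\<^sub>m (A :: 'a::comm_ring_1 mat)"
  using mult_smult_assoc_mat[of "1\<^sub>m m" m m A n k] mult_smult_distrib[of A n m "1\<^sub>m m" m k] by auto

lemma scalar_GL: "c \<noteq> 0 \<Longrightarrow> c \<cdot>\<^sub>m 1\<^sub>m m \<in> (GL m :: 'f mat set)"
  by (subst GL_iff_det) auto

lemma val_det_scalar: "val (det (unif \<cdot>\<^sub>m 1\<^sub>m m :: 'f mat)) = int m"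
  using unif by (simp add: val_power)

lemma const_central:
  assumes "x \<in> carrier (dual_group m)"
  shows "const_mat (c \<cdot>\<^sub>m 1\<^sub>m m) * x = x * const_mat (c \<cdot>\<^sub>m 1\<^sub>m m)"
  using gl_group_carrierD[OF assms] by (simp add: const_scalar scalar_mult_mat)

text \<open>Infinitesimal unipotents are compact, so the modulus only depends on the standard part,
  where it is a to the power of the valuation of the determinant. A central scalar matrix gives a^m
  = 1, and a is positive.\<close>

lemma dual_group_unimodular:
  assumes m: "m > 0" and s: "s \<in> carrier (dual_group m)"
  shows "group.modulus (dual_group m) (D.GL0 m) s = 1"
proof -
  interpret C: commensurable_family "dual_group m" "carrier (dual_group m)" "D.compact_open m" "D.GL0 m"
    by (rule D.compact_open_family)
  let ?\<Delta> = "C.modulus (D.GL0 m)"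
  have mult: "?\<Delta> (g * h) = ?\<Delta> g * ?\<Delta> h" if "g \<in> carrier (dual_group m)" "h \<in> carrier (dual_group m)" for g h
    using C.modulus_mult[OF that] by simp
  have "\<exists>a>0. \<forall>g\<in>GL m. ?\<Delta> (const_mat g) = a powi val (det g)"
  proof (rule unramified_character)
    fix g h :: "'f mat" assume gh: "g \<in> GL m" "h \<in> GL m"
    then show "?\<Delta> (const_mat (g * h)) = ?\<Delta> (const_mat g) * ?\<Delta> (const_mat h)"
      using mult[OF const_mat_group const_mat_group] const_mat_mult[OF GL_carrier GL_carrier] by metis
  next
    fix g :: "'f mat" assume "g \<in> GL m"
    then show "?\<Delta> (const_mat g) > 0" using C.modulus_pos const_mat_group by blast
  next
    fix g assume "g \<in> F.GL0 m"
    then show "?\<Delta> (const_mat g) = 1" using C.modulus_compact[OF D.GL0_compact_open const_mat_GL0] by blast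
  qed
  then obtain a where a: "a > 0" "\<And>g. g \<in> GL m \<Longrightarrow> ?\<Delta> (const_mat g) = a powi val (det g)" by blast
  have sc: "unif \<cdot>\<^sub>m 1\<^sub>m m \<in> (GL m :: 'f mat set)" by (rule scalar_GL[OF unif(1)])
  have "?\<Delta> (const_mat (unif \<cdot>\<^sub>m 1\<^sub>m m)) = 1"
    using const_central by (intro C.modulus_central const_mat_group sc) simp
  then have "a ^ m = 1 ^ m" using a(2)[OF sc] by (simp only: val_det_scalar) simp
  then have "a = 1" using a(1) m by (subst (asm) power_eq_iff_eq_base) auto
  obtain x where x: "x \<in> carrier_mat m m" "s = dual_mat (1\<^sub>m m) x * const_mat (std_mat s)"
    using unipotent_decomposition[OF s] by blast
  obtain A where A: "A \<in> D.compact_open m" "dual_mat (1\<^sub>m m) x \<in> A" using unipotent_fat_compact[OF x(1)] by blast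
  have g: "std_mat s \<in> GL m" using s by (simp add: dual_group_iff)
  have "dual_mat (1\<^sub>m m) x \<in> carrier (dual_group m)" using A C.family_subset by blast
  then have "?\<Delta> s = ?\<Delta> (dual_mat (1\<^sub>m m) x) * ?\<Delta> (const_mat (std_mat s))"
    using mult[OF _ const_mat_group[OF g]] x(2) by metis
  then show ?thesis using C.modulus_compact[OF A] a(2)[OF g] \<open>a = 1\<close> by simp
qed

text \<open>Standard and infinitesimal parts reduce separately, which squares the number of classes;
  this is the origin of the factor 2 in \<open>index_torus\<close>.\<close>

lemma dual_residue_representatives:
  obtains T where "finite T" "card T = resq ^ 2" "T \<subseteq> dpp 0"
    "\<And>x. x \<in> dpp 0 \<Longrightarrow> \<exists>t\<in>T. x - t \<in> dpp 1"
    "\<And>s t. s \<in> T \<Longrightarrow> t \<in> T \<Longrightarrow> s - t \<in> dpp 1 \<Longrightarrow> s = t"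
proof -
  obtain T where T: "finite T" "card T = resq" "T \<subseteq> pp 0"
    "\<And>x. x \<in> pp 0 \<Longrightarrow> \<exists>t\<in>T. x - t \<in> pp 1"
    "\<And>s t. s \<in> T \<Longrightarrow> t \<in> T \<Longrightarrow> s - t \<in> pp 1 \<Longrightarrow> s = t"
    using residue_representatives by metis
  let ?T = "(\<lambda>(a, b). Dual a b) ` (T \<times> T)"
  show ?thesis
  proof (rule that[of ?T])
    show "card ?T = resq ^ 2"
      using T(1,2) by (subst card_image) (auto simp: inj_on_def card_cartesian_product power2_eq_square)
    show "?T \<subseteq> dpp 0" using T(3) by (auto simp: dpp_def)
  next
    fix x assume "x \<in> dpp 0"
    then have "std x \<in> pp 0" "eps x \<in> pp 0" by (auto simp: dpp_def)
    then obtain a b where "a \<in> T" "b \<in> T" "std x - a \<in> pp 1" "eps x - b \<in> pp 1" using T(4) by meson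
    then show "\<exists>t\<in>?T. x - t \<in> dpp 1" by (intro bexI[of _ "Dual a b"]) (auto simp: dpp_def)
  next
    fix s t assume "s \<in> ?T" "t \<in> ?T" "s - t \<in> dpp 1"
    then show "s = t" using T(5) by (auto simp: dpp_def)
  qed (use T(1) in auto)
qed

end

section \<open>The block upper triangular subgroup over the dual numbers and its modulus
  character\<close>

locale local_field_blocks = nonarchimedean_local_field val for val :: "'f::field \<Rightarrow> int" +
  fixes m1 m2 :: nat
  assumes m1: "m1 > 0" and m2: "m2 > 0"
begin

definition ut :: "'f dual mat \<Rightarrow> 'f dual mat \<Rightarrow> 'f dual mat \<Rightarrow> 'f dual mat" where
  "ut A B D = four_block_mat A B (0\<^sub>m m2 m1) D"

abbreviation "G1 \<equiv> carrier (dual_group m1)"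
abbreviation "G2 \<equiv> carrier (dual_group m2)"
abbreviation "GG \<equiv> dual_group (m1 + m2)"

definition parabolic :: "'f dual mat set" where
  "parabolic = {ut A B D | A B D. A \<in> G1 \<and> B \<in> carrier_mat m1 m2 \<and> D \<in> G2}"

lemma ut_carrier: "A \<in> carrier_mat m1 m1 \<Longrightarrow> D \<in> carrier_mat m2 m2 \<Longrightarrow> ut A B D \<in> carrier_mat (m1 + m2) (m1 + m2)"
  by (simp add: ut_def)

lemma ut_mult:
  assumes "A \<in> carrier_mat m1 m1" "B \<in> carrier_mat m1 m2" "D \<in> carrier_mat m2 m2"
    "A' \<in> carrier_mat m1 m1" "B' \<in> carrier_mat m1 m2" "D' \<in> carrier_mat m2 m2"
  shows "ut A B D * ut A' B' D' = ut (A * A') (A * B' + B * D') (D * D')"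
  unfolding ut_def using assms by (subst mult_four_block_mat[of _ m1 m1 _ m2 _ m2 _ _ m1 _ m2]) auto

lemma ut_std:
  assumes "A \<in> carrier_mat m1 m1" "B \<in> carrier_mat m1 m2" "D \<in> carrier_mat m2 m2"
  shows "std_mat (ut A B D) = four_block_mat (std_mat A) (std_mat B) (0\<^sub>m m2 m1) (std_mat D)"
    "eps_mat (ut A B D) = four_block_mat (eps_mat A) (eps_mat B) (0\<^sub>m m2 m1) (eps_mat D)"
  unfolding ut_def using std_mat_four_block[of A m1 m1 B m2 "0\<^sub>m m2 m1" m2 D] assms
  by (simp_all add: std_mat_simps)

lemma ut_group:
  assumes "A \<in> G1" "B \<in> carrier_mat m1 m2" "D \<in> G2"
  shows "ut A B D \<in> carrier GG"
proof -
  have A: "A \<in> carrier_mat m1 m1" "std_mat A \<in> GL m1" and D: "D \<in> carrier_mat m2 m2" "std_mat D \<in> GL m2"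
    using assms by (auto simp: dual_group_iff)
  have "std_mat B \<in> carrier_mat m1 m2" using assms(2) by simp
  then show ?thesis
    using ut_std(1)[OF A(1) assms(2) D(1)] four_block_GL(1)[OF A(2) _ D(2)] ut_carrier[OF A(1) D(1)]
    by (simp add: dual_group_iff)
qed

lemma ut_one: "ut (1\<^sub>m m1) (0\<^sub>m m1 m2) (1\<^sub>m m2) = 1\<^sub>m (m1 + m2)"
  by (simp add: ut_def)

lemma ut_inverse:
  assumes A: "A \<in> G1" and B: "B \<in> carrier_mat m1 m2" and D: "D \<in> G2"
  shows "inv\<^bsub>GG\<^esub> (ut A B D)
    = ut (inv\<^bsub>dual_group m1\<^esub> A) (- (inv\<^bsub>dual_group m1\<^esub> A * B * inv\<^bsub>dual_group m2\<^esub> D)) (inv\<^bsub>dual_group m2\<^esub> D)"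
proof -
  let ?A = "inv\<^bsub>dual_group m1\<^esub> A" and ?D = "inv\<^bsub>dual_group m2\<^esub> D"
  note a = gl_group_carrierD[OF A] gl_group_inv[OF A] and d = gl_group_carrierD[OF D] gl_group_inv[OF D]
  let ?B = "- (?A * B * ?D)"
  have c: "?A * B \<in> carrier_mat m1 m2" "?A * B * ?D \<in> carrier_mat m1 m2" "?B \<in> carrier_mat m1 m2"
    "B * ?D \<in> carrier_mat m1 m2" using a d B by auto
  have "A * (?A * B * ?D) = A * (?A * (B * ?D))" using assoc_mult_mat[OF a(2) B d(2)] by simp
  also have "\<dots> = (A * ?A) * (B * ?D)" by (rule assoc_mult_mat[OF a(1,2) c(4), symmetric])
  also have "\<dots> = B * ?D" using left_mult_one_mat[OF c(4)] by (simp add: a)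
  finally have 1: "A * ?B + B * ?D = 0\<^sub>m m1 m2"
    using carrier_matD[OF a(1)] carrier_matD[OF c(2)] c(4) by (subst uminus_mult_right_mat) auto
  have "?A * B * ?D * D = ?A * B * (?D * D)" by (rule assoc_mult_mat[OF c(1) d(2,1)])
  also have "\<dots> = ?A * B" using right_mult_one_mat[OF c(1)] by (simp add: d)
  finally have 2: "?A * B + ?B * D = 0\<^sub>m m1 m2"
    using carrier_matD[OF d(1)] carrier_matD[OF c(2)] c(1)
    by (subst uminus_mult_left_mat) (auto simp: add_uminus_minus_mat[of _ m1 m2])
  have "ut A B D * ut ?A ?B ?D = 1\<^sub>m (m1 + m2)"
    using ut_mult[OF a(1) B d(1) a(2) c(3) d(2)] 1 a d by (simp add: ut_one)
  moreover have "ut ?A ?B ?D * ut A B D = 1\<^sub>m (m1 + m2)"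
    using ut_mult[OF a(2) c(3) d(2) a(1) B d(1)] 2 a d by (simp add: ut_one)
  ultimately show ?thesis
    by (intro gl_groupI(2)) (auto intro!: ut_carrier a d)
qed

lemma parabolicI: "A \<in> G1 \<Longrightarrow> B \<in> carrier_mat m1 m2 \<Longrightarrow> D \<in> G2 \<Longrightarrow> ut A B D \<in> parabolic"
  unfolding parabolic_def by blast

lemma dual_one: "1\<^sub>m m \<in> carrier (dual_group m)"
  using group.is_monoid[OF group_gl_group[of m]] monoid.one_closed[of "dual_group m"] by simp

lemma dual_mult: "A \<in> carrier (dual_group m) \<Longrightarrow> B \<in> carrier (dual_group m) \<Longrightarrow> A * B \<in> carrier (dual_group m)"
  using group.is_monoid[OF group_gl_group[of m]] monoid.m_closed[of "dual_group m" A B] by simp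

lemma dual_inv_closed: "A \<in> carrier (dual_group m) \<Longrightarrow> inv\<^bsub>dual_group m\<^esub> A \<in> carrier (dual_group m)"
  using group.inv_closed[OF group_gl_group] .

lemma subgroup_parabolic: "subgroup parabolic GG"
proof -
  interpret group GG by (rule group_gl_group)
  show ?thesis
  proof (rule subgroupI)
    show "parabolic \<subseteq> carrier GG" using ut_group by (auto simp: parabolic_def)
    show "parabolic \<noteq> {}" using parabolicI[OF dual_one zero_carrier_mat dual_one] by blast
  next
    fix q assume "q \<in> parabolic"
    then obtain A B D where q: "q = ut A B D" "A \<in> G1" "B \<in> carrier_mat m1 m2" "D \<in> G2"
      by (auto simp: parabolic_def)
    have "- (inv\<^bsub>dual_group m1\<^esub> A * B * inv\<^bsub>dual_group m2\<^esub> D) \<in> carrier_mat m1 m2"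
      using gl_group_inv(1)[OF q(2)] gl_group_inv(1)[OF q(4)] q(3) by auto
    then show "inv\<^bsub>GG\<^esub> q \<in> parabolic"
      unfolding q(1) ut_inverse[OF q(2-4)] using q by (intro parabolicI dual_inv_closed)
  next
    fix q q' assume "q \<in> parabolic" "q' \<in> parabolic"
    then obtain A B D A' B' D' where q: "q = ut A B D" "A \<in> G1" "B \<in> carrier_mat m1 m2" "D \<in> G2"
      and q': "q' = ut A' B' D'" "A' \<in> G1" "B' \<in> carrier_mat m1 m2" "D' \<in> G2"
      by (auto simp: parabolic_def)
    note c = gl_group_carrierD[OF q(2)] q(3) gl_group_carrierD[OF q(4)]
      gl_group_carrierD[OF q'(2)] q'(3) gl_group_carrierD[OF q'(4)]
    show "q \<otimes>\<^bsub>GG\<^esub> q' \<in> parabolic"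
      unfolding q(1) q'(1) gl_group_simps ut_mult[OF c] using q q' c
      by (intro parabolicI dual_mult) auto
  qed
qed

lemma total_family: "commensurable_family GG (carrier GG) (D.compact_open (m1 + m2)) (D.GL0 (m1 + m2))"
  by (rule D.compact_open_family)

abbreviation "U0 \<equiv> parabolic \<inter> D.GL0 (m1 + m2)"

lemma relative_family:
  "commensurable_family GG parabolic ((\<inter>) parabolic ` D.compact_open (m1 + m2)) U0"
  using commensurable_family.restrict_family[OF total_family subgroup_parabolic]
    subgroup.subset[OF subgroup_parabolic] by blast

sublocale G: group GG by (rule group_gl_group)
sublocale R: commensurable_family GG parabolic "(\<inter>) parabolic ` D.compact_open (m1 + m2)" U0
  by (rule relative_family)

abbreviation "\<Delta> \<equiv> G.modulus U0"

lemma \<Delta>_mult: "q \<in> parabolic \<Longrightarrow> r \<in> parabolic \<Longrightarrow> \<Delta> (q * r) = \<Delta> q * \<Delta> r"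
  using R.modulus_mult by simp

lemma \<Delta>_compact: "q \<in> parabolic \<Longrightarrow> A \<in> D.compact_open (m1 + m2) \<Longrightarrow> q \<in> A \<Longrightarrow> \<Delta> q = 1"
  using R.modulus_compact[of "parabolic \<inter> A" q] by simp

text \<open>The determinants of the diagonal blocks are integral with valuations adding up to zero,
  so each is a unit; integrality of the blocks alone would not make them invertible
  integrally.\<close>

lemma ut_GL0_iff:
  assumes A: "A \<in> G1" and B: "B \<in> carrier_mat m1 m2" and D: "D \<in> G2"
  shows "ut A B D \<in> D.GL0 (m1 + m2) \<longleftrightarrow> A \<in> D.GL0 m1 \<and> B \<in> D.FM 0 m1 m2 \<and> D \<in> D.GL0 m2"
proof -
  note a = gl_group_carrierD[OF A] and d = gl_group_carrierD[OF D]
  note s = ut_std[OF a B d]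
  have aG: "std_mat A \<in> GL m1" and dG: "std_mat D \<in> GL m2" using A D by (auto simp: dual_group_iff)
  have nz: "det (std_mat A) \<noteq> 0" "det (std_mat D) \<noteq> 0"
    using aG dG GL_iff_det GL_carrier by blast+
  have det: "det (std_mat (ut A B D)) = det (std_mat A) * det (std_mat D)"
    unfolding s(1) using four_block_GL(2)[OF aG _ dG] B by simp
  show ?thesis
  proof
    assume h: "ut A B D \<in> D.GL0 (m1 + m2)"
    then have "four_block_mat (std_mat A) (std_mat B) (0\<^sub>m m2 m1) (std_mat D) \<in> F.FM 0 (m1 + m2) (m1 + m2)"
      "four_block_mat (eps_mat A) (eps_mat B) (0\<^sub>m m2 m1) (eps_mat D) \<in> F.FM 0 (m1 + m2) (m1 + m2)"
      and v: "val (det (std_mat A)) + val (det (std_mat D)) = 0"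
      using det nz by (auto simp: dual_GL0_iff GL0_iff s val_mult)
    then have f: "std_mat A \<in> F.FM 0 m1 m1" "std_mat B \<in> F.FM 0 m1 m2" "std_mat D \<in> F.FM 0 m2 m2"
      "eps_mat A \<in> F.FM 0 m1 m1" "eps_mat B \<in> F.FM 0 m1 m2" "eps_mat D \<in> F.FM 0 m2 m2"
      using a B d by (auto dest: F.FM_four_blockD)
    moreover have "val (det (std_mat A)) \<ge> 0" "val (det (std_mat D)) \<ge> 0"
      using F.det_filt[OF f(1)] F.det_filt[OF f(3)] nz by (auto simp: pp_def)
    ultimately show "A \<in> D.GL0 m1 \<and> B \<in> D.FM 0 m1 m2 \<and> D \<in> D.GL0 m2"
      using v nz by (simp add: dual_GL0_iff GL0_iff dual_FM_iff)
  next
    assume "A \<in> D.GL0 m1 \<and> B \<in> D.FM 0 m1 m2 \<and> D \<in> D.GL0 m2"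
    then show "ut A B D \<in> D.GL0 (m1 + m2)"
      using nz det by (simp add: dual_GL0_iff GL0_iff s dual_FM_iff F.FM_four_block F.FM_zero val_mult)
  qed
qed

text \<open>The one element whose modulus is found by counting; \<open>\<Delta>_formula\<close>
  deduces the other values from it and from the centre.\<close>

definition torus :: "'f dual mat" where
  "torus = ut (const_mat (unif \<cdot>\<^sub>m 1\<^sub>m m1)) (0\<^sub>m m1 m2) (1\<^sub>m m2)"

lemma torus_parabolic: "torus \<in> parabolic"
  unfolding torus_def by (intro parabolicI const_mat_group scalar_GL unif dual_one zero_carrier_mat)

lemma torus_conj:
  assumes A: "A \<in> G1" and B: "B \<in> carrier_mat m1 m2" and D: "D \<in> G2"
  shows "inv\<^bsub>GG\<^esub> torus * ut A B D * torus = ut A (Dual (inverse unif) 0 \<cdot>\<^sub>m B) D"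
proof -
  let ?k = "Dual unif 0" and ?k' = "Dual (inverse unif) 0"
  let ?K = "?k \<cdot>\<^sub>m 1\<^sub>m m1 :: 'f dual mat" and ?K' = "?k' \<cdot>\<^sub>m 1\<^sub>m m1 :: 'f dual mat"
  have kk: "?k' * ?k = 1" "?k * ?k' = 1" using unif by (simp_all add: times_dual_def one_dual_def)
  have t: "torus = ut ?K (0\<^sub>m m1 m2) (1\<^sub>m m2)" by (simp add: torus_def const_scalar)
  have KK: "?K * ?K' = 1\<^sub>m m1" "?K' * ?K = 1\<^sub>m m1"
    using kk by (auto simp: scalar_mult_mat[of _ m1 m1] intro!: eq_matI)
  have c: "?K \<in> carrier_mat m1 m1" "?K' \<in> carrier_mat m1 m1" "(0\<^sub>m m1 m2 :: 'f dual mat) \<in> carrier_mat m1 m2"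
    "(1\<^sub>m m2 :: 'f dual mat) \<in> carrier_mat m2 m2" by auto
  note a = gl_group_carrierD[OF A] and d = gl_group_carrierD[OF D]
  have "torus * ut ?K' (0\<^sub>m m1 m2) (1\<^sub>m m2) = 1\<^sub>m (m1 + m2)"
    unfolding t using ut_mult[OF c(1,3,4) c(2,3,4)] KK c by (simp add: ut_one)
  moreover have "ut ?K' (0\<^sub>m m1 m2) (1\<^sub>m m2) * torus = 1\<^sub>m (m1 + m2)"
    unfolding t using ut_mult[OF c(2,3,4) c(1,3,4)] KK c by (simp add: ut_one)
  ultimately have inv: "inv\<^bsub>GG\<^esub> torus = ut ?K' (0\<^sub>m m1 m2) (1\<^sub>m m2)"
    unfolding t by (intro gl_groupI(2)) (auto intro!: ut_carrier)
  have 1: "?k' \<cdot>\<^sub>m A \<in> carrier_mat m1 m1" "?k' \<cdot>\<^sub>m B \<in> carrier_mat m1 m2" using a B by auto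
  have "inv\<^bsub>GG\<^esub> torus * ut A B D = ut (?k' \<cdot>\<^sub>m A) (?k' \<cdot>\<^sub>m B) D"
    unfolding inv using ut_mult[OF c(2,3,4) a B d] a B d by (simp add: scalar_mult_mat)
  also have "\<dots> * torus = ut A (?k' \<cdot>\<^sub>m B) D"
  proof -
    have "?k \<cdot>\<^sub>m (?k' \<cdot>\<^sub>m A) = A"
      using kk by (intro eq_matI) (auto simp: mult.assoc[symmetric])
    then show ?thesis
      unfolding t using ut_mult[OF 1 d c(1,3,4)] 1(1) a d right_mult_one_mat[OF 1(2)] left_add_zero_mat[OF 1(2)]
      by (simp add: scalar_mult_mat)
  qed
  finally show ?thesis .
qed

lemma torus_conj_U0:
  assumes A: "A \<in> G1" and B: "B \<in> carrier_mat m1 m2" and D: "D \<in> G2" and U: "ut A B D \<in> U0"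
  shows "ut A B D \<in> G.conj_set torus U0 \<longleftrightarrow> B \<in> D.FM 1 m1 m2"
proof -
  let ?k' = "Dual (inverse unif) 0"
  have B': "?k' \<cdot>\<^sub>m B \<in> carrier_mat m1 m2" using B by simp
  have shift: "inverse unif * x \<in> pp 0 \<longleftrightarrow> x \<in> pp 1" for x
    using unif by (cases "x = 0") (auto simp: pp_def val_mult val_inverse)
  have "ut A B D \<in> G.conj_set torus U0 \<longleftrightarrow> ut A (?k' \<cdot>\<^sub>m B) D \<in> U0"
    using ut_group[OF A B D] torus_conj[OF A B D] by (simp add: G.conj_set_def)
  also have "\<dots> \<longleftrightarrow> ?k' \<cdot>\<^sub>m B \<in> D.FM 0 m1 m2"
    using ut_GL0_iff[OF A B' D] ut_GL0_iff[OF A B D] U parabolicI[OF A B' D] by auto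
  also have "\<dots> \<longleftrightarrow> B \<in> D.FM 1 m1 m2"
    using B by (auto simp: D.FM_def dpp_def shift)
  finally show ?thesis .
qed

text \<open>By \<open>torus_conj_U0\<close> the conjugate consists of the elements of U0 whose upper
  right block vanishes modulo the maximal ideal, so the cosets correspond to that block modulo
  \<open>dpp 1\<close>: m1 m2 entries with \<open>resq ^ 2\<close> classes each.\<close>

lemma index_torus: "G.index U0 (G.conj_set torus U0) = resq ^ (2 * m1 * m2)"
proof -
  obtain T where T: "finite T" "card T = resq ^ 2" "T \<subseteq> dpp 0"
    "\<And>x. x \<in> dpp 0 \<Longrightarrow> \<exists>t\<in>T. x - t \<in> dpp 1"
    "\<And>s t. s \<in> T \<Longrightarrow> t \<in> T \<Longrightarrow> s - t \<in> dpp 1 \<Longrightarrow> s = t"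
    using dual_residue_representatives by metis
  define rep where "rep x = (SOME t. t \<in> T \<and> x - t \<in> dpp 1)" for x
  have rep: "rep x \<in> T" "x - rep x \<in> dpp 1" if "x \<in> dpp 0" for x
    using someI_ex[of "\<lambda>t. t \<in> T \<and> x - t \<in> dpp 1"] T(4)[OF that] unfolding rep_def by blast+
  have rep_eq: "rep x = rep y \<longleftrightarrow> x - y \<in> dpp 1" if "x \<in> dpp 0" "y \<in> dpp 0" for x y
  proof
    assume "rep x = rep y"
    then show "x - y \<in> dpp 1" using D.filt_diff[OF rep(2)[OF that(1)] rep(2)[OF that(2)]] by simp
  next
    assume "x - y \<in> dpp 1"
    then have "(x - y) - (x - rep x) + (y - rep y) \<in> dpp 1"
      using rep[OF that(1)] rep[OF that(2)] by (intro D.filt_add D.filt_diff[of "x - y"])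
    then show "rep x = rep y" using rep[OF that(1)] rep[OF that(2)] by (intro T(5)) auto
  qed
  let ?I = "{..<m1} \<times> {..<m2}"
  \<comment> \<open>\<open>Y\<close> reads B D^-1 from the matrix. The factor D^-1 is what makes
    left cosets visible as congruence classes of \<open>Y\<close>.\<close>
  define Y where "Y u = mat m1 m2 (\<lambda>(i, j). u $$ (i, j + m1)) *
      inv\<^bsub>dual_group m2\<^esub> (mat m2 m2 (\<lambda>(i, j). u $$ (i + m1, j + m1)))" for u :: "'f dual mat"
  define f where "f u = (\<lambda>(i, j)\<in>?I. rep (Y u $$ (i, j)))" for u
  have Y: "Y (ut A B D) = B * inv\<^bsub>dual_group m2\<^esub> D"
    if "A \<in> carrier_mat m1 m1" "B \<in> carrier_mat m1 m2" "D \<in> carrier_mat m2 m2" for A B D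
  proof -
    have "mat m1 m2 (\<lambda>(i, j). ut A B D $$ (i, j + m1)) = B"
      "mat m2 m2 (\<lambda>(i, j). ut A B D $$ (i + m1, j + m1)) = D"
      unfolding ut_def using that by (auto intro!: eq_matI)
    then show ?thesis by (simp add: Y_def)
  qed
  have U0: "\<exists>A B D. u = ut A B D \<and> A \<in> G1 \<and> B \<in> carrier_mat m1 m2 \<and> D \<in> G2 \<and>
      A \<in> D.GL0 m1 \<and> B \<in> D.FM 0 m1 m2 \<and> D \<in> D.GL0 m2" if "u \<in> U0" for u
    using that ut_GL0_iff unfolding parabolic_def by blast
  have Y0: "Y u \<in> D.FM 0 m1 m2" if u: "u \<in> U0" for u
  proof -
    obtain A B D where "u = ut A B D" "A \<in> G1" "B \<in> D.FM 0 m1 m2" "D \<in> D.GL0 m2" "D \<in> G2"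
      using U0[OF u] by blast
    then show ?thesis
      using Y[OF gl_group_carrierD D.FM_carrier gl_group_carrierD] by (auto simp: D.GL0_def intro: D.FM_mult0)
  qed
  have f_eq: "f u = f u' \<longleftrightarrow> Y u' - Y u \<in> D.FM 1 m1 m2" if u: "u \<in> U0" "u' \<in> U0" for u u'
  proof -
    note y = Y0[OF u(1)] Y0[OF u(2)]
    have "f u = f u' \<longleftrightarrow> (\<forall>i<m1. \<forall>j<m2. rep (Y u' $$ (i, j)) = rep (Y u $$ (i, j)))"
      unfolding f_def by (auto simp: fun_eq_iff restrict_def split: if_splits)
    also have "\<dots> \<longleftrightarrow> (\<forall>i<m1. \<forall>j<m2. Y u' $$ (i, j) - Y u $$ (i, j) \<in> dpp 1)"
      using y by (simp add: rep_eq D.FM_def)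
    also have "\<dots> \<longleftrightarrow> Y u' - Y u \<in> D.FM 1 m1 m2"
      using D.FM_carrier[OF y(1)] D.FM_carrier[OF y(2)] by (auto simp: D.FM_def)
    finally show ?thesis .
  qed
  have "card (f ` U0) = G.index U0 (G.conj_set torus U0)"
  proof (rule G.card_image_eq_index(1))
    show "subgroup (G.conj_set torus U0) GG"
      using R.family_conj[OF R.base torus_parabolic] R.family_subgroup by blast
    show "U0 \<subseteq> carrier GG" by (auto simp: D.GL0_def)
    fix u u' assume u: "u \<in> U0" "u' \<in> U0"
    obtain A B D where 1: "u = ut A B D" "A \<in> G1" "B \<in> carrier_mat m1 m2" "D \<in> G2" "A \<in> D.GL0 m1"
      using U0[OF u(1)] by blast
    obtain A' B' D' where 2: "u' = ut A' B' D'" "A' \<in> G1" "B' \<in> carrier_mat m1 m2" "D' \<in> G2" "D' \<in> D.GL0 m2"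
      using U0[OF u(2)] by blast
    let ?A = "inv\<^bsub>dual_group m1\<^esub> A" and ?D = "inv\<^bsub>dual_group m2\<^esub> D"
    let ?D' = "inv\<^bsub>dual_group m2\<^esub> D'"
    note a = gl_group_carrierD[OF 1(2)] gl_group_inv[OF 1(2)] and d = gl_group_carrierD[OF 1(4)] gl_group_inv[OF 1(4)]
    note a' = gl_group_carrierD[OF 2(2)] and d' = gl_group_carrierD[OF 2(4)] gl_group_inv[OF 2(4)]
    let ?X = "?A * B' + - (?A * B * ?D) * D'"
    have c: "- (?A * B * ?D) \<in> carrier_mat m1 m2" "?A * B * ?D \<in> carrier_mat m1 m2" "?A * B' \<in> carrier_mat m1 m2"
      "B * ?D \<in> carrier_mat m1 m2" "B' * ?D' \<in> carrier_mat m1 m2" using a d d' 1 2 by auto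
    have prod: "inv\<^bsub>GG\<^esub> u * u' = ut (?A * A') ?X (?D * D')"
      unfolding 1(1) 2(1) ut_inverse[OF 1(2-4)] by (rule ut_mult[OF a(2) c(1) d(2) a' 2(3) d'(1)])
    have Xc: "?X \<in> carrier_mat m1 m2" using c d' by auto
    have "inv\<^bsub>GG\<^esub> u * u' \<in> U0"
      using u R.family_subgroup[OF R.base] subgroup.m_closed[of U0 GG "inv\<^bsub>GG\<^esub> u" u'] subgroup.m_inv_closed[of U0 GG u]
      by simp
    then have "inv\<^bsub>GG\<^esub> u * u' \<in> G.conj_set torus U0 \<longleftrightarrow> ?X \<in> D.FM 1 m1 m2"
      unfolding prod using 1 2 Xc by (intro torus_conj_U0 dual_mult dual_inv_closed)
    \<comment> \<open>The upper right block of u^-1 u' is the difference of the two values of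
      \<open>Y\<close> between invertible integral matrices, which do not affect membership in level
      1.\<close>
    also have "?X = ?A * (Y u' - Y u) * D'"
    proof -
      have "?A * (B' * ?D') * D' = ?A * B'"
      proof -
        have "?A * (B' * ?D') * D' = ?A * (B' * ?D' * D')" by (rule assoc_mult_mat[OF a(2) c(5) d'(1)])
        also have "B' * ?D' * D' = B' * (?D' * D')" by (rule assoc_mult_mat[OF 2(3) d'(2,1)])
        also have "\<dots> = B'" using right_mult_one_mat[OF 2(3)] by (simp add: d')
        finally show ?thesis .
      qed
      moreover have "?A * (B * ?D) * D' = ?A * B * ?D * D'"
        using assoc_mult_mat[OF a(2) 1(3) d(2)] by simp
      moreover have "?A * (B' * ?D' - B * ?D) * D' = ?A * (B' * ?D') * D' - ?A * (B * ?D) * D'"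
        using mult_minus_distrib_mat[OF a(2) c(5,4)]
          minus_mult_distrib_mat[OF mult_carrier_mat[OF a(2) c(5)] mult_carrier_mat[OF a(2) c(4)] d'(1)] by simp
      moreover have "- (?A * B * ?D) * D' = - (?A * B * ?D * D')"
        using carrier_matD[OF c(2)] carrier_matD[OF d'(1)] by (intro uminus_mult_left_mat) simp
      moreover have "?A * B * ?D * D' \<in> carrier_mat m1 m2" using c d' by auto
      ultimately show ?thesis
        unfolding 1(1) 2(1) Y[OF a(1) 1(3) d(1)] Y[OF a' 2(3) d'(1)]
        using c by (simp only: add_uminus_minus_mat)
    qed
    also have "\<dots> \<in> D.FM 1 m1 m2 \<longleftrightarrow> Y u' - Y u \<in> D.FM 1 m1 m2"
    proof
      assume "Y u' - Y u \<in> D.FM 1 m1 m2"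
      then show "?A * (Y u' - Y u) * D' \<in> D.FM 1 m1 m2"
        using 1(5) 2(5) by (intro D.FM_mult0(2)[OF D.FM_mult0(1)]) (auto simp: D.GL0_def)
    next
      let ?Z = "Y u' - Y u"
      assume Z: "?A * ?Z * D' \<in> D.FM 1 m1 m2"
      have Zc: "?Z \<in> carrier_mat m1 m2" using D.FM_carrier[OF Y0[OF u(1)]] by auto
      have "A \<in> D.FM 0 m1 m1" "?D' \<in> D.FM 0 m2 m2" using 1(5) 2(5) by (auto simp: D.GL0_def)
      then have "A * (?A * ?Z * D') * ?D' \<in> D.FM 1 m1 m2"
        by (rule D.FM_mult0(2)[OF D.FM_mult0(1)[OF _ Z]])
      moreover have "A * (?A * ?Z * D') * ?D' = ?Z"
      proof -
        have "A * (?A * ?Z * D') = A * (?A * (?Z * D'))" using assoc_mult_mat[OF a(2) Zc d'(1)] by simp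
        also have "\<dots> = (A * ?A) * (?Z * D')"
          by (rule assoc_mult_mat[OF a(1,2) mult_carrier_mat[OF Zc d'(1)], symmetric])
        also have "\<dots> = ?Z * D'" using left_mult_one_mat[OF mult_carrier_mat[OF Zc d'(1)]] by (simp add: a)
        finally have "A * (?A * ?Z * D') * ?D' = ?Z * D' * ?D'" by simp
        also have "\<dots> = ?Z * (D' * ?D')" by (rule assoc_mult_mat[OF Zc d'(1,2)])
        also have "\<dots> = ?Z" using right_mult_one_mat[OF Zc] by (simp add: d')
        finally show ?thesis .
      qed
      ultimately show "?Z \<in> D.FM 1 m1 m2" by simp
    qed
    finally show "f u = f u' \<longleftrightarrow> inv\<^bsub>GG\<^esub> u \<otimes>\<^bsub>GG\<^esub> u' \<in> G.conj_set torus U0"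
      using f_eq[OF u] by simp
  qed
  moreover have "f ` U0 = ?I \<rightarrow>\<^sub>E T"
  proof (intro equalityI subsetI)
    fix \<tau> assume "\<tau> \<in> f ` U0"
    then obtain u where u: "u \<in> U0" "\<tau> = f u" by blast
    have "rep (Y u $$ (i, j)) \<in> T" if "i < m1" "j < m2" for i j
      using Y0[OF u(1)] that by (intro rep) (simp add: D.FM_def)
    then show "\<tau> \<in> ?I \<rightarrow>\<^sub>E T" unfolding u(2) f_def by (auto split: if_splits)
  next
    fix \<tau> assume \<tau>: "\<tau> \<in> ?I \<rightarrow>\<^sub>E T"
    let ?B = "mat m1 m2 \<tau>"
    have B: "?B \<in> D.FM 0 m1 m2" using \<tau> T(3) by (auto simp: D.FM_def)
    have u: "ut (1\<^sub>m m1) ?B (1\<^sub>m m2) \<in> U0"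
      using ut_GL0_iff[OF dual_one _ dual_one, of ?B] parabolicI[OF dual_one _ dual_one, of ?B] B
        subgroup.one_closed[OF D.subgroup_GL0[of m1]] subgroup.one_closed[OF D.subgroup_GL0[of m2]] by auto
    have i1: "inv\<^bsub>dual_group m2\<^esub> (1\<^sub>m m2 :: 'f dual mat) = 1\<^sub>m m2"
      by (rule gl_groupI(2)) auto
    have "Y (ut (1\<^sub>m m1) ?B (1\<^sub>m m2)) = ?B" by (subst Y) (auto simp: i1)
    moreover have "rep t = t" if "t \<in> T" for t
      using rep[of t] that T(3) D.filt_uminus[of "t - rep t" 1] by (intro T(5)) auto
    ultimately have "f (ut (1\<^sub>m m1) ?B (1\<^sub>m m2)) (i, j) = \<tau> (i, j)" for i j
      using \<tau> unfolding f_def by (cases "i < m1 \<and> j < m2") (auto simp: PiE_iff extensional_def)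
    then have "f (ut (1\<^sub>m m1) ?B (1\<^sub>m m2)) = \<tau>" by (intro ext) (metis surj_pair)
    then show "\<tau> \<in> f ` U0" using u by (metis imageI)
  qed
  moreover have "card (?I \<rightarrow>\<^sub>E T) = resq ^ (2 * m1 * m2)"
    by (simp add: card_PiE T(2) power_mult[symmetric] mult.assoc)
  ultimately show ?thesis by simp
qed

lemma \<Delta>_torus: "\<Delta> torus = 1 / real resq ^ (2 * m1 * m2)"
proof -
  have fam: "G.conj_set torus U0 \<in> (\<inter>) parabolic ` D.compact_open (m1 + m2)"
    by (rule R.family_conj[OF R.base torus_parabolic])
  have sub: "G.conj_set torus U0 \<subseteq> U0"
  proof
    fix x assume x: "x \<in> G.conj_set torus U0"
    then have "x \<in> parabolic" using fam R.family_subset by blast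
    then obtain A B D where q: "x = ut A B D" "A \<in> G1" "B \<in> carrier_mat m1 m2" "D \<in> G2"
      by (auto simp: parabolic_def)
    let ?k' = "Dual (inverse unif) 0"
    have B': "?k' \<cdot>\<^sub>m B \<in> carrier_mat m1 m2" using q by simp
    have h: "ut A (?k' \<cdot>\<^sub>m B) D \<in> U0" using x torus_conj[OF q(2-4)] by (simp add: G.conj_set_def q(1))
    have "Dual unif 0 \<cdot>\<^sub>m (?k' \<cdot>\<^sub>m B) = B"
      using unif by (auto simp: smult_smult_assoc times_dual_def intro!: eq_matI dual.expand)
    moreover have "?k' \<cdot>\<^sub>m B \<in> D.FM 0 m1 m2" using h ut_GL0_iff[OF q(2) B' q(4)] by simp
    moreover have "Dual unif 0 \<in> dpp 0" using unif by (simp add: dpp_def pp_def)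
    then have "Dual unif 0 \<cdot>\<^sub>m Z \<in> D.FM 0 m1 m2" if "Z \<in> D.FM 0 m1 m2" for Z
      using that D.filt_mult[of "Dual unif 0" 0 _ 0] by (auto simp: D.FM_def)
    ultimately have "B \<in> D.FM 0 m1 m2" by metis
    then show "x \<in> U0"
      using h ut_GL0_iff[OF q(2) B' q(4)] ut_GL0_iff[OF q(2-4)] parabolicI[OF q(2-4)] q(1) by simp
  qed
  have "G.vol U0 U0 = G.index U0 (G.conj_set torus U0) * G.vol U0 (G.conj_set torus U0)"
    by (rule R.vol_index[OF R.base fam sub])
  then show ?thesis
    using resq_ge by (simp add: R.vol_base index_torus G.modulus_def field_simps)
qed

text \<open>A scalar in the first diagonal block conjugates the unipotent into an integral one, and
  a character with positive values is invariant under conjugation.\<close>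

lemma \<Delta>_unipotent:
  assumes Y: "Y \<in> carrier_mat m1 m2"
  shows "\<Delta> (ut (1\<^sub>m m1) Y (1\<^sub>m m2)) = 1"
proof -
  obtain r where r: "Y \<in> D.FM r m1 m2" using D.FM_exhaust[OF Y] by blast
  define t where "t = unif powi (- r)"
  have t: "t \<noteq> 0" "val t = - r" unfolding t_def using unif_powi by auto
  let ?u = "\<lambda>Y. ut (1\<^sub>m m1) Y (1\<^sub>m m2)"
  let ?k = "Dual t 0"
  let ?t = "ut (?k \<cdot>\<^sub>m 1\<^sub>m m1) (0\<^sub>m m1 m2) (1\<^sub>m m2)"
  have c: "?k \<cdot>\<^sub>m 1\<^sub>m m1 \<in> carrier_mat m1 m1" "(0\<^sub>m m1 m2 :: 'f dual mat) \<in> carrier_mat m1 m2"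
    "(1\<^sub>m m2 :: 'f dual mat) \<in> carrier_mat m2 m2" "(1\<^sub>m m1 :: 'f dual mat) \<in> carrier_mat m1 m1"
    "?k \<cdot>\<^sub>m Y \<in> carrier_mat m1 m2" using Y by auto
  have tP: "?t \<in> parabolic"
    using const_mat_group[OF scalar_GL[OF t(1)], of m1] by (intro parabolicI dual_one c) (simp add: const_scalar)
  have uP: "?u Y \<in> parabolic" "?u (?k \<cdot>\<^sub>m Y) \<in> parabolic" using Y c by (intro parabolicI dual_one; simp)+
  have "?k \<in> dpp (- r)" using t by (simp add: dpp_def pp_def)
  then have "?k \<cdot>\<^sub>m Y \<in> D.FM 0 m1 m2"
    using r D.filt_mult[of ?k "- r" _ r] by (auto simp: D.FM_def)
  then have "?u (?k \<cdot>\<^sub>m Y) \<in> D.GL0 (m1 + m2)"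
    using ut_GL0_iff[OF dual_one c(5) dual_one] subgroup.one_closed[OF D.subgroup_GL0[of m1]]
      subgroup.one_closed[OF D.subgroup_GL0[of m2]] by simp
  then have 1: "\<Delta> (?u (?k \<cdot>\<^sub>m Y)) = 1" using \<Delta>_compact[OF uP(2) D.GL0_compact_open] by blast
  have "?t * ?u Y = ut (?k \<cdot>\<^sub>m 1\<^sub>m m1) (?k \<cdot>\<^sub>m Y) (1\<^sub>m m2)"
    using ut_mult[OF c(1-3) c(4) Y c(3)] c Y by (simp add: scalar_mult_mat)
  moreover have "?u (?k \<cdot>\<^sub>m Y) * ?t = ut (?k \<cdot>\<^sub>m 1\<^sub>m m1) (?k \<cdot>\<^sub>m Y) (1\<^sub>m m2)"
    using ut_mult[OF c(4,5,3) c(1-3)] c right_mult_one_mat[OF c(5)] by simp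
  ultimately have "\<Delta> ?t * \<Delta> (?u Y) = \<Delta> (?u (?k \<cdot>\<^sub>m Y)) * \<Delta> ?t"
    using \<Delta>_mult[OF tP uP(1)] \<Delta>_mult[OF uP(2) tP] by simp
  then show ?thesis using 1 R.modulus_pos[OF tP] by simp
qed

text \<open>The upper right block and all infinitesimal parts contribute one, leaving a and b to the
  powers of the valuations of the two determinants. The torus element determines a; the centre of
  the whole group gives a^m1 b^m2 = 1 and hence b.\<close>

lemma \<Delta>_formula:
  assumes A: "A \<in> G1" and B: "B \<in> carrier_mat m1 m2" and D: "D \<in> G2"
  shows "\<Delta> (ut A B D) = real resq powi (2 * int m1 * val (det (std_mat D)) - 2 * int m2 * val (det (std_mat A)))"
proof -
  let ?j1 = "\<lambda>A. ut A (0\<^sub>m m1 m2) (1\<^sub>m m2)" and ?j2 = "\<lambda>D. ut (1\<^sub>m m1) (0\<^sub>m m1 m2) D"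
  have o: "(0\<^sub>m m1 m2 :: 'f dual mat) \<in> carrier_mat m1 m2" "(1\<^sub>m m2 :: 'f dual mat) \<in> carrier_mat m2 m2"
    "(1\<^sub>m m1 :: 'f dual mat) \<in> carrier_mat m1 m1" by auto
  have jP: "?j1 A \<in> parabolic" if "A \<in> G1" for A using that by (intro parabolicI dual_one o)
  have jP2: "?j2 D \<in> parabolic" if "D \<in> G2" for D using that by (intro parabolicI dual_one o)
  have j1: "\<Delta> (?j1 (A * A')) = \<Delta> (?j1 A) * \<Delta> (?j1 A')" if "A \<in> G1" "A' \<in> G1" for A A'
  proof -
    note c = gl_group_carrierD[OF that(1)] gl_group_carrierD[OF that(2)]
    have "?j1 A * ?j1 A' = ?j1 (A * A')" using ut_mult[OF c(1) o(1,2) c(2) o(1,2)] c by simp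
    then show ?thesis using \<Delta>_mult[OF jP jP] that by metis
  qed
  have j2: "\<Delta> (?j2 (D * D')) = \<Delta> (?j2 D) * \<Delta> (?j2 D')" if "D \<in> G2" "D' \<in> G2" for D D'
  proof -
    note c = gl_group_carrierD[OF that(1)] gl_group_carrierD[OF that(2)]
    have "?j2 D * ?j2 D' = ?j2 (D * D')" using ut_mult[OF o(3,1) c(1) o(3,1) c(2)] c by simp
    then show ?thesis using \<Delta>_mult[OF jP2 jP2] that by metis
  qed
  have one0: "1\<^sub>m m1 \<in> D.GL0 m1" "1\<^sub>m m2 \<in> D.GL0 m2"
    using subgroup.one_closed[OF D.subgroup_GL0[of m1]] subgroup.one_closed[OF D.subgroup_GL0[of m2]] by auto
  have "\<exists>a>0. \<forall>g\<in>GL m1. \<Delta> (?j1 (const_mat g)) = a powi val (det g)"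
  proof (rule unramified_character)
    fix g h :: "'f mat" assume "g \<in> GL m1" "h \<in> GL m1"
    then show "\<Delta> (?j1 (const_mat (g * h))) = \<Delta> (?j1 (const_mat g)) * \<Delta> (?j1 (const_mat h))"
      using j1[OF const_mat_group const_mat_group] const_mat_mult[OF GL_carrier GL_carrier] by metis
  next
    fix g :: "'f mat" assume "g \<in> GL m1"
    then show "\<Delta> (?j1 (const_mat g)) > 0" by (intro R.modulus_pos jP const_mat_group)
  next
    fix g assume g: "g \<in> F.GL0 m1"
    have "?j1 (const_mat g) \<in> D.GL0 (m1 + m2)"
      using ut_GL0_iff[OF const_mat_group o(1) dual_one] const_mat_GL0[OF g] GL0_GL[OF g] one0 D.FM_zero by blast
    then show "\<Delta> (?j1 (const_mat g)) = 1"
      using g by (intro \<Delta>_compact[OF _ D.GL0_compact_open] jP const_mat_group GL0_GL)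
  qed
  then obtain a where a: "a > 0" "\<And>g. g \<in> GL m1 \<Longrightarrow> \<Delta> (?j1 (const_mat g)) = a powi val (det g)" by blast
  have "\<exists>a>0. \<forall>g\<in>GL m2. \<Delta> (?j2 (const_mat g)) = a powi val (det g)"
  proof (rule unramified_character)
    fix g h :: "'f mat" assume "g \<in> GL m2" "h \<in> GL m2"
    then show "\<Delta> (?j2 (const_mat (g * h))) = \<Delta> (?j2 (const_mat g)) * \<Delta> (?j2 (const_mat h))"
      using j2[OF const_mat_group const_mat_group] const_mat_mult[OF GL_carrier GL_carrier] by metis
  next
    fix g :: "'f mat" assume "g \<in> GL m2"
    then show "\<Delta> (?j2 (const_mat g)) > 0" by (intro R.modulus_pos jP2 const_mat_group)
  next
    fix g assume g: "g \<in> F.GL0 m2"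
    have "?j2 (const_mat g) \<in> D.GL0 (m1 + m2)"
      using ut_GL0_iff[OF dual_one o(1) const_mat_group] const_mat_GL0[OF g] GL0_GL[OF g] one0 D.FM_zero by blast
    then show "\<Delta> (?j2 (const_mat g)) = 1"
      using g by (intro \<Delta>_compact[OF _ D.GL0_compact_open] jP2 const_mat_group GL0_GL)
  qed
  then obtain b where b: "b > 0" "\<And>g. g \<in> GL m2 \<Longrightarrow> \<Delta> (?j2 (const_mat g)) = b powi val (det g)" by blast
  have q: "real resq > 0" using resq_ge by simp
  have "\<Delta> torus = a ^ m1"
    using a(2)[OF scalar_GL[OF unif(1)]] unfolding torus_def by (simp only: val_det_scalar) simp
  then have "a ^ m1 = (1 / real resq ^ (2 * m2)) ^ m1"
    unfolding \<Delta>_torus by (simp add: power_divide power_mult[symmetric] mult_ac)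
  then have a_eq: "a = 1 / real resq ^ (2 * m2)"
    using a(1) m1 q by (subst (asm) power_eq_iff_eq_base) auto
  have k1: "const_mat (unif \<cdot>\<^sub>m 1\<^sub>m m1) \<in> G1" "const_mat (unif \<cdot>\<^sub>m 1\<^sub>m m2) \<in> G2"
    using unif by (auto intro: const_mat_group scalar_GL)
  \<comment> \<open>The two scalar blocks together form a central element, of modulus one; this ties
    b to a.\<close>
  have "?j1 (const_mat (unif \<cdot>\<^sub>m 1\<^sub>m m1)) * ?j2 (const_mat (unif \<cdot>\<^sub>m 1\<^sub>m m2)) = const_mat (unif \<cdot>\<^sub>m 1\<^sub>m (m1 + m2))"
  proof -
    note c = gl_group_carrierD[OF k1(1)] gl_group_carrierD[OF k1(2)]
    have "ut (Dual unif 0 \<cdot>\<^sub>m 1\<^sub>m m1) (0\<^sub>m m1 m2) (Dual unif 0 \<cdot>\<^sub>m 1\<^sub>m m2) = Dual unif 0 \<cdot>\<^sub>m 1\<^sub>m (m1 + m2)"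
      unfolding ut_def by (auto intro!: eq_matI)
    then show ?thesis using ut_mult[OF c(1) o(1,2) o(3,1) c(2)] c by (simp add: const_scalar)
  qed
  moreover have "\<Delta> (const_mat (unif \<cdot>\<^sub>m 1\<^sub>m (m1 + m2))) = 1"
  proof (rule R.modulus_central)
    show "const_mat (unif \<cdot>\<^sub>m 1\<^sub>m (m1 + m2)) \<in> parabolic"
      using calculation subgroup.m_closed[OF subgroup_parabolic jP[OF k1(1)] jP2[OF k1(2)]] by simp
  qed (simp add: const_central)
  ultimately have "\<Delta> (?j1 (const_mat (unif \<cdot>\<^sub>m 1\<^sub>m m1))) * \<Delta> (?j2 (const_mat (unif \<cdot>\<^sub>m 1\<^sub>m m2))) = 1"
    using \<Delta>_mult[OF jP[OF k1(1)] jP2[OF k1(2)]] by simp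
  then have "a ^ m1 * b ^ m2 = 1"
    using a(2)[OF scalar_GL[OF unif(1)]] b(2)[OF scalar_GL[OF unif(1)]] by (simp only: val_det_scalar) simp
  then have "b ^ m2 = (real resq ^ (2 * m1)) ^ m2"
    unfolding a_eq using q by (simp add: power_divide power_mult[symmetric] field_simps mult_ac)
  then have b_eq: "b = real resq ^ (2 * m1)"
    using b(1) m2 q by (subst (asm) power_eq_iff_eq_base) auto
  note ac = gl_group_carrierD[OF A] and dc = gl_group_carrierD[OF D]
  have 1: "\<Delta> (?j1 A) = a powi val (det (std_mat A))"
  proof -
    obtain x where x: "x \<in> carrier_mat m1 m1" "A = dual_mat (1\<^sub>m m1) x * const_mat (std_mat A)"
      using unipotent_decomposition[OF A] by blast
    have g: "std_mat A \<in> GL m1" using A by (simp add: dual_group_iff)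
    have N: "dual_mat (1\<^sub>m m1) x \<in> G1"
      using x(1) dual_mat_parts(1)[of "1\<^sub>m m1" m1 m1 x] by (intro dual_groupI) (simp_all add: GL_one)
    \<comment> \<open>Padded with zero blocks, the element is an infinitesimal unipotent of the
      large group and lies in a compact open subgroup there.\<close>
    let ?x = "four_block_mat x (0\<^sub>m m1 m2) (0\<^sub>m m2 m1) (0\<^sub>m m2 m2)"
    have "?j1 (dual_mat (1\<^sub>m m1) x) = dual_mat (1\<^sub>m (m1 + m2)) ?x"
      using ut_std[OF gl_group_carrierD[OF N] o(1,2)] x(1)
      by (intro dual_mat_eqI) (auto simp: std_mat_simps dual_mat_parts[of _ m1 m1] dual_mat_parts[of _ "m1 + m2" "m1 + m2"])
    then obtain K where "K \<in> D.compact_open (m1 + m2)" "?j1 (dual_mat (1\<^sub>m m1) x) \<in> K"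
      using unipotent_fat_compact[of ?x "m1 + m2"] x(1) by auto
    then have "\<Delta> (?j1 (dual_mat (1\<^sub>m m1) x)) = 1" by (rule \<Delta>_compact[OF jP[OF N]])
    then show ?thesis using j1[OF N const_mat_group[OF g]] x(2) a(2)[OF g] by simp
  qed
  have 2: "\<Delta> (?j2 D) = b powi val (det (std_mat D))"
  proof -
    obtain x where x: "x \<in> carrier_mat m2 m2" "D = dual_mat (1\<^sub>m m2) x * const_mat (std_mat D)"
      using unipotent_decomposition[OF D] by blast
    have g: "std_mat D \<in> GL m2" using D by (simp add: dual_group_iff)
    have N: "dual_mat (1\<^sub>m m2) x \<in> G2"
      using x(1) dual_mat_parts(1)[of "1\<^sub>m m2" m2 m2 x] by (intro dual_groupI) (simp_all add: GL_one)
    let ?x = "four_block_mat (0\<^sub>m m1 m1) (0\<^sub>m m1 m2) (0\<^sub>m m2 m1) x"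
    have "?j2 (dual_mat (1\<^sub>m m2) x) = dual_mat (1\<^sub>m (m1 + m2)) ?x"
      using ut_std[OF o(3,1) gl_group_carrierD[OF N]] x(1)
      by (intro dual_mat_eqI) (auto simp: std_mat_simps dual_mat_parts[of _ m2 m2] dual_mat_parts[of _ "m1 + m2" "m1 + m2"])
    then obtain K where "K \<in> D.compact_open (m1 + m2)" "?j2 (dual_mat (1\<^sub>m m2) x) \<in> K"
      using unipotent_fat_compact[of ?x "m1 + m2"] x(1) by auto
    then have "\<Delta> (?j2 (dual_mat (1\<^sub>m m2) x)) = 1" by (rule \<Delta>_compact[OF jP2[OF N]])
    then show ?thesis using j2[OF N const_mat_group[OF g]] x(2) b(2)[OF g] by simp
  qed
  let ?Y = "B * inv\<^bsub>dual_group m2\<^esub> D"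
  have Y: "?Y \<in> carrier_mat m1 m2" using B gl_group_inv(1)[OF D] by simp
  have YD: "?Y * D = B"
    using assoc_mult_mat[OF B gl_group_inv(1)[OF D] dc] gl_group_inv(3)[OF D] right_mult_one_mat[OF B] by simp
  have "?j1 A * ?j2 D = ut A (0\<^sub>m m1 m2) D" using ut_mult[OF ac o(1,2) o(3,1) dc] ac dc by simp
  moreover have "ut (1\<^sub>m m1) ?Y (1\<^sub>m m2) * ut A (0\<^sub>m m1 m2) D = ut A B D"
    using ut_mult[OF o(3) Y o(2) ac o(1) dc] ac dc YD B by simp
  moreover have "ut (1\<^sub>m m1) ?Y (1\<^sub>m m2) \<in> parabolic" "ut A (0\<^sub>m m1 m2) D \<in> parabolic"
    using A D Y o by (auto intro!: parabolicI dual_one)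
  ultimately have "\<Delta> (ut A B D) = \<Delta> (?j1 A) * \<Delta> (?j2 D)"
    using \<Delta>_mult[of "ut (1\<^sub>m m1) ?Y (1\<^sub>m m2)" "ut A (0\<^sub>m m1 m2) D"] \<Delta>_mult[OF jP[OF A] jP2[OF D]]
      \<Delta>_unipotent[OF Y] by simp
  also have "\<dots> = real resq powi (2 * int m1 * val (det (std_mat D)) - 2 * int m2 * val (det (std_mat A)))"
  proof -
    have "b = real resq powi (2 * int m1)" unfolding b_eq using power_int_of_nat[of "real resq" "2 * m1"] by simp
    moreover have "a = real resq powi (- 2 * int m2)"
      unfolding a_eq using power_int_minus[of "real resq" "int (2 * m2)"]
      by (simp add: power_int_of_nat inverse_eq_divide del: of_nat_mult) (simp add: power_int_def nat_mult_distrib inverse_eq_divide power_one_over)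
    ultimately show ?thesis
      unfolding 1 2 using q by (simp add: power_int_mult[symmetric] power_int_add[symmetric] algebra_simps)
  qed
  finally show ?thesis .
qed

sublocale H: relative_haar GG parabolic "D.compact_open (m1 + m2)" "D.GL0 (m1 + m2)"
proof (rule relative_haar.intro[OF group_gl_group relative_haar_axioms.intro])
  fix s assume "s \<in> carrier GG"
  then show "G.modulus (D.GL0 (m1 + m2)) s = 1" using m1 by (intro dual_group_unimodular) simp_all
qed (rule total_family relative_family)+

end

section \<open>The Shalika subgroup and its character\<close>

text \<open>The action of F[e] on F^2, entrywise in block form. Rectangular matrices are allowed
  because it is applied to off-diagonal blocks too.\<close>

definition block_embed :: "'a::zero dual mat \<Rightarrow> 'a mat" where
  "block_embed A = four_block_mat (std_mat A) (eps_mat A) (0\<^sub>m (dim_row A) (dim_col A)) (std_mat A)"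

lemma block_embed_carrier [simp]:
  "A \<in> carrier_mat nr nc \<Longrightarrow> block_embed A \<in> carrier_mat (nr + nr) (nc + nc)"
  by (simp add: block_embed_def)

lemma block_embed_mult:
  fixes A B :: "'a::comm_ring_1 dual mat"
  assumes A: "A \<in> carrier_mat nr n" and B: "B \<in> carrier_mat n nc"
  shows "block_embed (A * B) = block_embed A * block_embed B"
proof -
  have d: "dim_row A = nr" "dim_col A = n" "dim_row B = n" "dim_col B = nc" using A B by auto
  have "block_embed A * block_embed B = four_block_mat (std_mat A * std_mat B + eps_mat A * 0\<^sub>m n nc)
      (std_mat A * eps_mat B + eps_mat A * std_mat B) (0\<^sub>m nr n * std_mat B + std_mat A * 0\<^sub>m n nc)
      (0\<^sub>m nr n * eps_mat B + std_mat A * std_mat B)"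
    unfolding block_embed_def d using A B by (intro mult_four_block_mat) auto
  then show ?thesis
    using A B std_mat_mult[OF A B] eps_mat_mult[OF A B] by (simp add: block_embed_def)
qed

lemma block_embed_one: "block_embed (1\<^sub>m n) = (1\<^sub>m (n + n) :: 'a::comm_ring_1 mat)"
  by (simp add: block_embed_def std_mat_simps)

lemma block_embed_zero: "block_embed (0\<^sub>m nr nc) = (0\<^sub>m (nr + nr) (nc + nc) :: 'a::comm_ring_1 mat)"
  by (simp add: block_embed_def std_mat_simps)

lemma mat_trace_add:
  "A \<in> carrier_mat n n \<Longrightarrow> B \<in> carrier_mat n n \<Longrightarrow> mat_trace (A + B) = mat_trace A + mat_trace B"
  by (auto simp: mat_trace_def sum.distrib)

lemma mat_trace_zero: "mat_trace (0\<^sub>m n n) = 0"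
  by (simp add: mat_trace_def)

lemma mat_trace_commute:
  assumes "A \<in> carrier_mat n m" "B \<in> carrier_mat m n"
  shows "mat_trace (A * B) = mat_trace (B * A)"
proof -
  have d: "dim_row (A * B) = n" "dim_row (B * A) = m" using assms by auto
  have "mat_trace (A * B) = (\<Sum>i<n. \<Sum>k<m. A $$ (i, k) * B $$ (k, i))"
    unfolding mat_trace_def d by (rule sum.cong[OF refl], rule mult_mat_entry[OF assms]) auto
  also have "\<dots> = (\<Sum>k<m. \<Sum>i<n. B $$ (k, i) * A $$ (i, k))"
    by (subst sum.swap) (simp add: mult.commute)
  also have "\<dots> = mat_trace (B * A)"
    unfolding mat_trace_def d
    by (rule sum.cong[OF refl], rule mult_mat_entry[OF assms(2,1), symmetric]) auto
  finally show ?thesis .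
qed

lemma mat_trace_four_block:
  assumes "A \<in> carrier_mat n n" "D \<in> carrier_mat m m"
  shows "mat_trace (four_block_mat A B C D) = mat_trace A + mat_trace D"
proof -
  have split: "(\<Sum>i<n + m. f i) = (\<Sum>i<n. f i) + (\<Sum>i<m. f (i + n))" for f :: "nat \<Rightarrow> 'a"
    by (induction m) (auto simp: add_ac)
  have "mat_trace (four_block_mat A B C D) = (\<Sum>i<n + m. four_block_mat A B C D $$ (i, i))"
    using assms by (simp add: mat_trace_def)
  also have "\<dots> = mat_trace A + mat_trace D"
    unfolding split mat_trace_def using assms by (auto intro!: arg_cong2[of _ _ _ _ "(+)"] sum.cong)
  finally show ?thesis .
qed

context nonarchimedean_local_field
begin

text \<open>The determinant is a square, which makes the square root in \<open>sqrt_modulus\<close>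
  an integral power of \<open>resq\<close>.\<close>

lemma block_embed_GL:
  assumes "s \<in> carrier (dual_group k)"
  shows "block_embed s \<in> GL (k + k)" "det (block_embed s) = det (std_mat s) ^ 2"
proof -
  have s: "s \<in> carrier_mat k k" "std_mat s \<in> GL k" using assms by (auto simp: dual_group_iff)
  have "eps_mat s \<in> carrier_mat k k" using s by simp
  note four_block_GL[OF s(2) this s(2)]
  then show "block_embed s \<in> GL (k + k)" "det (block_embed s) = det (std_mat s) ^ 2"
    using s(1) by (simp_all add: block_embed_def power2_eq_square)
qed

lemma block_embed_GL0:
  assumes "s \<in> D.GL0 k"
  shows "block_embed s \<in> F.GL0 (k + k)"
proof -
  have s: "std_mat s \<in> F.GL0 k" "eps_mat s \<in> F.FM 0 k k" using assms by (auto simp: dual_GL0_iff)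
  then have "s \<in> carrier_mat k k" using GL0_carrier by fastforce
  then show ?thesis using four_block_GL0[OF s s(1)] by (simp add: block_embed_def)
qed

lemma block_embed_congruence:
  assumes "s \<in> D.congruence r k"
  shows "block_embed s \<in> F.congruence r (k + k)"
proof -
  have s: "s \<in> carrier_mat k k" "s - 1\<^sub>m k \<in> D.FM r k k" using assms by (auto simp: D.congruence_def)
  have "block_embed s - 1\<^sub>m (k + k)
      = four_block_mat (std_mat (s - 1\<^sub>m k)) (eps_mat (s - 1\<^sub>m k)) (0\<^sub>m k k) (std_mat (s - 1\<^sub>m k))"
    unfolding block_embed_def using s(1) by (intro eq_matI) auto
  also have "\<dots> \<in> F.FM r (k + k) (k + k)"
    using s(2) by (intro F.FM_four_block F.FM_zero) (auto simp: dual_FM_iff)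
  finally show ?thesis using s(1) by (simp add: F.congruence_def)
qed

text \<open>\<open>shalika_element k x g\<close> is the image of g + e x g; conversely x = z g^-1
  recovers the Shalika coordinates of g + e z.\<close>

lemma shalika_subgroup_eq: "(shalika_subgroup k :: 'f mat set) = block_embed ` carrier (dual_group k)"
proof (intro equalityI subsetI)
  fix h :: "'f mat" assume "h \<in> shalika_subgroup k"
  then obtain x g where h: "h = shalika_element k x g" "x \<in> carrier_mat k k" "g \<in> GL k"
    by (auto simp: shalika_subgroup_def)
  have c: "g \<in> carrier_mat k k" "x * g \<in> carrier_mat k k"
    using GL_carrier[OF h(3)] mult_carrier_mat[OF h(2) GL_carrier[OF h(3)]] by auto
  have "dual_mat g (x * g) \<in> carrier (dual_group k)"
    using h c by (intro dual_groupI) (simp_all add: dual_mat_parts[OF c])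
  moreover have "h = block_embed (dual_mat g (x * g))"
    using h(1,2) c carrier_matD[OF dual_mat_carrier[OF c(1), of "x * g"]]
    by (simp add: shalika_element_eq block_embed_def dual_mat_parts[OF c])
  ultimately show "h \<in> block_embed ` carrier (dual_group k)" by blast
next
  fix h assume "h \<in> block_embed ` carrier (dual_group k)"
  then obtain s where s: "s \<in> carrier (dual_group k)" "h = block_embed s" by blast
  have sc: "s \<in> carrier_mat k k" "std_mat s \<in> GL k" using s by (auto simp: dual_group_iff)
  obtain g where g: "g \<in> GL k" "g * std_mat s = 1\<^sub>m k" using GL_inverse[OF sc(2)] by blast
  have c: "eps_mat s \<in> carrier_mat k k" "g \<in> carrier_mat k k" "std_mat s \<in> carrier_mat k k" using sc g GL_carrier by auto
  have "eps_mat s * g * std_mat s = eps_mat s * (g * std_mat s)" using c by (intro assoc_mult_mat)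
  then have e: "eps_mat s * g * std_mat s = eps_mat s" unfolding g(2) using right_mult_one_mat[OF c(1)] by simp
  have "h = shalika_element k (eps_mat s * g) (std_mat s)"
    unfolding s(2) shalika_element_eq[OF mult_carrier_mat[OF c(1,2)] c(3)] e block_embed_def
    using sc(1) by simp
  then show "h \<in> shalika_subgroup k"
    unfolding shalika_subgroup_def using mult_carrier_mat[OF c(1,2)] sc(2) by blast
qed

lemma shalika_character_block_embed:
  assumes s: "s \<in> carrier (dual_group k)" and x: "x \<in> carrier_mat k k" and eq: "eps_mat s = x * std_mat s"
  shows "shalika_character \<theta> k (block_embed s) = \<theta> (mat_trace x)"
proof -
  have sc: "s \<in> carrier_mat k k" "std_mat s \<in> GL k" using s by (auto simp: dual_group_iff)
  have "block_embed s = shalika_element k x (std_mat s)"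
    using sc x eq by (simp add: shalika_element_eq block_embed_def)
  then show ?thesis using shalika_character_eq[OF x sc(2)] by simp
qed

lemma dual_group_infinitesimal:
  assumes s: "s \<in> carrier (dual_group k)"
  obtains x where "x \<in> carrier_mat k k" "eps_mat s = x * std_mat s"
proof -
  have sc: "s \<in> carrier_mat k k" "std_mat s \<in> GL k" using s by (auto simp: dual_group_iff)
  obtain g where g: "g \<in> GL k" "g * std_mat s = 1\<^sub>m k" using GL_inverse[OF sc(2)] by blast
  have c: "eps_mat s \<in> carrier_mat k k" "g \<in> carrier_mat k k" "std_mat s \<in> carrier_mat k k" using sc g GL_carrier by auto
  have "eps_mat s * g * std_mat s = eps_mat s * (g * std_mat s)" using c by (intro assoc_mult_mat)
  then have "eps_mat s = eps_mat s * g * std_mat s" unfolding g(2) using right_mult_one_mat[OF c(1)] by simp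
  then show ?thesis using that[of "eps_mat s * g"] mult_carrier_mat[OF c(1,2)] by blast
qed

end

locale local_field_character = nonarchimedean_local_field val for val :: "'f::field \<Rightarrow> int" +
  fixes \<theta> :: "'f \<Rightarrow> complex"
  assumes \<theta>_smooth: "smooth_additive_character val \<theta>" and \<theta>_nontrivial: "\<exists>x. \<theta> x \<noteq> 1"
begin

lemma \<theta>_add: "\<theta> (x + y) = \<theta> x * \<theta> y" and \<theta>_nonzero: "\<theta> x \<noteq> 0"
  using \<theta>_smooth by (auto simp: smooth_additive_character_def)

lemma \<theta>_zero: "\<theta> 0 = 1"
  using \<theta>_add[of 0 0] \<theta>_nonzero[of 0] by simp

lemma \<theta>_conductor: "\<exists>r. \<forall>x\<in>pp r. \<theta> x = 1"
proof -
  have "0 \<in> topspace (field_topology val)" by simp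
  then obtain U where U: "openin (field_topology val) U" "0 \<in> U" "\<forall>y\<in>U. \<theta> y = \<theta> 0"
    using \<theta>_smooth unfolding smooth_additive_character_def locally_constant_on_def by blast
  then obtain r where "\<forall>y. y - 0 \<in> pp r \<longrightarrow> y \<in> U" unfolding openin_field_topology by blast
  then show ?thesis using U(3) \<theta>_zero by (intro exI[of _ r]) auto
qed

definition Th :: "nat \<Rightarrow> 'f dual mat \<Rightarrow> complex" where
  "Th k s = shalika_character \<theta> k (block_embed s)"

lemma Th_eq:
  "s \<in> carrier (dual_group k) \<Longrightarrow> x \<in> carrier_mat k k \<Longrightarrow> eps_mat s = x * std_mat s \<Longrightarrow> Th k s = \<theta> (mat_trace x)"
  unfolding Th_def by (rule shalika_character_block_embed)

lemma Th_nonzero: "s \<in> carrier (dual_group k) \<Longrightarrow> Th k s \<noteq> 0"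
  using dual_group_infinitesimal[of s k] Th_eq \<theta>_nonzero by metis

text \<open>(1 + e x) g (1 + e y) h = (1 + e (x + g y g^-1)) g h, and the trace does not see the
  conjugation of y by g. The matrix \<open>i\<close> below is g^-1.\<close>

lemma Th_mult:
  assumes s: "s \<in> carrier (dual_group k)" and t: "t \<in> carrier (dual_group k)"
  shows "Th k (s * t) = Th k s * Th k t"
proof -
  obtain x where x: "x \<in> carrier_mat k k" "eps_mat s = x * std_mat s" using dual_group_infinitesimal[OF s] by blast
  obtain y where y: "y \<in> carrier_mat k k" "eps_mat t = y * std_mat t" using dual_group_infinitesimal[OF t] by blast
  have sc: "s \<in> carrier_mat k k" "std_mat s \<in> GL k" and tc: "t \<in> carrier_mat k k" "std_mat t \<in> GL k"
    using s t by (auto simp: dual_group_iff)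
  let ?g = "std_mat s" and ?h = "std_mat t"
  obtain i where i: "i \<in> GL k" "i * ?g = 1\<^sub>m k" using GL_inverse[OF sc(2)] by blast
  have c: "?g \<in> carrier_mat k k" "?h \<in> carrier_mat k k" "i \<in> carrier_mat k k" using sc tc i GL_carrier by auto
  note m = mult_carrier_mat[of _ k k _ k] and as = assoc_mult_mat[of _ k k _ k _ k]
  let ?z = "x + ?g * y * i"
  have "(?g * y * i) * (?g * ?h) = ?g * y * (i * (?g * ?h))" using c y by (intro as m)
  also have "i * (?g * ?h) = (i * ?g) * ?h" using c by (intro as[symmetric])
  also have "\<dots> = ?h" using c by (simp add: i)
  also have "?g * y * ?h = ?g * (y * ?h)" using c y by (intro as)
  finally have 1: "(?g * y * i) * (?g * ?h) = ?g * eps_mat t" by (simp add: y)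
  have 2: "x * (?g * ?h) = eps_mat s * ?h" using as[OF x(1) c(1,2)] by (simp add: x)
  have "?z * (?g * ?h) = x * (?g * ?h) + (?g * y * i) * (?g * ?h)"
    using c x y by (intro add_mult_distrib_mat[of _ k k _ _ k]) auto
  then have "?z * (?g * ?h) = eps_mat s * ?h + ?g * eps_mat t" by (simp add: 1 2)
  also have "\<dots> = eps_mat (s * t)"
    unfolding eps_mat_mult[OF sc(1) tc(1)] using sc tc by (intro comm_add_mat[of _ k k]) auto
  finally have e: "eps_mat (s * t) = ?z * std_mat (s * t)" by (simp add: std_mat_mult[OF sc(1) tc(1)])
  have st: "s * t \<in> carrier (dual_group k)"
    using s t group.is_monoid[OF group_gl_group[of k]] monoid.m_closed[of "dual_group k" s t] by simp
  have zc: "?z \<in> carrier_mat k k" using c x y by auto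
  have "mat_trace ?z = mat_trace x + mat_trace (?g * y * i)"
    using c x y by (intro mat_trace_add) auto
  also have "mat_trace (?g * y * i) = mat_trace (i * (?g * y))" using c y by (intro mat_trace_commute) auto
  also have "i * (?g * y) = (i * ?g) * y" using c y by (intro as[symmetric])
  also have "\<dots> = y" using y by (simp add: i)
  finally show ?thesis
    using Th_eq[OF st zc e] Th_eq[OF s x] Th_eq[OF t y] by (simp add: \<theta>_add)
qed

text \<open>Here x is the infinitesimal part times an integral inverse, so it is as small as that
  part, and \<theta> is trivial on a small enough ideal.\<close>

lemma Th_congruence: "\<exists>r\<ge>1. \<forall>s\<in>D.congruence r k. Th k s = 1"
proof -
  obtain r0 where r0: "\<And>x. x \<in> pp r0 \<Longrightarrow> \<theta> x = 1" using \<theta>_conductor by blast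
  define r where "r = max 1 r0"
  have r: "r \<ge> 1" "r0 \<le> r" by (auto simp: r_def)
  have "Th k s = 1" if s: "s \<in> D.congruence r k" for s
  proof -
    have sG: "s \<in> carrier (dual_group k)" and s0: "std_mat s \<in> F.GL0 k"
      using subsetD[OF D.congruence_GL0[OF r(1)] s] dual_GL0_iff by (auto simp: D.GL0_def)
    have sc: "s \<in> carrier_mat k k" using sG by (rule gl_group_carrierD)
    obtain i where i: "i \<in> F.GL0 k" "i * std_mat s = 1\<^sub>m k" using GL0_inverse[OF s0] by blast
    have "eps_mat s = eps_mat (s - 1\<^sub>m k)" using sc by (auto intro!: eq_matI)
    then have z: "eps_mat s \<in> F.FM r k k" using s by (auto simp: D.congruence_def dual_FM_iff)
    then have x: "eps_mat s * i \<in> F.FM r k k" using i by (intro F.FM_mult0) (auto simp: GL0_iff)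
    have "eps_mat s * i * std_mat s = eps_mat s * (i * std_mat s)"
      using sc GL0_carrier[OF i(1)] by (intro assoc_mult_mat) auto
    then have e: "eps_mat s = eps_mat s * i * std_mat s" using i sc by simp
    have "mat_trace (eps_mat s * i) \<in> pp r"
      unfolding mat_trace_def using x F.FM_carrier[OF x] by (intro F.filt_sum) (auto simp: F.FM_def)
    then show ?thesis using Th_eq[OF sG F.FM_carrier[OF x] e] r0 pp_mono[OF _ r(2)] by simp
  qed
  then show ?thesis using r by blast
qed

end

section \<open>Embedding the Shalika subgroup compatibly with the parabolic\<close>

context local_field_blocks
begin

abbreviation "n1 \<equiv> m1 + m1"
abbreviation "n2 \<equiv> m2 + m2"
abbreviation "nn \<equiv> n1 + n2"

text \<open>Row \<open>i\<close> of the permuted matrix is row \<open>shuffle i\<close> of the original one: the coordinates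
  \<open>(a\<^sub>1, a\<^sub>2, b\<^sub>1, b\<^sub>2)\<close> of the Shalika subgroup are rearranged to \<open>(a\<^sub>1, b\<^sub>1, a\<^sub>2, b\<^sub>2)\<close>.\<close>

definition shuffle :: "nat \<Rightarrow> nat" where
  "shuffle i = (if i < m1 then i else if i < n1 then i + m2 else if i < n1 + m2 then i - m1 else i)"

definition wmat :: "'f mat" where
  "wmat = mat nn nn (\<lambda>(i, j). if j = shuffle i then 1 else 0)"

definition wmat' :: "'f mat" where
  "wmat' = mat nn nn (\<lambda>(i, j). if i = shuffle j then 1 else 0)"

text \<open>The conjugate of the Shalika subgroup by the permutation matrix; \<open>wmat'\<close> is
  the inverse of \<open>wmat\<close>.\<close>

definition embed :: "'f dual mat \<Rightarrow> 'f mat" where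
  "embed s = wmat * block_embed s * wmat'"

lemma shuffle_less: "i < nn \<Longrightarrow> shuffle i < nn"
  by (auto simp: shuffle_def)

lemma shuffle_inj: "i < nn \<Longrightarrow> j < nn \<Longrightarrow> shuffle i = shuffle j \<longleftrightarrow> i = j"
  by (auto simp: shuffle_def split: if_splits)

lemma wmat_carrier [simp]: "wmat \<in> carrier_mat nn nn" "wmat' \<in> carrier_mat nn nn"
  by (auto simp: wmat_def wmat'_def)

lemma wmat_mult_entry:
  assumes "X \<in> carrier_mat nn k" "i < nn" "j < k"
  shows "(wmat * X) $$ (i, j) = X $$ (shuffle i, j)"
proof -
  have "(wmat * X) $$ (i, j) = (\<Sum>l<nn. wmat $$ (i, l) * X $$ (l, j))"
    using assms by (intro mult_mat_entry) auto
  also have "\<dots> = (\<Sum>l<nn. if l = shuffle i then X $$ (l, j) else 0)"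
    using assms by (intro sum.cong) (auto simp: wmat_def)
  also have "\<dots> = X $$ (shuffle i, j)" using shuffle_less[OF assms(2)] by simp
  finally show ?thesis .
qed

lemma mult_wmat'_entry:
  assumes "X \<in> carrier_mat k nn" "i < k" "j < nn"
  shows "(X * wmat') $$ (i, j) = X $$ (i, shuffle j)"
proof -
  have "(X * wmat') $$ (i, j) = (\<Sum>l<nn. X $$ (i, l) * wmat' $$ (l, j))"
    using assms by (intro mult_mat_entry) auto
  also have "\<dots> = (\<Sum>l<nn. if l = shuffle j then X $$ (i, l) else 0)"
    using assms by (intro sum.cong) (auto simp: wmat'_def)
  also have "\<dots> = X $$ (i, shuffle j)" using shuffle_less[OF assms(3)] by simp
  finally show ?thesis .
qed

lemma wmat_inverse: "wmat * wmat' = 1\<^sub>m nn" "wmat' * wmat = 1\<^sub>m nn"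
proof -
  show *: "wmat * wmat' = 1\<^sub>m nn"
  proof (rule eq_matI)
    fix i j assume ij: "i < dim_row (1\<^sub>m nn)" "j < dim_col (1\<^sub>m nn)"
    then have "(wmat * wmat') $$ (i, j) = wmat' $$ (shuffle i, j)"
      by (intro wmat_mult_entry[of _ nn]) auto
    then show "(wmat * wmat') $$ (i, j) = 1\<^sub>m nn $$ (i, j)"
      using ij shuffle_less[of i] shuffle_inj[of i j] by (auto simp: wmat'_def)
  qed (auto simp: wmat_def wmat'_def)
  show "wmat' * wmat = 1\<^sub>m nn" by (rule mat_mult_left_right_inverse[OF _ _ *]) auto
qed

lemma wmat_GL0: "wmat \<in> F.GL0 nn" "wmat' \<in> F.GL0 nn"
proof -
  have "wmat \<in> F.FM 0 nn nn" "wmat' \<in> F.FM 0 nn nn"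
    by (auto simp: wmat_def wmat'_def F.FM_def pp_def val_one)
  then show "wmat \<in> F.GL0 nn" "wmat' \<in> F.GL0 nn"
    using gl_groupI[of wmat nn wmat'] gl_groupI[of wmat' nn wmat] wmat_inverse by (simp_all add: F.GL0_def)
qed

lemma wmat_GL: "wmat \<in> GL nn"
  using wmat_GL0(1) by (rule GL0_GL)

lemma nn_eq: "m1 + m2 + (m1 + m2) = nn" by simp

lemma block_embed_nn: "s \<in> carrier_mat (m1 + m2) (m1 + m2) \<Longrightarrow> block_embed s \<in> carrier_mat nn nn"
  using block_embed_carrier[of s "m1 + m2" "m1 + m2"] by (simp only: nn_eq)

lemma embed_carrier: "s \<in> carrier_mat (m1 + m2) (m1 + m2) \<Longrightarrow> embed s \<in> carrier_mat nn nn"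
  unfolding embed_def using block_embed_nn wmat_carrier by (meson mult_carrier_mat)

lemma embed_mult:
  assumes s: "s \<in> carrier_mat (m1 + m2) (m1 + m2)" and t: "t \<in> carrier_mat (m1 + m2) (m1 + m2)"
  shows "embed (s * t) = embed s * embed t"
proof -
  note c = block_embed_nn[OF s] block_embed_nn[OF t] wmat_carrier
  note m = mult_carrier_mat[of _ nn nn _ nn] and as = assoc_mult_mat[of _ nn nn _ nn _ nn]
  let ?S = "block_embed s" and ?T = "block_embed t"
  have "embed s * embed t = wmat * ?S * (wmat' * (wmat * ?T * wmat'))"
    unfolding embed_def using c by (intro as m)
  also have "wmat' * (wmat * ?T * wmat') = wmat' * (wmat * (?T * wmat'))" using c by (subst as) (auto intro: m)
  also have "\<dots> = (wmat' * wmat) * (?T * wmat')" using c by (intro as[symmetric] m)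
  also have "\<dots> = ?T * wmat'" using left_mult_one_mat[OF m[OF c(2,4)]] by (simp add: wmat_inverse)
  also have "wmat * ?S * (?T * wmat') = wmat * ?S * ?T * wmat'" using c by (intro as[symmetric] m)
  also have "wmat * ?S * ?T = wmat * (?S * ?T)" using c by (intro as)
  finally show ?thesis by (simp add: embed_def block_embed_mult[OF s t])
qed

lemma embed_wmat:
  assumes s: "s \<in> carrier_mat (m1 + m2) (m1 + m2)"
  shows "embed s * wmat = wmat * block_embed s"
proof -
  note c = block_embed_nn[OF s] wmat_carrier
  have "embed s * wmat = wmat * block_embed s * (wmat' * wmat)"
    unfolding embed_def using c by (intro assoc_mult_mat[of _ nn nn _ nn _ nn] mult_carrier_mat[of _ nn nn _ nn])
  then show ?thesis using right_mult_one_mat[OF mult_carrier_mat[OF c(2,1)]] by (simp add: wmat_inverse)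
qed

lemma block_embed_GL_nn: "s \<in> carrier GG \<Longrightarrow> block_embed s \<in> GL nn"
  using block_embed_GL(1)[of s "m1 + m2"] by (simp only: nn_eq)

lemma block_embed_GL0_nn: "s \<in> D.GL0 (m1 + m2) \<Longrightarrow> block_embed s \<in> F.GL0 nn"
  using block_embed_GL0[of s "m1 + m2"] by (simp only: nn_eq)

lemma block_embed_congruence_nn: "s \<in> D.congruence r (m1 + m2) \<Longrightarrow> block_embed s \<in> F.congruence r nn"
  using block_embed_congruence[of s r "m1 + m2"] by (simp only: nn_eq)

lemma embed_GL: "s \<in> carrier GG \<Longrightarrow> embed s \<in> GL nn"
  unfolding embed_def using block_embed_GL_nn wmat_GL GL0_GL[OF wmat_GL0(2)] by (intro GL_mult)

lemma shuffle_cases: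
  assumes "i < nn"
  obtains i0 where "i0 < m1" "i = i0" "shuffle i = i0"
  | i0 where "i0 < m1" "i = m1 + i0" "shuffle i = m1 + m2 + i0"
  | i0 where "i0 < m2" "i = n1 + i0" "shuffle i = m1 + i0"
  | i0 where "i0 < m2" "i = n1 + (m2 + i0)" "shuffle i = m1 + m2 + (m1 + i0)"
proof -
  consider "i < m1" | "m1 \<le> i" "i < n1" | "n1 \<le> i" "i < n1 + m2" | "n1 + m2 \<le> i" by linarith
  then show thesis
  proof cases
    case 1 then show ?thesis using that(1)[of i] by (simp add: shuffle_def)
  next
    case 2 then show ?thesis using that(2)[of "i - m1"] by (simp add: shuffle_def)
  next
    case 3 then show ?thesis using that(3)[of "i - n1"] by (simp add: shuffle_def)
  next
    case 4 then show ?thesis using that(4)[of "i - (n1 + m2)"] assms by (simp add: shuffle_def)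
  qed
qed

lemma block_embed_entry:
  assumes "X \<in> carrier_mat p q" "i < p + p" "j < q + q"
  shows "block_embed X $$ (i, j) = (if i < p then if j < q then std (X $$ (i, j)) else eps (X $$ (i, j - q))
      else if j < q then 0 else std (X $$ (i - p, j - q)))"
  using assms by (auto simp: block_embed_def)

text \<open>The shuffle brings together the standard and infinitesimal coordinates of each diagonal
  block. So a block matrix over F[e] becomes the block matrix of the images, and the parabolic over
  F[e] lands in P with the two smaller Shalika subgroups on the diagonal.\<close>

lemma embed_four_block:
  assumes "A \<in> carrier_mat m1 m1" "B \<in> carrier_mat m1 m2" "C \<in> carrier_mat m2 m1" "D \<in> carrier_mat m2 m2"
  shows "embed (four_block_mat A B C D)
    = four_block_mat (block_embed A) (block_embed B) (block_embed C) (block_embed D)"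
    (is "_ = ?R")
proof (rule eq_matI)
  let ?s = "four_block_mat A B C D"
  have s: "?s \<in> carrier_mat (m1 + m2) (m1 + m2)" using assms by simp
  note d = assms[THEN carrier_matD(1)] assms[THEN carrier_matD(2)]
  fix i j assume "i < dim_row ?R" "j < dim_col ?R"
  then have ij: "i < nn" "j < nn" using d by (auto simp: block_embed_def)
  have "embed ?s $$ (i, j) = block_embed ?s $$ (shuffle i, shuffle j)"
    unfolding embed_def
    using mult_wmat'_entry[of "wmat * block_embed ?s" nn i j] wmat_mult_entry[OF block_embed_nn[OF s], of i "shuffle j"]
      block_embed_nn[OF s] wmat_carrier ij shuffle_less[of j] by (metis mult_carrier_mat)
  also have "\<dots> = ?R $$ (i, j)"
  proof -
    note e = block_embed_entry[OF s] block_embed_entry[OF assms(1)] block_embed_entry[OF assms(2)]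
      block_embed_entry[OF assms(3)] block_embed_entry[OF assms(4)]
    have dr: "dim_row (block_embed A) = n1" "dim_col (block_embed A) = n1"
      "dim_row (block_embed D) = n2" "dim_col (block_embed D) = n2"
      using d by (simp_all add: block_embed_def)
    show ?thesis
      by (rule shuffle_cases[OF ij(1)]; rule shuffle_cases[OF ij(2)]; simp add: e d dr)
  qed
  finally show "embed ?s $$ (i, j) = ?R $$ (i, j)" .
qed (use assms in \<open>auto simp: embed_def wmat_def wmat'_def block_embed_def\<close>)

lemma four_block_split:
  assumes "s \<in> carrier_mat (m1 + m2) (m1 + m2)"
  obtains A B C D where "A \<in> carrier_mat m1 m1" "B \<in> carrier_mat m1 m2" "C \<in> carrier_mat m2 m1"
    "D \<in> carrier_mat m2 m2" "s = four_block_mat A B C D"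
proof -
  obtain A B C D where sp: "split_block s m1 m1 = (A, B, C, D)" by (metis prod_cases4)
  show ?thesis using split_block[OF sp, of m2 m2] assms by (intro that) auto
qed

lemma embed_ut:
  assumes "A \<in> carrier_mat m1 m1" "B \<in> carrier_mat m1 m2" "D \<in> carrier_mat m2 m2"
  shows "embed (ut A B D) = four_block_mat (block_embed A) (block_embed B) (0\<^sub>m n2 n1) (block_embed D)"
  unfolding ut_def using embed_four_block[of A B "0\<^sub>m m2 m1" D] assms by (simp add: block_embed_zero)

end

section \<open>The functional on the induced representation\<close>

lemma mat_add_diff:
  "E \<in> carrier_mat nr nc \<Longrightarrow> P \<in> carrier_mat nr nc \<Longrightarrow> P + (E - P) = (E :: 'a::ab_group_add mat)"
  by (intro eq_matI) auto

text \<open>Moves an upper unipotent from the right of a lower one to its left, where it becomes an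
  element of P. The hypothesis Y X = 0 removes the correction in the upper left block and the one in
  X.\<close>

lemma lower_upper_commute:
  fixes X Y :: "'a::comm_ring_1 mat"
  assumes X: "X \<in> carrier_mat q p" and Y: "Y \<in> carrier_mat p q" and YX: "Y * X = 0\<^sub>m p p"
  shows "four_block_mat (1\<^sub>m p) (0\<^sub>m p q) X (1\<^sub>m q) * four_block_mat (1\<^sub>m p) Y (0\<^sub>m q p) (1\<^sub>m q)
    = four_block_mat (1\<^sub>m p) Y (0\<^sub>m q p) (1\<^sub>m q + X * Y) * four_block_mat (1\<^sub>m p) (0\<^sub>m p q) X (1\<^sub>m q)"
proof -
  note z = zero_carrier_mat and o = one_carrier_mat
  have XY: "X * Y \<in> carrier_mat q q" "1\<^sub>m q + X * Y \<in> carrier_mat q q" using X Y by auto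
  have "X * Y * X = X * (Y * X)" by (rule assoc_mult_mat[OF X Y X])
  also have "\<dots> = 0\<^sub>m q p" unfolding YX using right_mult_zero_mat[OF X] by simp
  finally have "(1\<^sub>m q + X * Y) * X = X"
    using add_mult_distrib_mat[OF o XY(1) X] X by simp
  then show ?thesis
    unfolding mult_four_block_mat[OF o z X o o Y z o] mult_four_block_mat[OF o Y z XY(2) o z X o]
    using X Y XY YX comm_add_mat[OF XY(1) o] right_mult_one_mat[OF XY(2)] by simp
qed

lemma clinear_complex_iff:
  "clinear (f :: 'a::complex_vector \<Rightarrow> complex) \<longleftrightarrow>
    (\<forall>x y. f (x + y) = f x + f y) \<and> (\<forall>c x. f (c *\<^sub>C x) = c * f x)"
  by (subst clinear_iff) (simp add: scaleC_complex_def)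

section \<open>The integrand: equivariance, smoothness and support\<close>

locale shalika_pair = local_field_blocks val m1 m2 + local_field_character val \<theta>
  for val :: "'f::field \<Rightarrow> int" and m1 m2 :: nat and \<theta> :: "'f \<Rightarrow> complex" +
  fixes \<pi>1 :: "'f mat \<Rightarrow> 'v::complex_vector \<Rightarrow> 'v" and \<pi>2 :: "'f mat \<Rightarrow> 'w::complex_vector \<Rightarrow> 'w"
    and l1 :: "'v \<Rightarrow> complex" and l2 :: "'w \<Rightarrow> complex"
  assumes rep1: "smooth_representation val (m1 + m1) UNIV \<pi>1"
    and rep2: "smooth_representation val (m2 + m2) UNIV \<pi>2"
    and hom1: "l1 \<in> Hom_character (shalika_subgroup m1) UNIV \<pi>1 (shalika_character \<theta> m1)"
    and hom2: "l2 \<in> Hom_character (shalika_subgroup m2) UNIV \<pi>2 (shalika_character \<theta> m2)"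
begin

abbreviation "V \<equiv> induced_space val n1 n2 \<pi>1 \<pi>2"

lemma \<pi>1_linear: "g \<in> GL n1 \<Longrightarrow> clinear (\<pi>1 g)" and \<pi>2_linear: "h \<in> GL n2 \<Longrightarrow> clinear (\<pi>2 h)"
  using rep1 rep2 by (auto simp: smooth_representation_def clinear_iff)

lemma \<pi>_mult: "g \<in> GL n1 \<Longrightarrow> g' \<in> GL n1 \<Longrightarrow> \<pi>1 (g * g') v = \<pi>1 g (\<pi>1 g' v)"
  "h \<in> GL n2 \<Longrightarrow> h' \<in> GL n2 \<Longrightarrow> \<pi>2 (h * h') u = \<pi>2 h (\<pi>2 h' u)"
  "\<pi>1 (1\<^sub>m n1) v = v" "\<pi>2 (1\<^sub>m n2) u = u"
  using rep1 rep2 by (auto simp: smooth_representation_def)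

lemma l_linear: "l1 (v + v') = l1 v + l1 v'" "l1 (c *\<^sub>C v) = c * l1 v"
  "l2 (u + u') = l2 u + l2 u'" "l2 (c *\<^sub>C u) = c * l2 u"
  using hom1 hom2 by (auto simp: Hom_character_def linear_functional_on_def)

lemma l_equivariant:
  "a \<in> G1 \<Longrightarrow> l1 (\<pi>1 (block_embed a) v) = Th m1 a * l1 v"
  "d \<in> G2 \<Longrightarrow> l2 (\<pi>2 (block_embed d) u) = Th m2 d * l2 u"
  using hom1 hom2 unfolding Hom_character_def shalika_subgroup_eq Th_def by auto

definition lam :: "('v, 'w) tensor \<Rightarrow> complex" where
  "lam = (SOME L. clinear L \<and> (\<forall>v u. L (tens v u) = l1 v * l2 u))"

lemma lam: "clinear lam" "lam (tens v u) = l1 v * l2 u"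
proof -
  obtain L where "clinear L" "\<And>v u. L (tens v u) = l1 v * l2 u"
    by (rule tensor_lift[of "\<lambda>v u. l1 v * l2 u"])
      (simp_all add: clinear_complex_iff l_linear algebra_simps)
  then have "\<exists>L. clinear L \<and> (\<forall>v u. L (tens v u) = l1 v * l2 u)" by blast
  from someI_ex[OF this] show "clinear lam" "lam (tens v u) = l1 v * l2 u" unfolding lam_def by auto
qed

lemma lam_linear: "lam (x + y) = lam x + lam y" "lam (c *\<^sub>C x) = c * lam x" "lam 0 = 0"
proof -
  show 1: "lam (x + y) = lam x + lam y" "lam (c *\<^sub>C x) = c * lam x" for x y c
    using lam(1) by (simp_all add: clinear_complex_iff)
  show "lam 0 = 0" using 1(1)[of 0 0] by simp
qed

lemma lam_equivariant:
  assumes a: "a \<in> G1" and d: "d \<in> G2"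
  shows "lam (tensor_map (\<pi>1 (block_embed a)) (\<pi>2 (block_embed d)) t) = Th m1 a * Th m2 d * lam t"
proof -
  note props = tensor_map_props[OF \<pi>1_linear[OF block_embed_GL(1)[OF a]] \<pi>2_linear[OF block_embed_GL(1)[OF d]]]
  have "(\<lambda>t. lam (tensor_map (\<pi>1 (block_embed a)) (\<pi>2 (block_embed d)) t)) = (\<lambda>t. Th m1 a * Th m2 d * lam t)"
  proof (rule tensor_map_unique)
    show "clinear (\<lambda>t. lam (tensor_map (\<pi>1 (block_embed a)) (\<pi>2 (block_embed d)) t))"
      using props(1) lam_linear by (simp add: clinear_complex_iff) (simp add: clinear_iff)
    show "clinear (\<lambda>t. Th m1 a * Th m2 d * lam t)"
      using lam_linear by (simp add: clinear_complex_iff algebra_simps)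
  qed (simp add: props(2) lam(2) l_equivariant(1)[OF a] l_equivariant(2)[OF d])
  then show ?thesis by meson
qed

text \<open>The determinants are squares and n1, n2 are even, so the modulus of P is the square of a
  power of \<open>resq\<close>; its root has exactly the exponent occurring in
  \<open>\<Delta>_formula\<close>.\<close>

lemma sqrt_modulus:
  assumes "x \<noteq> 0" "y \<noteq> 0"
  shows "sqrt (normalised_abs val (x ^ 2) ^ n2 * normalised_abs val (y ^ 2) powi (- int n1))
    = real resq powi (2 * int m1 * val y - 2 * int m2 * val x)"
proof -
  have q: "real resq > 0" using resq_ge by simp
  have ab: "normalised_abs val (z ^ 2) = real resq powi (- 2 * val z)" if "z \<noteq> 0" for z
    using that by (simp add: normalised_abs_simps val_power)
  have "normalised_abs val (x ^ 2) ^ n2 * normalised_abs val (y ^ 2) powi (- int n1)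
      = (real resq powi (- 2 * val x)) powi int n2 * (real resq powi (- 2 * val y)) powi (- int n1)"
    by (simp only: ab[OF assms(1)] ab[OF assms(2)] power_int_of_nat)
  also have "\<dots> = real resq powi (- 2 * val x * int n2 + (- 2 * val y) * (- int n1))"
    using q by (simp only: power_int_mult[symmetric]) (rule power_int_add[symmetric], simp)
  also have "- 2 * val x * int n2 + (- 2 * val y) * (- int n1)
      = (2 * int m1 * val y - 2 * int m2 * val x) * 2"
    by (simp add: algebra_simps)
  also have "real resq powi \<dots> = (real resq powi (2 * int m1 * val y - 2 * int m2 * val x)) ^ 2"
    by (simp only: power_int_mult) simp
  finally show ?thesis by simp
qed

lemma induced_lam:
  assumes f: "f \<in> V" and a: "a \<in> G1" and d: "d \<in> G2" and b: "b \<in> carrier_mat n1 n2" and g: "g \<in> GL nn"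
  shows "lam (f (four_block_mat (block_embed a) b (0\<^sub>m n2 n1) (block_embed d) * g))
    = of_real (real resq powi (2 * int m1 * val (det (std_mat d)) - 2 * int m2 * val (det (std_mat a))))
      * (Th m1 a * Th m2 d) * lam (f g)"
proof -
  note aG = block_embed_GL[OF a] and dG = block_embed_GL[OF d]
  have nz: "det (std_mat a) \<noteq> 0" "det (std_mat d) \<noteq> 0"
    using a d GL_iff_det GL_carrier by (auto simp: dual_group_iff)
  have "f (four_block_mat (block_embed a) b (0\<^sub>m n2 n1) (block_embed d) * g)
      = complex_of_real (sqrt (parabolic_modulus val n1 n2 (block_embed a) (block_embed d))) *\<^sub>C
        tensor_map (\<pi>1 (block_embed a)) (\<pi>2 (block_embed d)) (f g)"
    using f aG(1) dG(1) b g by (simp add: induced_space_def)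
  then show ?thesis
    by (simp only: lam_linear lam_equivariant[OF a d] parabolic_modulus_def aG(2) dG(2) sqrt_modulus[OF nz] mult.assoc)
qed

text \<open>Local constancy gives a uniform level on the compact group \<open>F.GL0\<close>. By
  \<open>iwasawa_block\<close> every g is p k with k there, and left equivariance under p carries
  the level to all of the group.\<close>

lemma induced_uniform:
  assumes f: "f \<in> V"
  shows "\<exists>r\<ge>1. \<forall>g\<in>GL nn. \<forall>h\<in>F.congruence r nn. f (g * h) = f g"
proof -
  have "locally_constant_on (GL_topology val nn) f" using f by (simp add: induced_space_def)
  then obtain r where r: "r \<ge> 1" "\<And>k h. k \<in> F.GL0 nn \<Longrightarrow> h \<in> F.congruence r nn \<Longrightarrow> f (k * h) = f k"
    using uniform_on_GL0 by blast
  have "f (g * h) = f g" if g: "g \<in> GL nn" and h: "h \<in> F.congruence r nn" for g h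
  proof -
    obtain a b d k where p: "a \<in> GL n1" "b \<in> carrier_mat n1 n2" "d \<in> GL n2" "k \<in> F.GL0 nn"
      "g = four_block_mat a b (0\<^sub>m n2 n1) d * k" using iwasawa_block[OF g] by blast
    let ?p = "four_block_mat a b (0\<^sub>m n2 n1) d"
    have hG: "h \<in> F.GL0 nn" using h F.congruence_GL0[OF r(1)] by blast
    have eq: "f (?p * x) = complex_of_real (sqrt (parabolic_modulus val n1 n2 a d)) *\<^sub>C tensor_map (\<pi>1 a) (\<pi>2 d) (f x)"
      if "x \<in> GL nn" for x
      using f p(1-3) that by (simp add: induced_space_def)
    have "g * h = ?p * (k * h)"
      unfolding p(5) by (rule assoc_mult_mat[OF GL_carrier[OF four_block_GL(1)[OF p(1-3)]] GL0_carrier[OF p(4)] GL0_carrier[OF hG]])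
    then show ?thesis
      using eq[OF GL0_GL[OF GL0_mult[OF p(4) hG]]] eq[OF GL0_GL[OF p(4)]] r(2)[OF p(4) h] p(5) by simp
  qed
  then show ?thesis using r(1) by blast
qed

text \<open>The argument \<open>embed s * wmat\<close> also equals
  \<open>wmat * block_embed s\<close>: the first form exhibits left equivariance under P, the second
  shows that right multiplication of s is right translation of f.\<close>

definition phi :: "('f mat \<Rightarrow> ('v, 'w) tensor) \<Rightarrow> 'f dual mat \<Rightarrow> complex" where
  "phi f s = lam (f (embed s * wmat)) / Th (m1 + m2) s"

lemma embed_wmat_GL: "s \<in> carrier GG \<Longrightarrow> embed s * wmat \<in> GL nn"
  by (intro GL_mult embed_GL wmat_GL)

text \<open>The matrix z g^-1 of a block upper triangular element is again block upper triangular,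
  and its trace only involves the diagonal blocks x and y.\<close>

lemma Th_ut:
  assumes A: "A \<in> G1" and B: "B \<in> carrier_mat m1 m2" and D: "D \<in> G2"
  shows "Th (m1 + m2) (ut A B D) = Th m1 A * Th m2 D"
proof -
  note a = gl_group_carrierD[OF A] and d = gl_group_carrierD[OF D]
  obtain x where x: "x \<in> carrier_mat m1 m1" "eps_mat A = x * std_mat A" using dual_group_infinitesimal[OF A] by blast
  obtain y where y: "y \<in> carrier_mat m2 m2" "eps_mat D = y * std_mat D" using dual_group_infinitesimal[OF D] by blast
  have "std_mat D \<in> GL m2" using D by (simp add: dual_group_iff)
  then obtain i where i: "i \<in> GL m2" "i * std_mat D = 1\<^sub>m m2" using GL_inverse by blast
  have c: "std_mat A \<in> carrier_mat m1 m1" "std_mat B \<in> carrier_mat m1 m2" "std_mat D \<in> carrier_mat m2 m2"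
    "eps_mat B \<in> carrier_mat m1 m2" "i \<in> carrier_mat m2 m2" using a B d GL_carrier[OF i(1)] by auto
  \<comment> \<open>Solves x std B + u std D = eps B, the upper right block of the equation that
    determines z g^-1; \<open>i\<close> is the inverse of std D.\<close>
  let ?u = "(eps_mat B - x * std_mat B) * i"
  have bc: "eps_mat B - x * std_mat B \<in> carrier_mat m1 m2" "x * std_mat B \<in> carrier_mat m1 m2"
    using c x mult_carrier_mat[OF x(1) c(2)] by auto
  have uc: "?u \<in> carrier_mat m1 m2" by (rule mult_carrier_mat[OF bc(1) c(5)])
  have "?u * std_mat D = (eps_mat B - x * std_mat B) * (i * std_mat D)"
    by (rule assoc_mult_mat[OF bc(1) c(5,3)])
  then have u: "?u * std_mat D = eps_mat B - x * std_mat B" using i right_mult_one_mat[OF bc(1)] by simp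
  have e1: "x * std_mat A + ?u * 0\<^sub>m m2 m1 = eps_mat A"
    unfolding right_mult_zero_mat[OF uc] x(2) by (rule right_add_zero_mat[OF mult_carrier_mat[OF x(1) c(1)]])
  have e2: "x * std_mat B + ?u * std_mat D = eps_mat B"
    unfolding u by (rule mat_add_diff[OF c(4) bc(2)])
  have e3: "0\<^sub>m m2 m1 * std_mat A + y * 0\<^sub>m m2 m1 = 0\<^sub>m m2 m1"
    using c y by simp
  have e4: "0\<^sub>m m2 m1 * std_mat B + y * std_mat D = eps_mat D"
    unfolding left_mult_zero_mat[OF c(2)] y(2) by (rule left_add_zero_mat[OF mult_carrier_mat[OF y(1) c(3)]])
  have "eps_mat (ut A B D) = four_block_mat x ?u (0\<^sub>m m2 m1) y * std_mat (ut A B D)"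
    unfolding ut_std[OF a B d]
      mult_four_block_mat[OF x(1) uc zero_carrier_mat y(1) c(1,2) zero_carrier_mat c(3)] e1 e2 e3 e4 ..
  then have "Th (m1 + m2) (ut A B D) = \<theta> (mat_trace (four_block_mat x ?u (0\<^sub>m m2 m1) y))"
    using x y by (intro Th_eq ut_group A B D) auto
  also have "\<dots> = Th m1 A * Th m2 D"
    using x y Th_eq[OF A x] Th_eq[OF D y] by (simp add: mat_trace_four_block \<theta>_add)
  finally show ?thesis .
qed

text \<open>The functional \<open>lam\<close> turns the Levi action into
  \<open>Th m1 A * Th m2 D\<close>, which cancels against \<open>Th_ut\<close>; the root of the
  modulus of P remains and equals \<Delta> by \<open>\<Delta>_formula\<close>.\<close>

lemma phi_equivariant:
  assumes f: "f \<in> V"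
  shows "H.equivariant (phi f)"
  unfolding H.equivariant_def
proof (intro ballI)
  fix q s assume q: "q \<in> parabolic" and s: "s \<in> carrier GG"
  obtain A B D where e: "q = ut A B D" "A \<in> G1" "B \<in> carrier_mat m1 m2" "D \<in> G2"
    using q by (auto simp: parabolic_def)
  note a = gl_group_carrierD[OF e(2)] and d = gl_group_carrierD[OF e(4)] and sc = gl_group_carrierD[OF s]
  have qG: "q \<in> carrier GG" using q subgroup.subset[OF subgroup_parabolic] by blast
  note qc = gl_group_carrierD[OF qG]
  have Bc: "block_embed B \<in> carrier_mat n1 n2" using e(3) by simp
  have "embed (q * s) * wmat = embed q * (embed s * wmat)"
    unfolding embed_mult[OF qc sc]
    by (rule assoc_mult_mat[OF embed_carrier[OF qc] embed_carrier[OF sc] wmat_carrier(1)])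
  also have "\<dots> = four_block_mat (block_embed A) (block_embed B) (0\<^sub>m n2 n1) (block_embed D) * (embed s * wmat)"
    unfolding e(1) embed_ut[OF a e(3) d] ..
  finally have "lam (f (embed (q * s) * wmat)) = of_real (\<Delta> q) * (Th m1 A * Th m2 D) * lam (f (embed s * wmat))"
    using induced_lam[OF f e(2,4) Bc embed_wmat_GL[OF s]] \<Delta>_formula[OF e(2-4)] e(1) by simp
  then show "phi f (q \<otimes>\<^bsub>GG\<^esub> s) = of_real (\<Delta> q) * phi f s"
    using Th_mult[OF qG s] Th_ut[OF e(2-4)] Th_nonzero[OF e(2)] Th_nonzero[OF e(4)] e(1)
    by (simp add: phi_def)
qed

lemma phi_right_invariant:
  assumes f: "f \<in> V"
  shows "\<exists>r\<ge>1. H.right_invariant (phi f) (D.congruence r (m1 + m2)) \<and>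
      (\<forall>g\<in>GL nn. \<forall>h\<in>F.congruence r nn. f (g * h) = f g)"
proof -
  obtain r1 where r1: "r1 \<ge> 1" "\<And>g h. g \<in> GL nn \<Longrightarrow> h \<in> F.congruence r1 nn \<Longrightarrow> f (g * h) = f g"
    using induced_uniform[OF f] by blast
  obtain r2 where r2: "r2 \<ge> 1" "\<And>s. s \<in> D.congruence r2 (m1 + m2) \<Longrightarrow> Th (m1 + m2) s = 1"
    using Th_congruence by blast
  define r where "r = max r1 r2"
  have r: "r \<ge> 1" "r1 \<le> r" "r2 \<le> r" using r1 by (auto simp: r_def)
  have "phi f (s * k) = phi f s" if s: "s \<in> carrier GG" and k: "k \<in> D.congruence r (m1 + m2)" for s k
  proof -
    have kG: "k \<in> carrier GG" using k D.congruence_GL0[OF r(1)] by (auto simp: D.GL0_def)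
    note sc = gl_group_carrierD[OF s] and kc = gl_group_carrierD[OF kG]
    note c = embed_carrier[OF sc] embed_carrier[OF kc] wmat_carrier(1) block_embed_nn[OF kc]
    have "embed (s * k) * wmat = embed s * (embed k * wmat)"
      unfolding embed_mult[OF sc kc] by (rule assoc_mult_mat[OF c(1-3)])
    also have "\<dots> = embed s * wmat * block_embed k"
      unfolding embed_wmat[OF kc] by (rule assoc_mult_mat[OF c(1,3,4), symmetric])
    finally have "f (embed (s * k) * wmat) = f (embed s * wmat)"
      using r1(2)[OF embed_wmat_GL[OF s]] block_embed_congruence_nn[OF k] F.congruence_mono[OF r(2)] by auto
    moreover have "Th (m1 + m2) k = 1" using r2(2) k D.congruence_mono[OF r(3)] by blast
    ultimately show ?thesis using Th_mult[OF s kG] by (simp add: phi_def)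
  qed
  then have "H.right_invariant (phi f) (D.congruence r (m1 + m2))"
    by (simp add: H.right_invariant_def)
  moreover have "f (g * h) = f g" if "g \<in> GL nn" "h \<in> F.congruence r nn" for g h
    using r1(2) that F.congruence_mono[OF r(2)] by blast
  ultimately show ?thesis using r(1) by blast
qed

text \<open>The lower left unipotent translates on which the integral defining the functional lives.\<close>

definition low :: "'f mat \<Rightarrow> 'f dual mat" where
  "low y = dual_mat (1\<^sub>m (m1 + m2)) (four_block_mat (0\<^sub>m m1 m1) (0\<^sub>m m1 m2) y (0\<^sub>m m2 m2))"

lemma low_block:
  assumes y: "y \<in> carrier_mat m2 m1"
  shows "low y = four_block_mat (1\<^sub>m m1) (0\<^sub>m m1 m2) (dual_mat (0\<^sub>m m2 m1) y) (1\<^sub>m m2)"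
proof -
  have c: "dual_mat (0\<^sub>m m2 m1) y \<in> carrier_mat m2 m1" by simp
  have c4: "four_block_mat (0\<^sub>m m1 m1) (0\<^sub>m m1 m2) y (0\<^sub>m m2 m2) \<in> carrier_mat (m1 + m2) (m1 + m2)" by simp
  show ?thesis
    unfolding low_def
    using std_mat_four_block[of "1\<^sub>m m1" m1 m1 "0\<^sub>m m1 m2" m2 "dual_mat (0\<^sub>m m2 m1) y" m2 "1\<^sub>m m2"] y
    by (intro dual_mat_eqI) (simp_all add: dual_mat_parts[OF one_carrier_mat c4] dual_mat_parts[OF zero_carrier_mat y] std_mat_simps)
qed

lemma low_group: "y \<in> carrier_mat m2 m1 \<Longrightarrow> low y \<in> carrier GG"
  unfolding low_def by (intro dual_groupI) (auto simp: dual_mat_parts(1)[of _ "m1 + m2" "m1 + m2"] GL_one)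

text \<open>The bound depends on the level r of f and not on k, because conjugation by integral
  matrices preserves congruence subgroups. A nonzero value forces \<theta>(trace(y v)) = 1 for every
  v of level r, which limits the size of y.\<close>

lemma support_bounded:
  assumes f: "f \<in> V" and r: "\<And>g h. g \<in> GL nn \<Longrightarrow> h \<in> F.congruence r nn \<Longrightarrow> f (g * h) = f g" and r1: "r \<ge> 1"
  obtains c where "\<And>y k. y \<in> carrier_mat m2 m1 \<Longrightarrow> k \<in> F.GL0 (m1 + m2) \<Longrightarrow>
    phi f (low y * const_mat k) \<noteq> 0 \<Longrightarrow> y \<in> F.FM c m2 m1"
proof -
  obtain a0 where a0: "\<theta> a0 \<noteq> 1" using \<theta>_nontrivial by blast
  have a0nz: "a0 \<noteq> 0" using a0 \<theta>_zero by auto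
  show ?thesis
  \<comment> \<open>If an entry of y had valuation below \<open>val a0 - r\<close>, then a0 divided
    by it would have level r, and \<theta> would have to be one at a0.\<close>
  proof (rule that[of "val a0 - r"])
    fix y k assume y: "y \<in> carrier_mat m2 m1" and k: "k \<in> F.GL0 (m1 + m2)"
      and nz: "phi f (low y * const_mat k) \<noteq> 0"
    have kG: "const_mat k \<in> carrier GG" using const_mat_group GL0_GL k by blast
    note lc = gl_group_carrierD[OF low_group[OF y]] and kc = gl_group_carrierD[OF kG]
    define g0 where "g0 = wmat * block_embed (const_mat k)"
    have g0: "g0 \<in> F.GL0 nn"
      unfolding g0_def by (intro GL0_mult wmat_GL0(1) block_embed_GL0_nn const_mat_GL0 k)
    note g0c = GL0_carrier[OF g0]
    have e0: "embed (low y * const_mat k) * wmat = embed (low y) * g0"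
      unfolding embed_mult[OF lc kc] g0_def embed_wmat[OF kc, symmetric]
      by (rule assoc_mult_mat[OF embed_carrier[OF lc] embed_carrier[OF kc] wmat_carrier(1)])
    let ?X = "block_embed (dual_mat (0\<^sub>m m2 m1) y)"
    have X: "?X = four_block_mat (0\<^sub>m m2 m1) y (0\<^sub>m m2 m1) (0\<^sub>m m2 m1)"
      using y by (simp add: block_embed_def dual_mat_parts[OF zero_carrier_mat y] carrier_matD[OF dual_mat_carrier[OF zero_carrier_mat[of m2 m1]]])
    have Xc: "?X \<in> carrier_mat n2 n1" unfolding X using y by simp
    have El: "embed (low y) = four_block_mat (1\<^sub>m n1) (0\<^sub>m n1 n2) ?X (1\<^sub>m n2)"
      unfolding low_block[OF y] by (subst embed_four_block) (auto simp: block_embed_one block_embed_zero)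
    have key: "\<theta> (mat_trace (y * v)) = 1" if v: "v \<in> F.FM r m1 m2" for v
    proof -
      note vc = F.FM_carrier[OF v]
      let ?Y = "four_block_mat (0\<^sub>m m1 m2) (0\<^sub>m m1 m2) (0\<^sub>m m1 m2) v"
      have Yc: "?Y \<in> carrier_mat n1 n2" using vc by simp
      \<comment> \<open>The corner chosen for v makes \<open>?Y * ?X\<close> vanish, while
        \<open>?X * ?Y\<close> is the image of e y v, so that 1 plus this product stays in the
        smaller Shalika subgroup.\<close>
      have XY: "?X * ?Y = four_block_mat (0\<^sub>m m2 m2) (y * v) (0\<^sub>m m2 m2) (0\<^sub>m m2 m2)"
        unfolding X using y vc by (subst mult_four_block_mat[of _ m2 m1 _ m1 _ m2 _ _ m2 _ m2]) auto
      have YX: "?Y * ?X = 0\<^sub>m n1 n1"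
        unfolding X using y vc by (subst mult_four_block_mat[of _ m1 m2 _ m2 _ m1 _ _ m1 _ m1]) auto
      define \<delta> where "\<delta> = dual_mat (1\<^sub>m m2) (y * v)"
      have yv: "y * v \<in> carrier_mat m2 m2" using y vc by simp
      note \<delta>p = dual_mat_parts[OF one_carrier_mat yv, folded \<delta>_def]
      have \<delta>G: "\<delta> \<in> G2" using \<delta>p by (intro dual_groupI) (simp_all add: \<delta>_def GL_one)
      have D: "block_embed \<delta> = 1\<^sub>m n2 + ?X * ?Y"
      proof -
        have "(1\<^sub>m n2 :: 'f mat) = four_block_mat (1\<^sub>m m2) (0\<^sub>m m2 m2) (0\<^sub>m m2 m2) (1\<^sub>m m2)" by simp
        then have "1\<^sub>m n2 + ?X * ?Y = four_block_mat (1\<^sub>m m2) (0\<^sub>m m2 m2) (0\<^sub>m m2 m2) (1\<^sub>m m2)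
            + four_block_mat (0\<^sub>m m2 m2) (y * v) (0\<^sub>m m2 m2) (0\<^sub>m m2 m2)" by (simp only: XY)
        also have "\<dots> = four_block_mat (1\<^sub>m m2) (y * v) (0\<^sub>m m2 m2) (1\<^sub>m m2)"
          using yv by (subst add_four_block_mat[of _ m2 m2 _ m2 _ m2]) auto
        finally show ?thesis
          using \<delta>p gl_group_carrierD[OF \<delta>G] by (simp add: block_embed_def)
      qed
      let ?N = "four_block_mat (1\<^sub>m n1) ?Y (0\<^sub>m n2 n1) (1\<^sub>m n2)"
      have N: "?N \<in> F.congruence r nn"
      proof -
        have "?N - 1\<^sub>m nn = four_block_mat (0\<^sub>m n1 n1) ?Y (0\<^sub>m n2 n1) (0\<^sub>m n2 n2)"
          using Yc by (intro eq_matI) auto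
        also have "\<dots> \<in> F.FM r nn nn" using v by (intro F.FM_four_block F.FM_zero)
        finally show ?thesis using Yc by (simp add: F.congruence_def)
      qed
      let ?P = "four_block_mat (block_embed (1\<^sub>m m1)) ?Y (0\<^sub>m n2 n1) (block_embed \<delta>)"
      have Dc: "block_embed \<delta> \<in> carrier_mat n2 n2" using gl_group_carrierD[OF \<delta>G] by simp
      have XYc: "?X * ?Y \<in> carrier_mat n2 n2" by (rule mult_carrier_mat[OF Xc Yc])
      have comm: "embed (low y) * ?N = ?P * embed (low y)"
        unfolding El D block_embed_one by (rule lower_upper_commute[OF Xc Yc YX])
      obtain gi where gi: "gi \<in> F.GL0 nn" "g0 * gi = 1\<^sub>m nn" "gi * g0 = 1\<^sub>m nn" using GL0_inverse[OF g0] by blast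
      have inv: "inv\<^bsub>gl_group nn\<^esub> g0 = gi"
        using gl_groupI(2)[OF g0c GL0_carrier[OF gi(1)] gi(2,3)] .
      have g0': "g0 \<in> carrier (gl_group nn)" "g0 \<in> F.FM 0 nn nn" "inv\<^bsub>gl_group nn\<^esub> g0 \<in> F.FM 0 nn nn"
        using g0 by (auto simp: F.GL0_def)
      \<comment> \<open>g0 and its inverse are integral, so conjugation by g0 does not lower the
        level.\<close>
      have \<kappa>: "gi * ?N * g0 \<in> F.congruence r nn"
        using F.congruence_conj(2)[OF g0', of ?N r] N by (simp add: inv)
      note cc = embed_carrier[OF lc] g0c GL0_carrier[OF gi(1)]
      have Nc: "?N \<in> carrier_mat nn nn" using N by (simp add: F.congruence_def)
      have Pc: "?P \<in> carrier_mat nn nn" using Dc by (simp add: block_embed_one)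
      note m = mult_carrier_mat[of _ nn nn _ nn] and as = assoc_mult_mat[of _ nn nn _ nn _ nn]
      have "embed (low y) * g0 * (gi * ?N * g0) = embed (low y) * (g0 * (gi * ?N * g0))"
        using cc Nc by (intro as m)
      also have "g0 * (gi * ?N * g0) = g0 * (gi * (?N * g0))" using cc Nc by (subst as) (auto intro: m)
      also have "\<dots> = (g0 * gi) * (?N * g0)" using cc Nc by (intro as[symmetric] m)
      also have "\<dots> = ?N * g0" unfolding gi(2) using left_mult_one_mat[OF m[OF Nc g0c]] by simp
      also have "embed (low y) * (?N * g0) = embed (low y) * ?N * g0" using cc Nc by (intro as[symmetric] m)
      also have "\<dots> = ?P * (embed (low y) * g0)" unfolding comm using cc Pc by (intro as m)
      finally have eq: "embed (low y) * g0 * (gi * ?N * g0) = ?P * (embed (low y) * g0)" .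
      have EG: "embed (low y) * g0 \<in> GL nn" by (intro GL_mult embed_GL low_group y GL0_GL g0)
      have "lam (f (embed (low y) * g0)) = lam (f (?P * (embed (low y) * g0)))"
        using r[OF EG \<kappa>] eq by simp
      also have "\<dots> = Th m1 (1\<^sub>m m1) * Th m2 \<delta> * lam (f (embed (low y) * g0))"
        using induced_lam[OF f dual_one \<delta>G Yc EG] \<delta>p by (simp add: std_mat_simps val_one)
      finally have "lam (f (embed (low y) * g0)) = Th m1 (1\<^sub>m m1) * Th m2 \<delta> * lam (f (embed (low y) * g0))" .
      moreover have "lam (f (embed (low y) * g0)) \<noteq> 0"
        using nz unfolding phi_def e0 by auto
      moreover have "Th m1 (1\<^sub>m m1) = 1"
        using Th_eq[OF dual_one zero_carrier_mat, of m1] by (simp add: std_mat_simps mat_trace_zero \<theta>_zero)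
      moreover have "Th m2 \<delta> = \<theta> (mat_trace (y * v))"
        using Th_eq[OF \<delta>G yv] \<delta>p right_mult_one_mat[OF yv] by simp
      ultimately show ?thesis by simp
    qed
    have "y $$ (i, j) \<in> pp (val a0 - r)" if ij: "i < m2" "j < m1" for i j
    proof (rule ccontr)
      assume n: "y $$ (i, j) \<notin> pp (val a0 - r)"
      then have yz: "y $$ (i, j) \<noteq> 0" "val (y $$ (i, j)) < val a0 - r" by (auto simp: pp_def)
      \<comment> \<open>Its only entry, transposed to the offending entry of y, makes the trace of y
        v equal to a0.\<close>
      define v where "v = mat m1 m2 (\<lambda>(p, q). if p = j \<and> q = i then a0 / y $$ (i, j) else 0)"
      have "v \<in> F.FM r m1 m2"
        using yz a0nz by (auto simp: F.FM_def v_def pp_def divide_inverse val_mult val_inverse)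
      then have "\<theta> (mat_trace (y * v)) = 1" by (rule key)
      moreover have "mat_trace (y * v) = a0"
      proof -
        have vc: "v \<in> carrier_mat m1 m2" by (simp add: v_def)
        have "mat_trace (y * v) = (\<Sum>p<m2. (y * v) $$ (p, p))" using y by (simp add: mat_trace_def)
        also have "\<dots> = (\<Sum>p<m2. if p = i then a0 else 0)"
        proof (rule sum.cong[OF refl])
          fix p assume "p \<in> {..<m2}"
          then have p: "p < m2" by simp
          have "(y * v) $$ (p, p) = (\<Sum>q<m1. y $$ (p, q) * v $$ (q, p))" by (rule mult_mat_entry[OF y vc p p])
          also have "\<dots> = (\<Sum>q<m1. if q = j then (if p = i then a0 else 0) else 0)"
            using p yz by (intro sum.cong) (auto simp: v_def)
          finally show "(y * v) $$ (p, p) = (if p = i then a0 else 0)" using ij by simp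
        qed
        finally show ?thesis using ij by simp
      qed
      ultimately show False using a0 by simp
    qed
    then show "y \<in> F.FM (val a0 - r) m2 m1" using y by (auto simp: F.FM_def)
  qed
qed

text \<open>Iwasawa for the standard part reduces to an element with standard part 1. There products
  add infinitesimal parts, so the block upper triangular portion can be split off to the
  left.\<close>

lemma group_decomposition:
  assumes s: "s \<in> carrier GG"
  obtains q y k where "q \<in> parabolic" "y \<in> carrier_mat m2 m1" "k \<in> F.GL0 (m1 + m2)"
    "s = q * (low y * const_mat k)"
proof -
  have sc: "s \<in> carrier_mat (m1 + m2) (m1 + m2)" "std_mat s \<in> GL (m1 + m2)" using s by (auto simp: dual_group_iff)
  obtain a b d k where p: "a \<in> GL m1" "b \<in> carrier_mat m1 m2" "d \<in> GL m2" "k \<in> F.GL0 (m1 + m2)"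
    "std_mat s = four_block_mat a b (0\<^sub>m m2 m1) d * k" using iwasawa_block[OF sc(2)] by blast
  define q1 where "q1 = ut (const_mat a) (const_mat b) (const_mat d)"
  have q1: "q1 \<in> parabolic" unfolding q1_def using p by (intro parabolicI const_mat_group) auto
  have q1G: "q1 \<in> carrier GG" using q1 subgroup.subset[OF subgroup_parabolic] by blast
  have kG: "const_mat k \<in> carrier GG" using p const_mat_group GL0_GL by blast
  have std_q1: "std_mat q1 = four_block_mat a b (0\<^sub>m m2 m1) d"
    using ut_std(1)[of "const_mat a" "const_mat b" "const_mat d"] GL_carrier[OF p(1)] GL_carrier[OF p(3)] p(2)
    by (simp add: q1_def const_mat_parts(1)[of a m1 m1] const_mat_parts(1)[of b m1 m2] const_mat_parts(1)[of d m2 m2])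
  \<comment> \<open>After removing the Iwasawa factors of the standard part, only an infinitesimal
    unipotent is left.\<close>
  let ?s = "inv\<^bsub>GG\<^esub> q1 \<otimes>\<^bsub>GG\<^esub> s \<otimes>\<^bsub>GG\<^esub> inv\<^bsub>GG\<^esub> const_mat k"
  have sG: "?s \<in> carrier GG" using s q1G kG by (intro G.m_closed G.inv_closed)
  have s_eq: "s = q1 \<otimes>\<^bsub>GG\<^esub> ?s \<otimes>\<^bsub>GG\<^esub> const_mat k" using s q1G kG by (simp only: G.m_assoc G.m_closed G.inv_closed G.inv_cancel_left G.l_inv G.r_one)
  note c = gl_group_carrierD[OF q1G] gl_group_carrierD[OF sG] gl_group_carrierD[OF kG]
  note as = assoc_mult_mat[of _ "m1 + m2" "m1 + m2" _ "m1 + m2" _ "m1 + m2"]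
    and m = mult_carrier_mat[of _ "m1 + m2" "m1 + m2" _ "m1 + m2"]
  have "std_mat s = std_mat q1 * std_mat ?s * std_mat (const_mat k)"
    using arg_cong[OF s_eq, of std_mat] std_mat_mult[OF m[OF c(1,2)] c(3)] std_mat_mult[OF c(1,2)] by simp
  also have "std_mat (const_mat k) = k" using GL0_carrier[OF p(4)] by (rule const_mat_parts)
  finally have st: "std_mat q1 * std_mat ?s * k = std_mat q1 * k" using p(5) std_q1 by simp
  have "std_mat ?s = 1\<^sub>m (m1 + m2)"
  proof -
    obtain ki where ki: "ki \<in> F.GL0 (m1 + m2)" "k * ki = 1\<^sub>m (m1 + m2)" using GL0_inverse[OF p(4)] by blast
    have q1s: "std_mat q1 \<in> GL (m1 + m2)" using q1G by (simp add: dual_group_iff)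
    obtain qi where qi: "qi \<in> GL (m1 + m2)" "qi * std_mat q1 = 1\<^sub>m (m1 + m2)" using GL_inverse[OF q1s] by blast
    have c': "std_mat q1 \<in> carrier_mat (m1 + m2) (m1 + m2)" "std_mat ?s \<in> carrier_mat (m1 + m2) (m1 + m2)"
      "k \<in> carrier_mat (m1 + m2) (m1 + m2)" "ki \<in> carrier_mat (m1 + m2) (m1 + m2)" "qi \<in> carrier_mat (m1 + m2) (m1 + m2)"
      using c GL0_carrier[OF p(4)] GL0_carrier[OF ki(1)] GL_carrier[OF qi(1)] by auto
    have cancel: "qi * (std_mat q1 * x * k * ki) = x" if x: "x \<in> carrier_mat (m1 + m2) (m1 + m2)" for x
    proof -
      have "std_mat q1 * x * k * ki = std_mat q1 * x * (k * ki)" using c' x by (intro as m)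
      also have "\<dots> = std_mat q1 * x" unfolding ki(2) using right_mult_one_mat[OF m[OF c'(1) x]] .
      finally have "qi * (std_mat q1 * x * k * ki) = qi * (std_mat q1 * x)" by simp
      also have "\<dots> = (qi * std_mat q1) * x" using c' x by (intro as[symmetric])
      also have "\<dots> = x" unfolding qi(2) using left_mult_one_mat[OF x] .
      finally show ?thesis .
    qed
    have "std_mat q1 * 1\<^sub>m (m1 + m2) = std_mat q1" using right_mult_one_mat[OF c'(1)] .
    then show ?thesis
      using cancel[OF c'(2)] cancel[OF one_carrier_mat] st by simp
  qed
  then have s2: "?s = dual_mat (1\<^sub>m (m1 + m2)) (eps_mat ?s)" using dual_mat_eta[of ?s] by simp
  obtain A B C D where sp: "A \<in> carrier_mat m1 m1" "B \<in> carrier_mat m1 m2" "C \<in> carrier_mat m2 m1"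
    "D \<in> carrier_mat m2 m2" "eps_mat ?s = four_block_mat A B C D"
    using four_block_split[of "eps_mat ?s"] c(2) by (metis map_carrier_mat)
  define q2 where "q2 = ut (dual_mat (1\<^sub>m m1) A) (dual_mat (0\<^sub>m m1 m2) B) (dual_mat (1\<^sub>m m2) D)"
  have q2: "q2 \<in> parabolic"
    unfolding q2_def using sp dual_mat_parts(1)[OF one_carrier_mat sp(1)] dual_mat_parts(1)[OF one_carrier_mat sp(4)]
    by (intro parabolicI dual_groupI) (auto simp: GL_one)
  have q2_eq: "q2 = dual_mat (1\<^sub>m (m1 + m2)) (four_block_mat A B (0\<^sub>m m2 m1) D)"
  proof (rule dual_mat_eqI)
    have c4: "four_block_mat A B (0\<^sub>m m2 m1) D \<in> carrier_mat (m1 + m2) (m1 + m2)" using sp by simp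
    note u = ut_std[of "dual_mat (1\<^sub>m m1) A" "dual_mat (0\<^sub>m m1 m2) B" "dual_mat (1\<^sub>m m2) D", folded q2_def]
    show "std_mat q2 = std_mat (dual_mat (1\<^sub>m (m1 + m2)) (four_block_mat A B (0\<^sub>m m2 m1) D))"
      "eps_mat q2 = eps_mat (dual_mat (1\<^sub>m (m1 + m2)) (four_block_mat A B (0\<^sub>m m2 m1) D))"
      using u dual_mat_parts[OF one_carrier_mat sp(1)] dual_mat_parts[OF one_carrier_mat sp(4)]
        dual_mat_parts[OF zero_carrier_mat sp(2)] dual_mat_parts[OF one_carrier_mat c4] by simp_all
  qed
  let ?L = "four_block_mat (0\<^sub>m m1 m1) (0\<^sub>m m1 m2) C (0\<^sub>m m2 m2)" and ?U = "four_block_mat A B (0\<^sub>m m2 m1) D"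
  have Lc: "?L \<in> carrier_mat (m1 + m2) (m1 + m2)" and Uc: "?U \<in> carrier_mat (m1 + m2) (m1 + m2)" using sp by auto
  have "?L + ?U = four_block_mat A B C D"
    using sp by (subst add_four_block_mat[of _ m1 m1 _ m2 _ m2]) auto
  \<comment> \<open>(1 + e U)(1 + e L) = 1 + e (U + L), because e^2 = 0.\<close>
  then have "q2 * low C = ?s"
    unfolding q2_eq low_def s2[unfolded sp(5)]
    using dual_mat_mult[OF one_carrier_mat Uc one_carrier_mat Lc] left_mult_one_mat[OF Lc] right_mult_one_mat[OF Uc]
    by simp
  then have "s = q1 * (q2 * low C) * const_mat k" using s_eq by simp
  have q2G: "q2 \<in> carrier GG" using q2 subgroup.subset[OF subgroup_parabolic] by blast
  note cc = gl_group_carrierD[OF q2G] gl_group_carrierD[OF low_group[OF sp(3)]]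
  have "s = q1 * (q2 * low C) * const_mat k" by fact
  also have "\<dots> = q1 * (q2 * low C * const_mat k)" using c cc by (intro as m)
  also have "q2 * low C * const_mat k = q2 * (low C * const_mat k)" using c cc by (intro as)
  also have "q1 * (q2 * (low C * const_mat k)) = q1 * q2 * (low C * const_mat k)"
    using c cc by (intro as[symmetric] m)
  finally have "s = q1 * q2 * (low C * const_mat k)" .
  moreover have "q1 * q2 \<in> parabolic" using subgroup.m_closed[OF subgroup_parabolic q1 q2] by simp
  ultimately show ?thesis using that sp(3) p(4) by blast
qed

text \<open>Up to Q, the support lies in \<open>fat_compact\<close> for the bound c of
  \<open>support_bounded\<close>; this compact subgroup meets only finitely many left cosets of
  K.\<close>

lemma phi_admissible:
  assumes f: "f \<in> V"
  shows "H.admissible (phi f)"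
proof -
  obtain r where r: "r \<ge> 1" "H.right_invariant (phi f) (D.congruence r (m1 + m2))"
    "\<And>g h. g \<in> GL nn \<Longrightarrow> h \<in> F.congruence r nn \<Longrightarrow> f (g * h) = f g"
    using phi_right_invariant[OF f] by blast
  obtain c where c: "\<And>y k. y \<in> carrier_mat m2 m1 \<Longrightarrow> k \<in> F.GL0 (m1 + m2) \<Longrightarrow>
    phi f (low y * const_mat k) \<noteq> 0 \<Longrightarrow> y \<in> F.FM c m2 m1" using support_bounded[OF f r(3) r(1)] by blast
  let ?K = "D.congruence r (m1 + m2)" and ?C = "fat_compact c (m1 + m2)"
  have K: "?K \<in> D.compact_open (m1 + m2)" using r(1) by (rule D.congruence_compact_open)
  have eqv: "H.equivariant (phi f)" by (rule phi_equivariant[OF f])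
  have sgK: "subgroup ?K GG" using r(1) by (rule D.subgroup_congruence)
  have C: "?C \<subseteq> carrier GG" using fat_compact_open H.total.family_subset by blast
  \<comment> \<open>K need not be contained in \<open>?C\<close>, so its cosets are counted through
    the intersection, which has finite index in \<open>?C\<close>.\<close>
  have fin: "finite ((\<lambda>x. x <#\<^bsub>GG\<^esub> ?K) ` ?C)"
  proof -
    have "finite (G.cosets_on ?C (?C \<inter> ?K))" by (rule H.total.family_finite[OF fat_compact_open K])
    moreover have "subgroup (?C \<inter> ?K) GG"
      by (rule H.total.family_subgroup[OF H.total.family_Int[OF fat_compact_open K]])
    then have "finite ((\<lambda>x. x <#\<^bsub>GG\<^esub> ?K) ` ?C) \<longleftrightarrow> finite (G.cosets_on ?C (?C \<inter> ?K))"
    proof (rule G.card_image_eq_index(2)[OF _ C])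
      fix x x' assume x: "x \<in> ?C" "x' \<in> ?C"
      have "inv\<^bsub>GG\<^esub> x \<otimes>\<^bsub>GG\<^esub> x' \<in> ?C"
        using x H.total.family_subgroup[OF fat_compact_open[of c "m1 + m2"]]
        by (simp only: subgroup.m_closed subgroup.m_inv_closed)
      then show "x <#\<^bsub>GG\<^esub> ?K = x' <#\<^bsub>GG\<^esub> ?K \<longleftrightarrow> inv\<^bsub>GG\<^esub> x \<otimes>\<^bsub>GG\<^esub> x' \<in> ?C \<inter> ?K"
        using G.l_coset_eq_iff[OF sgK subsetD[OF C x(1)] subsetD[OF C x(2)]] by blast
    qed
    ultimately show ?thesis by blast
  qed
  define h where "h X = {q * x | q x. q \<in> parabolic \<and> x \<in> X}" for X
  have h: "H.double_coset ?K x = h (x <#\<^bsub>GG\<^esub> ?K)" if x: "x \<in> ?C" for x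
  proof -
    have "q * x * k = q * (x * k)" if "q \<in> parabolic" "k \<in> ?K" for q k
      using assoc_mult_mat[of q "m1 + m2" "m1 + m2" x "m1 + m2" k "m1 + m2"]
        gl_group_carrierD[OF subsetD[OF subgroup.subset[OF subgroup_parabolic] that(1)]]
        gl_group_carrierD[OF subsetD[OF C x]] gl_group_carrierD[OF subsetD[OF subgroup.subset[OF sgK] that(2)]] by blast
    then show ?thesis
      unfolding H.double_coset_def h_def by (auto simp: G.mem_l_coset) metis+
  qed
  have "H.double_cosets (phi f) ?K \<subseteq> h ` (\<lambda>x. x <#\<^bsub>GG\<^esub> ?K) ` ?C"
  proof
    fix Dc assume "Dc \<in> H.double_cosets (phi f) ?K"
    then obtain s where s: "s \<in> carrier GG" "phi f s \<noteq> 0" "Dc = H.double_coset ?K s"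
      by (auto simp: H.double_cosets_def)
    obtain q y k where d: "q \<in> parabolic" "y \<in> carrier_mat m2 m1" "k \<in> F.GL0 (m1 + m2)"
      "s = q * (low y * const_mat k)" using group_decomposition[OF s(1)] by blast
    let ?x = "low y * const_mat k"
    have kG: "const_mat k \<in> carrier GG" using const_mat_group GL0_GL d(3) by blast
    have xG: "?x \<in> carrier GG" using G.m_closed[OF low_group[OF d(2)] kG] by simp
    have "phi f s = of_real (\<Delta> q) * phi f ?x"
      using eqv d(1) xG unfolding H.equivariant_def d(4) by simp
    then have "phi f ?x \<noteq> 0" using s(2) by auto
    then have y: "y \<in> F.FM c m2 m1" using c d by blast
    have xC: "?x \<in> ?C"
    proof -
      let ?L = "four_block_mat (0\<^sub>m m1 m1) (0\<^sub>m m1 m2) y (0\<^sub>m m2 m2)"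
      have L: "?L \<in> F.FM c (m1 + m2) (m1 + m2)" using y by (intro F.FM_four_block F.FM_zero)
      have "?x = dual_mat k (?L * k)"
      proof -
        have kc: "k \<in> carrier_mat (m1 + m2) (m1 + m2)" by (rule GL0_carrier[OF d(3)])
        have "const_mat k = dual_mat k (0\<^sub>m (m1 + m2) (m1 + m2))"
          using const_mat_parts[OF kc] dual_mat_parts[OF kc zero_carrier_mat] by (intro dual_mat_eqI) simp_all
        then have "?x = dual_mat (1\<^sub>m (m1 + m2)) ?L * dual_mat k (0\<^sub>m (m1 + m2) (m1 + m2))" by (simp add: low_def)
        also have "\<dots> = dual_mat (1\<^sub>m (m1 + m2) * k) (1\<^sub>m (m1 + m2) * 0\<^sub>m (m1 + m2) (m1 + m2) + ?L * k)"
          by (rule dual_mat_mult[OF one_carrier_mat F.FM_carrier[OF L] kc zero_carrier_mat])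
        finally show ?thesis using kc mult_carrier_mat[OF F.FM_carrier[OF L] kc] by simp
      qed
      moreover have "?L * k \<in> F.FM c (m1 + m2) (m1 + m2)"
        using d(3) by (intro F.FM_mult0(2)[OF L]) (simp add: GL0_iff)
      ultimately show ?thesis
        using d(3) dual_mat_parts[OF GL0_carrier[OF d(3)] F.FM_carrier] by (simp add: fat_compact_def)
    qed
    have "H.double_coset ?K (s * 1\<^sub>m (m1 + m2)) = H.double_coset ?K ?x"
      using H.double_coset_eq[OF K xG d(1) subgroup.one_closed[OF sgK]] unfolding gl_group_simps d(4)[symmetric] .
    then have "Dc = H.double_coset ?K ?x"
      unfolding right_mult_one_mat[OF gl_group_carrierD[OF s(1)]] s(3) .
    then show "Dc \<in> h ` (\<lambda>x. x <#\<^bsub>GG\<^esub> ?K) ` ?C" using h[OF xC] xC by blast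
  qed
  then have "finite (H.double_cosets (phi f) ?K)" using fin finite_surj by blast
  then show ?thesis
    unfolding H.admissible_def H.admissible_level_def using eqv K r(2) by blast
qed

end

lemma four_block_mat_inj:
  assumes "four_block_mat A B C D = four_block_mat A' B' C' D'"
    and "A \<in> carrier_mat p p'" "B \<in> carrier_mat p q'" "C \<in> carrier_mat q p'" "D \<in> carrier_mat q q'"
    and "A' \<in> carrier_mat p p'" "B' \<in> carrier_mat p q'" "C' \<in> carrier_mat q p'" "D' \<in> carrier_mat q q'"
  shows "A = A' \<and> B = B' \<and> C = C' \<and> D = D'"
proof (intro conjI)
  note e = arg_cong[OF assms(1), of "\<lambda>M. M $$ (_, _)"]
  show "A = A'"
  proof (rule eq_matI)
    fix i j assume "i < dim_row A'" "j < dim_col A'"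
    then show "A $$ (i, j) = A' $$ (i, j)" using e[of i j] assms(2-) by simp
  qed (use assms in auto)
  show "B = B'"
  proof (rule eq_matI)
    fix i j assume "i < dim_row B'" "j < dim_col B'"
    then show "B $$ (i, j) = B' $$ (i, j)" using e[of i "j + p'"] assms(2-) by simp
  qed (use assms in auto)
  show "C = C'"
  proof (rule eq_matI)
    fix i j assume "i < dim_row C'" "j < dim_col C'"
    then show "C $$ (i, j) = C' $$ (i, j)" using e[of "i + p" j] assms(2-) by simp
  qed (use assms in auto)
  show "D = D'"
  proof (rule eq_matI)
    fix i j assume "i < dim_row D'" "j < dim_col D'"
    then show "D $$ (i, j) = D' $$ (i, j)" using e[of "i + p" "j + p'"] assms(2-) by simp
  qed (use assms in auto)
qed

context shalika_pair
begin

lemma phi_translate: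
  assumes f: "f \<in> V" and t: "t \<in> carrier GG" and s: "s \<in> carrier GG"
  shows "phi (right_translation nn (block_embed t) f) s = Th (m1 + m2) t * phi f (s * t)"
proof -
  note sc = gl_group_carrierD[OF s] and tc = gl_group_carrierD[OF t]
  note c = embed_carrier[OF sc] embed_carrier[OF tc] wmat_carrier(1) block_embed_nn[OF tc]
  have "embed (s * t) * wmat = embed s * (embed t * wmat)"
    unfolding embed_mult[OF sc tc] by (rule assoc_mult_mat[OF c(1-3)])
  also have "\<dots> = embed s * wmat * block_embed t"
    unfolding embed_wmat[OF tc] by (rule assoc_mult_mat[OF c(1,3,4), symmetric])
  finally have "right_translation nn (block_embed t) f (embed s * wmat) = f (embed (s * t) * wmat)"
    using embed_wmat_GL[OF s] by (simp add: right_translation_def)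
  then show ?thesis
    using Th_mult[OF s t] Th_nonzero[OF t] by (simp add: phi_def)
qed

lemma haar_phi_hom:
  "(\<lambda>f. H.haar (phi f)) \<in>
    Hom_character (shalika_subgroup (m1 + m2)) V (right_translation nn) (shalika_character \<theta> (m1 + m2))"
  unfolding Hom_character_def linear_functional_on_def
proof (intro CollectI conjI ballI allI)
  fix f g assume f: "f \<in> V" and g: "g \<in> V"
  have "phi (f + g) = (\<lambda>s. phi f s + phi g s)"
    by (simp add: phi_def lam_linear fun_eq_iff add_divide_distrib)
  then show "H.haar (phi (f + g)) = H.haar (phi f) + H.haar (phi g)"
    using H.haar_add phi_admissible f g by simp
next
  fix c f assume f: "f \<in> V"
  have "phi (c *\<^sub>C f) = (\<lambda>s. c * phi f s)"
    by (simp add: phi_def lam_linear fun_eq_iff scaleC_fun_def)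
  then show "H.haar (phi (c *\<^sub>C f)) = c * H.haar (phi f)"
    using H.haar_scale phi_admissible f by simp
next
  fix h :: "'f mat" and f assume h: "h \<in> shalika_subgroup (m1 + m2)" and f: "f \<in> V"
  obtain t where t: "t \<in> carrier GG" "h = block_embed t" using h by (auto simp: shalika_subgroup_eq)
  note adm = phi_admissible[OF f]
  note tr = H.haar_translate[OF adm t(1)]
  have "H.haar (phi (right_translation nn h f))
      = H.haar (\<lambda>s. Th (m1 + m2) t * phi f (s \<otimes>\<^bsub>GG\<^esub> t))"
    unfolding t(2) using phi_translate[OF f t(1)] H.admissible_scale[OF tr(1)] by (intro H.haar_cong) simp_all
  also have "\<dots> = Th (m1 + m2) t * H.haar (phi f)"
    unfolding H.haar_scale[OF tr(1)] tr(2) ..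
  finally show "H.haar (phi (right_translation nn h f)) = shalika_character \<theta> (m1 + m2) h * H.haar (phi f)"
    by (simp add: t(2) Th_def)
qed

section \<open>A test section with nonzero integral\<close>

lemma stabiliser_congruence:
  assumes "smooth_representation val n UNIV \<pi>"
  shows "\<exists>r\<ge>1. \<forall>k\<in>F.congruence r n. \<pi> k v = v"
proof -
  have o: "openin (GL_topology val n) {g \<in> GL n. \<pi> g v = v}" and "\<pi> (1\<^sub>m n) v = v"
    using assms by (auto simp: smooth_representation_def)
  then have "1\<^sub>m n \<in> {g \<in> GL n. \<pi> g v = v}" using GL_one by simp
  then obtain r where r: "\<And>h. h \<in> GL n \<Longrightarrow> h - 1\<^sub>m n \<in> F.FM r n n \<Longrightarrow> \<pi> h v = v"
    using o unfolding openin_GL_topology by blast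
  have "\<pi> k v = v" if k: "k \<in> F.congruence (max 1 r) n" for k
  proof (rule r)
    show "k \<in> GL n" using F.congruence_GL0[of "max 1 r" n] k by (auto intro: GL0_GL)
    show "k - 1\<^sub>m n \<in> F.FM r n n" using k F.FM_mono by (auto simp: F.congruence_def)
  qed
  then show ?thesis by (intro exI[of _ "max 1 r"]) auto
qed

text \<open>The cell P K w with K the congruence subgroup of level r, together with the data of one
  factorisation of g.\<close>

definition big_cell :: "int \<Rightarrow> 'f mat \<Rightarrow> 'f mat \<Rightarrow> 'f mat \<Rightarrow> 'f mat \<Rightarrow> 'f mat \<Rightarrow> bool" where
  "big_cell r g a b d h \<longleftrightarrow> a \<in> GL n1 \<and> b \<in> carrier_mat n1 n2 \<and> d \<in> GL n2 \<and> h \<in> F.congruence r nn \<and>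
     g = four_block_mat a b (0\<^sub>m n2 n1) d * (h * wmat)"

definition cell_value :: "'v \<Rightarrow> 'w \<Rightarrow> 'f mat \<Rightarrow> 'f mat \<Rightarrow> ('v, 'w) tensor" where
  "cell_value v u a d = complex_of_real (sqrt (parabolic_modulus val n1 n2 a d)) *\<^sub>C tens (\<pi>1 a v) (\<pi>2 d u)"

text \<open>A factorisation in the cell is not unique, hence the choice of a value;
  \<open>cell_value_unique\<close> shows that it is harmless once v and u are fixed at level
  r.\<close>

definition cell_section :: "int \<Rightarrow> 'v \<Rightarrow> 'w \<Rightarrow> 'f mat \<Rightarrow> ('v, 'w) tensor" where
  "cell_section r v u g = (if \<exists>a b d h. big_cell r g a b d h
     then (SOME x. \<exists>a b d h. big_cell r g a b d h \<and> x = cell_value v u a d) else 0)"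

lemma big_cell_GL:
  assumes r: "r \<ge> 1" and c: "big_cell r g a b d h"
  shows "g \<in> GL nn"
proof -
  have h: "h \<in> GL nn" using c F.congruence_GL0[OF r] GL0_GL by (auto simp: big_cell_def)
  show ?thesis
    using c GL_mult[OF four_block_GL(1) GL_mult[OF h wmat_GL]] by (auto simp: big_cell_def)
qed

lemma parabolic_modulus_mult:
  assumes "a \<in> GL n1" "a' \<in> GL n1" "d \<in> GL n2" "d' \<in> GL n2"
  shows "parabolic_modulus val n1 n2 (a * a') (d * d') = parabolic_modulus val n1 n2 a d * parabolic_modulus val n1 n2 a' d'"
  using assms by (simp add: parabolic_modulus_def GL_det_mult normalised_abs_mult power_mult_distrib power_int_mult_distrib)

lemma parabolic_modulus_GL0:
  assumes "a \<in> F.GL0 n1" "d \<in> F.GL0 n2"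
  shows "parabolic_modulus val n1 n2 a d = 1"
  using assms by (simp add: parabolic_modulus_def GL0_iff normalised_abs_simps)

text \<open>Two factorisations differ by an element k of the congruence subgroup that is also in P.
  Its diagonal blocks are congruent to 1, so they fix v and u and have modulus one.\<close>

lemma cell_value_unique:
  assumes r: "r \<ge> 1" and v: "\<forall>k\<in>F.congruence r n1. \<pi>1 k v = v" and u: "\<forall>k\<in>F.congruence r n2. \<pi>2 k u = u"
    and c: "big_cell r g a b d h" and c': "big_cell r g a' b' d' h'"
  shows "cell_value v u a d = cell_value v u a' d'"
proof -
  have e: "a \<in> GL n1" "b \<in> carrier_mat n1 n2" "d \<in> GL n2" "h \<in> F.congruence r nn"
    and e': "a' \<in> GL n1" "b' \<in> carrier_mat n1 n2" "d' \<in> GL n2" "h' \<in> F.congruence r nn"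
    using c c' by (auto simp: big_cell_def)
  let ?P = "four_block_mat a b (0\<^sub>m n2 n1) d" and ?P' = "four_block_mat a' b' (0\<^sub>m n2 n1) d'"
  note as = assoc_mult_mat[of _ nn nn _ nn _ nn] and m = mult_carrier_mat[of _ nn nn _ nn]
  have hG: "h \<in> F.GL0 nn" "h' \<in> F.GL0 nn" using e(4) e'(4) F.congruence_GL0[OF r] by auto
  let ?i = "inv\<^bsub>gl_group nn\<^esub> h"
  have hgl: "h \<in> carrier (gl_group nn)" using hG by (simp add: F.GL0_def)
  note i = gl_group_inv[OF hgl]
  note pc = GL_carrier[OF four_block_GL(1)[OF e(1-3)]] GL_carrier[OF four_block_GL(1)[OF e'(1-3)]]
    GL0_carrier[OF hG(1)] GL0_carrier[OF hG(2)] wmat_carrier i(1)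
  define k where "k = h' * ?i"
  have k: "k \<in> F.congruence r nn"
    unfolding k_def using subgroup.m_closed[OF F.subgroup_congruence[OF r] e'(4) subgroup.m_inv_closed[OF F.subgroup_congruence[OF r] e(4)]]
    by simp
  have kc: "k \<in> carrier_mat nn nn" using k by (simp add: F.congruence_def)
  have wc: "x * (y * wmat) * wmat' = x * y" if "x \<in> carrier_mat nn nn" "y \<in> carrier_mat nn nn" for x y
  proof -
    have "x * (y * wmat) * wmat' = x * (y * wmat * wmat')" using that pc by (intro as m)
    also have "y * wmat * wmat' = y * (wmat * wmat')" using that pc by (intro as)
    also have "\<dots> = y" unfolding wmat_inverse using right_mult_one_mat[OF that(2)] .
    finally show ?thesis .
  qed
  have "?P * h = ?P' * h'"
    using c c' wc[OF pc(1,3)] wc[OF pc(2,4)] by (simp add: big_cell_def)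
  then have "?P * h * ?i = ?P' * h' * ?i" by simp
  moreover have "?P * h * ?i = ?P * (h * ?i)" using pc by (intro as)
  moreover have "?P' * h' * ?i = ?P' * k" unfolding k_def using pc by (intro as)
  ultimately have PP: "?P = ?P' * k" using i right_mult_one_mat[OF pc(1)] by simp
  obtain x y z t where sp: "split_block k n1 n1 = (x, y, z, t)" by (metis prod_cases4)
  have dims: "x \<in> carrier_mat n1 n1" "y \<in> carrier_mat n1 n2" "z \<in> carrier_mat n2 n1" "t \<in> carrier_mat n2 n2"
    and keq: "k = four_block_mat x y z t" using split_block[OF sp, of n2 n2] kc by auto
  note ac = GL_carrier[OF e(1)] GL_carrier[OF e(3)] GL_carrier[OF e'(1)] GL_carrier[OF e'(3)]
  have "?P' * k = four_block_mat (a' * x + b' * z) (a' * y + b' * t) (d' * z) (d' * t)"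
    unfolding keq using ac e'(2) dims
    by (subst mult_four_block_mat[of _ n1 n1 _ n2 _ n2 _ _ n1 _ n2]) (auto simp: left_add_zero_mat[OF mult_carrier_mat])
  then have blocks: "a = a' * x + b' * z \<and> b = a' * y + b' * t \<and> 0\<^sub>m n2 n1 = d' * z \<and> d = d' * t"
    using PP ac e(2) e'(2) dims by (intro four_block_mat_inj) auto
  obtain di where di: "di \<in> GL n2" "di * d' = 1\<^sub>m n2" using GL_inverse[OF e'(3)] by blast
  \<comment> \<open>The bottom left block of P' k vanishes and d' is invertible, which forces k into
    P.\<close>
  have "di * (d' * z) = (di * d') * z" using GL_carrier[OF di(1)] ac dims by (intro assoc_mult_mat[symmetric]) auto
  moreover have "d' * z = 0\<^sub>m n2 n1" using blocks by simp
  ultimately have z: "z = 0\<^sub>m n2 n1"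
    using di left_mult_one_mat[OF dims(3)] right_mult_zero_mat[OF GL_carrier[OF di(1)]] by simp
  have a: "a = a' * x"
    using blocks z right_mult_zero_mat[OF e'(2)] right_add_zero_mat[OF mult_carrier_mat[OF ac(3) dims(1)]] by simp
  have "k - 1\<^sub>m nn = four_block_mat (x - 1\<^sub>m n1) y z (t - 1\<^sub>m n2)"
    unfolding keq using dims by (intro eq_matI) auto
  then have "four_block_mat (x - 1\<^sub>m n1) y z (t - 1\<^sub>m n2) \<in> F.FM r nn nn" using k by (simp add: F.congruence_def)
  note F.FM_four_blockD(1,4)[OF this minus_carrier_mat[OF one_carrier_mat] dims(2,3) minus_carrier_mat[OF one_carrier_mat]]
  then have xt: "x \<in> F.congruence r n1" "t \<in> F.congruence r n2" using dims by (auto simp: F.congruence_def)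
  then have xt0: "x \<in> F.GL0 n1" "t \<in> F.GL0 n2" using F.congruence_GL0[OF r] by auto
  have "\<pi>1 a v = \<pi>1 a' v" "\<pi>2 d u = \<pi>2 d' u"
    using \<pi>_mult(1)[OF e'(1) GL0_GL[OF xt0(1)]] \<pi>_mult(2)[OF e'(3) GL0_GL[OF xt0(2)]] bspec[OF v xt(1)] bspec[OF u xt(2)] a blocks
    by auto
  moreover have "parabolic_modulus val n1 n2 a d = parabolic_modulus val n1 n2 a' d'"
    using parabolic_modulus_mult[OF e'(1) GL0_GL[OF xt0(1)] e'(3) GL0_GL[OF xt0(2)]] parabolic_modulus_GL0[OF xt0] a blocks
    by simp
  ultimately show ?thesis by (simp add: cell_value_def)
qed

lemma cell_section_eq:
  assumes "r \<ge> 1" "\<forall>k\<in>F.congruence r n1. \<pi>1 k v = v" "\<forall>k\<in>F.congruence r n2. \<pi>2 k u = u"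
    and c: "big_cell r g a b d h"
  shows "cell_section r v u g = cell_value v u a d"
proof -
  let ?Q = "\<lambda>x. \<exists>a b d h. big_cell r g a b d h \<and> x = cell_value v u a d"
  have "?Q (SOME x. ?Q x)" by (rule someI[of ?Q "cell_value v u a d"]) (use c in blast)
  then obtain a' b' d' h' where c': "big_cell r g a' b' d' h'" and e: "(SOME x. ?Q x) = cell_value v u a' d'" by blast
  have ex: "\<exists>a b d h. big_cell r g a b d h" using c by blast
  have "cell_section r v u g = cell_value v u a' d'"
    unfolding cell_section_def if_P[OF ex] by (rule e)
  also have "\<dots> = cell_value v u a d" by (rule cell_value_unique[OF assms(1-3) c' c])
  finally show ?thesis .
qed

lemma cell_value_equivariant:
  assumes "a \<in> GL n1" "a' \<in> GL n1" "d \<in> GL n2" "d' \<in> GL n2"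
  shows "cell_value v u (a * a') (d * d')
    = complex_of_real (sqrt (parabolic_modulus val n1 n2 a d)) *\<^sub>C tensor_map (\<pi>1 a) (\<pi>2 d) (cell_value v u a' d')"
proof -
  note p = tensor_map_props[OF \<pi>1_linear[OF assms(1)] \<pi>2_linear[OF assms(3)]]
  have lin: "tensor_map (\<pi>1 a) (\<pi>2 d) (c *\<^sub>C x) = c *\<^sub>C tensor_map (\<pi>1 a) (\<pi>2 d) x" for c x
    using p(1) by (simp add: clinear_iff)
  show ?thesis
    unfolding cell_value_def lin p(2) \<pi>_mult(1)[OF assms(1,2)] \<pi>_mult(2)[OF assms(3,4)]
      parabolic_modulus_mult[OF assms] real_sqrt_mult of_real_mult by (simp add: scaleC_scaleC)
qed

text \<open>Both directions are needed: the first computes the section at p g inside the cell, the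
  second shows that it vanishes at p g when g is outside.\<close>

lemma big_cell_parabolic:
  assumes r: "r \<ge> 1" and a: "a \<in> GL n1" and d: "d \<in> GL n2" and b: "b \<in> carrier_mat n1 n2" and g: "g \<in> GL nn"
  shows "big_cell r g a' b' d' h \<Longrightarrow> big_cell r (four_block_mat a b (0\<^sub>m n2 n1) d * g) (a * a') (a * b' + b * d') (d * d') h"
    and "big_cell r (four_block_mat a b (0\<^sub>m n2 n1) d * g) a' b' d' h \<Longrightarrow> \<exists>a'' b'' d''. big_cell r g a'' b'' d'' h"
proof -
  let ?P = "four_block_mat a b (0\<^sub>m n2 n1) d"
  note as = assoc_mult_mat[of _ nn nn _ nn _ nn] and m = mult_carrier_mat[of _ nn nn _ nn]
  note ac = GL_carrier[OF a] GL_carrier[OF d]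
  have PG: "?P \<in> GL nn" by (rule four_block_GL(1)[OF a b d])
  have hw: "h * wmat \<in> carrier_mat nn nn" if "h \<in> F.congruence r nn" for h
    using that by (auto simp: F.congruence_def intro!: m)
  have mult: "?P * four_block_mat x y (0\<^sub>m n2 n1) z = four_block_mat (a * x) (a * y + b * z) (0\<^sub>m n2 n1) (d * z)"
    if "x \<in> carrier_mat n1 n1" "y \<in> carrier_mat n1 n2" "z \<in> carrier_mat n2 n2" for x y z
    using ac b that right_add_zero_mat[OF mult_carrier_mat[OF ac(1) that(1)]] left_add_zero_mat[OF mult_carrier_mat[OF ac(2) that(3)]]
    by (subst mult_four_block_mat[of _ n1 n1 _ n2 _ n2 _ _ n1 _ n2]) auto
  show "big_cell r (?P * g) (a * a') (a * b' + b * d') (d * d') h" if c: "big_cell r g a' b' d' h"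
  proof -
    have e: "a' \<in> GL n1" "b' \<in> carrier_mat n1 n2" "d' \<in> GL n2" "h \<in> F.congruence r nn"
      and geq: "g = four_block_mat a' b' (0\<^sub>m n2 n1) d' * (h * wmat)" using c by (auto simp: big_cell_def)
    have "?P * g = ?P * four_block_mat a' b' (0\<^sub>m n2 n1) d' * (h * wmat)"
      unfolding geq by (rule as[OF GL_carrier[OF PG] GL_carrier[OF four_block_GL(1)[OF e(1-3)]] hw[OF e(4)], symmetric])
    then show ?thesis
      unfolding big_cell_def mult[OF GL_carrier[OF e(1)] e(2) GL_carrier[OF e(3)]]
      using GL_mult[OF a e(1)] GL_mult[OF d e(3)] e(4) mult_carrier_mat[OF ac(1) e(2)] mult_carrier_mat[OF b GL_carrier[OF e(3)]]
      by simp
  qed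
  show "\<exists>a'' b'' d''. big_cell r g a'' b'' d'' h" if c: "big_cell r (?P * g) a' b' d' h"
  proof -
    have e: "a' \<in> GL n1" "b' \<in> carrier_mat n1 n2" "d' \<in> GL n2" "h \<in> F.congruence r nn"
      and geq: "?P * g = four_block_mat a' b' (0\<^sub>m n2 n1) d' * (h * wmat)" using c by (auto simp: big_cell_def)
    note ec = GL_carrier[OF e(1)] GL_carrier[OF e(3)]
    obtain ai where ai: "ai \<in> GL n1" "a * ai = 1\<^sub>m n1" using GL_inverse[OF a] by blast
    obtain di where di: "di \<in> GL n2" "d * di = 1\<^sub>m n2" using GL_inverse[OF d] by blast
    note ic = GL_carrier[OF ai(1)] GL_carrier[OF di(1)]
    have did: "di * d' \<in> carrier_mat n2 n2" and bd: "b * (di * d') \<in> carrier_mat n1 n2"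
      using ic ec b by (auto intro: mult_carrier_mat)
    let ?y = "ai * (b' - b * (di * d'))"
    have yc: "b' - b * (di * d') \<in> carrier_mat n1 n2" "?y \<in> carrier_mat n1 n2"
      using bd ic by (auto intro: mult_carrier_mat minus_carrier_mat)
    have "a * (ai * a') = (a * ai) * a'" by (rule assoc_mult_mat[OF ac(1) ic(1) ec(1), symmetric])
    then have 1: "a * (ai * a') = a'" using ai left_mult_one_mat[OF ec(1)] by simp
    have "d * (di * d') = (d * di) * d'" by (rule assoc_mult_mat[OF ac(2) ic(2) ec(2), symmetric])
    then have 2: "d * (di * d') = d'" using di left_mult_one_mat[OF ec(2)] by simp
    have "a * ?y = (a * ai) * (b' - b * (di * d'))" by (rule assoc_mult_mat[OF ac(1) ic(1) yc(1), symmetric])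
    then have "a * ?y = b' - b * (di * d')" using ai left_mult_one_mat[OF yc(1)] by simp
    then have 3: "a * ?y + b * (di * d') = b'"
      using mat_add_diff[OF e(2) bd] comm_add_mat[OF yc(1) bd] by simp
    let ?R = "four_block_mat (ai * a') ?y (0\<^sub>m n2 n1) (di * d')"
    have R: "?P * ?R = four_block_mat a' b' (0\<^sub>m n2 n1) d'"
      using mult[OF mult_carrier_mat[OF ic(1) ec(1)] yc(2) did] 1 2 3 by simp
    have RG: "?R \<in> GL nn" by (rule four_block_GL(1)[OF GL_mult[OF ai(1) e(1)] yc(2) GL_mult[OF di(1) e(3)]])
    have eq: "?P * g = ?P * (?R * (h * wmat))"
      unfolding geq R[symmetric] by (rule as[OF GL_carrier[OF PG] GL_carrier[OF RG] hw[OF e(4)]])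
    obtain Pi where Pi: "Pi \<in> GL nn" "Pi * ?P = 1\<^sub>m nn" using GL_inverse[OF PG] by blast
    have cancel: "Pi * (?P * x) = x" if x: "x \<in> carrier_mat nn nn" for x
    proof -
      have "Pi * (?P * x) = (Pi * ?P) * x" by (rule as[OF GL_carrier[OF Pi(1)] GL_carrier[OF PG] x, symmetric])
      then show ?thesis using Pi left_mult_one_mat[OF x] by simp
    qed
    have "g = Pi * (?P * g)" by (rule cancel[OF GL_carrier[OF g], symmetric])
    also have "\<dots> = Pi * (?P * (?R * (h * wmat)))" by (simp only: eq)
    also have "\<dots> = ?R * (h * wmat)" by (rule cancel[OF m[OF GL_carrier[OF RG] hw[OF e(4)]]])
    finally have "big_cell r g (ai * a') ?y (di * d') h"
      unfolding big_cell_def using GL_mult[OF ai(1) e(1)] GL_mult[OF di(1) e(3)] yc e(4) by simp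
    then show ?thesis by blast
  qed
qed

text \<open>h w k = h (w k w^-1) w, and the permutation matrix w, being integral with integral
  inverse, preserves the level of k.\<close>

lemma big_cell_right:
  assumes r: "r \<ge> 1" and k: "k \<in> F.congruence r nn" and c: "big_cell r g a b d h"
  shows "\<exists>h'. big_cell r (g * k) a b d h'"
proof -
  note as = assoc_mult_mat[of _ nn nn _ nn _ nn] and m = mult_carrier_mat[of _ nn nn _ nn]
  have e: "a \<in> GL n1" "b \<in> carrier_mat n1 n2" "d \<in> GL n2" "h \<in> F.congruence r nn"
    and geq: "g = four_block_mat a b (0\<^sub>m n2 n1) d * (h * wmat)" using c by (auto simp: big_cell_def)
  have w: "wmat \<in> carrier (gl_group nn)" "wmat \<in> F.FM 0 nn nn" "inv\<^bsub>gl_group nn\<^esub> wmat \<in> F.FM 0 nn nn"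
    using wmat_GL0 by (auto simp: F.GL0_def)
  have winv: "inv\<^bsub>gl_group nn\<^esub> wmat = wmat'"
    by (rule gl_groupI(2)[OF wmat_carrier wmat_inverse])
  have k': "wmat * k * wmat' \<in> F.congruence r nn"
    using F.congruence_conj(1)[OF w, of k r] k by (simp add: winv)
  have h': "h * (wmat * k * wmat') \<in> F.congruence r nn"
    using subgroup.m_closed[OF F.subgroup_congruence[OF r] e(4) k'] by simp
  note cc = GL_carrier[OF four_block_GL(1)[OF e(1-3)]] wmat_carrier
  have hc: "h \<in> carrier_mat nn nn" "k \<in> carrier_mat nn nn" using e k by (auto simp: F.congruence_def)
  have "h * (wmat * k * wmat') * wmat = h * (wmat * k * wmat' * wmat)" using cc hc by (intro as m)
  also have "wmat * k * wmat' * wmat = wmat * k * (wmat' * wmat)" using cc hc by (intro as m)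
  also have "\<dots> = wmat * k" unfolding wmat_inverse using right_mult_one_mat[OF m[OF wmat_carrier(1) hc(2)]] .
  also have "h * (wmat * k) = h * wmat * k" using cc hc by (intro as[symmetric])
  finally have "four_block_mat a b (0\<^sub>m n2 n1) d * (h * (wmat * k * wmat') * wmat) = four_block_mat a b (0\<^sub>m n2 n1) d * (h * wmat * k)" by simp
  also have "\<dots> = g * k" unfolding geq using cc hc by (intro as[symmetric] m)
  finally have "big_cell r (g * k) a b d (h * (wmat * k * wmat'))"
    unfolding big_cell_def using e h' by simp
  then show ?thesis by blast
qed

lemma cell_section_induced:
  assumes r: "r \<ge> 1" and v: "\<forall>k\<in>F.congruence r n1. \<pi>1 k v = v" and u: "\<forall>k\<in>F.congruence r n2. \<pi>2 k u = u"
  shows "cell_section r v u \<in> V"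
  unfolding induced_space_def
proof (intro CollectI conjI allI impI ballI)
  fix g :: "'f mat" assume "g \<notin> GL nn"
  then show "cell_section r v u g = 0" using big_cell_GL[OF r] unfolding cell_section_def by auto
next
  fix a b d g :: "'f mat" assume a: "a \<in> GL n1" and d: "d \<in> GL n2" and b: "b \<in> carrier_mat n1 n2" and g: "g \<in> GL nn"
  let ?P = "four_block_mat a b (0\<^sub>m n2 n1) d"
  note cp = big_cell_parabolic[OF r a d b g] and eq = cell_section_eq[OF r v u]
  show "cell_section r v u (?P * g)
      = complex_of_real (sqrt (parabolic_modulus val n1 n2 a d)) *\<^sub>C tensor_map (\<pi>1 a) (\<pi>2 d) (cell_section r v u g)"
  proof (cases "\<exists>a' b' d' h. big_cell r g a' b' d' h")
    case True
    then obtain a' b' d' h where c: "big_cell r g a' b' d' h" by blast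
    then have "a' \<in> GL n1" "d' \<in> GL n2" by (auto simp: big_cell_def)
    then show ?thesis
      using eq[OF c] eq[OF cp(1)[OF c]] cell_value_equivariant[OF a _ d] by simp
  next
    case False
    then have "\<not> (\<exists>a' b' d' h. big_cell r (?P * g) a' b' d' h)" using cp(2) by blast
    moreover have "tensor_map (\<pi>1 a) (\<pi>2 d) 0 = 0"
      using tensor_map_props(1)[OF \<pi>1_linear[OF a] \<pi>2_linear[OF d]]
      by (metis clinear_iff complex_vector.scale_zero_left)
    ultimately show ?thesis using False by (simp add: cell_section_def)
  qed
next
  have right: "cell_section r v u (g * k) = cell_section r v u g" if g: "g \<in> GL nn" and k: "k \<in> F.congruence r nn" for g k
  proof -
    note eq = cell_section_eq[OF r v u]
    have kG: "k \<in> carrier (gl_group nn)" using k F.congruence_GL0[OF r] by (auto simp: F.GL0_def)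
    have ki: "inv\<^bsub>gl_group nn\<^esub> k \<in> F.congruence r nn"
      by (rule subgroup.m_inv_closed[OF F.subgroup_congruence[OF r] k])
    have "g * k * inv\<^bsub>gl_group nn\<^esub> k = g * (k * inv\<^bsub>gl_group nn\<^esub> k)"
      by (rule assoc_mult_mat[OF GL_carrier[OF g] gl_group_carrierD[OF kG] gl_group_inv(1)[OF kG]])
    then have gk: "g * k * inv\<^bsub>gl_group nn\<^esub> k = g"
      using gl_group_inv(2)[OF kG] right_mult_one_mat[OF GL_carrier[OF g]] by simp
    show ?thesis
    proof (cases "\<exists>a b d h. big_cell r g a b d h")
      case True
      then obtain a b d h where c: "big_cell r g a b d h" by blast
      obtain h' where "big_cell r (g * k) a b d h'" using big_cell_right[OF r k c] by blast
      then show ?thesis using eq c by simp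
    next
      case False
      then have "\<not> (\<exists>a b d h. big_cell r (g * k) a b d h)"
        using big_cell_right[OF r ki, of "g * k"] unfolding gk by blast
      then show ?thesis using False by (simp add: cell_section_def)
    qed
  qed
  show "locally_constant_on (GL_topology val nn) (cell_section r v u)"
    unfolding locally_constant_GL
  proof
    fix g :: "'f mat" assume g: "g \<in> GL nn"
    then have gG: "g \<in> carrier (gl_group nn)" by (simp add: GL_eq)
    note i = gl_group_inv[OF gG] and gc = GL_carrier[OF g]
    obtain c where c: "inv\<^bsub>gl_group nn\<^esub> g \<in> F.FM c nn nn" using F.FM_exhaust[OF i(1)] by blast
    \<comment> \<open>Writing h = g (g^-1 h), the level r - c of h - g is what makes g^-1 h
      congruent to 1 at level r.\<close>
    have "cell_section r v u h = cell_section r v u g" if h: "h \<in> GL nn" "h - g \<in> F.FM (r - c) nn nn" for h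
    proof -
      note hc = GL_carrier[OF h(1)]
      have "inv\<^bsub>gl_group nn\<^esub> g * (h - g) \<in> F.FM (c + (r - c)) nn nn" by (rule F.FM_mult[OF c h(2)])
      moreover have "inv\<^bsub>gl_group nn\<^esub> g * (h - g) = inv\<^bsub>gl_group nn\<^esub> g * h - 1\<^sub>m nn"
        using mult_minus_distrib_mat[OF i(1) hc gc] i by simp
      ultimately have k: "inv\<^bsub>gl_group nn\<^esub> g * h \<in> F.congruence r nn"
        using mult_carrier_mat[OF i(1) hc] by (simp add: F.congruence_def)
      have "g * (inv\<^bsub>gl_group nn\<^esub> g * h) = (g * inv\<^bsub>gl_group nn\<^esub> g) * h"
        by (rule assoc_mult_mat[OF gc i(1) hc, symmetric])
      then have "g * (inv\<^bsub>gl_group nn\<^esub> g * h) = h" using i left_mult_one_mat[OF hc] by simp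
      then show ?thesis using right[OF g k] by simp
    qed
    then show "\<exists>r'. \<forall>h\<in>GL nn. h - g \<in> F.FM r' nn nn \<longrightarrow> cell_section r v u h = cell_section r v u g" by blast
  qed
qed

text \<open>Unlike in \<open>low\<close>, the block Z may have a nonzero standard part, since a
  neighbourhood of 1 modulo Q needs both parts.\<close>

definition lower :: "'f dual mat \<Rightarrow> 'f dual mat" where
  "lower Z = four_block_mat (1\<^sub>m m1) (0\<^sub>m m1 m2) Z (1\<^sub>m m2)"

text \<open>For small Z the image lies in the congruence subgroup, so the factor in P is 1. The
  character is one as well, because z g^-1 only has a lower left block and hence trace zero.\<close>

lemma phi_cell_lower:
  assumes r: "r \<ge> 1" and v: "\<forall>k\<in>F.congruence r n1. \<pi>1 k v = v" and u: "\<forall>k\<in>F.congruence r n2. \<pi>2 k u = u"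
    and Z: "Z \<in> carrier_mat m2 m1" "block_embed Z \<in> F.FM r n2 n1"
  shows "lower Z \<in> carrier GG" and "phi (cell_section r v u) (lower Z) = l1 v * l2 u"
proof -
  have lc: "lower Z \<in> carrier_mat (m1 + m2) (m1 + m2)" using Z by (simp add: lower_def)
  have sZ: "std_mat Z \<in> carrier_mat m2 m1" "eps_mat Z \<in> carrier_mat m2 m1" using Z by auto
  have ls: "std_mat (lower Z) = four_block_mat (1\<^sub>m m1) (0\<^sub>m m1 m2) (std_mat Z) (1\<^sub>m m2)"
    "eps_mat (lower Z) = four_block_mat (0\<^sub>m m1 m1) (0\<^sub>m m1 m2) (eps_mat Z) (0\<^sub>m m2 m2)"
    unfolding lower_def using std_mat_four_block[OF one_carrier_mat zero_carrier_mat Z(1) one_carrier_mat]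
    by (simp_all add: std_mat_simps)
  have "det (std_mat (lower Z)) = det (1\<^sub>m m1 :: 'f mat) * det (1\<^sub>m m2 :: 'f mat)"
    unfolding ls by (rule det_four_block_mat_upper_right_zero) (use sZ in auto)
  then have "std_mat (lower Z) \<in> GL (m1 + m2)" using lc by (subst GL_iff_det) auto
  then show lG: "lower Z \<in> carrier GG" using lc by (intro dual_groupI)
  have E: "embed (lower Z) = four_block_mat (1\<^sub>m n1) (0\<^sub>m n1 n2) (block_embed Z) (1\<^sub>m n2)"
    unfolding lower_def using embed_four_block[OF one_carrier_mat zero_carrier_mat Z(1) one_carrier_mat]
    by (simp add: block_embed_one block_embed_zero)
  have "embed (lower Z) - 1\<^sub>m nn = four_block_mat (0\<^sub>m n1 n1) (0\<^sub>m n1 n2) (block_embed Z) (0\<^sub>m n2 n2)"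
    unfolding E using F.FM_carrier[OF Z(2)] by (intro eq_matI) auto
  also have "\<dots> \<in> F.FM r nn nn" by (intro F.FM_four_block F.FM_zero Z)
  finally have h: "embed (lower Z) \<in> F.congruence r nn" using embed_carrier[OF lc] by (simp add: F.congruence_def)
  have "big_cell r (embed (lower Z) * wmat) (1\<^sub>m n1) (0\<^sub>m n1 n2) (1\<^sub>m n2) (embed (lower Z))"
    unfolding big_cell_def using h GL_one
      left_mult_one_mat[OF mult_carrier_mat[OF embed_carrier[OF lc] wmat_carrier(1)]] by simp
  from cell_section_eq[OF r v u this]
  have "cell_section r v u (embed (lower Z) * wmat) = tens v u"
    by (simp add: cell_value_def \<pi>_mult parabolic_modulus_GL0 GL0_one scaleC_one)
  moreover have "Th (m1 + m2) (lower Z) = 1"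
  proof -
    let ?x = "four_block_mat (0\<^sub>m m1 m1) (0\<^sub>m m1 m2) (eps_mat Z) (0\<^sub>m m2 m2)"
    have xc: "?x \<in> carrier_mat (m1 + m2) (m1 + m2)" using sZ by simp
    have "eps_mat (lower Z) = ?x * std_mat (lower Z)"
      unfolding ls using sZ right_mult_one_mat[OF sZ(2)] right_add_zero_mat[OF sZ(2)]
      by (subst mult_four_block_mat[of _ m1 m1 _ m2 _ m2 _ _ m1 _ m2]) auto
    then show ?thesis
      using Th_eq[OF lG xc] by (simp add: mat_trace_four_block[OF zero_carrier_mat zero_carrier_mat] mat_trace_zero \<theta>_zero)
  qed
  ultimately show "phi (cell_section r v u) (lower Z) = l1 v * l2 u" by (simp add: phi_def lam)
qed

text \<open>On the support, s factors as q times \<open>lower Z\<close> with Z small, so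
  \<open>phi\<close> equals the positive number \<Delta> q times the constant value found in
  \<open>phi_cell_lower\<close>.\<close>

lemma phi_cell:
  assumes r: "r \<ge> 1" and v: "\<forall>k\<in>F.congruence r n1. \<pi>1 k v = v" and u: "\<forall>k\<in>F.congruence r n2. \<pi>2 k u = u"
    and s: "s \<in> carrier GG"
  shows "\<exists>x\<ge>0. phi (cell_section r v u) s = of_real x * (l1 v * l2 u)"
proof (cases "\<exists>a b d h. big_cell r (embed s * wmat) a b d h")
  case False
  then have "phi (cell_section r v u) s = 0" by (simp add: phi_def cell_section_def lam_linear)
  then show ?thesis by (intro exI[of _ 0]) simp
next
  case True
  then obtain a b d h where c: "a \<in> GL n1" "b \<in> carrier_mat n1 n2" "d \<in> GL n2" "h \<in> F.congruence r nn"
    "embed s * wmat = four_block_mat a b (0\<^sub>m n2 n1) d * (h * wmat)" by (auto simp: big_cell_def)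
  note sc = gl_group_carrierD[OF s]
  let ?P = "four_block_mat a b (0\<^sub>m n2 n1) d"
  note as = assoc_mult_mat[of _ nn nn _ nn _ nn] and m = mult_carrier_mat[of _ nn nn _ nn]
  have hG: "h \<in> F.GL0 nn" using c(4) F.congruence_GL0[OF r] by blast
  note cc = embed_carrier[OF sc] GL_carrier[OF four_block_GL(1)[OF c(1-3)]] GL0_carrier[OF hG] wmat_carrier
  have "embed s * wmat * wmat' = embed s * (wmat * wmat')" using cc by (intro as)
  then have 1: "embed s * wmat * wmat' = embed s" unfolding wmat_inverse using right_mult_one_mat[OF cc(1)] by simp
  have "?P * (h * wmat) * wmat' = ?P * (h * wmat * wmat')" using cc by (intro as m)
  also have "h * wmat * wmat' = h * (wmat * wmat')" using cc by (intro as)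
  also have "\<dots> = h" unfolding wmat_inverse using right_mult_one_mat[OF cc(3)] .
  finally have Es: "embed s = ?P * h" using 1 c(5) by simp
  obtain s11 s12 s21 s22 where sp: "s11 \<in> carrier_mat m1 m1" "s12 \<in> carrier_mat m1 m2" "s21 \<in> carrier_mat m2 m1"
    "s22 \<in> carrier_mat m2 m2" "s = four_block_mat s11 s12 s21 s22" using four_block_split[OF sc] by blast
  obtain h11 h12 h21 h22 where hsp: "split_block h n1 n1 = (h11, h12, h21, h22)" by (metis prod_cases4)
  have hd: "h11 \<in> carrier_mat n1 n1" "h12 \<in> carrier_mat n1 n2" "h21 \<in> carrier_mat n2 n1" "h22 \<in> carrier_mat n2 n2"
    and heq: "h = four_block_mat h11 h12 h21 h22" using split_block[OF hsp, of n2 n2] cc(3) by auto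
  note dc = GL_carrier[OF c(1)] GL_carrier[OF c(3)]
  have "?P * h = four_block_mat (a * h11 + b * h21) (a * h12 + b * h22) (d * h21) (d * h22)"
    unfolding heq using dc c(2) hd
      left_add_zero_mat[OF mult_carrier_mat[OF dc(2) hd(3)]] left_add_zero_mat[OF mult_carrier_mat[OF dc(2) hd(4)]]
    by (subst mult_four_block_mat[of _ n1 n1 _ n2 _ n2 _ _ n1 _ n2]) auto
  moreover have "embed s = four_block_mat (block_embed s11) (block_embed s12) (block_embed s21) (block_embed s22)"
    unfolding sp(5) by (rule embed_four_block[OF sp(1-4)])
  ultimately have "four_block_mat (block_embed s11) (block_embed s12) (block_embed s21) (block_embed s22)
      = four_block_mat (a * h11 + b * h21) (a * h12 + b * h22) (d * h21) (d * h22)" using Es by simp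
  then have blocks: "block_embed s11 = a * h11 + b * h21 \<and> block_embed s12 = a * h12 + b * h22 \<and>
      block_embed s21 = d * h21 \<and> block_embed s22 = d * h22"
    by (rule four_block_mat_inj[of _ _ _ _ _ _ _ _ n1 n1 n2 n2]) (use sp dc c(2) hd in auto)
  have "h - 1\<^sub>m nn = four_block_mat (h11 - 1\<^sub>m n1) h12 h21 (h22 - 1\<^sub>m n2)"
    unfolding heq using hd by (intro eq_matI) auto
  then have "four_block_mat (h11 - 1\<^sub>m n1) h12 h21 (h22 - 1\<^sub>m n2) \<in> F.FM r nn nn" using c(4) by (simp add: F.congruence_def)
  note h2 = F.FM_four_blockD(3,4)[OF this minus_carrier_mat[OF one_carrier_mat] hd(2,3) minus_carrier_mat[OF one_carrier_mat]]
  then have h22: "h22 \<in> F.GL0 n2" using hd F.congruence_GL0[OF r, of n2] by (auto simp: F.congruence_def)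
  have "d * h22 \<in> GL n2" using c(3) GL0_GL[OF h22] by (rule GL_mult)
  \<comment> \<open>The lower right block of \<open>embed s\<close> is d h22 with h22 congruent to
    1, hence invertible; so s22 is invertible over the dual numbers and elimination is
    possible.\<close>
  then have "det (block_embed s22) \<noteq> 0" using blocks GL_iff_det GL_carrier by metis
  moreover have "det (block_embed s22) = det (std_mat s22) * det (std_mat s22)"
    unfolding block_embed_def using sp(4) by (intro det_four_block_mat_lower_left_zero) auto
  ultimately have dets22: "det (std_mat s22) \<noteq> 0" by auto
  then have s22: "s22 \<in> G2" using sp(4) GL_iff_det[of "std_mat s22" m2] by (intro dual_groupI) auto
  note i = gl_group_inv[OF s22]
  define Z where "Z = inv\<^bsub>dual_group m2\<^esub> s22 * s21"
  have Zc: "Z \<in> carrier_mat m2 m1" unfolding Z_def by (rule mult_carrier_mat[OF i(1) sp(3)])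
  have "s22 * Z = (s22 * inv\<^bsub>dual_group m2\<^esub> s22) * s21"
    unfolding Z_def by (rule assoc_mult_mat[OF sp(4) i(1) sp(3), symmetric])
  then have sZ: "s22 * Z = s21" using i left_mult_one_mat[OF sp(3)] by simp
  have eZc: "block_embed Z \<in> carrier_mat n2 n1" using Zc by simp
  \<comment> \<open>The unknown factor d cancels: the image of Z is h22^-1 h21, a small block
    multiplied by an integral matrix.\<close>
  have "block_embed Z \<in> F.FM r n2 n1"
  proof -
    obtain di where di: "di \<in> GL n2" "di * d = 1\<^sub>m n2" using GL_inverse[OF c(3)] by blast
    obtain hi where hi: "hi \<in> F.GL0 n2" "hi * h22 = 1\<^sub>m n2" using GL0_inverse[OF h22] by blast
    have dhe: "d * h22 * block_embed Z = d * h21"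
      using block_embed_mult[OF sp(4) Zc] sZ blocks by simp
    have cancel: "di * (d * x) = x" if x: "x \<in> carrier_mat n2 n1" for x
    proof -
      have "di * (d * x) = (di * d) * x" by (rule assoc_mult_mat[OF GL_carrier[OF di(1)] dc(2) x, symmetric])
      then show ?thesis using di left_mult_one_mat[OF x] by simp
    qed
    have dhe': "d * (h22 * block_embed Z) = d * h21"
      by (rule trans[OF assoc_mult_mat[OF dc(2) hd(4) eZc, symmetric] dhe])
    have "h22 * block_embed Z = di * (d * (h22 * block_embed Z))"
      by (rule cancel[OF mult_carrier_mat[OF hd(4) eZc], symmetric])
    also have "\<dots> = di * (d * h21)" by (simp only: dhe')
    also have "\<dots> = h21" by (rule cancel[OF hd(3)])
    finally have e: "h22 * block_embed Z = h21" .
    have "hi * (h22 * block_embed Z) = (hi * h22) * block_embed Z"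
      by (rule assoc_mult_mat[OF GL0_carrier[OF hi(1)] hd(4) eZc, symmetric])
    then have "block_embed Z = hi * h21" unfolding e using hi left_mult_one_mat[OF eZc] by simp
    then show ?thesis using hi(1) h2(1) by (auto simp: GL0_iff intro: F.FM_mult0)
  qed
  note low = phi_cell_lower[OF r v u Zc this]
  \<comment> \<open>The Schur complement of s22, which makes s equal to \<open>ut A s12 s22\<close>
    times \<open>lower Z\<close>.\<close>
  define A where "A = s11 - s12 * Z"
  have s12Z: "s12 * Z \<in> carrier_mat m1 m1" by (rule mult_carrier_mat[OF sp(2) Zc])
  have Ac: "A \<in> carrier_mat m1 m1" unfolding A_def using s12Z by (intro minus_carrier_mat)
  have "A + s12 * Z = s11"
    unfolding A_def using mat_add_diff[OF sp(1) s12Z] comm_add_mat[OF minus_carrier_mat[OF s12Z, of s11] s12Z] by simp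
  then have e11: "A * 1\<^sub>m m1 + s12 * Z = s11" using right_mult_one_mat[OF Ac] by simp
  have e12: "A * 0\<^sub>m m1 m2 + s12 * 1\<^sub>m m2 = s12"
    unfolding right_mult_zero_mat[OF Ac] right_mult_one_mat[OF sp(2)] by (rule left_add_zero_mat[OF sp(2)])
  have e21: "0\<^sub>m m2 m1 * 1\<^sub>m m1 + s22 * Z = s21"
    unfolding sZ left_mult_zero_mat[OF one_carrier_mat] by (rule left_add_zero_mat[OF sp(3)])
  have e22: "0\<^sub>m m2 m1 * 0\<^sub>m m1 m2 + s22 * 1\<^sub>m m2 = s22"
    unfolding right_mult_one_mat[OF sp(4)] left_mult_zero_mat[OF zero_carrier_mat] by (rule left_add_zero_mat[OF sp(4)])
  have s_eq: "s = ut A s12 s22 * lower Z"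
    unfolding sp(5) ut_def lower_def
      mult_four_block_mat[OF Ac sp(2) zero_carrier_mat sp(4) one_carrier_mat zero_carrier_mat Zc one_carrier_mat]
      e11 e12 e21 e22 ..
  have uc: "ut A s12 s22 \<in> carrier_mat (m1 + m2) (m1 + m2)" by (rule ut_carrier[OF Ac sp(4)])
  have "det (std_mat s) = det (std_mat (ut A s12 s22)) * det (std_mat (lower Z))"
    unfolding s_eq std_mat_mult[OF uc gl_group_carrierD[OF low(1)]]
    using uc gl_group_carrierD[OF low(1)] by (intro det_mult[of _ "m1 + m2"]) auto
  moreover have "det (std_mat s) \<noteq> 0"
    using s GL_iff_det GL_carrier by (auto simp: dual_group_iff)
  moreover have "det (std_mat (ut A s12 s22)) = det (std_mat A) * det (std_mat s22)"
    unfolding ut_std[OF Ac sp(2,4)] using Ac sp by (intro det_four_block_mat_lower_left_zero) auto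
  ultimately have "det (std_mat A) \<noteq> 0" by auto
  then have AG: "A \<in> G1" using Ac GL_iff_det[of "std_mat A" m1] by (intro dual_groupI) auto
  have q: "ut A s12 s22 \<in> parabolic" by (rule parabolicI[OF AG sp(2) s22])
  have "phi (cell_section r v u) s = of_real (\<Delta> (ut A s12 s22)) * phi (cell_section r v u) (lower Z)"
    using phi_equivariant[OF cell_section_induced[OF r v u]] q low(1)
    unfolding H.equivariant_def s_eq by simp
  then show ?thesis
    using low(2) R.modulus_pos[OF q] by (intro exI[of _ "\<Delta> (ut A s12 s22)"]) simp
qed

lemma haar_phi_nonzero:
  assumes "\<exists>v. l1 v \<noteq> 0" "\<exists>u. l2 u \<noteq> 0"
  shows "\<exists>f\<in>V. H.haar (phi f) \<noteq> 0"
proof -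
  obtain v u where vu: "l1 v \<noteq> 0" "l2 u \<noteq> 0" using assms by blast
  obtain r1 where r1: "r1 \<ge> 1" "\<And>k. k \<in> F.congruence r1 n1 \<Longrightarrow> \<pi>1 k v = v"
    using stabiliser_congruence[OF rep1] by blast
  obtain r2 where r2: "r2 \<ge> 1" "\<And>k. k \<in> F.congruence r2 n2 \<Longrightarrow> \<pi>2 k u = u"
    using stabiliser_congruence[OF rep2] by blast
  \<comment> \<open>The larger level makes the congruence subgroup fix both v and u, so one cell
    serves the two representations at once.\<close>
  define r where "r = max r1 r2"
  have r: "r \<ge> 1" using r1 by (simp add: r_def)
  have v: "\<forall>k\<in>F.congruence r n1. \<pi>1 k v = v"
    using r1 F.congruence_mono[of r1 r n1] by (auto simp: r_def)
  have u: "\<forall>k\<in>F.congruence r n2. \<pi>2 k u = u"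
    using r2 F.congruence_mono[of r2 r n2] by (auto simp: r_def)
  have fV: "cell_section r v u \<in> V" by (rule cell_section_induced[OF r v u])
  have Z: "block_embed (0\<^sub>m m2 m1 :: 'f dual mat) \<in> F.FM r n2 n1" by (simp add: block_embed_zero F.FM_zero)
  note low = phi_cell_lower[OF r v u zero_carrier_mat Z]
  have "H.haar (phi (cell_section r v u)) \<noteq> 0"
  proof (rule H.haar_nonzero[OF phi_admissible[OF fV]])
    show "phi (cell_section r v u) (lower (0\<^sub>m m2 m1)) \<noteq> 0" using low(2) vu by simp
  qed (use phi_cell[OF r v u] low(1) in auto)
  then show ?thesis using fV by blast
qed

end

theorem theorem1p1:
  fixes val :: "'f::field \<Rightarrow> int"
    and \<theta> :: "'f \<Rightarrow> complex"
    and n1 n2 :: nat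
    and \<pi>1 :: "'f mat \<Rightarrow> 'v::complex_vector \<Rightarrow> 'v"
    and \<pi>2 :: "'f mat \<Rightarrow> 'w::complex_vector \<Rightarrow> 'w"
  assumes "nonarchimedean_local_field val"
    and "smooth_additive_character val \<theta>" and "\<exists>x. \<theta> x \<noteq> 1"
    and "even n1" and "n1 > 0" and "even n2" and "n2 > 0"
    and "smooth_representation val n1 UNIV \<pi>1"
    and "smooth_representation val n2 UNIV \<pi>2"
    and "admits_shalika_functional \<theta> n1 UNIV \<pi>1"
    and "admits_shalika_functional \<theta> n2 UNIV \<pi>2"
  shows "admits_shalika_functional \<theta> (n1 + n2)
    (induced_space val n1 n2 \<pi>1 \<pi>2) (right_translation (n1 + n2))"
proof -
  obtain m1 m2 where m: "n1 = m1 + m1" "n2 = m2 + m2"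
    using assms(4,6) by (metis evenE mult_2)
  have div: "n1 div 2 = m1" "n2 div 2 = m2" "(n1 + n2) div 2 = m1 + m2" using m by auto
  obtain l1 where l1: "l1 \<in> Hom_character (shalika_subgroup m1) UNIV \<pi>1 (shalika_character \<theta> m1)" "\<exists>v. l1 v \<noteq> 0"
    using assms(10) unfolding admits_shalika_functional_def div by blast
  obtain l2 where l2: "l2 \<in> Hom_character (shalika_subgroup m2) UNIV \<pi>2 (shalika_character \<theta> m2)" "\<exists>u. l2 u \<noteq> 0"
    using assms(11) unfolding admits_shalika_functional_def div by blast
  interpret nonarchimedean_local_field val by (rule assms(1))
  interpret shalika_pair val m1 m2 \<theta> \<pi>1 \<pi>2 l1 l2
    by unfold_locales (use assms m l1 l2 in auto)
  show ?thesis
    unfolding admits_shalika_functional_def div unfolding m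
    by (intro bexI[of _ "\<lambda>f. H.haar (phi f)"] haar_phi_nonzero haar_phi_hom l1 l2)
qed

end
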